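(* (Setting in context.) Let $z_1=|z_1|\omega$, $z_2=|z_2|\eta\in\mathbb{C}\setminus\{0\}$, $b=|z_1||z_2|$. For the dihedral group $I_{2k}$ with positive multiplicity $(\alpha,\beta)$ the Dunkl kernel is \[E_{\kappa}(z_{1},z_{2})=\Gamma(k(\alpha+\beta)+1)\int_{-1}^{1}\int_{-1}^{1}\Big[h_{\alpha+\beta}(1,q(u,v))+2^{1-k}(-ib)^{k}\cos(q(u-1,v-1))\,h_{\alpha+\beta+1}(1,q(u,v))\Big]d\mu_{\alpha}(u)\,d\mu_{\beta}(v),\] and for an odd-$k$ dihedral group $I_k$ with positive multiplicity $\alpha$, \[E_{\kappa}(z_{1},z_{2})=\Gamma(k\alpha+1)\int_{-1}^{1}\Big[h_{\alpha}(1,q(u,1))+2^{1-k}(-ib)^{k}\cos(q(u-1,0))\,h_{\alpha+1}(1,q(u,1))\Big]d\mu_{\alpha}(u).\]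
   Context: Identify $\mathbb{R}^2$ with $\mathbb{C}$; $I_N$ is the dihedral group of order $2N$. Dunkl operators: $T_if=\partial_if+\sum_{\alpha\in\mathcal R_+}\kappa(\alpha)\alpha_i\frac{f(x)-f(r_\alpha x)}{\langle\alpha,x\rangle}$, $\Delta_\kappa=T_1^2+T_2^2$, $\mathcal H_j(\upsilon_\kappa)$ = homogeneous degree-$j$ polynomials in $\ker\Delta_\kappa$. For $I_{2k}$, $\kappa=\alpha$ on one reflection class and $\beta$ on the other, weight $\upsilon_\kappa(z)=|\frac{z^k-\bar z^k}{2i}|^{2\alpha}|\frac{z^k+\bar z^k}{2}|^{2\beta}$, $\langle\kappa\rangle=k(\alpha+\beta)$; for odd $k$, $I_k$ has one class with value $\alpha$, weight $|\frac{z^k-\bar z^k}{2i}|^{2\alpha}$, $\langle\kappa\rangle=k\alpha$. $P_j(G;\omega,\eta)$ is the reproducing kernel of $\mathcal H_j(\upsilon_\kappa)$ on the unit circle for $\langle f,g\rangle=\int_{S^1}f\bar g\upsilon_\kappa d\sigma/\int_{S^1}\upsilon_\kappa d\sigma$. The Dunkl kernel is $E_\kappa(z_1,z_2)=2^{\langle\kappa\rangle}\Gamma(\langle\kappa\rangle+1)\sum_{j\ge0}(-i)^jb^{-\langle\kappa\rangle}J_{j+\langle\kappa\rangle}(b)P_j(G;\omega,\eta)$. $d\mu_\gamma(w)=c_\gamma(1+w)(1-w^2)^{\gamma-1}dw$ on $[-1,1]$, $c_\gamma=B(\frac12,\gamma)^{-1}$. $X(u,v)=(\mathrm{Im}\,\omega^{k})(\mathrm{Im}\,\eta^{k})u+(\mathrm{Re}\,\omega^{k})(\mathrm{Re}\,\eta^{k})v$,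 $q(u,v)=\arccos X(u,v)$ (extended to complex arguments so that $\cos(\arccos X)=X$), $A(s,q)=\prod_{l=0}^{k-1}(s+ib\cos(\frac{q+2\pi l}{k}))$, $B(s)=s+ib\,\mathrm{Re}(\omega\bar\eta)$, and $h_\gamma(t,q)=\mathcal L^{-1}\big(B(s)^{-1}A(s,q)^{-\gamma}\big)(t)$ is the inverse Laplace transform (principal branch). *)

theory Defs
  imports "HOL-Analysis.Analysis"
begin

text \<open>R^2 is identified with the complex plane. A root system is given as a list of
  pairs (a, c): a unit normal vector a of a mirror line (one representative per
  positive root; the Dunkl terms are invariant under a to -a) and the multiplicity c.\<close>

definition rinner :: "complex \<Rightarrow> complex \<Rightarrow> real" where
  "rinner a x = Re a * Re x + Im a * Im x"

definition refl :: "complex \<Rightarrow> complex \<Rightarrow> complex" where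
  "refl a x = x - of_real (2 * rinner a x / (cmod a)\<^sup>2) * a"

definition dderiv :: "complex \<Rightarrow> (complex \<Rightarrow> complex) \<Rightarrow> complex \<Rightarrow> complex" where
  "dderiv d f x = vector_derivative (\<lambda>t::real. f (x + of_real t * d)) (at 0)"

definition dunkl_T :: "(complex \<times> real) list \<Rightarrow> complex \<Rightarrow> (complex \<Rightarrow> complex) \<Rightarrow> complex \<Rightarrow> complex" where
  "dunkl_T R d f x = dderiv d f x +
     sum_list (map (\<lambda>(a, c). of_real (c * rinner a d) * (f x - f (refl a x)) / of_real (rinner a x)) R)"

definition dunkl_lap :: "(complex \<times> real) list \<Rightarrow> (complex \<Rightarrow> complex) \<Rightarrow> complex \<Rightarrow> complex" where
  "dunkl_lap R f x = dunkl_T R 1 (dunkl_T R 1 f) x + dunkl_T R \<i> (dunkl_T R \<i> f) x"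

definition regular_pt :: "(complex \<times> real) list \<Rightarrow> complex \<Rightarrow> bool" where
  "regular_pt R x \<longleftrightarrow> (\<forall>(a, c) \<in> set R. rinner a x \<noteq> 0)"

definition homog_poly :: "nat \<Rightarrow> (complex \<Rightarrow> complex) \<Rightarrow> bool" where
  "homog_poly j f \<longleftrightarrow> (\<exists>c :: nat \<Rightarrow> complex. \<forall>z.
      f z = (\<Sum>i\<le>j. c i * of_real (Re z ^ i * Im z ^ (j - i))))"

text \<open>H_j: homogeneous degree-j polynomials annihilated by the Dunkl Laplacian.
  Since the Dunkl Laplacian of a polynomial is a polynomial, vanishing on the dense
  set of regular points is the same as vanishing identically.\<close>
definition harm :: "(complex \<times> real) list \<Rightarrow> nat \<Rightarrow> (complex \<Rightarrow> complex) set" where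
  "harm R j = {f. homog_poly j f \<and> (\<forall>x. regular_pt R x \<longrightarrow> dunkl_lap R f x = 0)}"

definition circ_inner :: "(complex \<Rightarrow> real) \<Rightarrow> (complex \<Rightarrow> complex) \<Rightarrow> (complex \<Rightarrow> complex) \<Rightarrow> complex" where
  "circ_inner w f g =
     (set_lebesgue_integral lborel {0..2*pi} (\<lambda>\<theta>. f (cis \<theta>) * cnj (g (cis \<theta>)) * of_real (w (cis \<theta>))))
     / of_real (set_lebesgue_integral lborel {0..2*pi} (\<lambda>\<theta>. w (cis \<theta>)))"

definition repr_kernel :: "(complex \<times> real) list \<Rightarrow> (complex \<Rightarrow> real) \<Rightarrow> nat \<Rightarrow> complex \<Rightarrow> complex \<Rightarrow> complex" where
  "repr_kernel R w j = (THE K.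
      (\<forall>\<omega> \<eta>. (cmod \<omega> \<noteq> 1 \<or> cmod \<eta> \<noteq> 1) \<longrightarrow> K \<omega> \<eta> = 0) \<and>
      (\<forall>\<eta>. cmod \<eta> = 1 \<longrightarrow> (\<exists>g \<in> harm R j. \<forall>\<omega>. cmod \<omega> = 1 \<longrightarrow> K \<omega> \<eta> = g \<omega>)) \<and>
      (\<forall>f \<in> harm R j. \<forall>\<eta>. cmod \<eta> = 1 \<longrightarrow> circ_inner w f (\<lambda>\<omega>. K \<omega> \<eta>) = f \<eta>))"

text \<open>Bessel function of the first kind (for x > 0).\<close>
definition bessel_J :: "real \<Rightarrow> real \<Rightarrow> real" where
  "bessel_J \<nu> x = (\<Sum>m. (-1) ^ m / (fact m * Gamma (real m + \<nu> + 1)) * (x / 2) powr (2 * real m + \<nu>))"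

definition dunkl_kernel :: "(complex \<times> real) list \<Rightarrow> (complex \<Rightarrow> real) \<Rightarrow> complex \<Rightarrow> complex \<Rightarrow> complex" where
  "dunkl_kernel R w z1 z2 =
     (let K = sum_list (map snd R); b = cmod z1 * cmod z2; \<omega> = z1 / of_real (cmod z1); \<eta> = z2 / of_real (cmod z2)
      in of_real (2 powr K * Gamma (K + 1)) *
         (\<Sum>j. (- \<i>) ^ j * of_real (b powr (- K) * bessel_J (real j + K) b) * repr_kernel R w j \<omega> \<eta>))"

text \<open>Dihedral group I_{2k}: mirrors at angles pi l/k (multiplicity alpha, zeros of Im z^k)
  and at angles pi/(2k) + pi l/k (multiplicity beta, zeros of Re z^k).\<close>
definition roots_I2k :: "nat \<Rightarrow> real \<Rightarrow> real \<Rightarrow> (complex \<times> real) list" where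
  "roots_I2k k \<alpha> \<beta> =
     map (\<lambda>l. (\<i> * cis (pi * real l / real k), \<alpha>)) [0..<k] @
     map (\<lambda>l. (\<i> * cis (pi / (2 * real k) + pi * real l / real k), \<beta>)) [0..<k]"

definition weight_I2k :: "nat \<Rightarrow> real \<Rightarrow> real \<Rightarrow> complex \<Rightarrow> real" where
  "weight_I2k k \<alpha> \<beta> z = cmod ((z ^ k - cnj z ^ k) / (2 * \<i>)) powr (2 * \<alpha>) * cmod ((z ^ k + cnj z ^ k) / 2) powr (2 * \<beta>)"

text \<open>Dihedral group I_k, k odd: mirrors at angles pi l/k, multiplicity alpha.\<close>
definition roots_Ik :: "nat \<Rightarrow> real \<Rightarrow> (complex \<times> real) list" where
  "roots_Ik k \<alpha> = map (\<lambda>l. (\<i> * cis (pi * real l / real k), \<alpha>)) [0..<k]"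

definition weight_Ik :: "nat \<Rightarrow> real \<Rightarrow> complex \<Rightarrow> real" where
  "weight_Ik k \<alpha> z = cmod ((z ^ k - cnj z ^ k) / (2 * \<i>)) powr (2 * \<alpha>)"

definition E_I2k :: "nat \<Rightarrow> real \<Rightarrow> real \<Rightarrow> complex \<Rightarrow> complex \<Rightarrow> complex" where
  "E_I2k k \<alpha> \<beta> = dunkl_kernel (roots_I2k k \<alpha> \<beta>) (weight_I2k k \<alpha> \<beta>)"

definition E_Ik :: "nat \<Rightarrow> real \<Rightarrow> complex \<Rightarrow> complex \<Rightarrow> complex" where
  "E_Ik k \<alpha> = dunkl_kernel (roots_Ik k \<alpha>) (weight_Ik k \<alpha>)"

definition mu_int :: "real \<Rightarrow> (real \<Rightarrow> complex) \<Rightarrow> complex" where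
  "mu_int \<gamma> f = set_lebesgue_integral lborel {-1..1}
     (\<lambda>w. (inverse (Beta (1/2) \<gamma>) * (1 + w) * (1 - w\<^sup>2) powr (\<gamma> - 1)) *\<^sub>R f w)"

definition Xfun :: "nat \<Rightarrow> complex \<Rightarrow> complex \<Rightarrow> real \<Rightarrow> real \<Rightarrow> real" where
  "Xfun k \<omega> \<eta> u v = Im (\<omega> ^ k) * Im (\<eta> ^ k) * u + Re (\<omega> ^ k) * Re (\<eta> ^ k) * v"

text \<open>q = arccos X, with the complex arccos (so cos (q u v) = X u v always).\<close>
definition qfun :: "nat \<Rightarrow> complex \<Rightarrow> complex \<Rightarrow> real \<Rightarrow> real \<Rightarrow> complex" where
  "qfun k \<omega> \<eta> u v = Arccos (of_real (Xfun k \<omega> \<eta> u v))"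

text \<open>A(s,q)^(-gamma), principal branch: product of principal powers of the factors
  (the branch holomorphic in Re s > 0 that is real-analytic continuation of the
  principal value for large real s).\<close>
definition A_pow :: "nat \<Rightarrow> real \<Rightarrow> real \<Rightarrow> complex \<Rightarrow> complex \<Rightarrow> complex" where
  "A_pow k b \<gamma> s q = (\<Prod>l<k. (s + \<i> * of_real b * cos ((q + 2 * of_real pi * of_nat l) / of_nat k)) powr (- of_real \<gamma>))"

definition B_fun :: "real \<Rightarrow> complex \<Rightarrow> complex \<Rightarrow> complex \<Rightarrow> complex" where
  "B_fun b \<omega> \<eta> s = s + \<i> * of_real b * of_real (Re (\<omega> * cnj \<eta>))"

text \<open>Inverse Laplace transform of B(s)^(-1) A(s,q)^(-gamma) via the Bromwich integral
  along Re s = 1 (all singularities lie on the imaginary axis).\<close>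
definition h_fun :: "nat \<Rightarrow> real \<Rightarrow> complex \<Rightarrow> complex \<Rightarrow> real \<Rightarrow> real \<Rightarrow> complex \<Rightarrow> complex" where
  "h_fun k b \<omega> \<eta> \<gamma> t q = of_real (1 / (2 * pi)) *
     integral\<^sup>L lborel (\<lambda>y::real. let s = 1 + \<i> * of_real y in
        exp (s * of_real t) * A_pow k b \<gamma> s q / B_fun b \<omega> \<eta> s)"

end

theory Submission
 imports Defs "HOL-Complex_Analysis.Complex_Analysis"
begin

text \<open>On the unit circle the Dunkl Laplacian becomes an angular operator that is symmetric for the weight
and triangular, with distinct eigenvalues, on trigonometric polynomials. Hence the harmonics of degree \<open>j\<close>
are the trigonometric polynomials with frequencies \<open>j, j - 2, \<dots>, - j\<close> that are orthogonal to those of degree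
\<open>j - 2\<close>, and \<open>P\<^sub>j = S\<^sub>j - S\<^sub>j\<^sub>-\<^sub>2\<close> with \<open>S\<^sub>j\<close> the reproducing kernel of all such polynomials. For \<open>k = 1\<close>
comparing moments shows that \<open>S\<^sub>N\<close> is the average over \<open>d\<mu>\<close> of a Gegenbauer polynomial in \<open>X\<close>;
for general \<open>k\<close> the kernel is a finite sum of such kernels at the angles multiplied by \<open>k\<close>.

The integrand depends only on \<open>X\<close>. It is a Bromwich integral which, after shifting the line to the right,
is expanded in powers of \<open>w = - i b / (2 s)\<close>. The substitution \<open>w = r / (1 + r\<^sup>2)\<close> turns the product over the
roots into the generating function of the polynomials whose averages are the \<open>S\<^sub>j\<close>; inverting it gives the
coefficients in terms of the \<open>P\<^sub>j\<close>, and the result is the rearranged Bessel series of the Dunkl kernel.\<close>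

text \<open>The shape of the bracket comes from X(1,1) = cos q' with q' = k (\<xi> - \<phi>), where
  \<xi> and \<phi> are the arguments of \<omega> and \<eta>: it gives cos q(u-1,v-1) = cos q - cos
  q'. Since the product A(s,q) depends on q only through one additive term proportional to cos q,
  A(s,q) + 2^(1-k) (-ib)^k (cos q - cos q') = A(s,q'). This has B(s) as a factor, which cancels the
  denominator B(s); what remains is a polynomial in s times A(s,q)^(-\<gamma>-1).

  Accumulating the harmonics of degrees j, j-2, ... removes the Laplacian from the problem: the
  accumulated kernel is determined by reproducing an explicit space of trigonometric polynomials, so
  integrals of monomials decide everything.

  The parameter \<beta> is allowed to be 0 in most statements. The second reflection class then
  disappears from the mirrors and from the weight, and its measure becomes the point mass at 1, so
  the odd dihedral groups are covered by the same argument.\<close>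

section \<open>Finite sums with binomial coefficients and Pochhammer symbols\<close>

text \<open>The factor \<open>fact t * real (l choose t)\<close> is a falling factorial of
  \<open>l\<close>, so the sum is y^t times the t-th derivative in y of (x + y)^m / m!.\<close>

lemma sum_binomial_falling:
 fixes x y :: real
 shows "(\<Sum>l\<le>m. x^(m-l) * y^l / (fact l * fact (m-l)) * (fact t * real (l choose t)))
  = (if t \<le> m then y^t * (x+y)^(m-t) / fact (m-t) else 0)"
proof (cases "t \<le> m")
 case True
 have "(\<Sum>l\<le>m. x^(m-l) * y^l / (fact l * fact (m-l)) * (fact t * real (l choose t)))
   = (\<Sum>l\<in>{t..m}. x^(m-l) * y^l / (fact l * fact (m-l)) * (fact t * real (l choose t)))"
  by (rule sum.mono_neutral_right) (auto simp: binomial_eq_0)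
 also have "\<dots> = (\<Sum>l\<in>{0..m-t}. x^(m-t-l) * y^(t+l) / (fact l * fact (m-t-l)))"
  using True
  by (intro sum.reindex_bij_witness[of _ "\<lambda>l. l + t" "\<lambda>l. l - t"])
   (auto simp: binomial_fact field_simps)
 also have "\<dots> = y^t / fact (m-t) * (\<Sum>l\<in>{0..m-t}. real ((m-t) choose l) * y^l * x^(m-t-l))"
  unfolding sum_distrib_left
  by (intro sum.cong) (auto simp: binomial_fact field_simps power_add)
 also have "(\<Sum>l\<in>{0..m-t}. real ((m-t) choose l) * y^l * x^(m-t-l)) = (x+y)^(m-t)"
  by (subst add.commute, subst binomial_ring) (simp add: atLeast0AtMost)
 finally show ?thesis using True by simp
qed (auto simp: binomial_eq_0 intro!: sum.neutral)

text \<open>A polynomial of degree \<open>S\<close> in \<open>q\<close> is written in the basis of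
  falling factorials, on which finite differences act simply. Later only the leading coefficient
  matters; the vanishing for \<open>t > S\<close> is carried along for the induction.\<close>

lemma pochhammer_falling_expansion:
 fixes c e :: real
 shows "\<exists>A. A S = e^S \<and> (\<forall>t>S. A t = 0) \<and>
  (\<forall>q::nat. pochhammer (c + e * real q) S = (\<Sum>t\<le>S. A t * (fact t * real (q choose t))))"
proof (induction S)
 case 0
 show ?case by (intro exI[of _ "\<lambda>t. if t = 0 then 1 else 0"]) auto
next
 case (Suc S)
 then obtain A where A: "A S = e^S" "\<And>t. t > S \<Longrightarrow> A t = 0"
  "\<And>q::nat. pochhammer (c + e * real q) S = (\<Sum>t\<le>S. A t * (fact t * real (q choose t)))" by blast
 \<comment> \<open>The new factor c + S + e q is split as e (q - t) + (c + S + e t); the first part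
   raises the falling factorial of order t to order t + 1.\<close>
 define B where "B t = (if t = 0 then 0 else e * A (t-1)) + (c + real S + e * real t) * A t" for t
 have ff: "fact (Suc t) * real (q choose Suc t) = (real q - real t) * (fact t * real (q choose t))" for q t
 proof -
  have "real (Suc t * (q choose Suc t)) = real ((q - t) * (q choose t))"
   by (simp only: binomial_absorption binomial_absorb_comp)
  moreover have "real (q - t) * real (q choose t) = (real q - real t) * real (q choose t)"
   by (cases "t \<le> q") (auto simp: of_nat_diff binomial_eq_0)
  ultimately have "real (Suc t) * real (q choose Suc t) = (real q - real t) * real (q choose t)"
   by (simp only: of_nat_mult)
  thus ?thesis by (simp only: fact_Suc of_nat_mult mult_ac)
 qed
 have "pochhammer (c + e * real q) (Suc S) = (\<Sum>t\<le>Suc S. B t * (fact t * real (q choose t)))" for q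
 proof -
  have "(\<Sum>t\<le>Suc S. B t * (fact t * real (q choose t)))
   = (\<Sum>t\<le>Suc S. (if t = 0 then 0 else e * A (t-1)) * (fact t * real (q choose t)))
    + (\<Sum>t\<le>Suc S. (c + real S + e * real t) * A t * (fact t * real (q choose t)))"
   unfolding B_def by (simp add: distrib_right sum.distrib)
  also have "(\<Sum>t\<le>Suc S. (if t = 0 then 0 else e * A (t-1)) * (fact t * real (q choose t)))
   = (\<Sum>t\<le>S. e * A t * ((real q - real t) * (fact t * real (q choose t))))"
   unfolding ff[symmetric] by (subst sum.atMost_Suc_shift) simp
  also have "(\<Sum>t\<le>Suc S. (c + real S + e * real t) * A t * (fact t * real (q choose t)))
   = (\<Sum>t\<le>S. (c + real S + e * real t) * A t * (fact t * real (q choose t)))"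
   using A(2) by simp
  also have "(\<Sum>t\<le>S. e * A t * ((real q - real t) * (fact t * real (q choose t)))) + \<dots>
   = (c + e * real q + real S) * (\<Sum>t\<le>S. A t * (fact t * real (q choose t)))"
   unfolding sum_distrib_left sum.distrib[symmetric]
   by (intro sum.cong) (auto simp: algebra_simps)
  finally show ?thesis by (simp add: A(3) pochhammer_Suc mult.commute)
 qed
 moreover have "B (Suc S) = e ^ Suc S" "\<forall>t>Suc S. B t = 0" using A by (auto simp: B_def)
 ultimately show ?case by blast
qed

text \<open>Up to normalization this is an N-th finite difference of a polynomial of degree at most
  N, so only its coefficient of degree N survives.\<close>

lemma pochhammer_finite_difference:
 fixes c e :: real
 assumes "S \<le> N"
 shows "(\<Sum>q\<le>N. (-1)^q / (fact q * fact (N-q)) * pochhammer (c + e * real q) S)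
  = (if S = N then (-e)^N else 0)"
proof -
 obtain A where A: "A S = e^S"
  "\<And>q::nat. pochhammer (c + e * real q) S = (\<Sum>t\<le>S. A t * (fact t * real (q choose t)))"
  using pochhammer_falling_expansion[where S=S and e=e and c=c] by blast
 \<comment> \<open>The signs are read as powers of y = -1 with x = 1, so x + y = 0 and only t = N
   remains.\<close>
 have "(\<Sum>q\<le>N. (-1)^q / (fact q * fact (N-q)) * pochhammer (c + e * real q) S)
  = (\<Sum>t\<le>S. A t * (\<Sum>q\<le>N. 1^(N-q) * (-1)^q / (fact q * fact (N-q)) * (fact t * real (q choose t))))"
  unfolding A(2) sum_distrib_left by (subst sum.swap) (simp add: algebra_simps)
 also have "\<dots> = (\<Sum>t\<le>S. A t * (if t = N then (-1)^N else 0))"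
  using assms by (intro sum.cong refl, subst sum_binomial_falling) (auto simp: power_0_left)
 also have "\<dots> = (if S = N then (-e)^N else 0)"
  using assms A(1) by (auto simp: if_distrib[of "\<lambda>x. _ * x"] sum.delta power_mult_distrib[symmetric] cong: if_cong)
 finally show ?thesis .
qed

text \<open>With the last factor expanded in falling factorials of \<open>l\<close>, the inner sums
  collapse because x + y = 1. What is left over \<open>q\<close> is a finite difference of order M -
  t of a polynomial of degree M - s, nonzero only for t = s. It is applied with x and y the squares
  of a sine and a cosine.\<close>

lemma trinomial_pochhammer_sum:
 fixes x y c d :: real
 assumes "x + y = 1" "s \<le> M"
 shows "(\<Sum>q\<le>M. (-1)^q / fact q * pochhammer (c - real q) (M-s) *
  (\<Sum>l\<le>M-q. x^(M-q-l) * y^l / (fact l * fact (M-q-l)) * pochhammer (d + real l) s)) = y^s"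
proof -
 obtain A where A: "A s = (1::real)^s"
  "\<And>q::nat. pochhammer (d + 1 * real q) s = (\<Sum>t\<le>s. A t * (fact t * real (q choose t)))"
  using pochhammer_falling_expansion[where S=s and e=1 and c=d] by blast
 have inner: "(\<Sum>l\<le>m. x^(m-l) * y^l / (fact l * fact (m-l)) * pochhammer (d + real l) s)
  = (\<Sum>t\<le>s. A t * (if t \<le> m then y^t / fact (m-t) else 0))" for m
 proof -
  have "(\<Sum>l\<le>m. x^(m-l) * y^l / (fact l * fact (m-l)) * pochhammer (d + real l) s)
  = (\<Sum>t\<le>s. A t * (\<Sum>l\<le>m. x^(m-l) * y^l / (fact l * fact (m-l)) * (fact t * real (l choose t))))"
   unfolding A(2)[simplified] sum_distrib_left by (subst sum.swap) (simp add: algebra_simps)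
  thus ?thesis unfolding sum_binomial_falling assms(1) by (simp cong: if_cong)
 qed
 have "(\<Sum>q\<le>M. (-1)^q / fact q * pochhammer (c - real q) (M-s) *
  (\<Sum>l\<le>M-q. x^(M-q-l) * y^l / (fact l * fact (M-q-l)) * pochhammer (d + real l) s))
  = (\<Sum>t\<le>s. A t * y^t * (\<Sum>q\<le>M. if t \<le> M-q then (-1)^q / (fact q * fact (M-q-t)) * pochhammer (c - real q) (M-s) else 0))"
  unfolding inner sum_distrib_left
  by (subst sum.swap, intro sum.cong refl) (auto simp: field_simps)
 also have "\<dots> = (\<Sum>t\<le>s. A t * y^t * (if t = s then 1 else 0))"
 proof (intro sum.cong refl arg_cong2[where f="(*)"])
  fix t assume t: "t \<in> {..s}"
  have "(\<Sum>q\<le>M. if t \<le> M-q then (-1)^q / (fact q * fact (M-q-t)) * pochhammer (c - real q) (M-s) else 0)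
   = (\<Sum>q\<le>M-t. (-1)^q / (fact q * fact (M-t-q)) * pochhammer (c + (-1) * real q) (M-s))"
   using t assms by (intro sum.mono_neutral_cong_right) (auto simp: add.commute)
  also have "\<dots> = (if M - s = M - t then 1 else 0)"
   by (subst pochhammer_finite_difference) (use t in auto)
  finally show "(\<Sum>q\<le>M. if t \<le> M-q then (-1)^q / (fact q * fact (M-q-t)) * pochhammer (c - real q) (M-s) else 0)
   = (if t = s then 1 else 0)" using t assms by auto
 qed
 also have "\<dots> = y^s" using A(1) by (simp add: if_distrib[of "\<lambda>x. _ * x"] sum.delta cong: if_cong)
 finally show ?thesis .
qed

text \<open>Trinomial revision replaces the two coefficients by one generalized binomial coefficient
  of degree \<open>t\<close> in \<open>i\<close> and an ordinary one; the sum becomes a t-th finite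
  difference, which is a leading coefficient.\<close>

lemma gbinomial_alternating_sum:
 fixes a :: real
 shows "(\<Sum>i\<le>t. (-1)^i * ((a - real i) gchoose i) * ((a - 2 * real i) gchoose (t - i))) = 1"
proof -
 have "(\<Sum>i\<le>t. (-1)^i * ((a - real i) gchoose i) * ((a - 2 * real i) gchoose (t - i)))
  = (\<Sum>q\<le>t. (-1)^q / (fact q * fact (t-q)) * pochhammer ((a - real t + 1) + (-1) * real q) t)"
 proof (intro sum.cong refl)
  fix i assume i: "i \<in> {..t}"
  have "((a - real i) gchoose i) * ((a - 2 * real i) gchoose (t - i))
    = ((a - real i) gchoose t) * (real t gchoose i)"
   using gbinomial_trinomial_revision[of i t "a - real i"] i by (simp add: algebra_simps)
  also have "real t gchoose i = fact t / (fact i * fact (t - i))"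
   using i by (simp add: binomial_gbinomial[symmetric] binomial_fact)
  finally show "(-1)^i * ((a - real i) gchoose i) * ((a - 2 * real i) gchoose (t - i))
   = (-1)^i / (fact i * fact (t-i)) * pochhammer ((a - real t + 1) + (-1) * real i) t"
   by (simp add: gbinomial_pochhammer' field_simps)
 qed
 also have "\<dots> = 1" by (subst pochhammer_finite_difference) auto
 finally show ?thesis .
qed

text \<open>Coefficient inversion for the substitution \<open>w = r / (1 + r\<^sup>2)\<close>: \<open>S\<close> and \<open>d\<close> are the coefficients
 of the two sides of \<open>D(w) = (1 + r\<^sup>2)\<^sup>K\<^sup>+\<^sup>1 H(r)\<close>.\<close>

lemma catalan_inversion:
 fixes S d :: "nat \<Rightarrow> 'a::real_vector" and K :: real
 assumes S: "\<And>J. S J = (\<Sum>i\<le>J div 2. ((-1)^i * ((real (J - i) + K) gchoose i)) *\<^sub>R d (J - 2*i))"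
 shows "d n = (\<Sum>m\<le>n div 2. ((real n + K) gchoose m) *\<^sub>R (S (n - 2*m) - (if 2*m+2 \<le> n then S (n - 2*m - 2) else 0)))"
proof -
 let ?c = "\<lambda>J i. (-1)^i * ((real (J - i) + K) gchoose i)"
 \<comment> \<open>\<open>P\<close> is the difference sequence from which \<open>S\<close> is
   recovered by telescoping, and \<open>Q\<close> is the claimed solution.\<close>
 define P where "P n = S n - (if 2 \<le> n then S (n-2) else 0)" for n
 define Q where "Q n = (\<Sum>m\<le>n div 2. ((real n + K) gchoose m) *\<^sub>R P (n - 2*m))" for n
 have tel: "(\<Sum>t\<le>J div 2. P (J - 2*t)) = S J" for J
 proof (induction J rule: less_induct)
  case (less J)
  show ?case
  proof (cases "J \<ge> 2")
   case False thus ?thesis by (auto simp: P_def)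
  next
   case True
   hence "J div 2 = Suc ((J-2) div 2)" by simp
   hence "(\<Sum>t\<le>J div 2. P (J - 2*t)) = P J + (\<Sum>t\<le>(J-2) div 2. P (J - 2 - 2*t))"
    by (simp only: sum.atMost_Suc_shift) (simp add: diff_diff_left)
   also have "\<dots> = S J" using True less[of "J-2"] by (simp add: P_def)
   finally show ?thesis .
  qed
 qed
 \<comment> \<open>\<open>Q\<close> satisfies the same relations as \<open>d\<close>: collecting the
   terms with i + m = t, the coefficient of \<open>P (J - 2*t)\<close> is the alternating sum above,
   that is 1.\<close>
 have SQ: "S J = (\<Sum>i\<le>J div 2. (?c J i) *\<^sub>R Q (J - 2*i))" for J
 proof -
  let ?D = "J div 2"
  let ?g = "\<lambda>i m. ((-1)^i * ((real (J - i) + K) gchoose i) * ((real (J-2*i) + K) gchoose m)) *\<^sub>R P (J - 2*i - 2*m)"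
  have "(\<Sum>i\<le>?D. (?c J i) *\<^sub>R Q (J - 2*i)) = (\<Sum>i\<le>?D. \<Sum>m\<le>?D - i. ?g i m)"
  proof (intro sum.cong refl)
   fix i assume "i \<in> {..?D}"
   hence "(J - 2*i) div 2 = ?D - i" by auto
   thus "(?c J i) *\<^sub>R Q (J - 2*i) = (\<Sum>m\<le>?D - i. ?g i m)"
    by (simp add: Q_def scaleR_sum_right)
  qed
  also have "\<dots> = (\<Sum>(i,m)\<in>{(i,m). i + m \<le> ?D}. ?g i m)"
   by (subst sum.Sigma) (auto intro!: sum.cong)
  also have "\<dots> = (\<Sum>t\<le>?D. \<Sum>i\<le>t. ?g i (t-i))"
   by (rule sum.triangle_reindex_eq)
  also have "\<dots> = (\<Sum>t\<le>?D. P (J - 2*t))"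
  proof (intro sum.cong refl)
   fix t assume t: "t \<in> {..?D}"
   have "(\<Sum>i\<le>t. ?g i (t-i)) = (\<Sum>i\<le>t. ((-1)^i * ((real J + K - real i) gchoose i) * ((real J + K - 2 * real i) gchoose (t - i))) *\<^sub>R P (J - 2*t))"
    using t by (intro sum.cong refl) (auto simp: of_nat_diff algebra_simps)
   also have "\<dots> = 1 *\<^sub>R P (J - 2*t)"
    unfolding scaleR_sum_left[symmetric] gbinomial_alternating_sum ..
   finally show "(\<Sum>i\<le>t. ?g i (t-i)) = P (J - 2*t)" by simp
  qed
  finally show ?thesis using tel by simp
 qed
 \<comment> \<open>The relation for \<open>J\<close> contains \<open>d J\<close> with coefficient 1
   and otherwise only smaller indices, so it has at most one solution.\<close>
 have "d n = Q n"
 proof (induction n rule: less_induct)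
  case (less J)
  have split: "(\<Sum>i\<le>J div 2. (?c J i) *\<^sub>R f (J - 2*i))
    = f J + (\<Sum>i\<in>{1..J div 2}. (?c J i) *\<^sub>R f (J - 2*i))" for f :: "nat \<Rightarrow> 'a"
   unfolding atMost_atLeast0 by (subst sum.atLeast_Suc_atMost) auto
  have "d J + (\<Sum>i\<in>{1..J div 2}. (?c J i) *\<^sub>R d (J - 2*i))
    = Q J + (\<Sum>i\<in>{1..J div 2}. (?c J i) *\<^sub>R Q (J - 2*i))"
   using S[of J] SQ[of J] unfolding split by simp
  moreover have "(\<Sum>i\<in>{1..J div 2}. (?c J i) *\<^sub>R d (J - 2*i))
    = (\<Sum>i\<in>{1..J div 2}. (?c J i) *\<^sub>R Q (J - 2*i))"
   using less by (intro sum.cong refl) (auto simp: less)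
  ultimately show ?case by simp
 qed
 thus ?thesis unfolding Q_def P_def by (auto intro!: sum.cong)
qed

section \<open>Integrals along vertical lines and the Bromwich integral of a power\<close>

lemma integrable_one_plus_abs_powr:
 assumes "a > (1::real)"
 shows "integrable lborel (\<lambda>y::real. (1 + \<bar>y\<bar>) powr (-a))"
proof -
 let ?F = "\<lambda>y::real. (1 + y) powr (1 - a) / (1 - a)"
 have "(\<integral>\<^sup>+y. ennreal ((1 + y) powr (-a)) * indicator {0..} y \<partial>lborel) = ennreal (0 - ?F 0)"
 proof (rule nn_integral_FTC_atLeast)
  show "DERIV ?F x :> (1 + x) powr (- a)" if "0 \<le> x" for x
  proof -
   have "DERIV ?F x :> ((1 - a) * (1 + x) powr (1 - a - 1)) / (1 - a)"
    using that assms by (auto intro!: derivative_eq_intros)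
   thus ?thesis using assms by simp
  qed
  have "((\<lambda>y. y powr (1 - a)) \<longlongrightarrow> 0) at_top"
   using assms by (intro tendsto_neg_powr filterlim_ident) auto
  moreover have "filterlim (\<lambda>y::real. 1 + y) at_top at_top"
   by (rule filterlim_tendsto_add_at_top[OF tendsto_const filterlim_ident])
  ultimately have "((\<lambda>y::real. (1 + y) powr (1 - a)) \<longlongrightarrow> 0) at_top"
   by (rule filterlim_compose)
  from tendsto_divide[OF this tendsto_const[of "1-a"]] assms show "(?F \<longlongrightarrow> 0) at_top" by simp
 qed auto
 hence "(\<integral>\<^sup>+y. ennreal (indicator {0..} y *\<^sub>R (1 + \<bar>y\<bar>) powr (-a)) \<partial>lborel) = ennreal (0 - ?F 0)"
  by (subst (asm) nn_integral_cong[where v="\<lambda>y. ennreal (indicator {0..} y *\<^sub>R (1 + \<bar>y\<bar>) powr (-a))"])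
   (auto split: split_indicator)
 hence "has_bochner_integral lborel (\<lambda>y. indicator {0..} y *\<^sub>R (1 + \<bar>y\<bar>) powr (-a)) (0 - ?F 0)"
  using assms by (intro has_bochner_integral_nn_integral) auto
 from has_bochner_integral_even_function[OF this] show ?thesis
  by (auto simp: has_bochner_integral_iff)
qed

text \<open>The bound is uniform in all \<open>c\<close> above \<open>c0\<close>, so that one
  integrable majorant serves while the line moves to the right. It rests on (c + |y|)^2 <= 2 |c +
  iy|^2, with the square root of 2 rounded up to 2.\<close>

lemma norm_Complex_powr_le:
 assumes "0 < c0" "c0 \<le> c" "a \<ge> 0"
 shows "norm (Complex c y) powr (-a) \<le> (2 / min c0 1) powr a * (1 + \<bar>y\<bar>) powr (-a)"
proof -
 have "(c + \<bar>y\<bar>)\<^sup>2 \<le> 2 * (norm (Complex c y))\<^sup>2"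
  using sum_squares_bound[of c "\<bar>y\<bar>"] unfolding cmod_power2 power2_sum complex.sel power2_abs
  by (simp only: mult_2 add_mono order_refl)
 also have "\<dots> \<le> (2 * norm (Complex c y))\<^sup>2" by (simp only: power_mult_distrib mult_right_mono zero_le_power2) simp
 finally have "c + \<bar>y\<bar> \<le> 2 * norm (Complex c y)" by (rule power2_le_imp_le) simp
 moreover have "min c0 1 * (1 + \<bar>y\<bar>) \<le> c + \<bar>y\<bar>"
  using assms mult_right_mono[of "min c0 1" 1 "\<bar>y\<bar>"] by (auto simp: algebra_simps)
 ultimately have le: "min c0 1 / 2 * (1 + \<bar>y\<bar>) \<le> norm (Complex c y)" by simp
 have pos: "min c0 1 / 2 * (1 + \<bar>y\<bar>) > 0" using assms by (intro mult_pos_pos) auto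
 have "norm (Complex c y) powr (-a) \<le> (min c0 1 / 2 * (1 + \<bar>y\<bar>)) powr (-a)"
  by (rule powr_mono2'[OF _ pos le]) (use assms(3) in simp)
 also have "\<dots> = (min c0 1 / 2) powr (-a) * (1 + \<bar>y\<bar>) powr (-a)"
  by (rule powr_mult)
 also have "(min c0 1 / 2) powr (-a) = (2 / min c0 1) powr a"
  unfolding powr_minus powr_divide by (rule inverse_divide)
 finally show ?thesis .
qed

lemma integrable_vertical_line:
 assumes hol: "f holomorphic_on {s. 0 < Re s}" and c: "0 < c" and a: "a > 1"
  and bd: "\<And>s. Re s = c \<Longrightarrow> norm (f s) \<le> C * norm s powr (-a)"
 shows "integrable lborel (\<lambda>y. f (Complex c y))"
proof -
 have C: "C \<ge> 0"
 proof -
  have "0 \<le> C * norm (of_real c :: complex) powr (-a)"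
   using bd[of "of_real c"] norm_ge_zero[of "f (of_real c)"] by (simp del: norm_ge_zero)
  thus ?thesis using c by (simp add: zero_le_mult_iff)
 qed
 have cont: "continuous_on UNIV (\<lambda>y. f (Complex c y))"
  by (rule continuous_on_compose2[OF holomorphic_on_imp_continuous_on[OF hol]])
   (use c in \<open>auto intro!: continuous_intros simp: Complex_eq\<close>)
 show ?thesis
 proof (rule Bochner_Integration.integrable_bound)
  show "integrable lborel (\<lambda>y. C * ((2 / min c 1) powr a * (1 + \<bar>y\<bar>) powr (-a)))"
   using a by (intro integrable_mult_right integrable_one_plus_abs_powr)
  show "(\<lambda>y. f (Complex c y)) \<in> borel_measurable lborel"
   using cont by (simp add: borel_measurable_continuous_onI)
  show "AE y in lborel. norm (f (Complex c y)) \<le> norm (C * ((2 / min c 1) powr a * (1 + \<bar>y\<bar>) powr (-a)))"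
  proof (rule AE_I2)
   fix y
   have "norm (f (Complex c y)) \<le> C * norm (Complex c y) powr (-a)" by (rule bd) simp
   also have "\<dots> \<le> C * ((2 / min c 1) powr a * (1 + \<bar>y\<bar>) powr (-a))"
    using C c a by (intro mult_left_mono norm_Complex_powr_le) auto
   finally show "norm (f (Complex c y)) \<le> norm (C * ((2 / min c 1) powr a * (1 + \<bar>y\<bar>) powr (-a)))"
    using C by simp
  qed
 qed
qed

lemma LIMSEQ_integral_symmetric:
 fixes f :: "real \<Rightarrow> complex"
 assumes "integrable lborel f"
 shows "(\<lambda>n. integral {-real n..real n} f) \<longlonglongrightarrow> integral\<^sup>L lborel f"
proof -
 have "(\<lambda>n. LINT y|lborel. indicator {-real n..real n} y *\<^sub>R f y) \<longlonglongrightarrow> integral\<^sup>L lborel f"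
 proof (rule integral_dominated_convergence[where w="\<lambda>y. norm (f y)"])
  show "AE x in lborel. (\<lambda>n. indicator {-real n..real n} x *\<^sub>R f x) \<longlonglongrightarrow> f x"
  proof (rule AE_I2)
   fix x
   obtain N where N: "real N \<ge> \<bar>x\<bar>" using real_arch_simple by blast
   have "eventually (\<lambda>n. indicator {-real n..real n} x *\<^sub>R f x = f x) sequentially"
    using eventually_ge_at_top[of N] by eventually_elim (use N in \<open>auto simp: indicator_def\<close>)
   thus "(\<lambda>n. indicator {-real n..real n} x *\<^sub>R f x) \<longlonglongrightarrow> f x" by (rule tendsto_eventually)
  qed
 qed (use assms in \<open>auto simp: indicator_def\<close>)
 moreover have "(LINT y|lborel. indicator {-real n..real n} y *\<^sub>R f y) = integral {-real n..real n} f" for n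
 proof -
  have "set_integrable lborel {-real n..real n} f"
   using assms unfolding set_integrable_def by (intro integrable_mult_indicator) auto
  from set_borel_integral_eq_integral(2)[OF this] show ?thesis by (simp add: set_lebesgue_integral_def)
 qed
 ultimately show ?thesis by simp
qed

text \<open>The difference of the integrals over \<open>Re s = c\<close> and \<open>Re s = c'\<close>, cut off at height \<open>n\<close>, is a difference
 of values of a primitive along two horizontal segments, which decays like \<open>n\<^sup>-\<^sup>a\<close>.\<close>

lemma vertical_line_integral_shift:
 assumes hol: "f holomorphic_on {s. 0 < Re s}" and c: "0 < c" "c \<le> c'" and a: "a > 1"
  and bd: "\<And>s. c \<le> Re s \<Longrightarrow> Re s \<le> c' \<Longrightarrow> norm (f s) \<le> C * norm s powr (-a)"
 shows "(LINT y|lborel. f (Complex c y)) = (LINT y|lborel. f (Complex c' y))"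
proof -
 have "convex {s. 0 < Re s}" "open {s. 0 < Re s}"
  using convex_halfspace_Re_gt[of 0] open_halfspace_Re_gt[of 0] by auto
 from holomorphic_convex_primitive'[OF this hol] obtain F where
  F: "\<And>s. s \<in> {s. 0 < Re s} \<Longrightarrow> (F has_field_derivative f s) (at s within {s. 0 < Re s})" by blast
 have F': "(F has_field_derivative f s) (at s)" if "0 < Re s" for s
  using F[of s] that \<open>open {s. 0 < Re s}\<close> at_within_open by force
 \<comment> \<open>On a vertical line the primitive satisfies dF = i f dy, which explains the
   division by i.\<close>
 have int: "integral {-real n..real n} (\<lambda>y. f (Complex d y)) = (F (Complex d n) - F (Complex d (-real n))) / \<i>"
  if d: "d > 0" for n d
 proof -
  have "((\<lambda>y. F (Complex d y) / \<i>) has_vector_derivative f (Complex d y)) (at y within A)" for y A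
  proof -
   have "((F \<circ> (\<lambda>y. Complex d y)) has_vector_derivative \<i> * f (Complex d y)) (at y)"
    by (intro field_vector_diff_chain_at F') (use d in \<open>auto simp: Complex_eq intro!: derivative_eq_intros\<close>)
   hence "((\<lambda>y. F (Complex d y) / \<i>) has_vector_derivative (\<i> * f (Complex d y)) / \<i>) (at y)"
    unfolding o_def by (rule has_vector_derivative_divide)
   thus ?thesis by (auto intro: has_vector_derivative_at_within)
  qed
  hence "((\<lambda>y. f (Complex d y)) has_integral (F (Complex d n) / \<i> - F (Complex d (-real n)) / \<i>)) {-real n..real n}"
   by (intro fundamental_theorem_of_calculus) auto
  thus ?thesis by (simp add: integral_unique diff_divide_distrib right_diff_distrib)
 qed
 have C: "C \<ge> 0"
 proof -
  have "0 \<le> C * norm (of_real c :: complex) powr (-a)"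
   using bd[of "of_real c"] c norm_ge_zero[of "f (of_real c)"] by (simp del: norm_ge_zero)
  thus ?thesis using c by (simp add: zero_le_mult_iff)
 qed
 have hor: "norm (F (Complex c' y) - F (Complex c y)) \<le> C * \<bar>y\<bar> powr (-a) * (c' - c)" if "y \<noteq> 0" for y
 proof -
  let ?S = "closed_segment (Complex c y) (Complex c' y)"
  have seg: "c \<le> Re s \<and> Re s \<le> c' \<and> Im s = y" if "s \<in> ?S" for s
  proof -
   from that obtain u where u: "0 \<le> u" "u \<le> 1" "s = (1 - u) *\<^sub>R Complex c y + u *\<^sub>R Complex c' y"
    by (auto simp: closed_segment_def)
   have "Re s = c + u * (c' - c)" "Im s = y" unfolding u(3) by (simp_all add: algebra_simps)
   moreover have "0 \<le> u * (c' - c)" "u * (c' - c) \<le> 1 * (c' - c)" using u(1,2) c mult_right_mono[of u 1 "c' - c"] by auto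
   ultimately show ?thesis by simp
  qed
  have sub: "z \<in> ?S \<Longrightarrow> (F has_field_derivative f z) (at z within ?S)" for z
   using seg[of z] c by (intro has_field_derivative_at_within[OF F']) auto
  have bnd: "norm (f z) \<le> C * \<bar>y\<bar> powr (-a)" if "z \<in> ?S" for z
  proof -
   have "norm (f z) \<le> C * norm z powr (-a)" using seg[OF that] bd by auto
   moreover have "norm z powr (-a) \<le> \<bar>y\<bar> powr (-a)"
    by (rule powr_mono2') (use seg[OF that] abs_Im_le_cmod[of z] \<open>y \<noteq> 0\<close> a in auto)
   ultimately show ?thesis using C by (meson mult_left_mono order_trans)
  qed
  have "norm (Complex c' y - Complex c y) = c' - c" using c by (simp add: cmod_def)
  thus ?thesis
   using field_differentiable_bound[OF convex_closed_segment sub bnd, of "Complex c' y" "Complex c y"] by simp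
 qed
 have ib: "integrable lborel (\<lambda>y. f (Complex d y))" if "c \<le> d" "d \<le> c'" for d
  using that c by (intro integrable_vertical_line[OF hol _ a, where C=C] bd) auto
 let ?I = "\<lambda>d n. integral {-real n..real n} (\<lambda>y. f (Complex d y))"
 have L1: "(\<lambda>n. ?I c' n - ?I c n) \<longlonglongrightarrow> (LINT y|lborel. f (Complex c' y)) - (LINT y|lborel. f (Complex c y))"
  using c by (intro tendsto_diff LIMSEQ_integral_symmetric ib) auto
 have L2: "(\<lambda>n. ?I c' n - ?I c n) \<longlonglongrightarrow> 0"
 proof (rule Lim_null_comparison)
  show "eventually (\<lambda>n. norm (?I c' n - ?I c n) \<le> 2 * (C * real n powr (-a) * (c' - c))) sequentially"
   using eventually_gt_at_top[of 0]
  proof eventually_elim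
   case (elim n)
   have eq: "?I c' n - ?I c n = ((F (Complex c' n) - F (Complex c n)) - (F (Complex c' (-real n)) - F (Complex c (-real n)))) / \<i>"
    using c by (simp add: int algebra_simps)
   have "norm (?I c' n - ?I c n) \<le> norm (F (Complex c' n) - F (Complex c n)) + norm (F (Complex c' (-real n)) - F (Complex c (-real n)))"
    unfolding eq by (simp only: norm_divide norm_ii div_by_1 norm_triangle_ineq4)
   also have "\<dots> \<le> C * \<bar>real n\<bar> powr (-a) * (c' - c) + C * \<bar>-real n\<bar> powr (-a) * (c' - c)"
    using elim by (intro add_mono hor) auto
   finally show ?case by (simp add: mult_ac)
  qed
  have "((\<lambda>n. real n powr (-a)) \<longlongrightarrow> 0) sequentially"
   using a by (intro tendsto_neg_powr filterlim_real_sequentially) auto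
  from tendsto_mult_left_zero[OF this, of "2 * C * (c' - c)"]
  show "(\<lambda>n. 2 * (C * real n powr (-a) * (c' - c))) \<longlonglongrightarrow> 0" by (simp only: mult_ac)
 qed
 show ?thesis
  using LIMSEQ_unique[OF L1 L2] by (rule eq_iff_diff_eq_0[THEN iffD2, symmetric])
qed

text \<open>Division by a positive real keeps the argument, so no branch cut is crossed and the
  principal logarithms subtract.\<close>

lemma complex_divide_powr_minus:
 fixes z :: complex and t \<nu> :: real
 assumes "t > 0" "z \<noteq> 0"
 shows "(z / of_real t) powr (- of_real \<nu>) = z powr (- of_real \<nu>) * of_real (t powr \<nu>)"
proof -
 have t: "of_real (t powr \<nu>) = exp (of_real \<nu> * of_real (ln t) :: complex)"
 proof -
  have "t powr \<nu> = exp (\<nu> * ln t)" using assms(1) unfolding powr_def[of t] by (subst if_not_P) auto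
  thus ?thesis by (simp only: exp_of_real[symmetric] of_real_mult)
 qed
 have L: "Ln (z / of_real t) = Ln z - of_real (ln t)"
  using Ln_divide_of_real[OF assms] by simp
 have nz: "z / of_real t \<noteq> 0" using assms by simp
 have "(z / of_real t) powr (- of_real \<nu>) = exp (- of_real \<nu> * (Ln z - of_real (ln t)))"
  using nz unfolding powr_def L by simp
 also have "- of_real \<nu> * (Ln z - of_real (ln t)) = - of_real \<nu> * Ln z + of_real \<nu> * of_real (ln t)"
  by (simp add: algebra_simps)
 also have "exp \<dots> = z powr (- of_real \<nu>) * of_real (t powr \<nu>)"
  using assms(2) unfolding t exp_add powr_def[of z] by simp
 finally show ?thesis .
qed

text \<open>Shifting the line to the right makes the integral arbitrarily small.\<close>

lemma vertical_line_integral_eq_0: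
 assumes hol: "f holomorphic_on {s. 0 < Re s}" and c0: "0 < c0"
  and bd: "\<And>s. c0 \<le> Re s \<Longrightarrow> norm (f s) \<le> C * norm s powr (-2)"
 shows "(LINT y|lborel. f (Complex c0 y)) = 0"
proof -
 define M where "M = max c0 1"
 have "0 \<le> C * norm (of_real c0 :: complex) powr (-2)"
  using bd[of "of_real c0"] norm_ge_zero[of "f (of_real c0)"] by (simp del: norm_ge_zero)
 hence C0: "C \<ge> 0" using c0 by (simp add: zero_le_mult_iff)
 define D where "D = (LINT y|lborel. C * (2 powr (3/2) * (1 + \<bar>y\<bar>) powr (-(3/2::real))))"
 have le: "norm (LINT y|lborel. f (Complex c0 y)) \<le> c powr (-1/2) * D" if c: "c \<ge> M" for c
 proof -
  have c1: "c \<ge> 1" "c0 \<le> c" using c by (auto simp: M_def)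
  have eq: "(LINT y|lborel. f (Complex c0 y)) = (LINT y|lborel. f (Complex c y))"
   by (rule vertical_line_integral_shift[OF hol c0 c1(2) _ bd]) auto
  have "norm (LINT y|lborel. f (Complex c y))
   \<le> (LINT y|lborel. c powr (-1/2) * (C * (2 powr (3/2) * (1 + \<bar>y\<bar>) powr (-(3/2::real)))))"
  proof (rule Bochner_Integration.integral_norm_bound_integral)
   fix y
   have n: "norm (Complex c y) \<ge> c" using complex_Re_le_cmod[of "Complex c y"] by simp
   have 1: "norm (Complex c y) powr (-1/2) \<le> c powr (-1/2)"
    by (rule powr_mono2') (use c1 n in auto)
   have 2: "norm (Complex c y) powr (-(3/2)) \<le> 2 powr (3/2) * (1 + \<bar>y\<bar>) powr (-(3/2))"
    using norm_Complex_powr_le[of 1 c "3/2" y] c1 by simp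
   \<comment> \<open>The decay is shared out: the power -1/2 is at most c^(-1/2) and tends to 0 as
     the line moves, the power -3/2 remains integrable along the line.\<close>
   have 3: "norm (Complex c y) powr (-2) = norm (Complex c y) powr (-1/2) * norm (Complex c y) powr (-(3/2))"
    by (subst powr_add[symmetric]) simp
   have "norm (f (Complex c y)) \<le> C * norm (Complex c y) powr (-2)" using c1 by (intro bd) auto
   also have "\<dots> \<le> C * (c powr (-1/2) * (2 powr (3/2) * (1 + \<bar>y\<bar>) powr (-(3/2))))"
    unfolding 3 by (rule mult_left_mono[OF mult_mono[OF 1 2] C0]) auto
   finally show "norm (f (Complex c y)) \<le> c powr (-1/2) * (C * (2 powr (3/2) * (1 + \<bar>y\<bar>) powr (-(3/2::real))))"
    by (simp only: mult_ac)
  next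
   show "integrable lborel (\<lambda>y. f (Complex c y))"
    by (rule integrable_vertical_line[OF hol _ _ bd]) (use c1 in auto)
   show "integrable lborel (\<lambda>y. c powr (-1/2) * (C * (2 powr (3/2) * (1 + \<bar>y\<bar>) powr (-(3/2::real)))))"
    by (intro integrable_mult_right integrable_one_plus_abs_powr) auto
  qed
  also have "\<dots> = c powr (-1/2) * D" by (simp add: D_def)
  finally show ?thesis unfolding eq .
 qed
 have "((\<lambda>c::real. c powr (-1/2)) \<longlongrightarrow> 0) at_top"
  by (rule tendsto_neg_powr[OF _ filterlim_ident]) simp
 hence lim: "((\<lambda>c. c powr (-1/2) * D) \<longlongrightarrow> 0) at_top" by (rule tendsto_mult_left_zero)
 have "eventually (\<lambda>c. norm (LINT y|lborel. f (Complex c0 y)) \<le> c powr (-1/2) * D) at_top"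
  using eventually_ge_at_top[of M] by eventually_elim (rule le)
 with lim have "norm (LINT y|lborel. f (Complex c0 y)) \<le> 0"
  by (rule tendsto_lowerbound) simp
 thus ?thesis by simp
qed

text \<open>The pole at s = 1 lies to the right of the line. Subtracting 1/(s(1 - s)), which has the
  same residue there, leaves a function \<open>g\<close> that is holomorphic in the half-plane and
  O(|s|^(-2)); its integral vanishes by moving the line away. The subtracted term is an arctangent
  integral.\<close>

lemma vertical_line_integral_reciprocal:
 assumes "\<nu> > 1"
 shows "(LINT y|lborel. Complex (1/2) y powr (- of_real \<nu>) / (1 - Complex (1/2) y)) = 2 * pi"
proof -
 define p where "p s = s powr (1 - of_real \<nu>) - 1" for s :: complex
 \<comment> \<open>The value at 1 fills the removable singularity of p(s)/(s - 1).\<close>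
 define g where "g s = - (if s = 1 then deriv p 1 else (p s - p 1) / (s - 1)) / s" for s
 let ?H = "{s::complex. 0 < Re s}"
 have opn: "open ?H" using open_halfspace_Re_gt[of 0] by auto
 have holp: "p holomorphic_on ?H" unfolding p_def
  by (auto intro!: holomorphic_intros simp: complex_nonpos_Reals_iff)
 have hol: "g holomorphic_on ?H" unfolding g_def
  using pole_lemma_open[OF holp opn, of 1] by (auto intro!: holomorphic_intros)
 have p1: "p 1 = 0" by (simp add: p_def)
 have g_eq: "g s = s powr (- of_real \<nu>) / (1 - s) - 1 / (s * (1 - s))" if "s \<noteq> 0" "s \<noteq> 1" for s
 proof -
  have "s powr (1 - of_real \<nu>) = s * s powr (- of_real \<nu>)"
   using that powr_add[of s 1 "- of_real \<nu>"] by simp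
  hence "g s = (s * s powr (- of_real \<nu>) - 1) / (s * (1 - s))"
   using that p1 by (simp add: g_def p_def divide_simps) (simp add: algebra_simps)
  also have "\<dots> = s powr (- of_real \<nu>) / (1 - s) - 1 / (s * (1 - s))"
   using that by (simp add: diff_divide_distrib)
  finally show ?thesis .
 qed
 have "bounded (g ` cball 1 (1/4))"
 proof -
  have "cball 1 (1/4) \<subseteq> ?H"
  proof
   fix s :: complex assume "s \<in> cball 1 (1/4)"
   thus "s \<in> ?H" using abs_Re_le_cmod[of "1 - s"] by (auto simp: dist_norm)
  qed
  hence "continuous_on (cball 1 (1/4)) g"
   using hol holomorphic_on_imp_continuous_on continuous_on_subset by blast
  thus ?thesis by (intro compact_imp_bounded compact_continuous_image) auto
 qed
 then obtain B where B: "\<And>s. s \<in> cball 1 (1/4) \<Longrightarrow> norm (g s) \<le> B" unfolding bounded_iff by blast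
 \<comment> \<open>The first bound covers the disc of radius 1/4 about 1, where |s| <= 2; the second
   covers its complement, where |s| <= 5 |s - 1|.\<close>
 define C where "C = max (4 * B) (5 * ((1/2) powr (1 - \<nu>) + 1))"
 have B0: "B \<ge> 0" by (rule order_trans[OF norm_ge_zero B[of 1]]) simp
 have bd: "norm (g s) \<le> C * norm s powr (-2)" if s: "Re s \<ge> 1/2" for s
 proof -
  have s0: "norm s \<ge> 1/2" using s complex_Re_le_cmod[of s] by linarith
  have pw: "norm s powr (-2) = 1 / (norm s)\<^sup>2"
   unfolding powr_minus inverse_eq_divide by (subst powr_numeral) simp_all
  show ?thesis
  proof (cases "s \<in> cball 1 (1/4)")
   case True
   have "norm s \<le> norm (1::complex) + norm (s - 1)" using norm_triangle_sub[of s 1] by simp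
   also have "\<dots> \<le> 2" using True by (simp add: dist_norm norm_minus_commute)
   finally have "(norm s)\<^sup>2 \<le> 2\<^sup>2" by (intro power_mono) auto
   hence "B * (norm s)\<^sup>2 \<le> B * 4" using B0 by (intro mult_left_mono) auto
   also have "B * 4 \<le> C" by (simp add: C_def)
   finally have "B \<le> C * norm s powr (-2)" unfolding pw using s0
    by (simp only: mult_1_right times_divide_eq_right) (subst pos_le_divide_eq, auto)
   with B[OF True] show ?thesis by linarith
  next
   case False
   hence s1: "norm (s - 1) > 1/4" by (simp add: dist_norm norm_minus_commute)
   have "norm s \<le> 1 + norm (s - 1)" using norm_triangle_sub[of s 1] by simp
   hence s2: "norm s \<le> 5 * norm (s - 1)" using s1 by linarith
   have "norm (p s) \<le> norm s powr (1 - \<nu>) + 1"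
    unfolding p_def using norm_triangle_ineq4[of "s powr (1 - of_real \<nu>)" 1]
    by (simp add: norm_powr_real_powr')
   also have "norm s powr (1 - \<nu>) \<le> (1/2) powr (1 - \<nu>)"
    by (rule powr_mono2') (use assms s0 in auto)
   finally have ps: "norm (p s) \<le> (1/2) powr (1 - \<nu>) + 1" by simp
   have "s \<noteq> 1" using s1 by auto
   hence "norm (g s) = norm (p s) / (norm (s - 1) * norm s)"
    by (simp add: g_def p1 norm_divide norm_mult)
   also have "\<dots> \<le> ((1/2) powr (1 - \<nu>) + 1) / (norm s / 5 * norm s)"
    using ps s0 s1 s2 by (intro frac_le mult_mono mult_pos_pos) (auto intro: add_nonneg_nonneg)
   also have "\<dots> = 5 * ((1/2) powr (1 - \<nu>) + 1) * norm s powr (-2)"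
    using s0 by (simp add: pw power2_eq_square field_simps)
   also have "\<dots> \<le> C * norm s powr (-2)" by (intro mult_right_mono) (auto simp: C_def)
   finally show ?thesis .
  qed
 qed
 have int_g: "integrable lborel (\<lambda>y. g (Complex (1/2) y))"
  by (rule integrable_vertical_line[OF hol _ _ bd]) auto
 have zero: "(LINT y|lborel. g (Complex (1/2) y)) = 0"
  by (rule vertical_line_integral_eq_0[OF hol _ bd]) auto
 \<comment> \<open>On Re s = 1/2 the factors s and 1 - s are conjugate, so the subtracted term is
   real and a rescaled 1/(1 + x^2).\<close>
 have quad: "Complex (1/2) y * (1 - Complex (1/2) y) = of_real ((1 + (2*y)\<^sup>2) / 4)" for y
  by (simp add: complex_eq_iff power2_eq_square)
 have arct: "has_bochner_integral lborel (\<lambda>x::real. inverse (1 + x\<^sup>2)) pi"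
 proof -
  have "(\<integral>\<^sup>+x. ennreal (inverse (1 + x\<^sup>2)) * indicator {0..} x \<partial>lborel) = ennreal (pi / 2 - arctan 0)"
   by (rule nn_integral_FTC_atLeast)
    (auto intro!: derivative_eq_intros tendsto_arctan_at_top simp: add_nonneg_eq_0_iff)
  hence "(\<integral>\<^sup>+x. ennreal (indicator {0..} x *\<^sub>R inverse (1 + x\<^sup>2)) \<partial>lborel) = ennreal (pi / 2)"
   by (subst (asm) nn_integral_cong[where v="\<lambda>x. ennreal (indicator {0..} x *\<^sub>R inverse (1 + x\<^sup>2))"])
    (auto split: split_indicator)
  hence "has_bochner_integral lborel (\<lambda>x::real. indicator {0..} x *\<^sub>R inverse (1 + x\<^sup>2)) (pi / 2)"
   by (intro has_bochner_integral_nn_integral) (auto intro: add_nonneg_nonneg)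
  from has_bochner_integral_even_function[OF this] show ?thesis by simp
 qed
 have "has_bochner_integral lborel (\<lambda>y::real. inverse (1 + (0 + 2 * y)\<^sup>2)) (pi /\<^sub>R \<bar>2\<bar>)"
  using lborel_has_bochner_integral_real_affine_iff[of 2 "\<lambda>x::real. inverse (1 + x\<^sup>2)" pi 0] arct by simp
 from has_bochner_integral_mult_right[OF this, of 4]
 have "has_bochner_integral lborel (\<lambda>y::real. 4 * inverse (1 + (2 * y)\<^sup>2)) (2 * pi)" by simp
 from has_bochner_integral_of_real[OF this, where 'a=complex]
 have int2: "has_bochner_integral lborel (\<lambda>y::real. 1 / (Complex (1/2) y * (1 - Complex (1/2) y))) (of_real (2 * pi))"
  unfolding quad by (simp add: field_simps)
 have "has_bochner_integral lborel (\<lambda>y. g (Complex (1/2) y)) 0"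
  using int_g zero by (simp add: has_bochner_integral_iff)
 from has_bochner_integral_add[OF this int2]
 have "has_bochner_integral lborel (\<lambda>y. g (Complex (1/2) y) + 1 / (Complex (1/2) y * (1 - Complex (1/2) y))) (of_real (2 * pi))"
  by simp
 also have "(\<lambda>y. g (Complex (1/2) y) + 1 / (Complex (1/2) y * (1 - Complex (1/2) y)))
  = (\<lambda>y. Complex (1/2) y powr (- of_real \<nu>) / (1 - Complex (1/2) y))"
 proof (rule ext)
  fix y
  have "Complex (1/2) y \<noteq> 0" "Complex (1/2) y \<noteq> 1" by (simp_all add: complex_eq_iff)
  from g_eq[OF this] show "g (Complex (1/2) y) + 1 / (Complex (1/2) y * (1 - Complex (1/2) y))
    = Complex (1/2) y powr (- of_real \<nu>) / (1 - Complex (1/2) y)" by simp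
 qed
 finally show ?thesis by (simp add: has_bochner_integral_iff)
qed

lemma has_bochner_integral_laplace_exp:
 fixes w :: complex
 assumes "Re w > 0"
 shows "has_bochner_integral lborel (\<lambda>t. indicator {0<..} t *\<^sub>R exp (- (w * of_real t))) (1 / w)"
proof -
 let ?f = "\<lambda>t::real. exp (- (w * of_real t))"
 have w0: "w \<noteq> 0" using assms by auto
 have n: "norm (?f t) = exp (- Re w * t)" for t by simp
 have "(\<integral>\<^sup>+t. ennreal (exp (- Re w * t)) * indicator {0..} t \<partial>lborel) = ennreal (0 - (- exp (- Re w * 0) / Re w))"
 proof (rule nn_integral_FTC_atLeast)
  show "DERIV (\<lambda>t. - exp (- Re w * t) / Re w) x :> exp (- Re w * x)" for x
   using assms by (auto intro!: derivative_eq_intros)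
  have "filterlim (\<lambda>t. Re w * t) at_top at_top"
   by (rule filterlim_tendsto_pos_mult_at_top[OF tendsto_const assms filterlim_ident])
  hence "filterlim (\<lambda>t. - Re w * t) at_bot at_top" by (simp add: filterlim_uminus_at_bot)
  hence "((\<lambda>t. exp (- Re w * t)) \<longlongrightarrow> 0) at_top"
   by (rule filterlim_compose[OF exp_at_bot])
  from tendsto_divide[OF tendsto_minus[OF this] tendsto_const[of "Re w"]]
  show "((\<lambda>t. - exp (- Re w * t) / Re w) \<longlongrightarrow> 0) at_top" using assms by simp
 qed auto
 hence "(\<integral>\<^sup>+t. ennreal (norm (indicator {0..} t *\<^sub>R ?f t)) \<partial>lborel) < \<infinity>"
  by (subst nn_integral_cong[where v="\<lambda>t. ennreal (exp (- Re w * t)) * indicator {0..} t"])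
   (auto split: split_indicator)
 moreover have "(\<lambda>t. indicator {0..} t *\<^sub>R ?f t) \<in> borel_measurable lborel" by simp
 ultimately have int: "integrable lborel (\<lambda>t. indicator {0..} t *\<^sub>R ?f t)"
  by (subst integrable_iff_bounded) auto
 have fin: "integral {-real n..real n} (\<lambda>t. indicator {0..} t *\<^sub>R ?f t) = (1 - ?f n) / w" for n
 proof -
  have "((\<lambda>z. - exp (- (w * z)) / w) has_field_derivative ?f t) (at (of_real t))" for t
   using w0 by (auto intro!: derivative_eq_intros)
  hence "((\<lambda>t. - ?f t / w) has_vector_derivative ?f t) (at t within {0..real n})" for t
   by (rule has_vector_derivative_real_field)
  hence "(?f has_integral (- ?f n / w - (- ?f 0 / w))) {0..real n}"
   by (intro fundamental_theorem_of_calculus) auto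
  hence "((\<lambda>t. if t \<in> {0..real n} then ?f t else 0) has_integral (- ?f n / w - (- ?f 0 / w))) {-real n..real n}"
   by (subst has_integral_restrict) auto
  hence "((\<lambda>t. indicator {0..} t *\<^sub>R ?f t) has_integral (- ?f n / w - (- ?f 0 / w))) {-real n..real n}"
   by (rule has_integral_eq[rotated]) (auto simp: indicator_def)
  thus ?thesis by (simp add: integral_unique diff_divide_distrib)
 qed
 have L1: "(\<lambda>n. (1 - ?f (real n)) / w) \<longlonglongrightarrow> (LINT t|lborel. indicator {0..} t *\<^sub>R ?f t)"
  using LIMSEQ_integral_symmetric[OF int] unfolding fin .
 have "(\<lambda>n. norm (?f (real n))) \<longlonglongrightarrow> 0"
 proof -
  have "filterlim (\<lambda>n. Re w * real n) at_top sequentially"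
   by (rule filterlim_tendsto_pos_mult_at_top[OF tendsto_const assms filterlim_real_sequentially])
  hence "filterlim (\<lambda>n. - Re w * real n) at_bot sequentially" by (simp add: filterlim_uminus_at_bot)
  from filterlim_compose[OF exp_at_bot this] show ?thesis unfolding n .
 qed
 hence "(\<lambda>n. ?f (real n)) \<longlonglongrightarrow> 0" by (rule tendsto_norm_zero_cancel)
 from tendsto_divide[OF tendsto_diff[OF tendsto_const[of 1] this] tendsto_const[of w]]
 have L2: "(\<lambda>n. (1 - ?f (real n)) / w) \<longlonglongrightarrow> 1 / w" using w0 by simp
 have "has_bochner_integral lborel (\<lambda>t. indicator {0..} t *\<^sub>R ?f t) (1 / w)"
  using int LIMSEQ_unique[OF L1 L2] by (simp add: has_bochner_integral_iff)
 thus ?thesis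
 proof (subst has_bochner_integral_cong_AE)
  have "AE t in lborel. t \<noteq> (0::real)" by (rule AE_lborel_singleton)
  thus "AE t in lborel. indicator {0<..} t *\<^sub>R ?f t = indicator {0..} t *\<^sub>R ?f t"
   by eventually_elim (auto simp: indicator_def)
 qed auto
qed

text \<open>The function exp(-t) exp(ts) s^(-\<nu>) is integrated over t > 0 and the line Re s = 1/2
  in both orders. Integrating over t first leaves s^(-\<nu>)/(1 - s), hence 2 pi; integrating over
  the line first gives t^(\<nu>-1) exp(-t) times the wanted integral, hence
  \<open>Gamma \<nu>\<close> times it.\<close>

theorem bromwich_integral_rGamma:
 assumes nu: "\<nu> > 1" and c: "c > 0"
 shows "(LINT y|lborel. exp (Complex c y) * Complex c y powr (- of_real \<nu>)) = of_real (2 * pi / Gamma \<nu>)"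
proof -
 define f where "f s = exp s * s powr (- of_real \<nu>)" for s :: complex
 define L where "L c = (LINT y|lborel. f (Complex c y))" for c
 have hol: "f holomorphic_on {s. 0 < Re s}" unfolding f_def
  by (auto intro!: holomorphic_intros simp: complex_nonpos_Reals_iff)
 have bd: "norm (f s) \<le> exp C * norm s powr (- \<nu>)" if "Re s \<le> C" for s C
  using that by (simp add: f_def norm_mult norm_powr_real_powr' mult_right_mono)
 have shift: "L a = L b" if "0 < a" "a \<le> b" for a b
  unfolding L_def by (rule vertical_line_integral_shift[OF hol that nu bd])
 have L: "L a = L c" if "0 < a" for a
  proof (cases "a \<le> c")
  case True thus ?thesis using that by (intro shift)
 next
  case False thus ?thesis using c by (intro shift[symmetric]) auto
 qed
 define s where "s y = Complex (1/2) y" for y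
 define g where "g y = s y powr (- of_real \<nu>)" for y
 have s_eq: "s y = 1/2 + \<i> * of_real y" for y by (simp add: s_def Complex_eq)
 have s0: "s y \<noteq> 0" for y by (simp add: s_def complex_eq_iff)
 have ng: "norm (g y) = norm (s y) powr (- \<nu>)" for y by (simp add: g_def norm_powr_real_powr')
 have int_g: "integrable lborel g"
 proof -
  have "(\<lambda>s. s powr (- of_real \<nu>)) holomorphic_on {s. 0 < Re s}"
   by (auto intro!: holomorphic_intros simp: complex_nonpos_Reals_iff)
  from integrable_vertical_line[OF this, of "1/2" \<nu> 1] show ?thesis
   using nu unfolding g_def s_def by (simp add: norm_powr_real_powr')
 qed
 \<comment> \<open>Substituting y/t for y moves the line to Re s = t/2 and produces the power of t;
   \<open>L\<close> does not depend on the abscissa.\<close>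
 have inner_y: "(LINT y|lborel. exp (of_real t * s y) * g y) = of_real (t powr (\<nu> - 1)) * L c" if t: "t > 0" for t
 proof -
  have "(LINT y|lborel. exp (of_real t * s y) * g y)
    = \<bar>1/t\<bar> *\<^sub>R (LINT y|lborel. exp (of_real t * s (0 + 1/t * y)) * g (0 + 1/t * y))"
   by (rule lborel_integral_real_affine) (use t in auto)
  also have "(\<lambda>y. exp (of_real t * s (0 + 1/t * y)) * g (0 + 1/t * y)) = (\<lambda>y. of_real (t powr \<nu>) * f (Complex (t/2) y))"
  proof (rule ext)
   fix y
   have 1: "s (0 + 1/t * y) = Complex (t/2) y / of_real t"
    using t by (simp add: s_def complex_eq_iff)
   have "Complex (t/2) y \<noteq> 0" using t by (simp add: complex_eq_iff)
   from complex_divide_powr_minus[OF t this, of \<nu>]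
   have "g (0 + 1/t * y) = Complex (t/2) y powr (- of_real \<nu>) * of_real (t powr \<nu>)"
    unfolding g_def 1 .
   thus "exp (of_real t * s (0 + 1/t * y)) * g (0 + 1/t * y) = of_real (t powr \<nu>) * f (Complex (t/2) y)"
    using t unfolding 1 f_def by simp
  qed
  also have "\<bar>1/t\<bar> *\<^sub>R (LINT y|lborel. of_real (t powr \<nu>) * f (Complex (t/2) y)) = \<bar>1/t\<bar> *\<^sub>R (of_real (t powr \<nu>) * L (t/2))"
   by (simp add: L_def)
  also have "L (t/2) = L c" using t by (intro L) auto
  also have "\<bar>1/t\<bar> *\<^sub>R (of_real (t powr \<nu>) * L c) = of_real (t powr (\<nu> - 1)) * L c"
   using t by (simp add: powr_diff scaleR_conv_of_real)
  finally show ?thesis .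
 qed
 \<comment> \<open>On Re s = 1/2 the modulus of exp(-t) exp(ts) is exp(-t/2), so the modulus of the
   kernel is a product of two integrable functions of one variable and Fubini applies.\<close>
 define k where "k t y = indicator {0<..} t *\<^sub>R (exp (- of_real t) * (exp (of_real t * s y) * g y))" for t y
 have meas_g [measurable]: "g \<in> borel_measurable lborel" using int_g by simp
 have nk: "norm (k t y) = indicator {0<..} t * exp (- (t / 2)) * norm (g y)" for t y
  by (auto simp: k_def norm_mult s_def indicator_def simp flip: exp_add)
 have int_k: "integrable (lborel \<Otimes>\<^sub>M lborel) (case_prod k)"
 proof (rule lborel_pair.Fubini_integrable)
  show "case_prod k \<in> borel_measurable (lborel \<Otimes>\<^sub>M lborel)"
   unfolding k_def s_eq by measurable
  have "integrable lborel (\<lambda>t. norm (indicator {0<..} t *\<^sub>R exp (- ((1/2) * of_real t)) :: complex))"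
   using has_bochner_integral_laplace_exp[of "1/2"] by (intro integrable_norm) (auto simp: has_bochner_integral_iff)
  hence "integrable lborel (\<lambda>t::real. indicator {0<..} t * exp (- (t / 2)))"
   by (rule back_subst[of "integrable lborel"]) (auto simp: indicator_def)
  hence "integrable lborel (\<lambda>t::real. indicator {0<..} t * exp (- (t / 2)) * (LINT y|lborel. norm (g y)))"
   by (rule integrable_mult_left)
  thus "integrable lborel (\<lambda>t. LINT y|lborel. norm (case_prod k (t, y)))"
   by (simp add: nk)
  show "AE t in lborel. integrable lborel (\<lambda>y. case_prod k (t, y))"
  proof (rule AE_I2)
   fix t
   have "integrable lborel (\<lambda>y. indicator {0<..} t * exp (- (t / 2)) * norm (g y))"
    using int_g by (intro integrable_mult_right integrable_norm)
   thus "integrable lborel (\<lambda>y. case_prod k (t, y))"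
   proof (rule Bochner_Integration.integrable_bound)
    show "(\<lambda>y. case_prod k (t, y)) \<in> borel_measurable lborel" unfolding k_def s_eq by simp
    show "AE y in lborel. norm (case_prod k (t, y)) \<le> norm (indicator {0<..} t * exp (- (t / 2)) * norm (g y))"
     by (simp add: nk)
   qed
  qed
 qed
 have A1: "(LINT y|lborel. LINT t|lborel. k t y) = (LINT t|lborel. LINT y|lborel. k t y)"
  by (rule lborel_pair.Fubini_integral[OF int_k])
 have A2: "(LINT t|lborel. k t y) = g y / (1 - s y)" for y
 proof -
  have "k t y = indicator {0<..} t *\<^sub>R exp (- ((1 - s y) * of_real t)) * g y" for t
   by (simp add: k_def algebra_simps flip: exp_add)
  moreover have "has_bochner_integral lborel (\<lambda>t. indicator {0<..} t *\<^sub>R exp (- ((1 - s y) * of_real t)) * g y) (1 / (1 - s y) * g y)"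
   by (intro has_bochner_integral_mult_left has_bochner_integral_laplace_exp) (simp add: s_def)
  ultimately show ?thesis by (simp add: has_bochner_integral_iff)
 qed
 have A3: "(LINT y|lborel. g y / (1 - s y)) = 2 * pi"
  unfolding g_def s_def by (rule vertical_line_integral_reciprocal[OF nu])
 have A4: "(LINT y|lborel. k t y) = of_real (indicator {0<..} t * (t powr (\<nu> - 1) * exp (- t))) * L c" for t
 proof (cases "t > 0")
  case True
  have "(LINT y|lborel. k t y) = exp (- of_real t) * (LINT y|lborel. exp (of_real t * s y) * g y)"
   using True by (simp add: k_def)
  thus ?thesis using True inner_y[of t] by (simp add: exp_of_real mult_ac flip: of_real_minus)
 qed (simp add: k_def)
 have A5: "(LINT t|lborel. indicator {0<..} t * (t powr (\<nu> - 1) * exp (- t))) = Gamma \<nu>"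
 proof -
  have "has_bochner_integral lborel (\<lambda>t. indicator {0<..} t * (t powr (\<nu> - 1) * exp (- t))) (Gamma \<nu>)"
  proof (rule has_bochner_integral_nn_integral)
   have "(\<integral>\<^sup>+t. ennreal (indicator {0<..} t * (t powr (\<nu> - 1) * exp (- t))) \<partial>lborel)
    = (\<integral>\<^sup>+t. ennreal (indicator {0..} t * t powr (\<nu> - 1) / exp t) \<partial>lborel)"
    by (intro nn_integral_cong) (auto simp: indicator_def exp_minus field_simps)
   thus "(\<integral>\<^sup>+t. ennreal (indicator {0<..} t * (t powr (\<nu> - 1) * exp (- t))) \<partial>lborel) = ennreal (Gamma \<nu>)"
    using Gamma_conv_nn_integral_real[of \<nu>] nu by simp
   show "Gamma \<nu> \<ge> 0" using nu by (simp add: Gamma_real_nonneg)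
  qed auto
  thus ?thesis by (simp add: has_bochner_integral_iff)
 qed
 have "2 * pi = (LINT t|lborel. LINT y|lborel. k t y)" using A1 unfolding A2 A3 .
 also have "\<dots> = (LINT t|lborel. complex_of_real (indicator {0<..} t * (t powr (\<nu> - 1) * exp (- t)))) * L c"
  unfolding A4 by simp
 also have "\<dots> = of_real (Gamma \<nu>) * L c" unfolding integral_complex_of_real A5 ..
 finally have "of_real (2 * pi) = of_real (Gamma \<nu>) * L c" .
 moreover have "Gamma \<nu> > 0" using nu by (intro Gamma_real_pos) linarith
 ultimately show ?thesis unfolding L_def f_def by (simp add: field_simps)
qed

subsection \<open>The Dunkl Laplacian in polar coordinates\<close>

text \<open>A pair \<open>(t, c)\<close> stands for the mirror at angle \<open>t\<close> with
  multiplicity \<open>c\<close>; i e^(it) is its unit normal.\<close>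

definition line_roots :: "(real \<times> real) list \<Rightarrow> (complex \<times> real) list" where
 "line_roots ts = map (\<lambda>(t, c). (\<i> * cis t, c)) ts"

definition regular_angle :: "(real \<times> real) list \<Rightarrow> real \<Rightarrow> bool" where
 "regular_angle ts \<xi> \<longleftrightarrow> (\<forall>(t, c)\<in>set ts. sin (\<xi> - t) \<noteq> 0)"

definition vd :: "(real \<Rightarrow> complex) \<Rightarrow> real \<Rightarrow> complex" where
 "vd g \<xi> = vector_derivative g (at \<xi>)"

text \<open>The mirror sum that accompanies the radial derivative: on r^j g the Dunkl operators have
  the radial component j g + \<open>Mop ts g\<close> and the angular component
  \<open>Dop ts g\<close>.\<close>

definition Mop :: "(real \<times> real) list \<Rightarrow> (real \<Rightarrow> complex) \<Rightarrow> real \<Rightarrow> complex" where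
 "Mop ts g \<xi> = (\<Sum>(t, c)\<leftarrow>ts. of_real c * (g \<xi> - g (2 * t - \<xi>)))"

text \<open>On the mirror the value 2 g' is the limit of the cotangent expression for a
  differentiable 2 pi-periodic \<open>g\<close>; with it trigonometric polynomials are mapped to
  trigonometric polynomials at every angle.\<close>

definition Dline :: "real \<Rightarrow> (real \<Rightarrow> complex) \<Rightarrow> real \<Rightarrow> complex" where
 "Dline t g \<xi> = (if sin (\<xi> - t) = 0 then 2 * vd g \<xi> else of_real (cot (\<xi> - t)) * (g \<xi> - g (2 * t - \<xi>)))"

definition Dop :: "(real \<times> real) list \<Rightarrow> (real \<Rightarrow> complex) \<Rightarrow> real \<Rightarrow> complex" where
 "Dop ts g \<xi> = vd g \<xi> + (\<Sum>(t, c)\<leftarrow>ts. of_real c * Dline t g \<xi>)"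

lemma rinner_line: "rinner (\<i> * cis t) (of_real r * cis \<xi>) = r * sin (\<xi> - t)"
 by (simp add: rinner_def sin_diff algebra_simps)

lemma refl_line: "refl (\<i> * cis t) (of_real r * cis \<xi>) = of_real r * cis (2 * t - \<xi>)"
proof -
 have "cis (\<xi> - t) - 2 * of_real (sin (\<xi> - t)) * \<i> = cis (t - \<xi>)"
  using cos_minus[of "\<xi> - t"] sin_minus[of "\<xi> - t"] by (simp add: complex_eq_iff)
 hence "cis t * (cis (\<xi> - t) - 2 * of_real (sin (\<xi> - t)) * \<i>) = cis t * cis (t - \<xi>)"
  by (simp only:)
 hence e: "cis \<xi> - 2 * of_real (sin (\<xi> - t)) * (\<i> * cis t) = cis (2 * t - \<xi>)"
  by (simp add: right_diff_distrib cis_mult mult_ac)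
 have "refl (\<i> * cis t) (of_real r * cis \<xi>) = of_real r * (cis \<xi> - 2 * of_real (sin (\<xi> - t)) * (\<i> * cis t))"
  unfolding refl_def rinner_line by (simp add: norm_mult right_diff_distrib mult_ac)
 thus ?thesis unfolding e .
qed

lemma isCont_tendsto_nhds: "isCont f a \<Longrightarrow> (f \<longlongrightarrow> f a) (nhds a)"
 by (simp add: isCont_def tendsto_at_iff_tendsto_nhds)

lemma eventually_regular_angle:
 assumes "regular_angle ts \<xi>"
 shows "eventually (regular_angle ts) (nhds \<xi>)"
proof -
 have "eventually (\<lambda>\<tau>. \<forall>p\<in>set ts. sin (\<tau> - fst p) \<noteq> 0) (nhds \<xi>)"
 proof (rule eventually_ball_finite)
  show "\<forall>p\<in>set ts. eventually (\<lambda>\<tau>. sin (\<tau> - fst p) \<noteq> 0) (nhds \<xi>)"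
  proof
   fix p assume "p \<in> set ts"
   hence "sin (\<xi> - fst p) \<noteq> 0" using assms by (auto simp: regular_angle_def)
   moreover have "isCont (\<lambda>\<tau>. sin (\<tau> - fst p)) \<xi>" by (intro continuous_intros)
   ultimately show "eventually (\<lambda>\<tau>. sin (\<tau> - fst p) \<noteq> 0) (nhds \<xi>)"
    by (intro tendsto_imp_eventually_ne[OF isCont_tendsto_nhds])
  qed
 qed simp
 thus ?thesis by (rule eventually_mono) (auto simp: regular_angle_def)
qed

text \<open>Writing \<open>x + t d = x exp (Ln (1 + t d / x))\<close> turns the directional derivative at \<open>x\<close> into derivatives
 with respect to the modulus and the argument.\<close>

lemma dderiv_polar:
 fixes f :: "complex \<Rightarrow> complex" and g :: "real \<Rightarrow> complex"
 assumes r: "r > 0"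
  and f: "eventually (\<lambda>\<tau>. \<forall>\<rho>>0. f (of_real \<rho> * cis \<tau>) = of_real (\<rho> powr j) * g \<tau>) (nhds \<xi>)"
  and g: "(g has_vector_derivative g') (at \<xi>)"
 shows "dderiv d f (of_real r * cis \<xi>)
  = of_real (r powr (j - 1)) * (of_real (Re (d * cis (-\<xi>)) * j) * g \<xi> + of_real (Im (d * cis (-\<xi>))) * g')"
proof -
 define x where "x = of_real r * cis \<xi>"
 have x0: "x \<noteq> 0" using r by (simp add: x_def)
 define w where "w t = Ln (1 + of_real t * (d / x))" for t :: real
 have "((\<lambda>z. Ln (1 + z * (d / x))) has_field_derivative d / x) (at (of_real 0))"
  by (auto intro!: derivative_eq_intros simp: x0)
 hence dw: "(w has_vector_derivative d / x) (at 0)"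
  unfolding w_def by (rule has_vector_derivative_real_field)
 have dRe: "((\<lambda>t. Re (w t)) has_real_derivative Re (d / x)) (at 0)"
  using bounded_linear.has_vector_derivative[OF bounded_linear_Re dw]
  by (simp add: has_real_derivative_iff_has_vector_derivative)
 have dIm: "((\<lambda>t. \<xi> + Im (w t)) has_real_derivative Im (d / x)) (at 0)"
  using bounded_linear.has_vector_derivative[OF bounded_linear_Im dw]
  by (auto simp: has_real_derivative_iff_has_vector_derivative intro!: derivative_eq_intros)
 have w0: "w 0 = 0" by (simp add: w_def)
 have E: "exp (j * (ln r + Re (w 0))) = r powr j"
  unfolding powr_def[of r j] w0 using r by simp
 have dP: "((\<lambda>t. exp (j * (ln r + Re (w t)))) has_real_derivative (r powr j * (j * Re (d / x)))) (at 0)"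
 proof -
  have "((\<lambda>t. j * (ln r + Re (w t))) has_real_derivative j * (0 + Re (d / x))) (at 0)"
   by (intro DERIV_cmult DERIV_add DERIV_const dRe)
  from DERIV_chain2[OF DERIV_exp this] show ?thesis unfolding E by simp
 qed
 have dG: "((\<lambda>t. g (\<xi> + Im (w t))) has_vector_derivative (Im (d / x) *\<^sub>R g')) (at 0)"
  using vector_diff_chain_at[of "\<lambda>t. \<xi> + Im (w t)" "Im (d / x)" 0 g g'] dIm g
  by (simp add: has_real_derivative_iff_has_vector_derivative w0 o_def)
 have dT: "((\<lambda>t. exp (j * (ln r + Re (w t))) *\<^sub>R g (\<xi> + Im (w t))) has_vector_derivative
   (exp (j * (ln r + Re (w 0))) *\<^sub>R (Im (d / x) *\<^sub>R g') + (r powr j * (j * Re (d / x))) *\<^sub>R g (\<xi> + Im (w 0)))) (at 0)"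
  by (rule has_vector_derivative_scaleR[OF dP dG])
 have dT': "((\<lambda>t. exp (j * (ln r + Re (w t))) *\<^sub>R g (\<xi> + Im (w t))) has_vector_derivative
   (of_real (r powr j) * (of_real (Im (d / x)) * g' + of_real (j * Re (d / x)) * g \<xi>))) (at 0)"
  using dT unfolding E by (simp add: w0 scaleR_conv_of_real algebra_simps)
 have ev: "eventually (\<lambda>t. f (x + of_real t * d) = exp (j * (ln r + Re (w t))) *\<^sub>R g (\<xi> + Im (w t))) (nhds 0)"
 proof -
  have "isCont (\<lambda>t. \<xi> + Im (w t)) 0" using dIm DERIV_isCont by blast
  hence "filterlim (\<lambda>t. \<xi> + Im (w t)) (nhds \<xi>) (nhds 0)"
   using isCont_tendsto_nhds by (fastforce simp: w0)
  from this f have e1: "eventually (\<lambda>t. \<forall>\<rho>>0. f (of_real \<rho> * cis (\<xi> + Im (w t))) = of_real (\<rho> powr j) * g (\<xi> + Im (w t))) (nhds 0)"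
   by (auto simp: filterlim_iff)
  have "isCont (\<lambda>t::real. 1 + of_real t * (d / x)) 0" by (intro continuous_intros)
  hence e2: "eventually (\<lambda>t::real. 1 + of_real t * (d / x) \<noteq> 0) (nhds 0)"
   by (intro tendsto_imp_eventually_ne[OF isCont_tendsto_nhds]) simp_all
  from e1 e2 show ?thesis
  proof eventually_elim
   case (elim t)
   have "x + of_real t * d = x * exp (w t)" using elim(2) x0 by (simp add: w_def field_simps)
   also have "exp (w t) = of_real (exp (Re (w t))) * cis (Im (w t))"
    by (metis complex_surj exp_eq_polar)
   also have "x * \<dots> = of_real (r * exp (Re (w t))) * cis (\<xi> + Im (w t))"
    by (simp add: x_def cis_mult[symmetric] mult_ac)
   finally have xt: "x + of_real t * d = of_real (r * exp (Re (w t))) * cis (\<xi> + Im (w t))" .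
   have pw: "(r * exp (Re (w t))) powr j = exp (j * (ln r + Re (w t)))"
    unfolding powr_def[of "r * exp (Re (w t))" j] using r by (simp add: ln_mult)
   have "f (x + of_real t * d) = of_real ((r * exp (Re (w t))) powr j) * g (\<xi> + Im (w t))"
    unfolding xt by (rule elim(1)[rule_format]) (use r in simp)
   thus ?case unfolding pw by (simp only: scaleR_conv_of_real)
  qed
 qed
 have "((\<lambda>t. f (x + of_real t * d)) has_vector_derivative
   (of_real (r powr j) * (of_real (Im (d / x)) * g' + of_real (j * Re (d / x)) * g \<xi>))) (at 0)"
  using dT' eventually_nhds_x_imp_x[OF ev] ev
  by (subst has_vector_derivative_cong_ev) (auto elim: eventually_mono)
 hence "dderiv d f x = of_real (r powr j) * (of_real (Im (d / x)) * g' + of_real (j * Re (d / x)) * g \<xi>)"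
  unfolding dderiv_def by (rule vector_derivative_at)
 moreover define \<delta> where "\<delta> = d * cis (-\<xi>)"
 have "d / x = \<delta> / of_real r"
  by (simp add: x_def \<delta>_def divide_inverse mult_ac)
 hence "Re (d / x) = Re \<delta> / r" "Im (d / x) = Im \<delta> / r"
  by (simp_all add: Re_divide_of_real Im_divide_of_real)
 moreover have "r powr (j - 1) = r powr j / r" using r by (simp add: powr_diff)
 ultimately have "dderiv d f x = of_real (r powr j) * (of_real (Im \<delta> / r) * g' + of_real (j * (Re \<delta> / r)) * g \<xi>)"
  "r powr (j - 1) = r powr j / r" by simp_all
 thus ?thesis unfolding x_def[symmetric] \<delta>_def[symmetric]
  by (simp only:) (simp add: divide_inverse algebra_simps)
qed

text \<open>The polar form of \<open>f\<close> is assumed only at regular angles because the first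
  of two Dunkl operators delivers it only there; \<open>closed\<close> keeps the reflected points
  regular.\<close>

lemma dunkl_T_polar:
 fixes f :: "complex \<Rightarrow> complex" and g :: "real \<Rightarrow> complex"
 assumes r: "r > 0" and reg: "regular_angle ts \<xi>"
  and closed: "\<And>t c \<tau>. (t, c) \<in> set ts \<Longrightarrow> regular_angle ts \<tau> \<Longrightarrow> regular_angle ts (2 * t - \<tau>)"
  and f: "\<And>\<rho> \<tau>. \<rho> > 0 \<Longrightarrow> regular_angle ts \<tau> \<Longrightarrow> f (of_real \<rho> * cis \<tau>) = of_real (\<rho> powr j) * g \<tau>"
  and g: "g differentiable (at \<xi>)"
 shows "dunkl_T (line_roots ts) d f (of_real r * cis \<xi>)
  = of_real (r powr (j - 1)) * (of_real (Re (d * cis (-\<xi>))) * (of_real j * g \<xi> + Mop ts g \<xi>)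
    + of_real (Im (d * cis (-\<xi>))) * Dop ts g \<xi>)"
proof -
 let ?z = "of_real r * cis \<xi>"
 let ?p = "Re (d * cis (-\<xi>))" and ?q = "Im (d * cis (-\<xi>))"
 have 1: "dderiv d f ?z = of_real (r powr (j - 1)) * (of_real (?p * j) * g \<xi> + of_real ?q * vd g \<xi>)"
 proof (rule dderiv_polar[OF r])
  show "(g has_vector_derivative vd g \<xi>) (at \<xi>)"
   using g unfolding vd_def by (simp add: vector_derivative_works)
  show "eventually (\<lambda>\<tau>. \<forall>\<rho>>0. f (of_real \<rho> * cis \<tau>) = of_real (\<rho> powr j) * g \<tau>) (nhds \<xi>)"
   using eventually_regular_angle[OF reg] by eventually_elim (auto simp: f)
 qed
 have 2: "of_real (c * rinner (\<i> * cis t) d) * (f ?z - f (refl (\<i> * cis t) ?z))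
    / of_real (rinner (\<i> * cis t) ?z)
   = of_real (r powr (j - 1)) * (of_real ?p * (of_real c * (g \<xi> - g (2 * t - \<xi>))) + of_real ?q * (of_real c * Dline t g \<xi>))"
  if tc: "(t, c) \<in> set ts" for t c
 proof -
  have s0: "sin (\<xi> - t) \<noteq> 0" using reg tc by (auto simp: regular_angle_def)
  \<comment> \<open>In the frame turned by \<xi> the pairing of normal and direction is p sin + q
    cos; division by sin (\<xi> - t) then separates the radial part from the cotangent part.\<close>
  have "rinner (\<i> * cis t) d = Im (cis (-t) * d)" by (simp add: rinner_def algebra_simps)
  also have "cis (-t) * d = (d * cis (-\<xi>)) * cis (\<xi> - t)" by (simp add: cis_mult mult.commute mult.left_commute)
  finally have ri: "rinner (\<i> * cis t) d = ?p * sin (\<xi> - t) + ?q * cos (\<xi> - t)" by simp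
  have fx: "f ?z = of_real (r powr j) * g \<xi>" "f (of_real r * cis (2 * t - \<xi>)) = of_real (r powr j) * g (2 * t - \<xi>)"
   using r reg closed[OF tc reg] by (auto simp: f)
  have "c * rinner (\<i> * cis t) d / (r * sin (\<xi> - t)) * r powr j = r powr (j - 1) * (?p * c + ?q * c * cot (\<xi> - t))"
   using r s0 unfolding ri by (simp add: cot_def powr_diff field_simps)
  hence e: "of_real (c * rinner (\<i> * cis t) d) / of_real (r * sin (\<xi> - t)) * of_real (r powr j)
    = (of_real (r powr (j - 1)) * (of_real ?p * of_real c + of_real ?q * of_real c * of_real (cot (\<xi> - t))) :: complex)"
   by (metis (no_types, opaque_lifting) of_real_add of_real_divide of_real_mult)
  have "of_real (c * rinner (\<i> * cis t) d) * (f ?z - f (refl (\<i> * cis t) ?z))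
    / of_real (rinner (\<i> * cis t) ?z)
   = of_real (c * rinner (\<i> * cis t) d) / of_real (r * sin (\<xi> - t)) * of_real (r powr j) * (g \<xi> - g (2 * t - \<xi>))"
   unfolding rinner_line refl_line fx by (simp add: algebra_simps)
  also have "\<dots> = of_real (r powr (j - 1)) * (of_real ?p * (of_real c * (g \<xi> - g (2 * t - \<xi>))) + of_real ?q * (of_real c * Dline t g \<xi>))"
   unfolding e Dline_def using s0 by (simp add: algebra_simps)
  finally show ?thesis .
 qed
 have "(\<Sum>(a, c)\<leftarrow>line_roots ts. of_real (c * rinner a d) * (f ?z - f (refl a ?z))
    / of_real (rinner a ?z))
   = (\<Sum>(t, c)\<leftarrow>ts. of_real (r powr (j - 1)) * (of_real ?p * (of_real c * (g \<xi> - g (2 * t - \<xi>))) + of_real ?q * (of_real c * Dline t g \<xi>)))"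
  unfolding line_roots_def map_map
 proof (intro arg_cong[where f=sum_list] map_cong refl)
  fix p assume p: "p \<in> set ts"
  obtain t c where tc: "p = (t, c)" by (cases p)
  show "((\<lambda>(a, c). of_real (c * rinner a d) * (f ?z - f (refl a ?z))
    / of_real (rinner a ?z)) \<circ> (\<lambda>(t, c). (\<i> * cis t, c))) p
   = (case p of (t, c) \<Rightarrow> of_real (r powr (j - 1)) * (of_real ?p * (of_real c * (g \<xi> - g (2 * t - \<xi>))) + of_real ?q * (of_real c * Dline t g \<xi>)))"
   unfolding tc o_def prod.case by (rule 2) (use p tc in simp)
 qed
 also have "\<dots> = of_real (r powr (j - 1)) * (of_real ?p * Mop ts g \<xi> + of_real ?q * (\<Sum>(t, c)\<leftarrow>ts. of_real c * Dline t g \<xi>))"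
  unfolding Mop_def by (induction ts) (auto simp: algebra_simps)
 finally show ?thesis
  unfolding dunkl_T_def 1 Dop_def by (simp add: algebra_simps)
qed

lemma Mop_linear: "Mop ts (\<lambda>\<tau>. a * g \<tau> + h \<tau>) \<xi> = a * Mop ts g \<xi> + Mop ts h \<xi>"
 unfolding Mop_def by (induction ts) (auto simp: algebra_simps)

lemma differentiable_reflect:
 fixes g :: "real \<Rightarrow> complex"
 assumes "\<And>\<tau>. g differentiable (at \<tau>)"
 shows "(\<lambda>\<tau>. g (2 * t - \<tau>)) differentiable (at \<xi>)"
proof -
 have "(\<lambda>\<tau>::real. 2 * t - \<tau>) differentiable (at \<xi>)" by (intro derivative_intros)
 from differentiable_chain_at[OF this, of g] assms show ?thesis by (simp add: o_def)
qed

lemma differentiable_Mop: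
 assumes "\<And>\<tau>. g differentiable (at \<tau>)"
 shows "Mop ts g differentiable (at \<xi>)"
proof -
 have "(\<lambda>\<xi>. \<Sum>(t, c)\<leftarrow>ts. of_real c * (g \<xi> - g (2 * t - \<xi>))) differentiable (at \<xi>)"
  by (induction ts) (auto intro!: derivative_intros assms differentiable_reflect simp: case_prod_beta)
 thus ?thesis by (simp add: Mop_def[abs_def])
qed

text \<open>The two first-order images have angular parts \<open>g1\<close> and \<open>g2\<close>,
  which are the pair A = j g + Mop g, B = Dop g rotated by \<xi>. In the sum of the squares the
  rotation cancels, but differentiating it contributes another \<open>A\<close>, and reflecting it
  turns the difference of A and its reflection into their sum. Hence 2K A - Mop A appears where Mop
  A might be expected.\<close>

theorem dunkl_lap_polar:
 fixes f :: "complex \<Rightarrow> complex" and g :: "real \<Rightarrow> complex" and ts :: "(real \<times> real) list"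
 defines "K \<equiv> (\<Sum>(t, c)\<leftarrow>ts. c)"
 assumes r: "r > 0" and reg: "regular_angle ts \<xi>"
  and closed: "\<And>t c \<tau>. (t, c) \<in> set ts \<Longrightarrow> regular_angle ts \<tau> \<Longrightarrow> regular_angle ts (2 * t - \<tau>)"
  and f: "\<And>\<rho> \<tau>. \<rho> > 0 \<Longrightarrow> f (of_real \<rho> * cis \<tau>) = of_real (\<rho> powr j) * g \<tau>"
  and g: "\<And>\<tau>. g differentiable (at \<tau>)" and Dg: "\<And>\<tau>. Dop ts g differentiable (at \<tau>)"
 shows "dunkl_lap (line_roots ts) f (of_real r * cis \<xi>)
  = of_real (r powr (j - 2)) * (of_real ((j + 2 * K) * j) * g \<xi> + of_real (2 * K) * Mop ts g \<xi>
    - Mop ts (Mop ts g) \<xi> + Dop ts (Dop ts g) \<xi>)"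
proof -
 define A where "A \<tau> = of_real j * g \<tau> + Mop ts g \<tau>" for \<tau>
 define B where "B = Dop ts g"
 define g1 where "g1 \<tau> = of_real (cos \<tau>) * A \<tau> - of_real (sin \<tau>) * B \<tau>" for \<tau>
 define g2 where "g2 \<tau> = of_real (sin \<tau>) * A \<tau> + of_real (cos \<tau>) * B \<tau>" for \<tau>
 have dA: "A differentiable (at \<tau>)" for \<tau>
  unfolding A_def[abs_def] by (intro derivative_intros g differentiable_Mop)
 have dB: "B differentiable (at \<tau>)" for \<tau> unfolding B_def by (rule Dg)
 have T1: "dunkl_T (line_roots ts) 1 f (of_real \<rho> * cis \<tau>) = of_real (\<rho> powr (j - 1)) * g1 \<tau>"
  and T2: "dunkl_T (line_roots ts) \<i> f (of_real \<rho> * cis \<tau>) = of_real (\<rho> powr (j - 1)) * g2 \<tau>"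
  if "\<rho> > 0" "regular_angle ts \<tau>" for \<rho> \<tau>
  using dunkl_T_polar[OF that closed f g] by (simp_all add: g1_def g2_def A_def B_def)
 have hA: "(A has_vector_derivative vd A \<tau>) (at \<tau>)" and hB: "(B has_vector_derivative vd B \<tau>) (at \<tau>)" for \<tau>
  using dA dB by (simp_all add: vd_def vector_derivative_works)
 have hc: "((\<lambda>\<tau>. of_real (cos \<tau>) :: complex) has_vector_derivative of_real (- sin \<tau>)) (at \<tau>)"
  and hs: "((\<lambda>\<tau>. of_real (sin \<tau>) :: complex) has_vector_derivative of_real (cos \<tau>)) (at \<tau>)" for \<tau>
  by (auto intro!: has_vector_derivative_of_real derivative_eq_intros)
 have h1: "(g1 has_vector_derivative (of_real (cos \<tau>) * vd A \<tau> + of_real (- sin \<tau>) * A \<tau> - (of_real (sin \<tau>) * vd B \<tau> + of_real (cos \<tau>) * B \<tau>))) (at \<tau>)"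
  and h2: "(g2 has_vector_derivative (of_real (sin \<tau>) * vd A \<tau> + of_real (cos \<tau>) * A \<tau> + (of_real (cos \<tau>) * vd B \<tau> + of_real (- sin \<tau>) * B \<tau>))) (at \<tau>)" for \<tau>
  unfolding g1_def[abs_def] g2_def[abs_def]
  by (intro has_vector_derivative_diff has_vector_derivative_add has_vector_derivative_mult hc hs hA hB)+
 have d1: "g1 differentiable (at \<tau>)" and d2: "g2 differentiable (at \<tau>)" for \<tau>
  by (rule differentiableI_vector[OF h1], rule differentiableI_vector[OF h2])
 let ?c = "complex_of_real (cos \<xi>)" and ?s = "complex_of_real (sin \<xi>)"
 have L1: "dunkl_T (line_roots ts) 1 (dunkl_T (line_roots ts) 1 f) (of_real r * cis \<xi>)
  = of_real (r powr (j - 2)) * (?c * (of_real (j - 1) * g1 \<xi> + Mop ts g1 \<xi>) - ?s * Dop ts g1 \<xi>)"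
  using dunkl_T_polar[OF r reg closed T1 d1] by simp
 have L2: "dunkl_T (line_roots ts) \<i> (dunkl_T (line_roots ts) \<i> f) (of_real r * cis \<xi>)
  = of_real (r powr (j - 2)) * (?s * (of_real (j - 1) * g2 \<xi> + Mop ts g2 \<xi>) + ?c * Dop ts g2 \<xi>)"
  using dunkl_T_polar[OF r reg closed T2 d2] by simp
 have cs: "?c * ?c + ?s * ?s = 1"
  by (metis of_real_1 of_real_add of_real_mult sin_cos_squared_add3)
 have V1: "vd g1 \<xi> = ?c * vd A \<xi> + of_real (- sin \<xi>) * A \<xi> - (?s * vd B \<xi> + ?c * B \<xi>)"
  and V2: "vd g2 \<xi> = ?s * vd A \<xi> + ?c * A \<xi> + (?c * vd B \<xi> + of_real (- sin \<xi>) * B \<xi>)"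
  using vector_derivative_at[OF h1] vector_derivative_at[OF h2] by (simp_all add: vd_def)
 have V: "?c * vd g2 \<xi> - ?s * vd g1 \<xi> = (?c * ?c + ?s * ?s) * A \<xi> + (?c * ?c + ?s * ?s) * vd B \<xi>"
  unfolding V1 V2 by (simp add: algebra_simps)
 have G: "?c * g1 \<xi> + ?s * g2 \<xi> = (?c * ?c + ?s * ?s) * A \<xi>"
  unfolding g1_def g2_def by (simp add: algebra_simps)
 \<comment> \<open>Contribution of one mirror. The reflected frame is turned by twice \<xi> - t, and
   the double-angle identities \<open>k1\<close> and \<open>k2\<close> absorb the products of
   trigonometric functions.\<close>
 have line: "?c * (g1 \<xi> - g1 (2 * t - \<xi>)) + ?s * (g2 \<xi> - g2 (2 * t - \<xi>)) + (?c * Dline t g2 \<xi> - ?s * Dline t g1 \<xi>)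
  = (A \<xi> + A (2 * t - \<xi>)) + Dline t B \<xi>" if "sin (\<xi> - t) \<noteq> 0" for t
 proof -
  let ?c' = "complex_of_real (cos (2 * t - \<xi>))" and ?s' = "complex_of_real (sin (2 * t - \<xi>))"
   and ?k = "complex_of_real (cot (\<xi> - t))"
  have C: "?c * ?c' + ?s * ?s' = of_real (cos (2 * (\<xi> - t)))"
  proof -
   have "cos \<xi> * cos (2 * t - \<xi>) + sin \<xi> * sin (2 * t - \<xi>) = cos (\<xi> - (2 * t - \<xi>))" by (simp only: cos_diff)
   also have "\<xi> - (2 * t - \<xi>) = 2 * (\<xi> - t)" by simp
   finally show ?thesis by (metis of_real_add of_real_mult)
  qed
  have S: "?s * ?c' - ?c * ?s' = of_real (sin (2 * (\<xi> - t)))"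
  proof -
   have "sin \<xi> * cos (2 * t - \<xi>) - cos \<xi> * sin (2 * t - \<xi>) = sin (\<xi> - (2 * t - \<xi>))" by (simp only: sin_diff)
   also have "\<xi> - (2 * t - \<xi>) = 2 * (\<xi> - t)" by simp
   finally show ?thesis by (metis of_real_diff of_real_mult)
  qed
  have k1: "?k * of_real (sin (2 * (\<xi> - t))) - of_real (cos (2 * (\<xi> - t))) = 1"
  proof -
   have "cot (\<xi> - t) * sin (2 * (\<xi> - t)) - cos (2 * (\<xi> - t)) = 1"
    unfolding sin_double cos_double_cos cot_def using that by (simp add: power2_eq_square)
   thus ?thesis by (metis of_real_1 of_real_diff of_real_mult)
  qed
  have k2: "of_real (sin (2 * (\<xi> - t))) + ?k * of_real (cos (2 * (\<xi> - t))) = ?k"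
  proof -
   have "sin (2 * (\<xi> - t)) + cot (\<xi> - t) * cos (2 * (\<xi> - t)) = cot (\<xi> - t)"
    unfolding sin_double cos_double_sin cot_def using that by (simp add: power2_eq_square field_simps)
   thus ?thesis by (metis of_real_add of_real_mult)
  qed
  have "?c * (g1 \<xi> - g1 (2 * t - \<xi>)) + ?s * (g2 \<xi> - g2 (2 * t - \<xi>)) + (?c * Dline t g2 \<xi> - ?s * Dline t g1 \<xi>)
   = (?c * ?c + ?s * ?s) * A \<xi> - (?c * ?c' + ?s * ?s') * A (2 * t - \<xi>) - (?s * ?c' - ?c * ?s') * B (2 * t - \<xi>)
    + ?k * ((?c * ?c + ?s * ?s) * B \<xi> + (?s * ?c' - ?c * ?s') * A (2 * t - \<xi>) - (?c * ?c' + ?s * ?s') * B (2 * t - \<xi>))"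
   using that by (simp add: Dline_def g1_def g2_def algebra_simps)
  also have "\<dots> = A \<xi> + (?k * of_real (sin (2 * (\<xi> - t))) - of_real (cos (2 * (\<xi> - t)))) * A (2 * t - \<xi>)
    + ?k * B \<xi> - (of_real (sin (2 * (\<xi> - t))) + ?k * of_real (cos (2 * (\<xi> - t)))) * B (2 * t - \<xi>)"
   unfolding cs C S by (simp add: algebra_simps)
  also have "\<dots> = (A \<xi> + A (2 * t - \<xi>)) + Dline t B \<xi>"
   unfolding k1 k2 using that by (simp add: Dline_def algebra_simps)
  finally show ?thesis .
 qed
 have "?c * Mop ts g1 \<xi> + ?s * Mop ts g2 \<xi> + (?c * (\<Sum>(t, c)\<leftarrow>ts. of_real c * Dline t g2 \<xi>) - ?s * (\<Sum>(t, c)\<leftarrow>ts. of_real c * Dline t g1 \<xi>))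
  = (\<Sum>(t, c)\<leftarrow>ts. of_real c * (?c * (g1 \<xi> - g1 (2 * t - \<xi>)) + ?s * (g2 \<xi> - g2 (2 * t - \<xi>)) + (?c * Dline t g2 \<xi> - ?s * Dline t g1 \<xi>)))"
  unfolding Mop_def by (induction ts) (auto simp: algebra_simps)
 also have "\<dots> = (\<Sum>(t, c)\<leftarrow>ts. of_real c * ((A \<xi> + A (2 * t - \<xi>)) + Dline t B \<xi>))"
  by (intro arg_cong[where f=sum_list] map_cong refl) (use reg in \<open>auto simp: regular_angle_def line\<close>)
 \<comment> \<open>The sum of A and its reflection is 2 A minus their difference, and the weighted
   differences make up Mop A.\<close>
 also have "\<dots> = of_real (2 * K) * A \<xi> - Mop ts A \<xi> + (\<Sum>(t, c)\<leftarrow>ts. of_real c * Dline t B \<xi>)"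
  unfolding K_def Mop_def by (induction ts) (auto simp: algebra_simps)
 finally have sums: "?c * Mop ts g1 \<xi> + ?s * Mop ts g2 \<xi> + (?c * (\<Sum>(t, c)\<leftarrow>ts. of_real c * Dline t g2 \<xi>) - ?s * (\<Sum>(t, c)\<leftarrow>ts. of_real c * Dline t g1 \<xi>))
  = of_real (2 * K) * A \<xi> - Mop ts A \<xi> + (\<Sum>(t, c)\<leftarrow>ts. of_real c * Dline t B \<xi>)" .
 have MA: "Mop ts A \<xi> = of_real j * Mop ts g \<xi> + Mop ts (Mop ts g) \<xi>"
  unfolding A_def[abs_def] by (rule Mop_linear)
 have "dunkl_lap (line_roots ts) f (of_real r * cis \<xi>)
  = of_real (r powr (j - 2)) * (of_real (j - 1) * (?c * g1 \<xi> + ?s * g2 \<xi>)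
   + (?c * vd g2 \<xi> - ?s * vd g1 \<xi>)
   + (?c * Mop ts g1 \<xi> + ?s * Mop ts g2 \<xi> + (?c * (\<Sum>(t, c)\<leftarrow>ts. of_real c * Dline t g2 \<xi>) - ?s * (\<Sum>(t, c)\<leftarrow>ts. of_real c * Dline t g1 \<xi>))))"
  unfolding dunkl_lap_def L1 L2 Dop_def by (simp add: algebra_simps)
 also have "\<dots> = of_real (r powr (j - 2)) * (of_real (j + 2 * K) * A \<xi> - Mop ts A \<xi> + Dop ts B \<xi>)"
  unfolding sums V G cs Dop_def by (simp add: algebra_simps)
 also have "\<dots> = of_real (r powr (j - 2)) * (of_real ((j + 2 * K) * j) * g \<xi> + of_real (2 * K) * Mop ts g \<xi>
    - Mop ts (Mop ts g) \<xi> + Dop ts (Dop ts g) \<xi>)"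
  unfolding MA unfolding A_def B_def by (simp add: algebra_simps)
 finally show ?thesis .
qed

subsection \<open>Trigonometric polynomials\<close>

abbreviation Etrig :: "int \<Rightarrow> real \<Rightarrow> complex" where
 "Etrig l \<equiv> (\<lambda>\<xi>. cis (of_int l * \<xi>))"

definition trig :: "int set \<Rightarrow> (real \<Rightarrow> complex) set" where
 "trig S = {g. \<exists>c. g = (\<lambda>\<xi>. \<Sum>l\<in>S. c l * Etrig l \<xi>)}"

text \<open>The frequencies that occur in homogeneous polynomials of degree \<open>j\<close> on the
  unit circle.\<close>

definition freq :: "nat \<Rightarrow> int set" where
 "freq j = {l. \<bar>l\<bar> \<le> int j \<and> even (l - int j)}"

text \<open>These are the frequencies for degree j - 2, described without a subtraction so that the
  set is empty for j < 2.\<close>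

definition freq_less :: "nat \<Rightarrow> int set" where
 "freq_less j = {l. \<bar>l\<bar> < int j \<and> even (l - int j)}"

lemma trigI: "g = (\<lambda>\<xi>. \<Sum>l\<in>S. c l * Etrig l \<xi>) \<Longrightarrow> g \<in> trig S"
 by (auto simp: trig_def)

lemma trig_0: "(\<lambda>_. 0) \<in> trig S" by (rule trigI[where c="\<lambda>_. 0"]) simp

lemma trig_mono: "S \<subseteq> T \<Longrightarrow> finite T \<Longrightarrow> g \<in> trig S \<Longrightarrow> g \<in> trig T"
proof -
 assume "S \<subseteq> T" "finite T" "g \<in> trig S"
 then obtain c where "g = (\<lambda>\<xi>. \<Sum>l\<in>S. c l * Etrig l \<xi>)" by (auto simp: trig_def)
 hence "g = (\<lambda>\<xi>. \<Sum>l\<in>T. (if l \<in> S then c l else 0) * Etrig l \<xi>)"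
  using \<open>S \<subseteq> T\<close> \<open>finite T\<close> by (auto intro!: ext sum.mono_neutral_cong_left)
 thus ?thesis by (rule trigI)
qed

lemma trig_Etrig: "l \<in> S \<Longrightarrow> finite S \<Longrightarrow> Etrig l \<in> trig S"
 by (rule trigI[where c="\<lambda>m. if m = l then 1 else 0"]) (simp add: if_distrib[of "\<lambda>x. x * _"] cong: if_cong)

lemma trig_add: "g \<in> trig S \<Longrightarrow> h \<in> trig S \<Longrightarrow> (\<lambda>\<xi>. g \<xi> + h \<xi>) \<in> trig S"
proof -
 assume "g \<in> trig S" "h \<in> trig S"
 then obtain c d where "g = (\<lambda>\<xi>. \<Sum>l\<in>S. c l * Etrig l \<xi>)" "h = (\<lambda>\<xi>. \<Sum>l\<in>S. d l * Etrig l \<xi>)"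
  by (auto simp: trig_def)
 hence "(\<lambda>\<xi>. g \<xi> + h \<xi>) = (\<lambda>\<xi>. \<Sum>l\<in>S. (c l + d l) * Etrig l \<xi>)"
  by (simp add: sum.distrib distrib_right)
 thus ?thesis by (rule trigI)
qed

lemma trig_cmult: "g \<in> trig S \<Longrightarrow> (\<lambda>\<xi>. a * g \<xi>) \<in> trig S"
proof -
 assume "g \<in> trig S"
 then obtain c where "g = (\<lambda>\<xi>. \<Sum>l\<in>S. c l * Etrig l \<xi>)" by (auto simp: trig_def)
 hence "(\<lambda>\<xi>. a * g \<xi>) = (\<lambda>\<xi>. \<Sum>l\<in>S. (a * c l) * Etrig l \<xi>)" by (simp add: sum_distrib_left mult.assoc)
 thus ?thesis by (rule trigI)
qed

lemma trig_diff: "g \<in> trig S \<Longrightarrow> h \<in> trig S \<Longrightarrow> (\<lambda>\<xi>. g \<xi> - h \<xi>) \<in> trig S"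
 using trig_add[of g S "\<lambda>\<xi>. (-1) * h \<xi>"] trig_cmult[of h S "-1"] by simp

lemma trig_sum: "(\<And>i. i \<in> A \<Longrightarrow> g i \<in> trig S) \<Longrightarrow> (\<lambda>\<xi>. \<Sum>i\<in>A. g i \<xi>) \<in> trig S"
proof (induction A rule: infinite_finite_induct)
 case (insert i A)
 hence "(\<lambda>\<xi>. g i \<xi> + (\<Sum>i\<in>A. g i \<xi>)) \<in> trig S" by (intro trig_add) auto
 with insert show ?case by simp
qed (simp_all add: trig_0)

lemma trig_sum_list: "(\<And>p. p \<in> set ts \<Longrightarrow> g p \<in> trig S) \<Longrightarrow> (\<lambda>\<xi>. \<Sum>p\<leftarrow>ts. g p \<xi>) \<in> trig S"
proof (induction ts)
 case (Cons p ts)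
 hence "(\<lambda>\<xi>. g p \<xi> + (\<Sum>p\<leftarrow>ts. g p \<xi>)) \<in> trig S" by (intro trig_add) auto
 thus ?case by simp
qed (simp add: trig_0)

lemma Etrig_mult: "Etrig l \<xi> * Etrig m \<xi> = Etrig (l + m) \<xi>"
 by (simp add: cis_mult distrib_right)

lemma Etrig_reflect: "Etrig l (2 * t - \<xi>) = cis (2 * of_int l * t) * Etrig (-l) \<xi>"
 by (simp add: cis_mult algebra_simps)

lemma trig_mult:
 assumes "g \<in> trig S" "h \<in> trig T" "finite S" "finite T"
 shows "(\<lambda>\<xi>. g \<xi> * h \<xi>) \<in> trig ((\<lambda>(l, m). l + m) ` (S \<times> T))"
proof -
 obtain c where c: "g = (\<lambda>\<xi>. \<Sum>l\<in>S. c l * Etrig l \<xi>)" using assms(1) by (auto simp: trig_def)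
 obtain d where d: "h = (\<lambda>\<xi>. \<Sum>l\<in>T. d l * Etrig l \<xi>)" using assms(2) by (auto simp: trig_def)
 have "(\<lambda>\<xi>. g \<xi> * h \<xi>) = (\<lambda>\<xi>. \<Sum>l\<in>S. \<Sum>m\<in>T. (c l * d m) * Etrig (l + m) \<xi>)"
  unfolding c d by (rule ext, unfold sum_product Etrig_mult[symmetric]) (simp add: mult_ac)
 also have "\<dots> \<in> trig ((\<lambda>(l, m). l + m) ` (S \<times> T))"
  by (intro trig_sum trig_cmult trig_Etrig) (use assms in auto)
 finally show ?thesis .
qed

lemma trig_reflect:
 assumes "g \<in> trig S" "\<And>l. l \<in> S \<Longrightarrow> -l \<in> S" "finite S"
 shows "(\<lambda>\<xi>. g (2 * t - \<xi>)) \<in> trig S"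
proof -
 obtain c where c: "g = (\<lambda>\<xi>. \<Sum>l\<in>S. c l * Etrig l \<xi>)" using assms(1) by (auto simp: trig_def)
 have "(\<lambda>\<xi>. g (2 * t - \<xi>)) = (\<lambda>\<xi>. \<Sum>l\<in>S. (c l * cis (2 * of_int l * t)) * Etrig (-l) \<xi>)"
  unfolding c Etrig_reflect by (simp add: mult.assoc)
 also have "\<dots> \<in> trig S" by (intro trig_sum trig_cmult trig_Etrig assms)
 finally show ?thesis .
qed

lemma trig_cnj:
 assumes "g \<in> trig S" "\<And>l. l \<in> S \<Longrightarrow> -l \<in> S" "finite S"
 shows "(\<lambda>\<xi>. cnj (g \<xi>)) \<in> trig S"
proof -
 obtain c where c: "g = (\<lambda>\<xi>. \<Sum>l\<in>S. c l * Etrig l \<xi>)" using assms(1) by (auto simp: trig_def)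
 have "(\<lambda>\<xi>. cnj (g \<xi>)) = (\<lambda>\<xi>. \<Sum>l\<in>S. cnj (c l) * Etrig (-l) \<xi>)"
  unfolding c by (simp add: cis_cnj)
 also have "\<dots> \<in> trig S" by (intro trig_sum trig_cmult trig_Etrig assms)
 finally show ?thesis .
qed

lemma has_vector_derivative_Etrig:
 "(Etrig l has_vector_derivative (\<i> * of_int l * Etrig l \<xi>)) (at \<xi>)"
proof -
 have "((\<lambda>z. exp (\<i> * of_int l * z)) has_field_derivative (\<i> * of_int l * exp (\<i> * of_int l * of_real \<xi>))) (at (of_real \<xi>))"
  by (auto intro!: derivative_eq_intros)
 from has_vector_derivative_real_field[OF this] show ?thesis by (simp add: cis_conv_exp mult_ac)
qed

lemma trig_differentiable: "g \<in> trig S \<Longrightarrow> g differentiable (at \<xi>)"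
proof -
 assume "g \<in> trig S"
 then obtain c where c: "g = (\<lambda>\<xi>. \<Sum>l\<in>S. c l * Etrig l \<xi>)" by (auto simp: trig_def)
 show ?thesis unfolding c
  by (cases "finite S") (auto intro!: derivative_intros differentiableI_vector[OF has_vector_derivative_Etrig])
qed

lemma trig_continuous: "g \<in> trig S \<Longrightarrow> continuous_on A g"
 using trig_differentiable[THEN differentiable_imp_continuous_within] continuous_at_imp_continuous_on by blast

lemma trig_periodic: "g \<in> trig S \<Longrightarrow> g (\<xi> + 2 * pi * of_int n) = g \<xi>"
proof -
 have "Etrig l (\<xi> + 2 * pi * of_int n) = Etrig l \<xi>" for l
 proof -
  have "Etrig l (\<xi> + 2 * pi * of_int n) = Etrig l \<xi> * cis (2 * pi * of_int (l * n))"
   by (simp add: cis_mult algebra_simps)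
  also have "cis (2 * pi * of_int (l * n)) = 1"
   by (rule cis_multiple_2pi) simp
  finally show ?thesis by simp
 qed
 thus "g \<in> trig S \<Longrightarrow> ?thesis" by (auto simp: trig_def)
qed

lemma vd_works: "g differentiable (at \<xi>) \<Longrightarrow> (g has_vector_derivative vd g \<xi>) (at \<xi>)"
 by (simp add: vd_def vector_derivative_works)

lemma vd_eqI: "(g has_vector_derivative g') (at \<xi>) \<Longrightarrow> vd g \<xi> = g'"
 unfolding vd_def by (rule vector_derivative_at)

lemma vd_Etrig: "vd (Etrig l) \<xi> = \<i> * of_int l * Etrig l \<xi>"
 by (rule vd_eqI[OF has_vector_derivative_Etrig])

lemma vd_linear:
 assumes "g differentiable (at \<xi>)" "h differentiable (at \<xi>)"
 shows "vd (\<lambda>\<tau>. a * g \<tau> + h \<tau>) \<xi> = a * vd g \<xi> + vd h \<xi>"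
 by (rule vd_eqI) (auto intro!: has_vector_derivative_add has_vector_derivative_mult_right vd_works assms)

lemma vd_mult:
 assumes "g differentiable (at \<xi>)" "h differentiable (at \<xi>)"
 shows "vd (\<lambda>\<tau>. g \<tau> * h \<tau>) \<xi> = g \<xi> * vd h \<xi> + vd g \<xi> * h \<xi>"
 by (rule vd_eqI) (auto intro!: has_vector_derivative_mult vd_works assms)

lemma Dline_linear:
 assumes "g differentiable (at \<xi>)" "h differentiable (at \<xi>)"
 shows "Dline t (\<lambda>\<tau>. a * g \<tau> + h \<tau>) \<xi> = a * Dline t g \<xi> + Dline t h \<xi>"
 using vd_linear[OF assms, of a] by (simp add: Dline_def algebra_simps)

lemma Dop_linear:
 assumes "g differentiable (at \<xi>)" "h differentiable (at \<xi>)"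
 shows "Dop ts (\<lambda>\<tau>. a * g \<tau> + h \<tau>) \<xi> = a * Dop ts g \<xi> + Dop ts h \<xi>"
proof -
 have "(\<Sum>(t, c)\<leftarrow>ts. of_real c * Dline t (\<lambda>\<tau>. a * g \<tau> + h \<tau>) \<xi>)
  = a * (\<Sum>(t, c)\<leftarrow>ts. of_real c * Dline t g \<xi>) + (\<Sum>(t, c)\<leftarrow>ts. of_real c * Dline t h \<xi>)"
  unfolding Dline_linear[OF assms] by (induction ts) (auto simp: algebra_simps)
 thus ?thesis unfolding Dop_def vd_linear[OF assms, of a] by (simp add: algebra_simps)
qed

lemma linear_operator_trig_sum:
 assumes lin: "\<And>a g h \<xi>. (\<And>\<tau>. g differentiable (at \<tau>)) \<Longrightarrow> (\<And>\<tau>. h differentiable (at \<tau>)) \<Longrightarrow>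
   F (\<lambda>\<tau>. a * g \<tau> + h \<tau>) \<xi> = a * F g \<xi> + F h \<xi>"
  and "finite S"
 shows "F (\<lambda>\<xi>. \<Sum>l\<in>S. c l * Etrig l \<xi>) = (\<lambda>\<xi>. \<Sum>l\<in>S. c l * F (Etrig l) \<xi>)"
 using \<open>finite S\<close>
proof (induction S)
 case empty
 have "F (\<lambda>_. 0) = (\<lambda>_. 0)"
  using lin[of "\<lambda>_. 0" "\<lambda>_. 0" "1"] by (auto intro!: ext)
 thus ?case by simp
next
 case (insert l S)
 have "F (\<lambda>\<tau>. c l * Etrig l \<tau> + (\<Sum>l\<in>S. c l * Etrig l \<tau>)) \<xi> = c l * F (Etrig l) \<xi> + F (\<lambda>\<tau>. \<Sum>l\<in>S. c l * Etrig l \<tau>) \<xi>" for \<xi>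
  by (rule lin) (auto intro!: differentiableI_vector[OF has_vector_derivative_Etrig] trig_differentiable[of _ S] trigI)
 with insert show ?case by (auto intro!: ext)
qed

text \<open>The sine of N \<phi> is divisible by sin \<phi> with a geometric sum of exponentials as
  quotient, so multiplication by the cotangent does not leave the trigonometric polynomials.\<close>

lemma cot_geometric_sum:
 assumes "sin \<phi> \<noteq> 0"
 shows "of_real (cot \<phi>) * (cis (real (Suc n) * \<phi>) - cis (- (real (Suc n) * \<phi>)))
  = \<i> * (cis (real (Suc n) * \<phi>) + cis (- (real (Suc n) * \<phi>)) + 2 * (\<Sum>m<n. cis ((real n - 1 - 2 * real m) * \<phi>)))"
proof -
 let ?s = "complex_of_real (sin \<phi>)"
 have two: "2 * \<i> * ?s = cis \<phi> - cis (-\<phi>)" by (simp add: complex_eq_iff)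
 have twoc: "2 * of_real (cos \<phi>) = cis \<phi> + cis (-\<phi>)" by (simp add: complex_eq_iff)
 have tel: "(2 * \<i> * ?s) * (\<Sum>m<n. cis ((real n - 1 - 2 * real m) * \<phi>)) = cis (real n * \<phi>) - cis (- (real n * \<phi>))"
 proof -
  have "(2 * \<i> * ?s) * (\<Sum>m<n. cis ((real n - 1 - 2 * real m) * \<phi>))
   = (\<Sum>m<n. cis ((real n - 2 * real m) * \<phi>) - cis ((real n - 2 * real (Suc m)) * \<phi>))"
   unfolding two sum_distrib_left
   by (intro sum.cong refl) (simp add: cis_mult left_diff_distrib algebra_simps)
  also have "\<dots> = cis ((real n - 2 * real 0) * \<phi>) - cis ((real n - 2 * real n) * \<phi>)"
   by (rule sum_lessThan_telescope')
  finally show ?thesis by (simp add: algebra_simps)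
 qed
 define a where "a = real (Suc n) * \<phi>"
 have n: "real n * \<phi> = a - \<phi>" by (simp add: a_def algebra_simps)
 have e: "cis (a - \<phi>) = cis a * cis (-\<phi>)" "cis (- (a - \<phi>)) = cis (-a) * cis \<phi>"
  by (simp_all add: cis_mult)
 have "2 * \<i> * ?s * (of_real (cot \<phi>) * (cis a - cis (-a))) = \<i> * (2 * of_real (cos \<phi>)) * (cis a - cis (-a))"
  using assms by (simp add: cot_def)
 also have "\<dots> = \<i> * ((2 * \<i> * ?s) * (cis a + cis (-a)) + 2 * (cis (a - \<phi>) - cis (- (a - \<phi>))))"
  unfolding two twoc e by (simp add: algebra_simps)
 also have "\<dots> = 2 * \<i> * ?s * (\<i> * (cis a + cis (-a) + 2 * (\<Sum>m<n. cis ((real n - 1 - 2 * real m) * \<phi>))))"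
  unfolding n[symmetric] tel[symmetric] by (simp add: algebra_simps)
 finally have "of_real (cot \<phi>) * (cis a - cis (-a))
   = \<i> * (cis a + cis (-a) + 2 * (\<Sum>m<n. cis ((real n - 1 - 2 * real m) * \<phi>)))"
  using assms by simp
 thus ?thesis unfolding a_def .
qed

text \<open>The formula also holds on the mirror: all exponentials there have frequencies of the
  same parity and coincide, and counted with multiplicity there are 2 (n + 1) of them, which is
  twice the derivative.\<close>

lemma Dline_Etrig_pos:
 "Dline t (Etrig (int (Suc n))) \<xi> = \<i> * (Etrig (int (Suc n)) \<xi> + cis (2 * real (Suc n) * t) * Etrig (- int (Suc n)) \<xi>
   + 2 * (\<Sum>m<n. cis (2 * real (Suc m) * t) * Etrig (int n - 1 - 2 * int m) \<xi>))"
proof -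
 define \<phi> where "\<phi> = \<xi> - t"
 have th: "\<xi> = t + \<phi>" by (simp add: \<phi>_def)
 have R: "\<i> * (Etrig (int (Suc n)) \<xi> + cis (2 * real (Suc n) * t) * Etrig (- int (Suc n)) \<xi>
   + 2 * (\<Sum>m<n. cis (2 * real (Suc m) * t) * Etrig (int n - 1 - 2 * int m) \<xi>))
  = cis (real (Suc n) * t) * (\<i> * (cis (real (Suc n) * \<phi>) + cis (- (real (Suc n) * \<phi>)) + 2 * (\<Sum>m<n. cis ((real n - 1 - 2 * real m) * \<phi>))))"
 proof -
  have "cis (2 * real (Suc m) * t) * Etrig (int n - 1 - 2 * int m) \<xi> = cis (real (Suc n) * t) * cis ((real n - 1 - 2 * real m) * \<phi>)" for m
   by (simp add: th cis_mult algebra_simps)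
  moreover have "Etrig (int (Suc n)) \<xi> = cis (real (Suc n) * t) * cis (real (Suc n) * \<phi>)"
   "cis (2 * real (Suc n) * t) * Etrig (- int (Suc n)) \<xi> = cis (real (Suc n) * t) * cis (- (real (Suc n) * \<phi>))"
   by (simp_all add: th cis_mult algebra_simps)
  ultimately show ?thesis by (simp only: sum_distrib_left[symmetric]) (simp add: algebra_simps)
 qed
 show ?thesis
 proof (cases "sin \<phi> = 0")
  case False
  have "Etrig (int (Suc n)) \<xi> - Etrig (int (Suc n)) (2 * t - \<xi>)
   = cis (real (Suc n) * t) * (cis (real (Suc n) * \<phi>) - cis (- (real (Suc n) * \<phi>)))"
   by (simp add: th cis_mult algebra_simps)
  thus ?thesis
   unfolding R cot_geometric_sum[OF False, symmetric] Dline_def using False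
   by (simp add: \<phi>_def[symmetric])
 next
  case True
  then obtain i :: int where i: "\<phi> = of_int i * pi" using sin_zero_iff_int2 by blast
  have par: "cis (x * \<phi>) = cis (y * \<phi>)" if "x - y = 2 * of_int z" for x y z
  proof -
   have "x = y + 2 * of_int z" using that by simp
   hence "x * \<phi> = y * \<phi> + 2 * pi * of_int (z * i)" by (simp add: i algebra_simps)
   thus ?thesis using cis_multiple_2pi[of "of_int (z * i)"] by (simp add: cis_mult[symmetric])
  qed
  have "cis (- (real (Suc n) * \<phi>)) = cis (real (Suc n) * \<phi>)"
  proof -
   have "cis ((- real (Suc n)) * \<phi>) = cis (real (Suc n) * \<phi>)"
    by (rule par[where z="- int (Suc n)"]) simp
   thus ?thesis by (simp only: mult_minus_left)
  qed
  moreover have "cis ((real n - 1 - 2 * real m) * \<phi>) = cis (real (Suc n) * \<phi>)" for m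
   by (rule par[where z="- 1 - int m"]) simp
  ultimately have "cis (real (Suc n) * t) * (\<i> * (cis (real (Suc n) * \<phi>) + cis (- (real (Suc n) * \<phi>)) + 2 * (\<Sum>m<n. cis ((real n - 1 - 2 * real m) * \<phi>))))
   = 2 * (\<i> * of_nat (Suc n) * (cis (real (Suc n) * t) * cis (real (Suc n) * \<phi>)))"
   by (simp add: algebra_simps)
  also have "cis (real (Suc n) * t) * cis (real (Suc n) * \<phi>) = Etrig (int (Suc n)) \<xi>"
   by (simp add: th cis_mult algebra_simps)
  finally show ?thesis
   unfolding R Dline_def vd_Etrig using True by (simp add: \<phi>_def)
 qed
qed

lemma Dline_cnj:
 assumes "g differentiable (at \<xi>)"
 shows "Dline t (\<lambda>\<tau>. cnj (g \<tau>)) \<xi> = cnj (Dline t g \<xi>)"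
proof -
 have "vd (\<lambda>\<tau>. cnj (g \<tau>)) \<xi> = cnj (vd g \<xi>)"
  by (rule vd_eqI, rule bounded_linear.has_vector_derivative[OF bounded_linear_cnj vd_works[OF assms]])
 thus ?thesis by (simp add: Dline_def)
qed

lemma Dline_Etrig_0: "Dline t (Etrig 0) \<xi> = 0"
 by (simp only: Dline_def vd_Etrig) simp

lemma Dline_Etrig_neg:
 "Dline t (Etrig (- int (Suc n))) \<xi> = - \<i> * (Etrig (- int (Suc n)) \<xi> + cis (- (2 * real (Suc n) * t)) * Etrig (int (Suc n)) \<xi>
   + 2 * (\<Sum>m<n. cis (- (2 * real (Suc m) * t)) * Etrig (- (int n - 1 - 2 * int m)) \<xi>))"
proof -
 have "Etrig (- int (Suc n)) = (\<lambda>\<tau>. cnj (Etrig (int (Suc n)) \<tau>))"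
  by (rule ext) (simp only: cis_cnj of_int_minus mult_minus_left)
 hence "Dline t (Etrig (- int (Suc n))) \<xi> = cnj (Dline t (Etrig (int (Suc n))) \<xi>)"
  using Dline_cnj[OF differentiableI_vector[OF has_vector_derivative_Etrig]] by metis
 also have "\<dots> = - \<i> * (Etrig (- int (Suc n)) \<xi> + cis (- (2 * real (Suc n) * t)) * Etrig (int (Suc n)) \<xi>
   + 2 * (\<Sum>m<n. cis (- (2 * real (Suc m) * t)) * Etrig (- (int n - 1 - 2 * int m)) \<xi>))"
  unfolding Dline_Etrig_pos
  by (simp only: complex_cnj_mult complex_cnj_add cnj_sum complex_cnj_i cis_cnj complex_cnj_numeral
    of_int_minus mult_minus_left minus_minus)
 finally show ?thesis .
qed

lemma finite_freq [simp]: "finite (freq j)" "finite (freq_less j)"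
 by (rule finite_subset[of _ "{-int j..int j}"]; auto simp: freq_def freq_less_def)+

lemma freq_uminus: "l \<in> freq j \<Longrightarrow> -l \<in> freq j" "l \<in> freq_less j \<Longrightarrow> -l \<in> freq_less j"
 by (auto simp: freq_def freq_less_def)

lemma freq_less_subset: "freq_less j \<subseteq> freq j" by (auto simp: freq_def freq_less_def)

lemma freq_less_eq: "freq_less j = (if j < 2 then {} else freq (j - 2))"
 unfolding freq_def freq_less_def by (auto simp: of_nat_diff) presburger+

lemma freq_eq: "freq j = insert (int j) (insert (- int j) (freq_less j))"
 by (auto simp: freq_def freq_less_def)

lemma freq_mono: "i \<le> j \<Longrightarrow> even (j - i) \<Longrightarrow> freq i \<subseteq> freq j"
 unfolding freq_def by (auto simp: of_nat_diff)

lemma Dline_Etrig_trig: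
 assumes "\<bar>l\<bar> = int j" shows "Dline t (Etrig l) \<in> trig (freq j)"
proof (cases j)
 case 0
 hence "l = 0" using assms by simp
 have "Dline t (Etrig l) = (\<lambda>_. 0)" unfolding \<open>l = 0\<close> by (rule ext) (rule Dline_Etrig_0)
 thus ?thesis by (simp only: trig_0)
next
 case (Suc n)
 have mem: "int j \<in> freq j" "- int j \<in> freq j" "m < n \<Longrightarrow> int n - 1 - 2 * int m \<in> freq j" "m < n \<Longrightarrow> - (int n - 1 - 2 * int m) \<in> freq j" for m
  by (auto simp: freq_def Suc)
 from assms consider "l = int (Suc n)" | "l = - int (Suc n)" using Suc by linarith
 thus ?thesis
 proof cases
  case 1
  show ?thesis unfolding 1 Dline_Etrig_pos[abs_def]
   by (intro trig_cmult trig_add trig_sum trig_Etrig finite_freq) (use mem Suc in auto)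
 next
  case 2
  show ?thesis unfolding 2 Dline_Etrig_neg[abs_def]
   by (intro trig_cmult trig_add trig_sum trig_Etrig finite_freq) (use mem Suc in auto)
 qed
qed

lemma Dline_trig:
 assumes "g \<in> trig (freq j)" shows "Dline t g \<in> trig (freq j)"
proof -
 obtain c where c: "g = (\<lambda>\<xi>. \<Sum>l\<in>freq j. c l * Etrig l \<xi>)" using assms by (auto simp: trig_def)
 have "Dline t g = (\<lambda>\<xi>. \<Sum>l\<in>freq j. c l * Dline t (Etrig l) \<xi>)"
  unfolding c by (rule linear_operator_trig_sum) (auto simp: Dline_linear)
 also have "\<dots> \<in> trig (freq j)"
 proof (intro trig_sum trig_cmult)
  fix l assume l: "l \<in> freq j"
  have "freq (nat \<bar>l\<bar>) \<subseteq> freq j" using l by (intro freq_mono) (auto simp: freq_def nat_le_iff even_nat_iff)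
  thus "Dline t (Etrig l) \<in> trig (freq j)"
   using Dline_Etrig_trig[of l "nat \<bar>l\<bar>"] by (auto intro: trig_mono)
 qed
 finally show ?thesis .
qed

lemma vd_trig: "g \<in> trig S \<Longrightarrow> finite S \<Longrightarrow> vd g \<in> trig S"
proof -
 assume "g \<in> trig S" "finite S"
 then obtain c where c: "g = (\<lambda>\<xi>. \<Sum>l\<in>S. c l * Etrig l \<xi>)" by (auto simp: trig_def)
 have "vd g = (\<lambda>\<xi>. \<Sum>l\<in>S. c l * vd (Etrig l) \<xi>)"
  unfolding c by (rule linear_operator_trig_sum) (auto simp: vd_linear \<open>finite S\<close>)
 also have "\<dots> = (\<lambda>\<xi>. \<Sum>l\<in>S. (c l * (\<i> * of_int l)) * Etrig l \<xi>)" by (simp add: vd_Etrig mult.assoc)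
 finally show ?thesis by (rule trigI)
qed

lemma Dop_trig: "g \<in> trig (freq j) \<Longrightarrow> Dop ts g \<in> trig (freq j)"
proof -
 assume g: "g \<in> trig (freq j)"
 have "(\<lambda>\<xi>. \<Sum>p\<leftarrow>ts. of_real (snd p) * Dline (fst p) g \<xi>) \<in> trig (freq j)"
  by (rule trig_sum_list, rule trig_cmult, rule Dline_trig[OF g])
 from trig_add[OF vd_trig[OF g finite_freq(1)] this] show ?thesis
  by (simp add: Dop_def[abs_def] case_prod_beta')
qed

lemma Mop_trig:
 assumes "g \<in> trig S" "\<And>l. l \<in> S \<Longrightarrow> -l \<in> S" "finite S"
 shows "Mop ts g \<in> trig S"
proof -
 have "(\<lambda>\<xi>. \<Sum>p\<leftarrow>ts. of_real (snd p) * (g \<xi> - g (2 * fst p - \<xi>))) \<in> trig S"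
  by (rule trig_sum_list, rule trig_cmult, rule trig_diff[OF assms(1) trig_reflect[OF assms]])
 thus ?thesis by (simp add: Mop_def[abs_def] case_prod_beta')
qed

lemma Dop_trig_less: "g \<in> trig (freq_less j) \<Longrightarrow> Dop ts g \<in> trig (freq_less j)"
proof -
 assume g: "g \<in> trig (freq_less j)"
 show ?thesis
 proof (cases "j < 2")
  case True
  hence "g = (\<lambda>_. 0)" using g by (simp add: freq_less_eq trig_def)
  moreover have "Dop ts (\<lambda>_. 0) \<xi> = 0" for \<xi>
   using Dop_linear[of "\<lambda>_. 0" \<xi> "\<lambda>_. 0" ts 1] by simp
  ultimately show ?thesis using trig_0 by (metis ext)
 next
  case False thus ?thesis using g Dop_trig by (simp add: freq_less_eq)
 qed
qed

lemma Etrig_differentiable: "Etrig l differentiable (at \<xi>)"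
 by (rule differentiableI_vector[OF has_vector_derivative_Etrig])

lemma eventually_regular_angle_at: "eventually (regular_angle ts) (at \<xi>)"
proof -
 have "eventually (\<lambda>\<tau>. \<forall>p\<in>set ts. sin (\<tau> - fst p) \<noteq> 0) (at \<xi>)"
 proof (rule eventually_ball_finite)
  show "\<forall>p\<in>set ts. eventually (\<lambda>\<tau>. sin (\<tau> - fst p) \<noteq> 0) (at \<xi>)"
  proof
   fix p assume "p \<in> set ts"
   show "eventually (\<lambda>\<tau>. sin (\<tau> - fst p) \<noteq> 0) (at \<xi>)"
   proof (cases "sin (\<xi> - fst p) = 0")
    case False
    have "isCont (\<lambda>\<tau>. sin (\<tau> - fst p)) \<xi>" by (intro continuous_intros)
    thus ?thesis unfolding isCont_def by (rule tendsto_imp_eventually_ne) (rule False)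
   next
    case True
    show ?thesis unfolding eventually_at
    proof (intro exI[of _ 1] conjI ballI impI)
     fix \<tau> assume t: "\<tau> \<noteq> \<xi> \<and> dist \<tau> \<xi> < 1"
     have "sin (\<tau> - fst p) = sin ((\<tau> - \<xi>) + (\<xi> - fst p))" by simp
     also have "\<dots> = sin (\<tau> - \<xi>) * cos (\<xi> - fst p)" by (simp only: sin_add True mult_zero_right add_0_right)
     finally have e: "sin (\<tau> - fst p) = sin (\<tau> - \<xi>) * cos (\<xi> - fst p)" .
     have "cos (\<xi> - fst p) \<noteq> 0" using True sin_cos_squared_add[of "\<xi> - fst p"] by auto
     moreover have "sin (\<tau> - \<xi>) \<noteq> 0"
     proof (cases "\<tau> > \<xi>")
      case True
      hence "sin (\<tau> - \<xi>) > 0" using t pi_gt3 by (intro sin_gt_zero) (auto simp: dist_real_def)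
      thus ?thesis by simp
     next
      case False
      hence "sin (\<xi> - \<tau>) > 0" using t pi_gt3 by (intro sin_gt_zero) (auto simp: dist_real_def)
      thus ?thesis using sin_minus[of "\<xi> - \<tau>"] by simp
     qed
     ultimately show "sin (\<tau> - fst p) \<noteq> 0" unfolding e by simp
    qed simp
   qed
  qed
 qed simp
 thus ?thesis by (rule eventually_mono) (auto simp: regular_angle_def)
qed

lemma trig_eq_0_if_regular:
 assumes "g \<in> trig S" "\<And>\<xi>. regular_angle ts \<xi> \<Longrightarrow> g \<xi> = 0"
 shows "g = (\<lambda>_. 0)"
proof
 fix \<xi>
 have "isCont g \<xi>" using trig_differentiable[OF assms(1)] differentiable_imp_continuous_within by blast
 hence "(g \<longlongrightarrow> g \<xi>) (at \<xi>)" by (simp add: isCont_def)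
 moreover have "eventually (\<lambda>\<tau>. g \<tau> = 0) (at \<xi>)"
  using eventually_regular_angle_at[of ts \<xi>] by eventually_elim (rule assms(2))
 hence "(g \<longlongrightarrow> 0) (at \<xi>)" by (rule tendsto_eventually)
 ultimately show "g \<xi> = 0" using tendsto_unique trivial_limit_at by blast
qed

section \<open>The angular Laplacian and its eigenvalues\<close>

definition Kop :: "(real \<times> real) list \<Rightarrow> real" where
 "Kop ts = (\<Sum>(t, c)\<leftarrow>ts. c)"

text \<open>The angular part of the Dunkl Laplacian, which acts on r^j g as r^(j-2) times
  \<open>Lop ts g\<close> + j (j + 2K) g.\<close>

definition Lop :: "(real \<times> real) list \<Rightarrow> (real \<Rightarrow> complex) \<Rightarrow> real \<Rightarrow> complex" where
 "Lop ts g \<xi> = of_real (2 * Kop ts) * Mop ts g \<xi> - Mop ts (Mop ts g) \<xi> + Dop ts (Dop ts g) \<xi>"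

text \<open>The coefficient of \<open>Etrig (-l)\<close> in the weighted sum of all reflections of
  \<open>Etrig l\<close>.\<close>

definition line_sum :: "(real \<times> real) list \<Rightarrow> int \<Rightarrow> complex" where
 "line_sum ts l = (\<Sum>(t, c)\<leftarrow>ts. of_real c * cis (2 * of_int l * t))"

lemma Mop_const: "Mop ts (\<lambda>_. a) \<xi> = 0"
 unfolding Mop_def by (induction ts) auto

lemma Mop_Etrig: "Mop ts (Etrig l) \<xi> = of_real (Kop ts) * Etrig l \<xi> - line_sum ts l * Etrig (-l) \<xi>"
 unfolding Mop_def Kop_def line_sum_def Etrig_reflect by (induction ts) (auto simp: algebra_simps)

lemma Lop_linear:
 assumes "g \<in> trig (freq j)" "h \<in> trig (freq j)"
 shows "Lop ts (\<lambda>\<tau>. a * g \<tau> + h \<tau>) \<xi> = a * Lop ts g \<xi> + Lop ts h \<xi>"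
proof -
 have d: "q differentiable (at \<tau>)" if "q \<in> trig (freq j)" for q \<tau> using that by (rule trig_differentiable)
 have M: "Mop ts (\<lambda>\<tau>. a * g \<tau> + h \<tau>) = (\<lambda>\<tau>. a * Mop ts g \<tau> + Mop ts h \<tau>)"
  by (rule ext) (rule Mop_linear)
 have D: "Dop ts (\<lambda>\<tau>. a * g \<tau> + h \<tau>) = (\<lambda>\<tau>. a * Dop ts g \<tau> + Dop ts h \<tau>)"
  by (rule ext) (rule Dop_linear[OF d[OF assms(1)] d[OF assms(2)]])
 show ?thesis unfolding Lop_def M D Mop_linear Dop_linear[OF d[OF Dop_trig[OF assms(1)]] d[OF Dop_trig[OF assms(2)]]]
  by (simp add: algebra_simps)
qed

lemma Lop_trig: "g \<in> trig (freq j) \<Longrightarrow> Lop ts g \<in> trig (freq j)"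
proof -
 assume g: "g \<in> trig (freq j)"
 have M: "Mop ts q \<in> trig (freq j)" if "q \<in> trig (freq j)" for q
  using that by (intro Mop_trig freq_uminus finite_freq)
 show ?thesis unfolding Lop_def[abs_def]
  by (rule trig_add[OF trig_diff[OF trig_cmult[OF M[OF g]] M[OF M[OF g]]] Dop_trig[OF Dop_trig[OF g]]])
qed

text \<open>Modulo lower frequencies a mirror only mixes \<open>l\<close> with \<open>-l\<close>;
  the sign \<sigma> treats both signs of \<open>l\<close> at once.\<close>

lemma Dop_Etrig_leading:
 fixes l :: int
 assumes n: "\<bar>l\<bar> = int n" "n > 0"
 defines "\<sigma> \<equiv> complex_of_int (sgn l)"
 shows "\<exists>low\<in>trig (freq_less n). Dop ts (Etrig l)
  = (\<lambda>\<xi>. \<i> * \<sigma> * of_real (real n + Kop ts) * Etrig l \<xi> + (\<i> * \<sigma> * line_sum ts l * Etrig (-l) \<xi> + low \<xi>))"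
proof -
 obtain m where m: "n = Suc m" using n by (cases n) auto
 define w where "w t \<xi> = 2 * \<i> * \<sigma> * (\<Sum>i<m. cis (2 * real (Suc i) * (of_int (sgn l) * t)) * Etrig (sgn l * (int m - 1 - 2 * int i)) \<xi>)" for t \<xi>
 have mem: "sgn l * (int m - 1 - 2 * int i) \<in> freq_less n" if "i < m" for i
  using that n by (auto simp: freq_less_def m sgn_if)
 have w: "w t \<in> trig (freq_less n)" for t
  unfolding w_def[abs_def] by (intro trig_cmult trig_sum trig_Etrig finite_freq) (use mem in auto)
 have D: "Dline t (Etrig l) \<xi> = \<i> * \<sigma> * (Etrig l \<xi> + cis (2 * of_int l * t) * Etrig (-l) \<xi>) + w t \<xi>" for t \<xi>
 proof -
  from n consider "l = int (Suc m)" | "l = - int (Suc m)" using m by linarith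
  thus ?thesis
  proof cases
   case 1
   have s: "sgn l = 1" using 1 by simp
   show ?thesis unfolding w_def \<sigma>_def s unfolding 1 Dline_Etrig_pos
    by (simp only: of_int_1 mult_1_right mult_1_left of_int_of_nat_eq) (simp only: ring_distribs mult_ac)
  next
   case 2
   have s: "sgn l = -1" using 2 by simp
   show ?thesis unfolding w_def \<sigma>_def s unfolding 2 Dline_Etrig_neg
    by (simp only: of_int_minus of_int_1 mult_minus_left mult_minus_right mult_1_right mult_1_left of_int_of_nat_eq minus_minus)
     (simp only: ring_distribs mult_ac mult_minus_left mult_minus_right minus_add_distrib)
  qed
 qed
 define low where "low \<xi> = (\<Sum>p\<leftarrow>ts. of_real (snd p) * w (fst p) \<xi>)" for \<xi>
 have low: "low \<in> trig (freq_less n)" unfolding low_def[abs_def] by (intro trig_sum_list trig_cmult w)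
 have ln: "of_int l = \<sigma> * of_nat n"
 proof -
  have "l = sgn l * int n" using n by (metis mult_sgn_abs)
  hence "complex_of_int l = complex_of_int (sgn l * int n)" by simp
  thus ?thesis by (simp add: \<sigma>_def)
 qed
 have "Dop ts (Etrig l) \<xi> = \<i> * \<sigma> * of_real (real n + Kop ts) * Etrig l \<xi> + (\<i> * \<sigma> * line_sum ts l * Etrig (-l) \<xi> + low \<xi>)" for \<xi>
 proof -
  have "(\<Sum>(t, c)\<leftarrow>ts. of_real c * Dline t (Etrig l) \<xi>)
   = \<i> * \<sigma> * of_real (Kop ts) * Etrig l \<xi> + (\<i> * \<sigma> * line_sum ts l * Etrig (-l) \<xi> + low \<xi>)"
   unfolding D Kop_def line_sum_def low_def by (induction ts) (auto simp: algebra_simps)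
  thus ?thesis unfolding Dop_def vd_Etrig ln by (simp add: algebra_simps)
 qed
 thus ?thesis using low by blast
qed

text \<open>On the span of frequencies l and -l, modulo lower ones, K - Mop is the scalar s times
  the exchange of the two, so 2K Mop - Mop^2 = K^2 - s^2, while Dop^2 = s^2 - (n + K)^2. The mirror
  sum s cancels and -n (n + 2K) remains. The symmetry assumption makes s the same for l and
  -l.\<close>

lemma Lop_Etrig_leading:
 assumes sym: "line_sum ts (-l) = line_sum ts l" and n: "\<bar>l\<bar> = int n"
 shows "(\<lambda>\<xi>. Lop ts (Etrig l) \<xi> + of_real (real n * (real n + 2 * Kop ts)) * Etrig l \<xi>) \<in> trig (freq_less n)"
proof (cases "n = 0")
 case True
 hence l: "l = 0" using n by simp
 have E0: "Etrig 0 = (\<lambda>_. 1)" by simp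
 have M0: "Mop ts (\<lambda>_. c) = (\<lambda>_. 0)" for c by (rule ext) (rule Mop_const)
 have v0: "vd (\<lambda>_. c) \<xi> = 0" for c \<xi> by (rule vd_eqI) simp
 have D0: "Dop ts (\<lambda>_. c) = (\<lambda>_. 0)" for c
 proof
  fix \<xi> show "Dop ts (\<lambda>_. c) \<xi> = 0" unfolding Dop_def Dline_def v0 by (induction ts) auto
 qed
 show ?thesis unfolding Lop_def l E0 M0 D0 using True trig_0 by simp
next
 case False
 hence n0: "n > 0" by simp
 let ?K = "complex_of_real (Kop ts)" and ?s = "line_sum ts l" and ?\<sigma> = "complex_of_int (sgn l)"
 let ?N = "complex_of_real (real n + Kop ts)"
 have sg: "complex_of_int (sgn (-l)) = - ?\<sigma>" by (simp add: sgn_minus)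
 have ss: "?\<sigma> * ?\<sigma> = 1" using n n0 by (auto simp: sgn_if)
 obtain u where u: "u \<in> trig (freq_less n)" "Dop ts (Etrig l) = (\<lambda>\<xi>. \<i> * ?\<sigma> * ?N * Etrig l \<xi> + (\<i> * ?\<sigma> * ?s * Etrig (-l) \<xi> + u \<xi>))"
  using Dop_Etrig_leading[OF n n0, of ts] by blast
 have n': "\<bar>-l\<bar> = int n" using n by simp
 obtain v where v: "v \<in> trig (freq_less n)" "Dop ts (Etrig (-l)) = (\<lambda>\<xi>. - (\<i> * ?\<sigma> * ?N * Etrig (-l) \<xi>) - \<i> * ?\<sigma> * ?s * Etrig l \<xi> + v \<xi>)"
  using Dop_Etrig_leading[OF n' n0, of ts] unfolding sym sg by (auto simp: algebra_simps)
 have du: "u differentiable (at \<xi>)" for \<xi> using u(1) by (rule trig_differentiable)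
 have d2: "(\<lambda>\<xi>. \<i> * ?\<sigma> * ?s * Etrig (-l) \<xi> + u \<xi>) differentiable (at \<xi>)" for \<xi>
  by (intro derivative_intros Etrig_differentiable du)
 have DD: "Dop ts (Dop ts (Etrig l)) \<xi> = \<i> * ?\<sigma> * ?N * Dop ts (Etrig l) \<xi> + (\<i> * ?\<sigma> * ?s * Dop ts (Etrig (-l)) \<xi> + Dop ts u \<xi>)" for \<xi>
  by (subst (1) u(2), subst Dop_linear[OF Etrig_differentiable d2], subst Dop_linear[OF Etrig_differentiable du]) (rule refl)
 have MM: "Mop ts (Mop ts (Etrig l)) \<xi> = ?K * Mop ts (Etrig l) \<xi> - ?s * Mop ts (Etrig (-l)) \<xi>" for \<xi>
 proof -
  have "Mop ts (Etrig l) = (\<lambda>\<xi>. ?K * Etrig l \<xi> + (- ?s) * Etrig (-l) \<xi>)" by (rule ext) (simp add: Mop_Etrig)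
  hence "Mop ts (Mop ts (Etrig l)) \<xi> = ?K * Mop ts (Etrig l) \<xi> + Mop ts (\<lambda>\<xi>. (- ?s) * Etrig (-l) \<xi>) \<xi>"
   by (simp only: Mop_linear)
  also have "Mop ts (\<lambda>\<xi>. (- ?s) * Etrig (-l) \<xi>) \<xi> = (- ?s) * Mop ts (Etrig (-l)) \<xi>"
   using Mop_linear[of ts "- ?s" "Etrig (-l)" "\<lambda>_. 0" \<xi>] by (simp only: Mop_const add_0_right)
  finally show ?thesis by simp
 qed
 have nn: "of_real (real n * (real n + 2 * Kop ts)) = ?N * ?N - ?K * ?K" by (simp add: algebra_simps)
 have "Lop ts (Etrig l) \<xi> + of_real (real n * (real n + 2 * Kop ts)) * Etrig l \<xi>
  = \<i> * ?\<sigma> * ?N * u \<xi> + (\<i> * ?\<sigma> * ?s * v \<xi> + Dop ts u \<xi>)" for \<xi>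
 proof -
  have "Lop ts (Etrig l) \<xi> + of_real (real n * (real n + 2 * Kop ts)) * Etrig l \<xi>
   = (?K * ?K - ?s * ?s - (?\<sigma> * ?\<sigma>) * (?N * ?N - ?s * ?s) + (?N * ?N - ?K * ?K)) * Etrig l \<xi>
    + (\<i> * ?\<sigma> * ?N * u \<xi> + (\<i> * ?\<sigma> * ?s * v \<xi> + Dop ts u \<xi>))"
   unfolding Lop_def DD MM nn unfolding u(2) v(2) Mop_Etrig sym minus_minus by (simp add: algebra_simps)
  thus ?thesis unfolding ss by simp
 qed
 moreover have "(\<lambda>\<xi>. \<i> * ?\<sigma> * ?N * u \<xi> + (\<i> * ?\<sigma> * ?s * v \<xi> + Dop ts u \<xi>)) \<in> trig (freq_less n)"
  by (rule trig_add[OF trig_cmult[OF u(1)] trig_add[OF trig_cmult[OF v(1)] Dop_trig_less[OF u(1)]]])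
 ultimately show ?thesis by simp
qed

lemma trig_freq_split:
 assumes "g \<in> trig (freq n)"
 obtains a b g0 where "g0 \<in> trig (freq_less n)" "g = (\<lambda>\<xi>. a * Etrig (int n) \<xi> + (b * Etrig (- int n) \<xi> + g0 \<xi>))"
proof -
 obtain c where c: "g = (\<lambda>\<xi>. \<Sum>l\<in>freq n. c l * Etrig l \<xi>)" using assms by (auto simp: trig_def)
 define g0 where "g0 = (\<lambda>\<xi>. \<Sum>l\<in>freq_less n. c l * Etrig l \<xi>)"
 have g0: "g0 \<in> trig (freq_less n)" unfolding g0_def by (rule trigI) (rule refl)
 have nin: "int n \<notin> freq_less n" "- int n \<notin> freq_less n" by (auto simp: freq_less_def)
 show ?thesis
 proof (cases "n = 0")
  case True
  \<comment> \<open>The two extreme frequencies coincide here, so the second coefficient is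
    0.\<close>
  hence "g = (\<lambda>\<xi>. c 0 * Etrig (int n) \<xi> + (0 * Etrig (- int n) \<xi> + g0 \<xi>))"
   unfolding c g0_def freq_eq using nin by (auto intro!: ext)
  thus ?thesis by (rule that[OF g0])
 next
  case False
  hence "g = (\<lambda>\<xi>. c (int n) * Etrig (int n) \<xi> + (c (- int n) * Etrig (- int n) \<xi> + g0 \<xi>))"
   unfolding c g0_def freq_eq using nin by (intro ext) (subst sum.insert, simp, simp, subst sum.insert, simp_all)
  thus ?thesis by (rule that[OF g0])
 qed
qed

text \<open>\<open>Lop\<close> is triangular with eigenvalues \<open>-n (n + 2 K)\<close> on the frequencies \<open>n\<close> and \<open>-n\<close>.\<close>

lemma Lop_solvable:
 assumes sym: "\<And>l. line_sum ts (-l) = line_sum ts l"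
  and ev: "\<And>i. i \<le> n \<Longrightarrow> \<mu> \<noteq> real i * (real i + 2 * Kop ts)"
  and g: "g \<in> trig (freq n)"
 shows "\<exists>h\<in>trig (freq n). (\<lambda>\<xi>. Lop ts h \<xi> + of_real \<mu> * h \<xi>) = g"
 using ev g
proof (induction n arbitrary: g rule: less_induct)
 case (less n)
 obtain a b g0 where g0: "g0 \<in> trig (freq_less n)" and g: "g = (\<lambda>\<xi>. a * Etrig (int n) \<xi> + (b * Etrig (- int n) \<xi> + g0 \<xi>))"
  using trig_freq_split[OF less.prems(2)] by blast
 define e where "e = real n * (real n + 2 * Kop ts)"
 define d where "d = complex_of_real (\<mu> - e)"
 have "\<mu> \<noteq> e" using less.prems(1)[of n] by (simp add: e_def)
 hence d0: "d \<noteq> 0" unfolding d_def by (simp del: of_real_diff)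
 have En: "Etrig (int n) \<in> trig (freq n)" "Etrig (- int n) \<in> trig (freq n)"
  by (rule trig_Etrig; (rule finite_freq | simp add: freq_def))+
 define h0 where "h0 = (\<lambda>\<xi>. (a / d) * Etrig (int n) \<xi> + (b / d) * Etrig (- int n) \<xi>)"
 have h0: "h0 \<in> trig (freq n)" unfolding h0_def by (intro trig_add trig_cmult En)
 obtain u where u: "u \<in> trig (freq_less n)" "u = (\<lambda>\<xi>. Lop ts (Etrig (int n)) \<xi> + of_real e * Etrig (int n) \<xi>)"
  using Lop_Etrig_leading[OF sym, of "int n" n] by (simp add: e_def)
 obtain v where v: "v \<in> trig (freq_less n)" "v = (\<lambda>\<xi>. Lop ts (Etrig (- int n)) \<xi> + of_real e * Etrig (- int n) \<xi>)"
  using Lop_Etrig_leading[OF sym, of "- int n" n] by (simp add: e_def)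
 have Lh0: "Lop ts h0 \<xi> = (a / d) * Lop ts (Etrig (int n)) \<xi> + (b / d) * Lop ts (Etrig (- int n)) \<xi>" for \<xi>
 proof -
  have "Lop ts (\<lambda>\<xi>. (b / d) * Etrig (- int n) \<xi>) \<xi> = (b / d) * Lop ts (Etrig (- int n)) \<xi> + Lop ts (\<lambda>_. 0) \<xi>"
   using Lop_linear[OF En(2) trig_0, of ts "b / d" \<xi>] by simp
  moreover have "Lop ts (\<lambda>_. 0) \<xi> = 0"
   using Lop_linear[OF trig_0[of "freq n"] trig_0, of ts 1 \<xi>] by simp
  ultimately show ?thesis unfolding h0_def by (subst Lop_linear[OF En(1) trig_cmult[OF En(2)]]) simp
 qed
 have res: "Lop ts h0 \<xi> + of_real \<mu> * h0 \<xi> = g \<xi> - g0 \<xi> + ((a / d) * u \<xi> + (b / d) * v \<xi>)" for \<xi>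
 proof -
  have "of_real \<mu> = d + of_real e" by (simp add: d_def)
  thus ?thesis unfolding Lh0 u(2) v(2) g unfolding h0_def using d0 by (simp add: field_simps)
 qed
 \<comment> \<open>\<open>h0\<close> inverts the diagonal part; its error has only lower frequencies
   and is left to the induction hypothesis.\<close>
 define q where "q = (\<lambda>\<xi>. g0 \<xi> - ((a / d) * u \<xi> + (b / d) * v \<xi>))"
 have q: "q \<in> trig (freq_less n)" unfolding q_def by (intro trig_diff trig_add trig_cmult g0 u(1) v(1))
 obtain h1 where h1: "h1 \<in> trig (freq n)" "(\<lambda>\<xi>. Lop ts h1 \<xi> + of_real \<mu> * h1 \<xi>) = q"
 proof (cases "n < 2")
  case True
  hence "q = (\<lambda>_. 0)" using q by (simp add: freq_less_eq trig_def)
  moreover have "Lop ts (\<lambda>_. 0) \<xi> = 0" for \<xi>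
   using Lop_linear[OF trig_0[of "freq n"] trig_0, of ts 1 \<xi>] by simp
  ultimately show ?thesis using that[of "\<lambda>_. 0"] trig_0 by simp
 next
  case False
  hence "freq_less n = freq (n - 2)" by (simp add: freq_less_eq)
  moreover have "freq (n - 2) \<subseteq> freq n" using False by (intro freq_mono) auto
  ultimately have q': "q \<in> trig (freq (n - 2))" "\<And>h. h \<in> trig (freq (n - 2)) \<Longrightarrow> h \<in> trig (freq n)"
   using q trig_mono[OF _ finite_freq(1)] by auto
  have "\<exists>h\<in>trig (freq (n - 2)). (\<lambda>\<xi>. Lop ts h \<xi> + of_real \<mu> * h \<xi>) = q"
   by (rule less.IH[OF _ _ q'(1)]) (use False less.prems(1) in auto)
  thus ?thesis using that q'(2) by blast
 qed
 have "(\<lambda>\<xi>. h0 \<xi> + h1 \<xi>) \<in> trig (freq n)" by (intro trig_add h0 h1)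
 moreover have "Lop ts (\<lambda>\<xi>. h0 \<xi> + h1 \<xi>) \<xi> + of_real \<mu> * (h0 \<xi> + h1 \<xi>) = g \<xi>" for \<xi>
 proof -
  have "Lop ts (\<lambda>\<xi>. h0 \<xi> + h1 \<xi>) \<xi> = Lop ts h0 \<xi> + Lop ts h1 \<xi>"
   using Lop_linear[OF h0 h1(1), of ts 1 \<xi>] by simp
  moreover have "Lop ts h1 \<xi> + of_real \<mu> * h1 \<xi> = q \<xi>" using h1(2) by meson
  ultimately have "Lop ts (\<lambda>\<xi>. h0 \<xi> + h1 \<xi>) \<xi> + of_real \<mu> * (h0 \<xi> + h1 \<xi>)
    = (Lop ts h0 \<xi> + of_real \<mu> * h0 \<xi>) + q \<xi>" by (simp add: distrib_left)
  thus ?thesis unfolding res q_def by simp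
 qed
 ultimately show ?case by blast
qed

subsection \<open>Homogeneous polynomials on the circle\<close>

lemma homog_poly_add:
 assumes "homog_poly j f" "homog_poly j g" shows "homog_poly j (\<lambda>z. f z + g z)"
proof -
 obtain c d where "\<And>z. f z = (\<Sum>i\<le>j. c i * of_real (Re z ^ i * Im z ^ (j - i)))"
  "\<And>z. g z = (\<Sum>i\<le>j. d i * of_real (Re z ^ i * Im z ^ (j - i)))"
  using assms unfolding homog_poly_def by blast
 thus ?thesis unfolding homog_poly_def
  by (intro exI[of _ "\<lambda>i. c i + d i"]) (simp only: distrib_right sum.distrib simp_thms)
qed

lemma homog_poly_cmult:
 assumes "homog_poly j f" shows "homog_poly j (\<lambda>z. a * f z)"
proof -
 obtain c where "\<And>z. f z = (\<Sum>i\<le>j. c i * of_real (Re z ^ i * Im z ^ (j - i)))"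
  using assms unfolding homog_poly_def by blast
 thus ?thesis unfolding homog_poly_def
  by (intro exI[of _ "\<lambda>i. a * c i"]) (simp only: sum_distrib_left mult.assoc simp_thms)
qed

lemma homog_poly_0: "homog_poly j (\<lambda>_. 0)"
 unfolding homog_poly_def by (rule exI[of _ "\<lambda>_. 0"]) simp

lemma homog_poly_sum:
 "(\<And>i. i \<in> A \<Longrightarrow> homog_poly j (f i)) \<Longrightarrow> homog_poly j (\<lambda>z. \<Sum>i\<in>A. f i z)"
proof (induction A rule: infinite_finite_induct)
 case (insert i A)
 hence "homog_poly j (\<lambda>z. f i z + (\<Sum>i\<in>A. f i z))" by (intro homog_poly_add) auto
 with insert show ?case by simp
qed (simp_all add: homog_poly_0)

lemma homog_poly_Re:
 assumes "homog_poly j f" shows "homog_poly (Suc j) (\<lambda>z. of_real (Re z) * f z)"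
proof -
 obtain c where c: "\<And>z. f z = (\<Sum>i\<le>j. c i * of_real (Re z ^ i * Im z ^ (j - i)))"
  using assms unfolding homog_poly_def by blast
 have "of_real (Re z) * f z = (\<Sum>i\<le>Suc j. (if i = 0 then 0 else c (i - 1)) * of_real (Re z ^ i * Im z ^ (Suc j - i)))" for z
  by (subst sum.atMost_Suc_shift) (simp add: c sum_distrib_left mult_ac)
 thus ?thesis unfolding homog_poly_def by (intro exI allI)
qed

lemma homog_poly_Im:
 assumes "homog_poly j f" shows "homog_poly (Suc j) (\<lambda>z. of_real (Im z) * f z)"
proof -
 obtain c where c: "\<And>z. f z = (\<Sum>i\<le>j. c i * of_real (Re z ^ i * Im z ^ (j - i)))"
  using assms unfolding homog_poly_def by blast
 have "of_real (Im z) * f z = (\<Sum>i\<le>Suc j. (if i \<le> j then c i else 0) * of_real (Re z ^ i * Im z ^ (Suc j - i)))" for z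
  by (simp add: c sum_distrib_left mult_ac Suc_diff_le)
 thus ?thesis unfolding homog_poly_def by (intro exI allI)
qed

lemma homog_poly_mult_id:
 assumes "homog_poly j f" shows "homog_poly (Suc j) (\<lambda>z. z * f z)" "homog_poly (Suc j) (\<lambda>z. cnj z * f z)"
proof -
 have 1: "z * f z = of_real (Re z) * f z + \<i> * (of_real (Im z) * f z)" for z
  by (subst complex_eq[of z]) (simp add: algebra_simps)
 have "cnj z = of_real (Re z) + (- \<i>) * of_real (Im z)" for z by (simp add: complex_eq_iff)
 hence 2: "cnj z * f z = of_real (Re z) * f z + (- \<i>) * (of_real (Im z) * f z)" for z
  by (simp only: distrib_right mult.assoc)
 show "homog_poly (Suc j) (\<lambda>z. z * f z)"
  unfolding 1 by (rule homog_poly_add[OF homog_poly_Re[OF assms] homog_poly_cmult[OF homog_poly_Im[OF assms]]])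
 show "homog_poly (Suc j) (\<lambda>z. cnj z * f z)"
  unfolding 2 by (rule homog_poly_add[OF homog_poly_Re[OF assms] homog_poly_cmult[OF homog_poly_Im[OF assms]]])
qed

lemma homog_poly_monomial: "homog_poly (m + n) (\<lambda>z. z ^ m * cnj z ^ n)"
proof (induction m)
 case 0
 show ?case
 proof (induction n)
  case 0 show ?case unfolding homog_poly_def by (intro exI[of _ "\<lambda>_. 1"]) simp
 next
  case (Suc n) thus ?case using homog_poly_mult_id(2)[of "0 + n" "\<lambda>z. z ^ 0 * cnj z ^ n"] by simp
 qed
next
 case (Suc m)
 thus ?case using homog_poly_mult_id(1)[OF Suc] by (simp add: mult.assoc)
qed

lemma trig_freq_mult:
 assumes "g \<in> trig (freq i)" "h \<in> trig (freq j)"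
 shows "(\<lambda>\<xi>. g \<xi> * h \<xi>) \<in> trig (freq (i + j))"
proof (rule trig_mono[OF _ _ trig_mult[OF assms finite_freq(1) finite_freq(1)]])
 show "(\<lambda>(l, m). l + m) ` (freq i \<times> freq j) \<subseteq> freq (i + j)" by (auto simp: freq_def)
qed simp

lemma trig_cos_sin: "(\<lambda>\<xi>. of_real (cos \<xi>)) \<in> trig (freq 1)" "(\<lambda>\<xi>. of_real (sin \<xi>)) \<in> trig (freq 1)"
proof -
 have E: "Etrig 1 \<in> trig (freq 1)" "Etrig (-1) \<in> trig (freq 1)"
  by (rule trig_Etrig; (rule finite_freq | simp add: freq_def))+
 have c: "complex_of_real (cos \<xi>) = (1/2) * (Etrig 1 \<xi> + Etrig (-1) \<xi>)" for \<xi> by (simp add: complex_eq_iff)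
 have s: "complex_of_real (sin \<xi>) = (-\<i>/2) * (Etrig 1 \<xi> - Etrig (-1) \<xi>)" for \<xi> by (simp add: complex_eq_iff)
 show "(\<lambda>\<xi>. of_real (cos \<xi>)) \<in> trig (freq 1)" unfolding c by (intro trig_cmult trig_add E)
 show "(\<lambda>\<xi>. of_real (sin \<xi>)) \<in> trig (freq 1)" unfolding s by (intro trig_cmult trig_diff E)
qed

lemma trig_1: "(\<lambda>_. 1) \<in> trig (freq 0)"
 using trig_Etrig[of 0 "freq 0"] by (simp add: freq_def)

lemma trig_cos_sin_power: "(\<lambda>\<xi>. of_real (cos \<xi> ^ m * sin \<xi> ^ n)) \<in> trig (freq (m + n))"
proof -
 have P: "(\<lambda>\<xi>. g \<xi> ^ m) \<in> trig (freq m)" if "g \<in> trig (freq 1)" for g m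
  by (induction m) (use trig_1 trig_freq_mult[OF that] in auto)
 show ?thesis using trig_freq_mult[OF P[OF trig_cos_sin(1), of m] P[OF trig_cos_sin(2), of n]] by simp
qed

lemma homog_poly_polar:
 assumes "homog_poly j f"
 shows "(\<lambda>\<xi>. f (cis \<xi>)) \<in> trig (freq j)" "f (of_real \<rho> * cis \<xi>) = of_real (\<rho> ^ j) * f (cis \<xi>)"
proof -
 obtain c where c: "\<And>z. f z = (\<Sum>i\<le>j. c i * of_real (Re z ^ i * Im z ^ (j - i)))"
  using assms unfolding homog_poly_def by blast
 have "(\<lambda>\<xi>. \<Sum>i\<le>j. c i * of_real (cos \<xi> ^ i * sin \<xi> ^ (j - i))) \<in> trig (freq j)"
 proof (intro trig_sum trig_cmult)
  fix i assume "i \<in> {..j}"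
  thus "(\<lambda>\<xi>. complex_of_real (cos \<xi> ^ i * sin \<xi> ^ (j - i))) \<in> trig (freq j)"
   using trig_cos_sin_power[of i "j - i"] by simp
 qed
 thus "(\<lambda>\<xi>. f (cis \<xi>)) \<in> trig (freq j)" by (simp add: c)
 have "(\<rho> * cos \<xi>) ^ i * (\<rho> * sin \<xi>) ^ (j - i) = \<rho> ^ j * (cos \<xi> ^ i * sin \<xi> ^ (j - i))" if "i \<le> j" for i
  using that by (simp add: power_mult_distrib mult_ac flip: power_add)
 hence "f (of_real \<rho> * cis \<xi>) = (\<Sum>i\<le>j. c i * of_real (\<rho> ^ j * (cos \<xi> ^ i * sin \<xi> ^ (j - i))))"
  unfolding c by (intro sum.cong refl) simp
 thus "f (of_real \<rho> * cis \<xi>) = of_real (\<rho> ^ j) * f (cis \<xi>)"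
  by (simp add: c sum_distrib_left mult_ac)
qed

text \<open>\<open>Etrig l\<close> is the restriction of z^p times the q-th power of the conjugate,
  with p + q = j and p - q = l; the parity condition in \<open>freq\<close> makes p and q
  integers.\<close>

lemma trig_homog_poly:
 assumes "g \<in> trig (freq j)"
 obtains f where "homog_poly j f" "\<And>\<xi>. f (cis \<xi>) = g \<xi>"
proof -
 obtain c where c: "g = (\<lambda>\<xi>. \<Sum>l\<in>freq j. c l * Etrig l \<xi>)" using assms by (auto simp: trig_def)
 define f where "f z = (\<Sum>l\<in>freq j. c l * (z ^ nat ((int j + l) div 2) * cnj z ^ nat ((int j - l) div 2)))" for z
 have ex: "nat ((int j + l) div 2) + nat ((int j - l) div 2) = j"
  "int (nat ((int j + l) div 2)) - int (nat ((int j - l) div 2)) = l" if "l \<in> freq j" for l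
 proof -
  have "even (l - int j)" using that unfolding freq_def by blast
  then obtain a where "l - int j = 2 * a" by (elim dvdE)
  hence l: "l = 2 * (a + int j) - int j" by simp
  have "(int j + l) div 2 = a + int j" "(int j - l) div 2 = - a" unfolding l by auto
  moreover have "0 \<le> a + int j" "0 \<le> - a" using that l by (auto simp: freq_def)
  ultimately show "nat ((int j + l) div 2) + nat ((int j - l) div 2) = j"
   "int (nat ((int j + l) div 2)) - int (nat ((int j - l) div 2)) = l" using l by auto
 qed
 have "homog_poly j f" unfolding f_def
 proof (intro homog_poly_sum homog_poly_cmult)
  fix l assume "l \<in> freq j"
  from homog_poly_monomial[of "nat ((int j + l) div 2)" "nat ((int j - l) div 2)"] ex(1)[OF this]
  show "homog_poly j (\<lambda>z. z ^ nat ((int j + l) div 2) * cnj z ^ nat ((int j - l) div 2))" by simp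
 qed
 moreover have "f (cis \<xi>) = g \<xi>" for \<xi>
  unfolding f_def c
 proof (intro sum.cong refl arg_cong2[where f="(*)"])
  fix l assume l: "l \<in> freq j"
  let ?p = "nat ((int j + l) div 2)" and ?q = "nat ((int j - l) div 2)"
  have "cis \<xi> ^ ?p * cnj (cis \<xi>) ^ ?q = cis ((real ?p - real ?q) * \<xi>)"
   unfolding cis_cnj Complex.DeMoivre cis_mult by (rule arg_cong[where f=cis]) (simp add: algebra_simps)
  also have "real ?p - real ?q = of_int l" using ex(2)[OF l] by (metis of_int_diff of_int_of_nat_eq)
  finally show "cis \<xi> ^ ?p * cnj (cis \<xi>) ^ ?q = Etrig l \<xi>" .
 qed
 ultimately show ?thesis by (rule that)
qed

subsection \<open>Dunkl harmonics as orthogonal complements\<close>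

text \<open>\<open>I\<close> abstracts the weighted integral over the circle, so that the
  description of the harmonics is separated from integration. The pairing \<open>I\<close> of a
  product is bilinear; conjugation enters only in the definiteness assumption
  \<open>I_pos\<close>.\<close>

locale dunkl_circle =
 fixes ts :: "(real \<times> real) list" and I :: "(real \<Rightarrow> complex) \<Rightarrow> complex"
 assumes I_linear: "\<And>g h a S T. g \<in> trig S \<Longrightarrow> h \<in> trig T \<Longrightarrow> finite S \<Longrightarrow> finite T \<Longrightarrow>
   I (\<lambda>\<xi>. a * g \<xi> + h \<xi>) = a * I g + I h"
  and I_reflect: "\<And>t c g S. (t, c) \<in> set ts \<Longrightarrow> g \<in> trig S \<Longrightarrow> finite S \<Longrightarrow> I (\<lambda>\<xi>. g (2 * t - \<xi>)) = I g"
  and I_Dop: "\<And>l. I (Dop ts (Etrig l)) = 0"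
  and I_pos: "\<And>g S. g \<in> trig S \<Longrightarrow> finite S \<Longrightarrow> I (\<lambda>\<xi>. g \<xi> * cnj (g \<xi>)) = 0 \<Longrightarrow> g = (\<lambda>_. 0)"
  and line_sum_sym: "\<And>l. line_sum ts (-l) = line_sum ts l"
  and Kop_nonneg: "Kop ts \<ge> 0"
  and reflect_regular: "\<And>t c \<tau>. (t, c) \<in> set ts \<Longrightarrow> regular_angle ts \<tau> \<Longrightarrow> regular_angle ts (2 * t - \<tau>)"
  and ts_nonempty: "ts \<noteq> []"
begin

lemma I_0: "I (\<lambda>_. 0) = 0"
 using I_linear[of "\<lambda>_. 0" "{}" "\<lambda>_. 0" "{}" 1] by (simp add: trig_0)

lemma I_add: "g \<in> trig S \<Longrightarrow> h \<in> trig T \<Longrightarrow> finite S \<Longrightarrow> finite T \<Longrightarrow> I (\<lambda>\<xi>. g \<xi> + h \<xi>) = I g + I h"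
 using I_linear[of g S h T 1] by simp

lemma I_cmult: "g \<in> trig S \<Longrightarrow> finite S \<Longrightarrow> I (\<lambda>\<xi>. a * g \<xi>) = a * I g"
 using I_linear[of g S "\<lambda>_. 0" "{}" a] by (simp add: trig_0 I_0)

lemma I_diff: "g \<in> trig S \<Longrightarrow> h \<in> trig T \<Longrightarrow> finite S \<Longrightarrow> finite T \<Longrightarrow> I (\<lambda>\<xi>. g \<xi> - h \<xi>) = I g - I h"
 using I_linear[of h T g S "-1"] by simp

lemma I_sum:
 "finite A \<Longrightarrow> finite S \<Longrightarrow> (\<And>i. i \<in> A \<Longrightarrow> g i \<in> trig S) \<Longrightarrow> I (\<lambda>\<xi>. \<Sum>i\<in>A. g i \<xi>) = (\<Sum>i\<in>A. I (g i))"
proof (induction A rule: finite_induct)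
 case (insert i A)
 have "I (\<lambda>\<xi>. g i \<xi> + (\<Sum>i\<in>A. g i \<xi>)) = I (g i) + I (\<lambda>\<xi>. \<Sum>i\<in>A. g i \<xi>)"
  using insert by (intro I_add trig_sum) auto
 with insert show ?case by simp
qed (simp add: I_0)

lemma I_sum_list:
 "finite S \<Longrightarrow> (\<And>p. p \<in> set us \<Longrightarrow> g p \<in> trig S) \<Longrightarrow> I (\<lambda>\<xi>. \<Sum>p\<leftarrow>us. g p \<xi>) = (\<Sum>p\<leftarrow>us. I (g p))"
proof (induction us)
 case (Cons p us)
 have "I (\<lambda>\<xi>. g p \<xi> + (\<Sum>p\<leftarrow>us. g p \<xi>)) = I (g p) + I (\<lambda>\<xi>. \<Sum>p\<leftarrow>us. g p \<xi>)"
  using Cons by (intro I_add trig_sum_list) auto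
 with Cons show ?case by simp
qed (simp add: I_0)

lemma Dop_Etrig_trig: "Dop ts (Etrig l) \<in> trig (freq (nat \<bar>l\<bar>))"
 by (rule Dop_trig, rule trig_Etrig[OF _ finite_freq(1)]) (auto simp: freq_def even_nat_iff)

lemma I_Dop_trig:
 assumes "g \<in> trig S" "finite S" shows "I (Dop ts g) = 0"
proof -
 obtain c where c: "g = (\<lambda>\<xi>. \<Sum>l\<in>S. c l * Etrig l \<xi>)" using assms by (auto simp: trig_def)
 define U where "U = (\<Union>l\<in>S. freq (nat \<bar>l\<bar>))"
 have U: "finite U" using assms by (simp add: U_def)
 have m: "Dop ts (Etrig l) \<in> trig U" if "l \<in> S" for l
  using that U by (intro trig_mono[OF _ _ Dop_Etrig_trig]) (auto simp: U_def)
 have "Dop ts g = (\<lambda>\<xi>. \<Sum>l\<in>S. c l * Dop ts (Etrig l) \<xi>)"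
  unfolding c by (rule linear_operator_trig_sum) (auto simp: Dop_linear assms)
 hence "I (Dop ts g) = (\<Sum>l\<in>S. I (\<lambda>\<xi>. c l * Dop ts (Etrig l) \<xi>))"
  by (simp only:) (rule I_sum[OF assms(2) U], rule trig_cmult, rule m)
 also have "\<dots> = 0"
  by (rule sum.neutral) (use I_cmult[OF m U] I_Dop in auto)
 finally show ?thesis .
qed

text \<open>The product rule for \<open>Dop\<close> holds up to a defect, the sum over the mirrors
  of Dline g times the difference of \<open>h\<close> and its reflection. This defect is odd under
  the reflection, so \<open>I\<close> annihilates it, and \<open>I\<close> annihilates
  \<open>Dop\<close> of the product, which is a trigonometric polynomial.\<close>

lemma Dop_skew:
 assumes g: "g \<in> trig (freq i)" and h: "h \<in> trig (freq j)"
 shows "I (\<lambda>\<xi>. Dop ts g \<xi> * h \<xi>) = - I (\<lambda>\<xi>. g \<xi> * Dop ts h \<xi>)"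
proof -
 let ?r = "\<lambda>p \<xi>. of_real (snd p) * (Dline (fst p) g \<xi> * (h \<xi> - h (2 * fst p - \<xi>)))"
 have d: "g differentiable (at \<xi>)" "h differentiable (at \<xi>)" for \<xi>
  using g h by (auto intro: trig_differentiable)
 have gh: "(\<lambda>\<xi>. g \<xi> * h \<xi>) \<in> trig (freq (i + j))" by (rule trig_freq_mult[OF g h])
 have hr: "(\<lambda>\<xi>. h \<xi> - h (2 * t - \<xi>)) \<in> trig (freq j)" for t
  by (intro trig_diff trig_reflect h finite_freq freq_uminus)
 have r: "(\<lambda>\<xi>. Dline t g \<xi> * (h \<xi> - h (2 * t - \<xi>))) \<in> trig (freq (i + j))" for t
  by (rule trig_freq_mult[OF Dline_trig[OF g] hr])
 have line: "Dline t g \<xi> * h \<xi> + g \<xi> * Dline t h \<xi>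
   = Dline t (\<lambda>\<xi>. g \<xi> * h \<xi>) \<xi> + Dline t g \<xi> * (h \<xi> - h (2 * t - \<xi>))" for t \<xi>
 proof (cases "sin (\<xi> - t) = 0")
  case False
  thus ?thesis by (simp add: Dline_def algebra_simps)
 next
  case True
  then obtain m :: int where "\<xi> - t = of_int m * pi" using sin_zero_iff_int2 by blast
  hence "2 * t - \<xi> = \<xi> + 2 * pi * of_int (- m)" by (simp add: algebra_simps)
  hence "h (2 * t - \<xi>) = h \<xi>" using trig_periodic[OF h] by metis
  thus ?thesis using True by (simp add: Dline_def vd_mult[OF d] algebra_simps)
 qed
 have pw: "Dop ts g \<xi> * h \<xi> + g \<xi> * Dop ts h \<xi> = Dop ts (\<lambda>\<xi>. g \<xi> * h \<xi>) \<xi> + (\<Sum>p\<leftarrow>ts. ?r p \<xi>)" for \<xi>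
 proof -
  have "(\<Sum>(t, c)\<leftarrow>ts. of_real c * Dline t g \<xi>) * h \<xi> + g \<xi> * (\<Sum>(t, c)\<leftarrow>ts. of_real c * Dline t h \<xi>)
   = (\<Sum>(t, c)\<leftarrow>ts. of_real c * (Dline t g \<xi> * h \<xi> + g \<xi> * Dline t h \<xi>))"
   by (induction ts) (auto simp: algebra_simps)
  also have "\<dots> = (\<Sum>(t, c)\<leftarrow>ts. of_real c * Dline t (\<lambda>\<xi>. g \<xi> * h \<xi>) \<xi>) + (\<Sum>p\<leftarrow>ts. ?r p \<xi>)"
   unfolding line by (induction ts) (auto simp: algebra_simps)
  finally show ?thesis unfolding Dop_def vd_mult[OF d] by (simp add: algebra_simps)
 qed
 have r0: "I (\<lambda>\<xi>. Dline t g \<xi> * (h \<xi> - h (2 * t - \<xi>))) = 0" if tc: "(t, c) \<in> set ts" for t c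
 proof -
  have sn: "sin (2 * t - \<xi> - t) = - sin (\<xi> - t)" for \<xi>
   using sin_minus[of "\<xi> - t"] by (simp add: algebra_simps)
  have ct: "cot (2 * t - \<xi> - t) = - cot (\<xi> - t)" for \<xi>
   using sin_minus[of "\<xi> - t"] cos_minus[of "\<xi> - t"] by (simp add: cot_def algebra_simps)
  \<comment> \<open>The cotangent and both differences change sign under the reflection, hence so
    does their product.\<close>
  have anti: "Dline t g (2 * t - \<xi>) * (h (2 * t - \<xi>) - h (2 * t - (2 * t - \<xi>)))
   = (-1) * (Dline t g \<xi> * (h \<xi> - h (2 * t - \<xi>)))" for \<xi>
  proof (cases "sin (\<xi> - t) = 0")
   case False
   thus ?thesis unfolding Dline_def sn ct by (simp add: algebra_simps)
  next
   case True
   then obtain m :: int where "\<xi> - t = of_int m * pi" using sin_zero_iff_int2 by blast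
   hence "2 * t - \<xi> = \<xi> + 2 * pi * of_int (- m)" by (simp add: algebra_simps)
   hence "h (2 * t - \<xi>) = h \<xi>" using trig_periodic[OF h] by metis
   thus ?thesis by simp
  qed
  have "I (\<lambda>\<xi>. Dline t g \<xi> * (h \<xi> - h (2 * t - \<xi>)))
   = I (\<lambda>\<xi>. (-1) * (Dline t g \<xi> * (h \<xi> - h (2 * t - \<xi>))))"
   using I_reflect[OF tc r[of t] finite_freq(1)] unfolding anti by simp
  also have "\<dots> = - I (\<lambda>\<xi>. Dline t g \<xi> * (h \<xi> - h (2 * t - \<xi>)))"
   using I_cmult[OF r[of t] finite_freq(1), of "-1"] by simp
  finally show ?thesis by simp
 qed
 have "I (\<lambda>\<xi>. \<Sum>p\<leftarrow>ts. ?r p \<xi>) = (\<Sum>p\<leftarrow>ts. I (?r p))"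
  by (rule I_sum_list[OF finite_freq(1)]) (rule trig_cmult[OF r])
 also have "\<dots> = (\<Sum>p\<leftarrow>ts. 0)"
  by (intro arg_cong[where f=sum_list] map_cong refl) (use I_cmult[OF r finite_freq(1)] r0 in auto)
 also have "\<dots> = 0" by (induction ts) auto
 finally have R0: "I (\<lambda>\<xi>. \<Sum>p\<leftarrow>ts. ?r p \<xi>) = 0" .
 have "I (\<lambda>\<xi>. Dop ts g \<xi> * h \<xi>) + I (\<lambda>\<xi>. g \<xi> * Dop ts h \<xi>) = I (\<lambda>\<xi>. Dop ts g \<xi> * h \<xi> + g \<xi> * Dop ts h \<xi>)"
  by (rule I_add[symmetric, OF trig_freq_mult[OF Dop_trig[OF g] h] trig_freq_mult[OF g Dop_trig[OF h]]]) auto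
 also have "\<dots> = I (Dop ts (\<lambda>\<xi>. g \<xi> * h \<xi>)) + I (\<lambda>\<xi>. \<Sum>p\<leftarrow>ts. ?r p \<xi>)"
  unfolding pw by (rule I_add[OF Dop_trig[OF gh] trig_sum_list[OF trig_cmult[OF r]]]) auto
 also have "\<dots> = 0" unfolding R0 I_Dop_trig[OF gh finite_freq(1)] by simp
 finally show ?thesis by (simp add: add_eq_0_iff)
qed

lemma Mop_symmetric:
 assumes g: "g \<in> trig (freq i)" and h: "h \<in> trig (freq j)"
 shows "I (\<lambda>\<xi>. Mop ts g \<xi> * h \<xi>) = I (\<lambda>\<xi>. g \<xi> * Mop ts h \<xi>)"
proof -
 have rg: "(\<lambda>\<xi>. g (2 * t - \<xi>)) \<in> trig (freq i)" and rh: "(\<lambda>\<xi>. h (2 * t - \<xi>)) \<in> trig (freq j)" for t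
  by (intro trig_reflect g h finite_freq freq_uminus; assumption)+
 note pr = trig_freq_mult[OF g h] trig_freq_mult[OF rg h] trig_freq_mult[OF g rh]
 have 1: "I (\<lambda>\<xi>. g (2 * t - \<xi>) * h \<xi>) = I (\<lambda>\<xi>. g \<xi> * h (2 * t - \<xi>))" if "(t, c) \<in> set ts" for t c
  using I_reflect[OF that pr(3)[of t]] by simp
 have "I (\<lambda>\<xi>. \<Sum>p\<leftarrow>ts. of_real (snd p) * (g \<xi> * h \<xi> - g (2 * fst p - \<xi>) * h \<xi>))
  = (\<Sum>p\<leftarrow>ts. I (\<lambda>\<xi>. of_real (snd p) * (g \<xi> * h \<xi> - g (2 * fst p - \<xi>) * h \<xi>)))"
  by (rule I_sum_list[OF finite_freq(1)]) (rule trig_cmult[OF trig_diff[OF pr(1) pr(2)]])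
 also have "\<dots> = (\<Sum>p\<leftarrow>ts. I (\<lambda>\<xi>. of_real (snd p) * (g \<xi> * h \<xi> - g \<xi> * h (2 * fst p - \<xi>))))"
 proof (intro arg_cong[where f=sum_list] map_cong refl)
  fix p assume "p \<in> set ts"
  hence "I (\<lambda>\<xi>. g (2 * fst p - \<xi>) * h \<xi>) = I (\<lambda>\<xi>. g \<xi> * h (2 * fst p - \<xi>))" using 1[of "fst p" "snd p"] by simp
  thus "I (\<lambda>\<xi>. of_real (snd p) * (g \<xi> * h \<xi> - g (2 * fst p - \<xi>) * h \<xi>)) = I (\<lambda>\<xi>. of_real (snd p) * (g \<xi> * h \<xi> - g \<xi> * h (2 * fst p - \<xi>)))"
   unfolding I_cmult[OF trig_diff[OF pr(1) pr(2)] finite_freq(1)] I_cmult[OF trig_diff[OF pr(1) pr(3)] finite_freq(1)]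
    I_diff[OF pr(1) pr(2) finite_freq(1) finite_freq(1)] I_diff[OF pr(1) pr(3) finite_freq(1) finite_freq(1)] by simp
 qed
 also have "\<dots> = I (\<lambda>\<xi>. \<Sum>p\<leftarrow>ts. of_real (snd p) * (g \<xi> * h \<xi> - g \<xi> * h (2 * fst p - \<xi>)))"
  by (rule I_sum_list[symmetric, OF finite_freq(1)]) (rule trig_cmult[OF trig_diff[OF pr(1) pr(3)]])
 finally show ?thesis
  unfolding Mop_def by (simp add: case_prod_beta' sum_list_mult_const[symmetric] sum_list_const_mult[symmetric] algebra_simps)
qed

lemma Lop_symmetric:
 assumes g: "g \<in> trig (freq i)" and h: "h \<in> trig (freq j)"
 shows "I (\<lambda>\<xi>. Lop ts g \<xi> * h \<xi>) = I (\<lambda>\<xi>. g \<xi> * Lop ts h \<xi>)"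
proof -
 have M: "Mop ts q \<in> trig (freq n)" if "q \<in> trig (freq n)" for q n
  using that by (intro Mop_trig freq_uminus finite_freq)
 let ?K = "complex_of_real (2 * Kop ts)"
 have "I (\<lambda>\<xi>. Lop ts g \<xi> * h \<xi>) = I (\<lambda>\<xi>. (?K * (Mop ts g \<xi> * h \<xi>) - Mop ts (Mop ts g) \<xi> * h \<xi>) + Dop ts (Dop ts g) \<xi> * h \<xi>)"
  by (simp add: Lop_def algebra_simps)
 also have "\<dots> = ?K * I (\<lambda>\<xi>. Mop ts g \<xi> * h \<xi>) - I (\<lambda>\<xi>. Mop ts (Mop ts g) \<xi> * h \<xi>) + I (\<lambda>\<xi>. Dop ts (Dop ts g) \<xi> * h \<xi>)"
  using trig_freq_mult[OF M[OF g] h] trig_freq_mult[OF M[OF M[OF g]] h] trig_freq_mult[OF Dop_trig[OF Dop_trig[OF g]] h]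
  by (subst I_add[where S="freq (i + j)" and T="freq (i + j)"], (auto intro!: trig_diff trig_cmult)[4])
   (subst I_diff[where S="freq (i + j)" and T="freq (i + j)"], (auto intro!: trig_cmult)[4], subst I_cmult[where S="freq (i + j)"], auto)
 also have "\<dots> = ?K * I (\<lambda>\<xi>. g \<xi> * Mop ts h \<xi>) - I (\<lambda>\<xi>. g \<xi> * Mop ts (Mop ts h) \<xi>) + I (\<lambda>\<xi>. g \<xi> * Dop ts (Dop ts h) \<xi>)"
  unfolding Mop_symmetric[OF g h] Mop_symmetric[OF M[OF g] h] Mop_symmetric[OF g M[OF h]]
   Dop_skew[OF Dop_trig[OF g] h] Dop_skew[OF g Dop_trig[OF h]] by simp
 also have "\<dots> = I (\<lambda>\<xi>. (?K * (g \<xi> * Mop ts h \<xi>) - g \<xi> * Mop ts (Mop ts h) \<xi>) + g \<xi> * Dop ts (Dop ts h) \<xi>)"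
  using trig_freq_mult[OF g M[OF h]] trig_freq_mult[OF g M[OF M[OF h]]] trig_freq_mult[OF g Dop_trig[OF Dop_trig[OF h]]]
  by (subst I_add[where S="freq (i + j)" and T="freq (i + j)"], (auto intro!: trig_diff trig_cmult)[4])
   (subst I_diff[where S="freq (i + j)" and T="freq (i + j)"], (auto intro!: trig_cmult)[4], subst I_cmult[where S="freq (i + j)"], auto)
 also have "\<dots> = I (\<lambda>\<xi>. g \<xi> * Lop ts h \<xi>)"
  by (simp add: Lop_def algebra_simps)
 finally show ?thesis .
qed

text \<open>Let P = Lop + j (j + 2K), which is symmetric for the pairing. If P g = 0, any lower
  \<open>p\<close> is of the form P h and I (g p) = I (P g h) = 0. Conversely P g has lost its
  extreme frequencies, so orthogonality of \<open>g\<close> to the lower ones makes P g orthogonal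
  to itself.\<close>

lemma eigenfunction_iff_orthogonal:
 assumes g: "g \<in> trig (freq j)"
 shows "(\<forall>\<xi>. Lop ts g \<xi> + of_real (real j * (real j + 2 * Kop ts)) * g \<xi> = 0)
  \<longleftrightarrow> (\<forall>p\<in>trig (freq_less j). I (\<lambda>\<xi>. g \<xi> * p \<xi>) = 0)"
proof -
 let ?\<mu> = "real j * (real j + 2 * Kop ts)"
 define P where "P h = (\<lambda>\<xi>. Lop ts h \<xi> + of_real ?\<mu> * h \<xi>)" for h
 have P: "P h \<in> trig (freq n)" if "h \<in> trig (freq n)" for h n
  unfolding P_def by (intro trig_add trig_cmult Lop_trig that)
 have sym: "I (\<lambda>\<xi>. P g \<xi> * h \<xi>) = I (\<lambda>\<xi>. g \<xi> * P h \<xi>)" if h: "h \<in> trig (freq n)" for h n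
 proof -
  note q = trig_freq_mult[OF Lop_trig[OF g] h] trig_freq_mult[OF g h] trig_freq_mult[OF g Lop_trig[OF h]]
  have "I (\<lambda>\<xi>. P g \<xi> * h \<xi>) = I (\<lambda>\<xi>. of_real ?\<mu> * (g \<xi> * h \<xi>) + Lop ts g \<xi> * h \<xi>)"
   by (simp add: P_def algebra_simps)
  also have "\<dots> = I (\<lambda>\<xi>. of_real ?\<mu> * (g \<xi> * h \<xi>) + g \<xi> * Lop ts h \<xi>)"
   unfolding I_linear[OF q(2) q(1) finite_freq(1) finite_freq(1)] I_linear[OF q(2) q(3) finite_freq(1) finite_freq(1)] Lop_symmetric[OF g h] ..
  finally show ?thesis by (simp add: P_def algebra_simps)
 qed
 show ?thesis
 proof
  assume e: "\<forall>\<xi>. Lop ts g \<xi> + of_real ?\<mu> * g \<xi> = 0"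
  show "\<forall>p\<in>trig (freq_less j). I (\<lambda>\<xi>. g \<xi> * p \<xi>) = 0"
  proof
   fix p assume p: "p \<in> trig (freq_less j)"
   show "I (\<lambda>\<xi>. g \<xi> * p \<xi>) = 0"
   proof (cases "j < 2")
    case True
    hence "p = (\<lambda>_. 0)" using p by (simp add: freq_less_eq trig_def)
    thus ?thesis by (simp add: I_0)
   next
    case False
    hence p': "p \<in> trig (freq (j - 2))" using p by (simp add: freq_less_eq)
    \<comment> \<open>As K is nonnegative, i (i + 2K) increases strictly with i, so P is invertible
      on the lower frequencies.\<close>
    have ev: "?\<mu> \<noteq> real i * (real i + 2 * Kop ts)" if "i \<le> j - 2" for i
    proof -
     have "real i < real j" using that False by simp
     moreover have "real i + 2 * Kop ts < real j + 2 * Kop ts" "real i + 2 * Kop ts \<ge> 0" using calculation Kop_nonneg by auto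
     ultimately have "real i * (real i + 2 * Kop ts) < real j * (real j + 2 * Kop ts)"
      by (intro mult_strict_mono') auto
     thus ?thesis by simp
    qed
    obtain h where h: "h \<in> trig (freq (j - 2))" "P h = p"
     using Lop_solvable[OF line_sum_sym ev p'] unfolding P_def by blast
    have "I (\<lambda>\<xi>. g \<xi> * p \<xi>) = I (\<lambda>\<xi>. P g \<xi> * h \<xi>)" using sym[OF h(1)] h(2) by simp
    also have "\<dots> = I (\<lambda>_. 0)" using e by (simp add: P_def)
    finally show ?thesis by (simp add: I_0)
   qed
  qed
 next
  assume o: "\<forall>p\<in>trig (freq_less j). I (\<lambda>\<xi>. g \<xi> * p \<xi>) = 0"
  obtain a b g0 where g0: "g0 \<in> trig (freq_less j)" and gs: "g = (\<lambda>\<xi>. a * Etrig (int j) \<xi> + (b * Etrig (- int j) \<xi> + g0 \<xi>))"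
   using trig_freq_split[OF g] by blast
  have En: "Etrig (int j) \<in> trig (freq j)" "Etrig (- int j) \<in> trig (freq j)"
   by (rule trig_Etrig; (rule finite_freq | simp add: freq_def))+
  have g0': "g0 \<in> trig (freq j)" using trig_mono[OF freq_less_subset finite_freq(1) g0] .
  have L: "P (Etrig (int j)) \<in> trig (freq_less j)" "P (Etrig (- int j)) \<in> trig (freq_less j)"
   unfolding P_def by (rule Lop_Etrig_leading[OF line_sum_sym]; simp)+
  have L0: "P g0 \<in> trig (freq_less j)"
  proof (cases "j < 2")
   case True
   hence "g0 = (\<lambda>_. 0)" using g0 by (simp add: freq_less_eq trig_def)
   moreover have "Lop ts (\<lambda>_. 0) \<xi> = 0" for \<xi>
    using Lop_linear[OF trig_0[of "freq 0"] trig_0, of ts 1 \<xi>] by simp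
   ultimately show ?thesis by (simp add: P_def trig_0)
  next
   case False thus ?thesis using P g0 by (simp add: freq_less_eq)
  qed
  have "P g = (\<lambda>\<xi>. a * P (Etrig (int j)) \<xi> + (b * P (Etrig (- int j)) \<xi> + P g0 \<xi>))"
   unfolding gs P_def Lop_linear[OF En(1) trig_add[OF trig_cmult[OF En(2)] g0']] Lop_linear[OF En(2) g0']
   by (simp add: algebra_simps)
  also have "\<dots> \<in> trig (freq_less j)"
   by (rule trig_add[OF trig_cmult[OF L(1)] trig_add[OF trig_cmult[OF L(2)] L0]])
  finally have Pg: "P g \<in> trig (freq_less j)" .
  have cP: "(\<lambda>\<xi>. cnj (P g \<xi>)) \<in> trig (freq_less j)"
   by (rule trig_cnj[OF Pg]) (auto simp: freq_uminus)
  have "P g = (\<lambda>_. 0)"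
  proof (rule I_pos[OF Pg finite_freq(2)])
   show "I (\<lambda>\<xi>. P g \<xi> * cnj (P g \<xi>)) = 0"
   proof (cases "j < 2")
    case True
    hence "P g = (\<lambda>_. 0)" using Pg by (simp add: freq_less_eq trig_def)
    thus ?thesis by (simp add: I_0)
   next
    case False
    hence "(\<lambda>\<xi>. cnj (P g \<xi>)) \<in> trig (freq (j - 2))" using cP by (simp add: freq_less_eq)
    from sym[OF this] P[OF this] o False show ?thesis by (simp add: freq_less_eq)
   qed
  qed
  thus "\<forall>\<xi>. Lop ts g \<xi> + of_real ?\<mu> * g \<xi> = 0" unfolding P_def by meson
 qed
qed

text \<open>The Laplacian is computed at regular points only; its angular factor is a trigonometric
  polynomial, so vanishing there extends to all angles by continuity.\<close>

theorem harm_iff: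
 "f \<in> harm (line_roots ts) j \<longleftrightarrow> homog_poly j f \<and> (\<forall>p\<in>trig (freq_less j). I (\<lambda>\<xi>. f (cis \<xi>) * p \<xi>) = 0)"
proof (cases "homog_poly j f")
 case False thus ?thesis by (simp add: harm_def)
next
 case True
 define g where "g = (\<lambda>\<xi>. f (cis \<xi>))"
 have g: "g \<in> trig (freq j)" unfolding g_def by (rule homog_poly_polar[OF True])
 have fp: "f (of_real \<rho> * cis \<tau>) = of_real (\<rho> powr real j) * g \<tau>" if "\<rho> > 0" for \<rho> \<tau>
  using homog_poly_polar(2)[OF True] that by (simp add: g_def powr_realpow)
 have reg0: "regular_pt (line_roots ts) (of_real r * cis \<xi>) \<longleftrightarrow> r \<noteq> 0 \<and> regular_angle ts \<xi>" for r \<xi>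
 proof -
  have "regular_pt (line_roots ts) (of_real r * cis \<xi>) \<longleftrightarrow> (\<forall>p\<in>set ts. r * sin (\<xi> - fst p) \<noteq> 0)"
   unfolding regular_pt_def line_roots_def set_map by (simp only: ball_simps case_prod_beta fst_conv rinner_line)
  also have "\<dots> \<longleftrightarrow> r \<noteq> 0 \<and> (\<forall>p\<in>set ts. sin (\<xi> - fst p) \<noteq> 0)"
   using ts_nonempty by (cases ts) auto
  finally show ?thesis by (simp add: regular_angle_def case_prod_unfold)
 qed
 have lap: "dunkl_lap (line_roots ts) f (of_real r * cis \<xi>)
  = of_real (r powr (real j - 2)) * (Lop ts g \<xi> + of_real (real j * (real j + 2 * Kop ts)) * g \<xi>)"
  if "r > 0" "regular_angle ts \<xi>" for r \<xi>
  using dunkl_lap_polar[OF that reflect_regular fp trig_differentiable[OF g] trig_differentiable[OF Dop_trig[OF g]]]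
  by (simp add: Lop_def Kop_def algebra_simps)
 have "(\<forall>x. regular_pt (line_roots ts) x \<longrightarrow> dunkl_lap (line_roots ts) f x = 0)
  \<longleftrightarrow> (\<forall>\<xi>. Lop ts g \<xi> + of_real (real j * (real j + 2 * Kop ts)) * g \<xi> = 0)"
 proof
  assume h: "\<forall>x. regular_pt (line_roots ts) x \<longrightarrow> dunkl_lap (line_roots ts) f x = 0"
  have "(\<lambda>\<xi>. Lop ts g \<xi> + of_real (real j * (real j + 2 * Kop ts)) * g \<xi>) = (\<lambda>_. 0)"
  proof (rule trig_eq_0_if_regular)
   show "(\<lambda>\<xi>. Lop ts g \<xi> + of_real (real j * (real j + 2 * Kop ts)) * g \<xi>) \<in> trig (freq j)"
    by (intro trig_add trig_cmult Lop_trig g)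
   fix \<xi> assume r: "regular_angle ts \<xi>"
   show "Lop ts g \<xi> + of_real (real j * (real j + 2 * Kop ts)) * g \<xi> = 0"
    using h[rule_format, of "of_real 1 * cis \<xi>"] r lap[of 1 \<xi>] reg0[of 1 \<xi>] by simp
  qed
  thus "\<forall>\<xi>. Lop ts g \<xi> + of_real (real j * (real j + 2 * Kop ts)) * g \<xi> = 0" by meson
 next
  assume h: "\<forall>\<xi>. Lop ts g \<xi> + of_real (real j * (real j + 2 * Kop ts)) * g \<xi> = 0"
  show "\<forall>x. regular_pt (line_roots ts) x \<longrightarrow> dunkl_lap (line_roots ts) f x = 0"
  proof (intro allI impI)
   fix x assume x: "regular_pt (line_roots ts) x"
   have xp: "x = of_real (norm x) * cis (Arg x)" by (simp add: rcis_cmod_Arg flip: rcis_def)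
   have "norm x \<noteq> 0" "regular_angle ts (Arg x)" using x reg0[of "norm x" "Arg x"] xp by auto
   thus "dunkl_lap (line_roots ts) f x = 0" using lap[of "norm x" "Arg x"] xp h by simp
  qed
 qed
 thus ?thesis using True eigenfunction_iff_orthogonal[OF g] by (simp add: harm_def g_def)
qed

end

subsection \<open>Integrals over a period\<close>

lemma antiderivative_UNIV:
 fixes f :: "real \<Rightarrow> complex"
 assumes "continuous_on UNIV f"
 obtains G where "\<And>x. (G has_vector_derivative f x) (at x)"
proof
 fix x :: real
 define a where "a = min 0 x - 1"
 define b where "b = max 0 x + 1"
 have "((\<lambda>u. LBINT y=0..u. f y) has_vector_derivative (f x)) (at x within {a..b})"
  unfolding zero_ereal_def
  by (rule interval_integral_FTC2) (auto simp: a_def b_def intro: continuous_on_subset[OF assms])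
 moreover have "at x within {a..b} = at x" by (rule at_within_Icc_at) (auto simp: a_def b_def)
 ultimately show "((\<lambda>u. LBINT y=0..u. f y) has_vector_derivative (f x)) (at x)" by simp
qed

text \<open>The increment of a primitive over one period is the same everywhere. Shifting,
  reflecting and scaling the argument of a periodic integrand then amount to evaluating this
  increment.\<close>

lemma periodic_antiderivative:
 fixes f :: "real \<Rightarrow> complex"
 assumes cont: "continuous_on UNIV f" and per: "\<And>x. f (x + p) = f x"
 obtains G c where "\<And>x. (G has_vector_derivative f x) (at x)" "\<And>x. G (x + p) - G x = c"
proof -
 obtain G where G: "\<And>x. (G has_vector_derivative f x) (at x)" using antiderivative_UNIV[OF cont] by blast
 have "((\<lambda>x. G (x + p) - G x) has_vector_derivative (f (x + p) - f x)) (at x)" for x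
 proof (intro has_vector_derivative_diff G)
  have "((\<lambda>x. x + p) has_vector_derivative 1) (at x)" by (auto intro!: derivative_eq_intros)
  from vector_diff_chain_at[OF this G] show "((\<lambda>x. G (x + p)) has_vector_derivative f (x + p)) (at x)"
   by (simp add: o_def)
 qed
 hence d: "((\<lambda>x. G (x + p) - G x) has_vector_derivative 0) (at x within UNIV)" for x
  unfolding per by simp
 obtain c where "\<And>x. x \<in> UNIV \<Longrightarrow> G (x + p) - G x = c"
  using has_vector_derivative_zero_constant[OF convex_UNIV d] by metis
 thus ?thesis by (intro that[OF G]) simp
qed

lemma has_integral_affine:
 fixes f :: "real \<Rightarrow> complex"
 assumes G: "\<And>x. (G has_vector_derivative f x) (at x)" and p: "p > 0"
 shows "((\<lambda>x. s *\<^sub>R f (s * x + a)) has_integral (G (s * p + a) - G a)) {0..p}"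
proof -
 have "((\<lambda>x. G (s * x + a)) has_vector_derivative (s *\<^sub>R f (s * x + a))) (at x within {0..p})" for x
 proof (rule has_vector_derivative_at_within)
  have "((\<lambda>x. s * x + a) has_vector_derivative s) (at x)" by (auto intro!: derivative_eq_intros)
  from vector_diff_chain_at[OF this G]
  show "((\<lambda>x. G (s * x + a)) has_vector_derivative (s *\<^sub>R f (s * x + a))) (at x)"
   by (simp add: o_def)
 qed
 from fundamental_theorem_of_calculus[OF _ this] p show ?thesis by simp
qed

lemma periodic_integral_shift:
 fixes f :: "real \<Rightarrow> complex"
 assumes cont: "continuous_on UNIV f" and per: "\<And>x. f (x + p) = f x" and p: "p > 0"
 shows "integral {0..p} (\<lambda>x. f (x + a)) = integral {0..p} f"
proof -
 obtain G c where G: "\<And>x. (G has_vector_derivative f x) (at x)" and c: "\<And>x. G (x + p) - G x = c"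
  using periodic_antiderivative[OF cont per] by blast
 have "((\<lambda>x. f (x + b)) has_integral c) {0..p}" for b
 proof -
  have e: "1 * p + b = b + p" by simp
  show ?thesis using has_integral_affine[OF G p, of 1 b] unfolding e c by simp
 qed
 from this[of a] this[of 0] show ?thesis by (simp add: has_integral_iff)
qed

lemma periodic_integral_reflect:
 fixes f :: "real \<Rightarrow> complex"
 assumes cont: "continuous_on UNIV f" and per: "\<And>x. f (x + p) = f x" and p: "p > 0"
 shows "integral {0..p} (\<lambda>x. f (a - x)) = integral {0..p} f"
proof -
 obtain G c where G: "\<And>x. (G has_vector_derivative f x) (at x)" and c: "\<And>x. G (x + p) - G x = c"
  using periodic_antiderivative[OF cont per] by blast
 have e: "(-1) * p + a = a - p" by simp
 have "G a - G (a - p) = c" using c[of "a - p"] by simp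
 hence d: "G (a - p) - G a = - c" by (simp add: algebra_simps)
 have m: "(-1) *\<^sub>R f ((-1) * x + a) = - f (a - x)" for x by simp
 have "((\<lambda>x. - f (a - x)) has_integral - c) {0..p}"
  using has_integral_affine[OF G p, of "-1" a] unfolding e d m .
 from has_integral_neg[OF this] have 1: "((\<lambda>x. f (a - x)) has_integral c) {0..p}" by (simp only: minus_minus)
 have "((\<lambda>x. f x) has_integral c) {0..p}"
 proof -
  have e: "1 * p + 0 = 0 + p" by simp
  show ?thesis using has_integral_affine[OF G p, of 1 0] unfolding e c by simp
 qed
 with 1 show ?thesis by (simp add: has_integral_iff)
qed

lemma periodic_integral_scale:
 fixes f :: "real \<Rightarrow> complex"
 assumes cont: "continuous_on UNIV f" and per: "\<And>x. f (x + p) = f x" and p: "p > 0" and k: "k > 0"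
 shows "integral {0..p} (\<lambda>x. f (real k * x)) = integral {0..p} f"
proof -
 obtain G c where G: "\<And>x. (G has_vector_derivative f x) (at x)" and c: "\<And>x. G (x + p) - G x = c"
  using periodic_antiderivative[OF cont per] by blast
 have s: "G (real n * p + 0) - G 0 = real n *\<^sub>R c" for n
 proof (induction n)
  case (Suc n)
  have e: "real (Suc n) * p + 0 = (real n * p + 0) + p" by (simp add: distrib_right)
  have "G (real (Suc n) * p + 0) - G 0 = (G ((real n * p + 0) + p) - G (real n * p + 0)) + (G (real n * p + 0) - G 0)"
   unfolding e by simp
  also have "\<dots> = real (Suc n) *\<^sub>R c" unfolding c Suc by (simp add: scaleR_left.add)
  finally show ?case .
 qed simp
 have i: "((\<lambda>x. real n *\<^sub>R f (real n * x + 0)) has_integral (real n *\<^sub>R c)) {0..p}" for n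
  using has_integral_affine[OF G p, of "real n" 0] unfolding s .
 have 1: "((\<lambda>x. f x) has_integral c) {0..p}" using i[of 1] by simp
 have "((\<lambda>x. inverse (real k) *\<^sub>R (real k *\<^sub>R f (real k * x + 0))) has_integral (inverse (real k) *\<^sub>R (real k *\<^sub>R c))) {0..p}"
  by (rule has_integral_cmul[OF i])
 hence "((\<lambda>x. f (real k * x)) has_integral c) {0..p}" using k by simp
 with 1 show ?thesis by (simp add: has_integral_iff)
qed

subsection \<open>The dihedral weight\<close>

text \<open>The separate case \<gamma> = 0 keeps the factor continuous, since
  \<open>0 powr 0\<close> is 0.\<close>

definition wfac :: "real \<Rightarrow> real \<Rightarrow> real" where
 "wfac \<gamma> x = (if \<gamma> = 0 then 1 else \<bar>x\<bar> powr (2 * \<gamma>))"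

definition wt :: "nat \<Rightarrow> real \<Rightarrow> real \<Rightarrow> real \<Rightarrow> real" where
 "wt k \<alpha> \<beta> \<xi> = wfac \<alpha> (sin (real k * \<xi>)) * wfac \<beta> (cos (real k * \<xi>))"

lemma wfac_nonneg: "wfac \<gamma> x \<ge> 0" by (simp add: wfac_def)

lemma wfac_minus: "wfac \<gamma> (- x) = wfac \<gamma> x" by (simp add: wfac_def)

lemma wfac_eq_0: "wfac \<gamma> x = 0 \<Longrightarrow> x = 0" by (simp add: wfac_def split: if_splits)

lemma continuous_wfac: "\<gamma> \<ge> 0 \<Longrightarrow> continuous_on A (wfac \<gamma>)"
proof (cases "\<gamma> = 0")
 case False
 assume "\<gamma> \<ge> 0"
 hence "continuous_on A (\<lambda>x. \<bar>x\<bar> powr (2 * \<gamma>))"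
  using False by (intro continuous_on_powr' continuous_intros) auto
 thus ?thesis using False by (simp add: wfac_def[abs_def])
qed (simp add: wfac_def[abs_def])

lemma wfac_square: "x \<noteq> 0 \<Longrightarrow> wfac \<gamma> x = (x\<^sup>2) powr \<gamma>"
 using powr_powr[of "\<bar>x\<bar>" 2 \<gamma>] by (simp add: wfac_def)

lemma DERIV_wfac:
 assumes "x \<noteq> 0" shows "(wfac \<gamma> has_real_derivative (2 * \<gamma> / x * wfac \<gamma> x)) (at x)"
proof -
 have "((\<lambda>x. (x\<^sup>2) powr \<gamma>) has_real_derivative (\<gamma> * (x\<^sup>2) powr (\<gamma> - 1) * (2 * x))) (at x)"
  using assms by (auto intro!: derivative_eq_intros)
 also have "\<gamma> * (x\<^sup>2) powr (\<gamma> - 1) * (2 * x) = 2 * \<gamma> / x * wfac \<gamma> x"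
  using assms by (simp add: powr_diff wfac_square power2_eq_square)
 finally show ?thesis
  by (rule has_field_derivative_transform_within_open[of _ _ _ "-{0}"]) (use assms in \<open>auto simp: wfac_square\<close>)
qed

lemma wt_nonneg: "wt k \<alpha> \<beta> \<xi> \<ge> 0" by (simp add: wt_def wfac_nonneg)

lemma continuous_wt: "\<alpha> \<ge> 0 \<Longrightarrow> \<beta> \<ge> 0 \<Longrightarrow> continuous_on A (wt k \<alpha> \<beta>)"
 unfolding wt_def[abs_def]
 by (intro continuous_intros continuous_on_compose2[OF continuous_wfac[of _ UNIV]]) auto

lemma wt_shift: fixes n :: int shows "k > 0 \<Longrightarrow> wt k \<alpha> \<beta> (\<xi> + pi * of_int n / real k) = wt k \<alpha> \<beta> \<xi>"
proof -
 assume k: "k > 0"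
 have e: "real k * (\<xi> + pi * of_int n / real k) = real k * \<xi> + of_int n * pi" using k by (simp add: field_simps)
 have s: "sin (of_int n * pi) = 0" unfolding sin_zero_iff_int2 by blast
 hence "(cos (of_int n * pi))\<^sup>2 = 1" using sin_cos_squared_add[of "of_int n * pi"] by simp
 hence "cos (of_int n * pi) = 1 \<or> cos (of_int n * pi) = -1" by (simp add: power2_eq_1_iff)
 thus ?thesis unfolding wt_def e sin_add cos_add s by (auto simp: wfac_minus)
qed

lemma wt_uminus: "wt k \<alpha> \<beta> (-\<xi>) = wt k \<alpha> \<beta> \<xi>"
 by (simp add: wt_def wfac_minus)

lemma wt_periodic: "k > 0 \<Longrightarrow> wt k \<alpha> \<beta> (\<xi> + 2 * pi) = wt k \<alpha> \<beta> \<xi>"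
 using wt_shift[of k \<alpha> \<beta> \<xi> "2 * int k"] by (simp add: mult.commute)

definition wint :: "nat \<Rightarrow> real \<Rightarrow> real \<Rightarrow> (real \<Rightarrow> complex) \<Rightarrow> complex" where
 "wint k \<alpha> \<beta> g = integral {0..2 * pi} (\<lambda>\<xi>. of_real (wt k \<alpha> \<beta> \<xi>) * g \<xi>)"

lemma finite_zeros_sin_cos:
 assumes "k > 0" shows "finite {\<xi>\<in>{0..2 * pi}. sin (real k * \<xi>) = 0 \<or> cos (real k * \<xi>) = 0}"
proof (rule finite_subset)
 let ?N = "\<lambda>n::int. of_int n * pi / (2 * real k)"
 show "{\<xi>\<in>{0..2 * pi}. sin (real k * \<xi>) = 0 \<or> cos (real k * \<xi>) = 0} \<subseteq> ?N ` {0..4 * int k}"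
 proof
  fix \<xi> assume t: "\<xi> \<in> {\<xi>\<in>{0..2 * pi}. sin (real k * \<xi>) = 0 \<or> cos (real k * \<xi>) = 0}"
  hence "sin (2 * (real k * \<xi>)) = 0" unfolding sin_double by auto
  then obtain n :: int where n: "2 * (real k * \<xi>) = of_int n * pi" using sin_zero_iff_int2 by blast
  hence th: "\<xi> = ?N n" using assms by (simp add: field_simps)
  have "0 \<le> of_int n * pi" "of_int n * pi \<le> (4 * real k) * pi"
   using t assms unfolding n[symmetric] by auto
  hence "0 \<le> real_of_int n" "real_of_int n \<le> 4 * real k"
   using pi_gt_zero by (simp_all add: zero_le_mult_iff mult_le_cancel_right)
  hence "0 \<le> n" "n \<le> 4 * int k" by linarith+
  hence "n \<in> {0..4 * int k}" by simp
  thus "\<xi> \<in> ?N ` {0..4 * int k}" using th by blast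
 qed
qed simp

lemma DERIV_wt:
 assumes "sin (real k * \<xi>) \<noteq> 0" "cos (real k * \<xi>) \<noteq> 0"
 shows "(wt k \<alpha> \<beta> has_real_derivative
  (2 * real k * (\<alpha> * cot (real k * \<xi>) - \<beta> * tan (real k * \<xi>)) * wt k \<alpha> \<beta> \<xi>)) (at \<xi>)"
proof -
 have s: "((\<lambda>\<xi>. wfac \<alpha> (sin (real k * \<xi>))) has_real_derivative
  (2 * \<alpha> / sin (real k * \<xi>) * wfac \<alpha> (sin (real k * \<xi>)) * (cos (real k * \<xi>) * real k))) (at \<xi>)"
  by (rule DERIV_chain2[where f="wfac \<alpha>" and g="\<lambda>\<xi>. sin (real k * \<xi>)", OF DERIV_wfac[OF assms(1)]]) (auto intro!: derivative_eq_intros)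
 have c: "((\<lambda>\<xi>. wfac \<beta> (cos (real k * \<xi>))) has_real_derivative
  (2 * \<beta> / cos (real k * \<xi>) * wfac \<beta> (cos (real k * \<xi>)) * (- sin (real k * \<xi>) * real k))) (at \<xi>)"
  by (rule DERIV_chain2[where f="wfac \<beta>" and g="\<lambda>\<xi>. cos (real k * \<xi>)", OF DERIV_wfac[OF assms(2)]]) (auto intro!: derivative_eq_intros)
 show ?thesis unfolding wt_def[abs_def]
  by (rule DERIV_cong[OF DERIV_mult[OF s c]]) (simp add: cot_def tan_def algebra_simps)
qed

text \<open>Integration by parts against the weight, whose logarithmic derivative is 2k (\<alpha>
  cot - \<beta> tan). It is singular at finitely many angles only, and the product of weight and
  \<open>H\<close> is continuous there, so the fundamental theorem still applies.\<close>

lemma wint_FTC: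
 fixes H H' :: "real \<Rightarrow> complex"
 assumes k: "k > 0" and ab: "\<alpha> \<ge> 0" "\<beta> \<ge> 0"
  and H: "\<And>\<xi>. (H has_vector_derivative H' \<xi>) (at \<xi>)" and per: "H (2 * pi) = H 0"
 shows "((\<lambda>\<xi>. of_real (wt k \<alpha> \<beta> \<xi>) * (H' \<xi> + of_real (2 * real k * (\<alpha> * cot (real k * \<xi>) - \<beta> * tan (real k * \<xi>))) * H \<xi>))
  has_integral 0) {0..2 * pi}"
proof -
 let ?S = "{\<xi>\<in>{0..2 * pi}. sin (real k * \<xi>) = 0 \<or> cos (real k * \<xi>) = 0}"
 let ?G = "\<lambda>\<xi>. wt k \<alpha> \<beta> \<xi> *\<^sub>R H \<xi>"
 have "((\<lambda>\<xi>. of_real (wt k \<alpha> \<beta> \<xi>) * (H' \<xi> + of_real (2 * real k * (\<alpha> * cot (real k * \<xi>) - \<beta> * tan (real k * \<xi>))) * H \<xi>))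
  has_integral (?G (2 * pi) - ?G 0)) {0..2 * pi}"
 proof (rule fundamental_theorem_of_calculus_strong[OF finite_zeros_sin_cos[OF k]])
  fix \<xi> assume "\<xi> \<in> {0..2 * pi} - ?S"
  hence "sin (real k * \<xi>) \<noteq> 0" "cos (real k * \<xi>) \<noteq> 0" by auto
  from has_vector_derivative_scaleR[OF DERIV_wt[OF this, of \<alpha> \<beta>] H[of \<xi>]]
  show "(?G has_vector_derivative (of_real (wt k \<alpha> \<beta> \<xi>) * (H' \<xi> + of_real (2 * real k * (\<alpha> * cot (real k * \<xi>) - \<beta> * tan (real k * \<xi>))) * H \<xi>))) (at \<xi>)"
   by (rule has_vector_derivative_eq_rhs) (simp add: scaleR_conv_of_real algebra_simps)
 next
  show "continuous_on {0..2 * pi} ?G"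
   by (intro continuous_intros continuous_wt ab continuous_at_imp_continuous_on ballI
     has_vector_derivative_continuous[OF H])
 qed simp
 moreover have "wt k \<alpha> \<beta> (2 * pi) = wt k \<alpha> \<beta> 0" using wt_periodic[OF k, of \<alpha> \<beta> 0] by simp
 ultimately show ?thesis by (simp add: per)
qed

lemma wint_integrable:
 fixes g :: "real \<Rightarrow> complex"
 assumes "\<alpha> \<ge> 0" "\<beta> \<ge> 0" "continuous_on UNIV g"
 shows "(\<lambda>\<xi>. of_real (wt k \<alpha> \<beta> \<xi>) * g \<xi>) integrable_on {a..b}"
 by (intro integrable_continuous_interval continuous_intros continuous_wt assms continuous_on_subset[OF assms(3)]) auto

lemma wint_linear:
 assumes "\<alpha> \<ge> 0" "\<beta> \<ge> 0" "continuous_on UNIV g" "continuous_on UNIV h"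
 shows "wint k \<alpha> \<beta> (\<lambda>\<xi>. a * g \<xi> + h \<xi>) = a * wint k \<alpha> \<beta> g + wint k \<alpha> \<beta> h"
proof -
 note i = wint_integrable[OF assms(1,2,3), of k 0 "2 * pi"] wint_integrable[OF assms(1,2,4), of k 0 "2 * pi"]
 have "wint k \<alpha> \<beta> (\<lambda>\<xi>. a * g \<xi> + h \<xi>) = integral {0..2 * pi} (\<lambda>\<xi>. a * (of_real (wt k \<alpha> \<beta> \<xi>) * g \<xi>) + of_real (wt k \<alpha> \<beta> \<xi>) * h \<xi>)"
  by (simp add: wint_def algebra_simps)
 also have "\<dots> = a * wint k \<alpha> \<beta> g + wint k \<alpha> \<beta> h"
  unfolding wint_def using i by (subst integral_add) (auto intro: integrable_on_mult_right)
 finally show ?thesis .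
qed

lemma wint_reflect:
 assumes k: "k > 0" and ab: "\<alpha> \<ge> 0" "\<beta> \<ge> 0" and g: "continuous_on UNIV g" "\<And>\<xi>. g (\<xi> + 2 * pi) = g \<xi>"
 shows "wint k \<alpha> \<beta> (\<lambda>\<xi>. g (pi * of_int n / real k - \<xi>)) = wint k \<alpha> \<beta> g"
proof -
 let ?f = "\<lambda>\<xi>. of_real (wt k \<alpha> \<beta> \<xi>) * g \<xi>"
 have w: "wt k \<alpha> \<beta> (pi * of_int n / real k - \<xi>) = wt k \<alpha> \<beta> \<xi>" for \<xi>
  using wt_shift[OF k, of \<alpha> \<beta> "-\<xi>" n] by (simp add: wt_uminus)
 have "integral {0..2 * pi} (\<lambda>\<xi>. ?f (pi * of_int n / real k - \<xi>)) = integral {0..2 * pi} ?f"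
  by (rule periodic_integral_reflect) (auto intro!: continuous_intros continuous_wt ab g simp: wt_periodic[OF k])
 thus ?thesis by (simp add: wint_def w)
qed

lemma wint_shift:
 assumes k: "k > 0" and ab: "\<alpha> \<ge> 0" "\<beta> \<ge> 0" and g: "continuous_on UNIV g" "\<And>\<xi>. g (\<xi> + 2 * pi) = g \<xi>"
 shows "wint k \<alpha> \<beta> (\<lambda>\<xi>. g (\<xi> + pi * of_int n / real k)) = wint k \<alpha> \<beta> g"
proof -
 let ?f = "\<lambda>\<xi>. of_real (wt k \<alpha> \<beta> \<xi>) * g \<xi>"
 have "integral {0..2 * pi} (\<lambda>\<xi>. ?f (\<xi> + pi * of_int n / real k)) = integral {0..2 * pi} ?f"
  by (rule periodic_integral_shift) (auto intro!: continuous_intros continuous_wt ab g simp: wt_periodic[OF k])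
 thus ?thesis by (simp add: wint_def wt_shift[OF k])
qed

lemma wint_scale:
 assumes k: "k > 0" and ab: "\<alpha> \<ge> 0" "\<beta> \<ge> 0" and g: "continuous_on UNIV g" "\<And>\<xi>. g (\<xi> + 2 * pi) = g \<xi>"
 shows "wint k \<alpha> \<beta> (\<lambda>\<xi>. g (real k * \<xi>)) = wint 1 \<alpha> \<beta> g"
proof -
 let ?f = "\<lambda>\<xi>. of_real (wt 1 \<alpha> \<beta> \<xi>) * g \<xi>"
 have "integral {0..2 * pi} (\<lambda>\<xi>. ?f (real k * \<xi>)) = integral {0..2 * pi} ?f"
  by (rule periodic_integral_scale[OF _ _ _ k]) (auto intro!: continuous_intros continuous_wt ab g simp: wt_periodic)
 thus ?thesis by (simp add: wint_def wt_def)
qed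

lemma trig_periodic_2pi: "g \<in> trig S \<Longrightarrow> g (\<xi> + 2 * pi) = g \<xi>"
 using trig_periodic[of g S \<xi> 1] by simp

lemma trig_eq_0_if_sin:
 assumes k: "k > 0" and g: "g \<in> trig S" and z': "\<And>\<xi>. sin (2 * real k * \<xi>) = 0 \<or> g \<xi> = 0"
 shows "g = (\<lambda>_. 0)"
proof (rule ext)
  fix \<xi>
  have "continuous (at \<xi>) g" by (rule differentiable_imp_continuous_within[OF trig_differentiable[OF g]])
  hence 1: "(g \<longlongrightarrow> g \<xi>) (at \<xi>)" by (simp add: isCont_def)
  have lim: "((\<lambda>\<tau>. 2 * real k * \<tau>) \<longlongrightarrow> 2 * real k * \<xi>) (at \<xi>)" by (intro tendsto_intros)
  have "\<tau> \<noteq> \<xi> \<Longrightarrow> 2 * real k * \<tau> \<noteq> 2 * real k * \<xi>" for \<tau> using k by simp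
  hence "eventually (\<lambda>\<tau>. 2 * real k * \<tau> \<noteq> 2 * real k * \<xi>) (at \<xi>)"
   unfolding eventually_at_filter by (intro always_eventually allI impI)
  hence fl: "filterlim (\<lambda>\<tau>. 2 * real k * \<tau>) (at (2 * real k * \<xi>)) (at \<xi>)"
   by (rule filterlim_atI[OF lim])
  \<comment> \<open>Regularity for the single mirror at angle 0 says that the sine is nonzero, so
    the density of regular angles can be reused at the scaled argument.\<close>
  have "eventually (\<lambda>\<tau>. regular_angle [(0, 0)] (2 * real k * \<tau>)) (at \<xi>)"
   by (rule eventually_compose_filterlim[where P="regular_angle [(0, 0)]", OF eventually_regular_angle_at fl])
  hence "eventually (\<lambda>\<tau>. g \<tau> = 0) (at \<xi>)"
   by (rule eventually_mono) (use z' in \<open>auto simp: regular_angle_def\<close>)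
  hence 2: "(g \<longlongrightarrow> 0) (at \<xi>)" by (rule tendsto_eventually)
  show "g \<xi> = 0" by (rule tendsto_unique[OF _ 1 2]) simp
qed

text \<open>The integral controls \<open>g\<close> on one period and off the zeros of the weight;
  periodicity and continuity supply the rest.\<close>

lemma wint_pos:
 assumes k: "k > 0" and ab: "\<alpha> \<ge> 0" "\<beta> \<ge> 0" and g: "g \<in> trig S"
  and 0: "wint k \<alpha> \<beta> (\<lambda>\<xi>. g \<xi> * cnj (g \<xi>)) = 0"
 shows "g = (\<lambda>_. 0)"
proof -
 let ?f = "\<lambda>\<xi>. wt k \<alpha> \<beta> \<xi> * (cmod (g \<xi>))\<^sup>2"
 have cf: "continuous_on {0..2 * pi} ?f"
  by (intro continuous_intros continuous_wt ab trig_continuous[OF g])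
 have e: "of_real (wt k \<alpha> \<beta> \<xi>) * (g \<xi> * cnj (g \<xi>)) = complex_of_real (?f \<xi>)" for \<xi>
  by (simp only: complex_norm_square[symmetric] of_real_mult of_real_power)
 have "complex_of_real (integral {0..2 * pi} ?f) = integral {0..2 * pi} (\<lambda>\<xi>. complex_of_real (?f \<xi>))"
  using integral_linear[OF integrable_continuous_interval[OF cf] bounded_linear_of_real] unfolding o_def by (rule sym)
 hence "complex_of_real (integral {0..2 * pi} ?f) = 0"
  using 0 unfolding wint_def e by (simp only:)
 hence "integral {0..2 * pi} ?f = 0" by (simp only: of_real_eq_0_iff)
 hence z: "\<forall>\<xi>\<in>{0..2 * pi}. ?f \<xi> = 0"
  by (subst (asm) integral_eq_0_iff[OF cf]) (simp_all add: wt_nonneg)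
 have z': "sin (2 * real k * \<xi>) = 0 \<or> g \<xi> = 0" for \<xi>
 proof -
  \<comment> \<open>The number of periods that moves \<xi> into the interval of integration.\<close>
  define m where "m = - \<lfloor>\<xi> / (2 * pi)\<rfloor>"
  have "of_int \<lfloor>\<xi> / (2 * pi)\<rfloor> \<le> \<xi> / (2 * pi)" by (rule of_int_floor_le)
  hence "of_int \<lfloor>\<xi> / (2 * pi)\<rfloor> * (2 * pi) \<le> \<xi>" by (subst (asm) pos_le_divide_eq) simp_all
  hence 1: "0 \<le> \<xi> + 2 * pi * of_int m" by (simp add: m_def mult_ac)
  have "\<xi> / (2 * pi) < of_int \<lfloor>\<xi> / (2 * pi)\<rfloor> + 1" by (rule real_of_int_floor_add_one_gt)
  hence "\<xi> < (of_int \<lfloor>\<xi> / (2 * pi)\<rfloor> + 1) * (2 * pi)" by (subst (asm) pos_divide_less_eq) simp_all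
  hence 2: "\<xi> + 2 * pi * of_int m \<le> 2 * pi" by (simp add: m_def algebra_simps)
  have "pi * of_int (2 * int k * m) / real k = 2 * pi * of_int m" using k by simp
  hence "wt k \<alpha> \<beta> (\<xi> + 2 * pi * of_int m) = wt k \<alpha> \<beta> \<xi>"
   using wt_shift[OF k, of \<alpha> \<beta> \<xi> "2 * int k * m"] by (simp only:)
  moreover have "g (\<xi> + 2 * pi * of_int m) = g \<xi>" by (rule trig_periodic[OF g])
  moreover have "?f (\<xi> + 2 * pi * of_int m) = 0" by (rule bspec[OF z]) (use 1 2 in simp)
  ultimately have "wt k \<alpha> \<beta> \<xi> * (cmod (g \<xi>))\<^sup>2 = 0" by (simp only:)
  hence "wt k \<alpha> \<beta> \<xi> = 0 \<or> g \<xi> = 0" by (auto simp only: mult_eq_0_iff power_eq_0_iff norm_eq_zero)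
  moreover have "wt k \<alpha> \<beta> \<xi> = 0 \<Longrightarrow> sin (2 * real k * \<xi>) = 0"
  proof -
   assume "wt k \<alpha> \<beta> \<xi> = 0"
   hence "sin (real k * \<xi>) = 0 \<or> cos (real k * \<xi>) = 0" by (auto simp: wt_def dest: wfac_eq_0)
   thus "sin (2 * real k * \<xi>) = 0" using sin_double[of "real k * \<xi>"] by (auto simp only: mult.assoc)
  qed
  ultimately show ?thesis by blast
 qed
 show ?thesis by (rule trig_eq_0_if_sin[OF k g z'])
qed

subsection \<open>The dihedral mirrors\<close>

text \<open>For \<beta> = 0 the second family is left out instead of being given multiplicity 0,
  since mirrors in the list also restrict the regular points.\<close>

definition dlines :: "nat \<Rightarrow> real \<Rightarrow> real \<Rightarrow> (real \<times> real) list" where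
 "dlines k \<alpha> \<beta> = map (\<lambda>l. (pi * real l / real k, \<alpha>)) [0..<k] @
  (if \<beta> = 0 then [] else map (\<lambda>l. (pi / (2 * real k) + pi * real l / real k, \<beta>)) [0..<k])"

lemma dlines_sum:
 "(\<Sum>(t, c)\<leftarrow>dlines k \<alpha> \<beta>. complex_of_real c * F t)
  = of_real \<alpha> * (\<Sum>l<k. F (0 + pi * real l / real k)) + of_real \<beta> * (\<Sum>l<k. F (pi / (2 * real k) + pi * real l / real k))"
proof -
 have s: "(\<Sum>(t, c)\<leftarrow>map (\<lambda>l. (f l, \<gamma>)) [0..<k]. complex_of_real c * F t) = of_real \<gamma> * (\<Sum>l<k. F (f l))" for f \<gamma>
  by (simp add: o_def sum_list_const_mult interv_sum_list_conv_sum_set_nat atLeast0LessThan)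
 show ?thesis unfolding dlines_def by (cases "\<beta> = 0") (simp_all only: map_append sum_list_append s if_True if_False, simp_all)
qed

lemma root_sum:
 fixes n :: int
 assumes k: "k > 0"
 shows "(\<Sum>l<k. cis (2 * of_int n * (t0 + pi * real l / real k))) = (if int k dvd n then of_nat k * cis (2 * of_int n * t0) else 0)"
proof -
 define z where "z = cis (2 * pi * of_int n / real k)"
 have zl: "cis (2 * of_int n * (t0 + pi * real l / real k)) = cis (2 * of_int n * t0) * z ^ l" for l
  unfolding z_def Complex.DeMoivre cis_mult by (rule arg_cong[where f=cis]) (simp add: algebra_simps)
 have z1: "z = 1 \<longleftrightarrow> int k dvd n"
 proof
  assume "z = 1"
  hence "cos (2 * pi * of_int n / real k) = 1" by (simp add: z_def complex_eq_iff)
  then obtain m :: int where "2 * pi * of_int n / real k = of_int m * 2 * pi" using cos_one_2pi_int by blast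
  hence "real_of_int n = of_int (m * int k)" using k by (simp add: field_simps)
  thus "int k dvd n" using of_int_eq_iff by (metis dvd_triv_right)
 next
  assume "int k dvd n"
  then obtain m where n: "n = int k * m" by (elim dvdE)
  have "2 * pi * of_int n / real k = 2 * pi * of_int m" using k by (simp add: n)
  thus "z = 1" by (simp add: z_def)
 qed
 have zk: "z ^ k = 1"
 proof -
  have "real k * (2 * pi * of_int n / real k) = 2 * pi * of_int n" using k by simp
  thus ?thesis by (simp add: z_def Complex.DeMoivre)
 qed
 have "(\<Sum>l<k. z ^ l) = (if int k dvd n then of_nat k else 0)"
 proof (cases "int k dvd n")
  case True thus ?thesis using z1 by simp
 next
  case False
  hence "z \<noteq> 1" using z1 by simp
  from geometric_sum[OF this] show ?thesis using False zk by simp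
 qed
 thus ?thesis unfolding zl by (simp add: sum_distrib_left[symmetric])
qed

lemma cis_pi_times_int: "cis (pi * of_int n) = cis (- (pi * of_int n))"
proof -
 have "cis (pi * of_int n) = cis (- (pi * of_int n)) * cis (2 * pi * of_int n)" by (simp add: cis_mult algebra_simps)
 thus ?thesis by simp
qed

text \<open>Summing over k equally spaced mirrors keeps only multiples of k; at these the phase of
  the second family is 1 or -1 and does not see the sign of \<open>l\<close>.\<close>

lemma line_sum_dlines_sym:
 assumes k: "k > 0"
 shows "line_sum (dlines k \<alpha> \<beta>) (-l) = line_sum (dlines k \<alpha> \<beta>) l"
proof -
 have c: "cis (2 * of_int (-l) * (pi / (2 * real k))) = cis (2 * of_int l * (pi / (2 * real k)))" if "int k dvd l"
 proof -
  from that obtain m where l: "l = int k * m" by (elim dvdE)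
  have 1: "2 * of_int l * (pi / (2 * real k)) = pi * of_int m" using k by (simp add: l)
  have 2: "2 * of_int (-l) * (pi / (2 * real k)) = - (2 * of_int l * (pi / (2 * real k)))" by simp
  show ?thesis unfolding 2 1 by (rule cis_pi_times_int[symmetric])
 qed
 have d: "int k dvd - l \<longleftrightarrow> int k dvd l" by simp
 show ?thesis unfolding line_sum_def dlines_sum root_sum[OF k] d
  by (cases "int k dvd l") (simp_all only: if_True if_False c, simp)
qed

lemma Kop_dlines: "Kop (dlines k \<alpha> \<beta>) = real k * (\<alpha> + \<beta>)"
proof -
 show ?thesis unfolding Kop_def dlines_def
  by (cases "\<beta> = 0") (simp_all add: o_def sum_list_triv algebra_simps)
qed

lemma sin_mult_zero_iff:
 assumes k: "k > 0"
 shows "sin (real k * \<tau>) = 0 \<longleftrightarrow> (\<exists>l<k. sin (\<tau> - pi * real l / real k) = 0)"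
proof
 assume "sin (real k * \<tau>) = 0"
 then obtain n :: int where n: "real k * \<tau> = of_int n * pi" using sin_zero_iff_int2 by blast
 define l where "l = nat (n mod int k)"
 have l: "l < k" "n = int k * (n div int k) + int l" using k by (auto simp: l_def nat_less_iff)
 have "of_int n = real k * of_int (n div int k) + real l" by (subst l(2)) simp
 hence "\<tau> - pi * real l / real k = of_int (n div int k) * pi"
  using n k by (simp add: field_simps)
 hence "sin (\<tau> - pi * real l / real k) = 0" using sin_zero_iff_int2 by blast
 with l show "\<exists>l<k. sin (\<tau> - pi * real l / real k) = 0" by blast
next
 assume "\<exists>l<k. sin (\<tau> - pi * real l / real k) = 0"
 then obtain l where "sin (\<tau> - pi * real l / real k) = 0" by blast
 then obtain m :: int where "\<tau> - pi * real l / real k = of_int m * pi" using sin_zero_iff_int2 by blast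
 hence "real k * \<tau> = of_int (int k * m + int l) * pi" using k by (simp add: field_simps)
 thus "sin (real k * \<tau>) = 0" using sin_zero_iff_int2 by blast
qed

lemma regular_angle_dlines:
 assumes k: "k > 0"
 shows "regular_angle (dlines k \<alpha> \<beta>) \<tau> \<longleftrightarrow> sin (real k * \<tau>) \<noteq> 0 \<and> (\<beta> \<noteq> 0 \<longrightarrow> cos (real k * \<tau>) \<noteq> 0)"
proof -
 have "real k * (\<tau> - pi / (2 * real k)) = real k * \<tau> - pi / 2" using k by (simp add: right_diff_distrib)
 hence "cos (real k * \<tau>) = - sin (real k * (\<tau> - pi / (2 * real k)))" by (simp add: sin_diff)
 hence "cos (real k * \<tau>) = 0 \<longleftrightarrow> (\<exists>l<k. sin (\<tau> - pi / (2 * real k) - pi * real l / real k) = 0)"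
  using sin_mult_zero_iff[OF k] by simp
 moreover have "regular_angle (dlines k \<alpha> \<beta>) \<tau> \<longleftrightarrow> \<not> (\<exists>l<k. sin (\<tau> - pi * real l / real k) = 0)
   \<and> (\<beta> \<noteq> 0 \<longrightarrow> \<not> (\<exists>l<k. sin (\<tau> - pi / (2 * real k) - pi * real l / real k) = 0))"
  unfolding regular_angle_def dlines_def diff_diff_eq by (cases "\<beta> = 0") (simp_all only: if_True if_False append_Nil2 set_append set_map set_upt ball_Un, auto)
 ultimately show ?thesis by (simp only: sin_mult_zero_iff[OF k, of \<tau>])
qed

lemma dlines_double_angle:
 assumes k: "k > 0" and t: "(t, c) \<in> set (dlines k \<alpha> \<beta>)"
 obtains n :: int where "2 * t = pi * of_int n / real k"
proof -
 from t consider l where "t = pi * real l / real k" | l where "t = pi / (2 * real k) + pi * real l / real k"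
  unfolding dlines_def by (auto split: if_splits)
 thus ?thesis
 proof cases
  case 1 thus ?thesis by (intro that[of "2 * int l"]) simp
 next
  case 2 thus ?thesis using k by (intro that[of "2 * int l + 1"]) (simp add: field_simps)
 qed
qed

lemma regular_angle_dlines_reflect:
 assumes k: "k > 0" and t: "(t, c) \<in> set (dlines k \<alpha> \<beta>)" and r: "regular_angle (dlines k \<alpha> \<beta>) \<tau>"
 shows "regular_angle (dlines k \<alpha> \<beta>) (2 * t - \<tau>)"
proof -
 obtain n :: int where n: "2 * t = pi * of_int n / real k" using dlines_double_angle[OF k t] by blast
 have e: "real k * (2 * t - \<tau>) = of_int n * pi - real k * \<tau>" unfolding n using k by (simp add: right_diff_distrib)
 have s: "sin (of_int n * pi) = 0" using sin_zero_iff_int2 by blast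
 hence c: "cos (of_int n * pi) \<noteq> 0" using sin_cos_squared_add[of "of_int n * pi"] by auto
 show ?thesis using r unfolding regular_angle_dlines[OF k] e sin_diff cos_diff s using c by simp
qed

subsection \<open>Skew symmetry of the angular Dunkl operator for the dihedral weight\<close>

text \<open>Summing over a family of k mirrors acts as a filter: the surviving frequencies differ
  from n + 1 by multiples of 2k.\<close>

lemma Dline_sum_Etrig:
 assumes k: "k > 0"
 shows "(\<Sum>l<k. Dline (t0 + pi * real l / real k) (Etrig (int (Suc n))) \<xi>)
  = \<i> * of_nat k * (Etrig (int (Suc n)) \<xi> + (if k dvd Suc n then cis (2 * real (Suc n) * t0) * Etrig (- int (Suc n)) \<xi> else 0)
   + 2 * (\<Sum>m<n. if k dvd Suc m then cis (2 * real (Suc m) * t0) * Etrig (int n - 1 - 2 * int m) \<xi> else 0))"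
proof -
 have r: "(\<Sum>l<k. cis (2 * real (Suc m) * (t0 + pi * real l / real k))) = of_nat k * (if k dvd Suc m then cis (2 * real (Suc m) * t0) else 0)" for m
 proof -
  have 1: "real_of_int (int (Suc m)) = real (Suc m)" and 2: "int k dvd int (Suc m) \<longleftrightarrow> k dvd Suc m"
   by (rule of_int_of_nat_eq) (rule int_dvd_int_iff)
  show ?thesis using root_sum[OF k, of "int (Suc m)" t0] unfolding 1 2 by (cases "k dvd Suc m") simp_all
 qed
 let ?E = "\<lambda>m. Etrig (int n - 1 - 2 * int m) \<xi>" and ?c = "\<lambda>m l. cis (2 * real (Suc m) * (t0 + pi * real l / real k))"
 have "(\<Sum>l<k. Dline (t0 + pi * real l / real k) (Etrig (int (Suc n))) \<xi>)
  = (\<Sum>l<k. \<i> * (Etrig (int (Suc n)) \<xi> + ?c n l * Etrig (- int (Suc n)) \<xi> + 2 * (\<Sum>m<n. ?c m l * ?E m)))"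
  by (simp only: Dline_Etrig_pos)
 also have "\<dots> = \<i> * (of_nat k * Etrig (int (Suc n)) \<xi> + (\<Sum>l<k. ?c n l) * Etrig (- int (Suc n)) \<xi> + 2 * (\<Sum>m<n. (\<Sum>l<k. ?c m l) * ?E m))"
  by (subst sum_distrib_left[symmetric]) (simp only: sum.distrib sum_distrib_left[symmetric] sum_distrib_right sum.swap[of _ "{..<k}" "{..<n}"] sum_constant card_lessThan)
 also have "\<dots> = \<i> * of_nat k * (Etrig (int (Suc n)) \<xi> + (if k dvd Suc n then cis (2 * real (Suc n) * t0) else 0) * Etrig (- int (Suc n)) \<xi>
   + 2 * (\<Sum>m<n. (if k dvd Suc m then cis (2 * real (Suc m) * t0) else 0) * ?E m))"
  unfolding r by (simp only: distrib_left sum_distrib_left mult_ac)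
 finally show ?thesis by (simp only: if_distrib[where f="\<lambda>x. x * _"] mult_zero_left)
qed

text \<open>All frequencies in the image are congruent modulo 2k, hence rotation by pi/k multiplies
  them by one common phase.\<close>

lemma Dop_Etrig_rotate:
 assumes k: "k > 0"
 shows "Dop (dlines k \<alpha> \<beta>) (Etrig (int (Suc n))) (\<xi> + pi / real k)
  = cis (pi * real (Suc n) / real k) * Dop (dlines k \<alpha> \<beta>) (Etrig (int (Suc n))) \<xi>"
proof -
 let ?c = "cis (pi * real (Suc n) / real k)"
 have E: "Etrig p (\<xi> + pi / real k) = ?c * Etrig p \<xi>" if "2 * int k dvd int (Suc n) - p" for p
 proof -
  from that obtain m where "int (Suc n) - p = 2 * int k * m" by (elim dvdE)
  hence "real_of_int (int (Suc n) - p) = of_int (2 * int k * m)" by (simp only:)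
  hence p: "of_int p = real (Suc n) - 2 * real k * of_int m" by simp
  have "of_int p * (\<xi> + pi / real k) = (pi * real (Suc n) / real k + of_int p * \<xi>) - 2 * pi * of_int m"
   unfolding p using k by (simp add: field_simps)
  also have "cis \<dots> = ?c * Etrig p \<xi>" by (simp add: cis_mult cis_divide[symmetric])
  finally show ?thesis .
 qed
 have D: "(\<Sum>l<k. Dline (t0 + pi * real l / real k) (Etrig (int (Suc n))) (\<xi> + pi / real k))
  = ?c * (\<Sum>l<k. Dline (t0 + pi * real l / real k) (Etrig (int (Suc n))) \<xi>)" for t0
 proof -
  have 1: "Etrig (int (Suc n)) (\<xi> + pi / real k) = ?c * Etrig (int (Suc n)) \<xi>" by (rule E) simp
  have 2: "(if k dvd Suc n then a * Etrig (- int (Suc n)) (\<xi> + pi / real k) else 0)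
   = ?c * (if k dvd Suc n then a * Etrig (- int (Suc n)) \<xi> else 0)" for a
  proof (cases "k dvd Suc n")
   case True
   hence "int k dvd int (Suc n)" by (simp only: int_dvd_int_iff)
   hence "2 * int k dvd int (Suc n) - - int (Suc n)" by (simp only: diff_minus_eq_add mult_2[symmetric] mult_dvd_mono dvd_refl)
   from E[OF this] True show ?thesis by (simp only: if_True mult_ac)
  qed simp
  have 3: "(if k dvd Suc m then a * Etrig (int n - 1 - 2 * int m) (\<xi> + pi / real k) else 0)
   = ?c * (if k dvd Suc m then a * Etrig (int n - 1 - 2 * int m) \<xi> else 0)" for a m
  proof (cases "k dvd Suc m")
   case True
   hence "int k dvd int (Suc m)" by (simp only: int_dvd_int_iff)
   moreover have "int (Suc n) - (int n - 1 - 2 * int m) = 2 * int (Suc m)" by simp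
   ultimately have "2 * int k dvd int (Suc n) - (int n - 1 - 2 * int m)" by (simp only: mult_dvd_mono dvd_refl)
   from E[OF this] True show ?thesis by (simp only: if_True mult_ac)
  qed simp
  show ?thesis unfolding Dline_sum_Etrig[OF k] 1 2 3
   by (simp only: distrib_left sum_distrib_left mult_ac)
 qed
 have v: "vd (Etrig (int (Suc n))) (\<xi> + pi / real k) = ?c * vd (Etrig (int (Suc n))) \<xi>"
  unfolding vd_Etrig using E[of "int (Suc n)"] by (simp only: diff_self dvd_0_right mult_ac)
 show ?thesis unfolding Dop_def dlines_sum D v by (simp only: distrib_left mult_ac)
qed

lemma Dline_Etrig_cnj: "Dline t (Etrig (- l)) \<xi> = cnj (Dline t (Etrig l) \<xi>)"
 unfolding Dline_def vd_Etrig by (simp add: cis_cnj)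

lemma Dop_cnj: "Dop (dlines k \<alpha> \<beta>) (Etrig (- l)) \<xi> = cnj (Dop (dlines k \<alpha> \<beta>) (Etrig l) \<xi>)"
 unfolding Dop_def dlines_sum Dline_Etrig_cnj vd_Etrig by (simp add: cis_cnj)

lemma wint_cnj: "wint k \<alpha> \<beta> (\<lambda>\<xi>. cnj (g \<xi>)) = cnj (wint k \<alpha> \<beta> g)"
proof -
 have "integral {0..2 * pi} (\<lambda>\<xi>. cnj (of_real (wt k \<alpha> \<beta> \<xi>) * g \<xi>)) = cnj (integral {0..2 * pi} (\<lambda>\<xi>. of_real (wt k \<alpha> \<beta> \<xi>) * g \<xi>))"
  by (rule integral_cnj[symmetric])
 thus ?thesis by (simp add: wint_def)
qed

lemma wint_rotate_eq_0:
 assumes k: "k > 0" and ab: "\<alpha> \<ge> 0" "\<beta> \<ge> 0" and g: "continuous_on UNIV g" "\<And>\<xi>. g (\<xi> + 2 * pi) = g \<xi>"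
  and rot: "\<And>\<xi>. g (\<xi> + pi * of_int n / real k) = c * g \<xi>" and c: "c \<noteq> 1"
 shows "wint k \<alpha> \<beta> g = 0"
proof -
 have "wint k \<alpha> \<beta> g = wint k \<alpha> \<beta> (\<lambda>\<xi>. c * g \<xi> + 0)"
  using wint_shift[OF k ab g, of n] unfolding rot by simp
 also have "\<dots> = c * wint k \<alpha> \<beta> g + wint k \<alpha> \<beta> (\<lambda>_. 0)" by (rule wint_linear[OF ab g(1)]) simp
 also have "wint k \<alpha> \<beta> (\<lambda>_. 0) = 0" by (simp add: wint_def)
 finally have "(1 - c) * wint k \<alpha> \<beta> g = 0" by (simp add: algebra_simps)
 thus ?thesis using c by simp
qed

text \<open>At a frequency divisible by 2k the filter keeps exactly the terms of a single mirror at
  the k-fold angle, so the family of k mirrors acts as k copies of that mirror.\<close>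

lemma Dline_sum_scale:
 assumes k: "k > 0" and q: "q > 0"
 shows "(\<Sum>l<k. Dline (t0 + pi * real l / real k) (Etrig (int (2 * k * q))) \<xi>)
  = of_nat k * Dline (real k * t0) (Etrig (int (2 * q))) (real k * \<xi>)"
proof -
 define n where "n = 2 * k * q - 1"
 have n: "2 * k * q = Suc n" using k q by (simp add: n_def)
 define p where "p = 2 * q - 1"
 have p: "2 * q = Suc p" using q by (simp add: p_def)
 have np: "Suc n = k * Suc p" using n p by (metis mult.assoc mult.commute)
 have kn: "k dvd Suc n" by (simp only: np dvd_triv_left)
 have "(\<Sum>m<n. if k dvd Suc m then cis (2 * real (Suc m) * t0) * Etrig (int n - 1 - 2 * int m) \<xi> else 0)
  = (\<Sum>m\<in>{m. m < n \<and> k dvd Suc m}. cis (2 * real (Suc m) * t0) * Etrig (int n - 1 - 2 * int m) \<xi>)"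
  by (subst sum.inter_filter[symmetric]) (auto intro: sum.cong)
 also have "\<dots> = (\<Sum>i<p. cis (2 * real (Suc i) * (real k * t0)) * Etrig (int p - 1 - 2 * int i) (real k * \<xi>))"
 proof (rule sum.reindex_bij_witness[where i="\<lambda>i. k * Suc i - 1" and j="\<lambda>m. Suc m div k - 1"])
  fix m assume m: "m \<in> {m. m < n \<and> k dvd Suc m}"
  then obtain j where j: "Suc m = k * j" by (auto elim: dvdE)
  hence "j \<noteq> 0" by (metis mult_0_right nat.distinct(1))
  then obtain i where i: "j = Suc i" by (cases j) auto
  have dv: "Suc m div k - 1 = i" using k unfolding j i by simp
  show "k * Suc (Suc m div k - 1) - 1 = m" unfolding dv using j i by simp
  have "k * j < k * Suc p" using m np j by simp
  hence "j < Suc p" by (simp only: mult_less_cancel1)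
  thus "Suc m div k - 1 \<in> {..<p}" unfolding dv using i by simp
  have rm: "real (Suc m) = real k * real (Suc i)" by (simp only: j i of_nat_mult)
  have rn: "real (Suc n) = real k * real (Suc p)" by (simp only: np of_nat_mult)
  have 1: "2 * real (Suc i) * (real k * t0) = 2 * real (Suc m) * t0" by (simp only: rm mult_ac)
  have e: "real_of_int (int n - 1 - 2 * int m) = real (Suc n) - 2 * real (Suc m)" by simp
  have e': "real_of_int (int p - 1 - 2 * int i) = real (Suc p) - 2 * real (Suc i)" by simp
  have 2: "real_of_int (int p - 1 - 2 * int i) * (real k * \<xi>) = real_of_int (int n - 1 - 2 * int m) * \<xi>"
   unfolding e e' rm rn by (simp only: left_diff_distrib right_diff_distrib mult_ac)
  show "cis (2 * real (Suc (Suc m div k - 1)) * (real k * t0)) * Etrig (int p - 1 - 2 * int (Suc m div k - 1)) (real k * \<xi>)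
   = cis (2 * real (Suc m) * t0) * Etrig (int n - 1 - 2 * int m) \<xi>"
   unfolding dv 1 2 by (rule refl)
 next
  fix i assume i: "i \<in> {..<p}"
  have S: "Suc (k * Suc i - 1) = k * Suc i" using k by simp
  show "Suc (k * Suc i - 1) div k - 1 = i" unfolding S using k by simp
  have "k * Suc i < k * Suc p" using i k by simp
  hence "Suc (k * Suc i - 1) < Suc n" unfolding S np .
  hence "k * Suc i - 1 < n" by (simp only: Suc_less_eq)
  thus "k * Suc i - 1 \<in> {m. m < n \<and> k dvd Suc m}" unfolding mem_Collect_eq S by simp
 qed
 finally have s: "(\<Sum>m<n. if k dvd Suc m then cis (2 * real (Suc m) * t0) * Etrig (int n - 1 - 2 * int m) \<xi> else 0)
  = (\<Sum>i<p. cis (2 * real (Suc i) * (real k * t0)) * Etrig (int p - 1 - 2 * int i) (real k * \<xi>))" .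
 have rn: "real (Suc n) = real (Suc p) * real k" by (simp only: np of_nat_mult mult.commute)
 have a: "Etrig (int (Suc n)) \<xi> = Etrig (int (Suc p)) (real k * \<xi>)" "Etrig (- int (Suc n)) \<xi> = Etrig (- int (Suc p)) (real k * \<xi>)"
  "cis (2 * real (Suc n) * t0) = cis (2 * real (Suc p) * (real k * t0))"
  by (simp_all only: of_int_minus of_int_of_nat_eq rn mult_minus_left mult.assoc)
 show ?thesis unfolding n p unfolding Dline_sum_Etrig[OF k] unfolding Dline_Etrig_pos unfolding s a using kn by (simp only: if_True mult_ac)
qed

text \<open>At the k-fold angle there are two mirrors, at 0 and at pi/2. Because 2q is even, both
  reflections send frequency 2q to the same exponential, so both families multiply the same
  difference, one by cot and the other by -tan.\<close>

lemma Dop_Etrig_resonant: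
 assumes k: "k > 0" and q: "q > 0" and reg: "sin (real k * \<xi>) \<noteq> 0" "cos (real k * \<xi>) \<noteq> 0"
 defines "n \<equiv> int (2 * k * q)"
 shows "Dop (dlines k \<alpha> \<beta>) (Etrig n) \<xi> = \<i> * of_int n * Etrig n \<xi>
  + of_real (real k * (\<alpha> * cot (real k * \<xi>) - \<beta> * tan (real k * \<xi>))) * (Etrig n \<xi> - Etrig (-n) \<xi>)"
proof -
 have En: "Etrig (int (2 * q)) (real k * \<xi>) = Etrig n \<xi>" "Etrig (int (2 * q)) (- (real k * \<xi>)) = Etrig (-n) \<xi>"
  by (simp_all add: n_def mult_ac)
 have c2: "cis (pi * real (2 * q)) = 1"
  using cis_multiple_2pi[of "of_nat q"] by (simp add: mult_ac)
 have E2: "Etrig (int (2 * q)) (pi - real k * \<xi>) = Etrig (-n) \<xi>"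
 proof -
  have "real_of_int (int (2 * q)) * (pi - real k * \<xi>) = pi * real (2 * q) + real_of_int (int (2 * q)) * (- (real k * \<xi>))"
   by (simp add: algebra_simps)
  thus ?thesis unfolding En(2)[symmetric] by (simp only: cis_mult[symmetric] c2 mult_1)
 qed
 have D1: "Dline (real k * 0) (Etrig (int (2 * q))) (real k * \<xi>) = of_real (cot (real k * \<xi>)) * (Etrig n \<xi> - Etrig (-n) \<xi>)"
  using reg En by (simp add: Dline_def)
 have h: "real k * (pi / (2 * real k)) = pi / 2" using k by simp
 have ct: "cot (real k * \<xi> - pi / 2) = - tan (real k * \<xi>)" using reg by (simp add: cot_def tan_def sin_diff cos_diff)
 have D2: "Dline (real k * (pi / (2 * real k))) (Etrig (int (2 * q))) (real k * \<xi>) = - of_real (tan (real k * \<xi>)) * (Etrig n \<xi> - Etrig (-n) \<xi>)"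
 proof -
  have nz: "sin (real k * \<xi> - pi / 2) \<noteq> 0" using reg by (simp add: sin_diff)
  have t: "2 * (pi / 2) = pi" by simp
  show ?thesis unfolding h Dline_def ct t E2 En(1) using nz by simp
 qed
 show ?thesis unfolding Dop_def dlines_sum n_def Dline_sum_scale[OF k q] D1[unfolded n_def] D2[unfolded n_def] vd_Etrig
  by (simp add: algebra_simps)
qed

text \<open>Frequencies that are not multiples of 2k integrate to 0 because rotation by pi/k
  preserves the weight and multiplies the image by a phase other than 1. For the others the
  integrand is an odd function plus an exact derivative; negative frequencies follow by
  conjugation.\<close>

lemma wint_Dop:
 assumes k: "k > 0" and ab: "\<alpha> \<ge> 0" "\<beta> \<ge> 0"
 shows "wint k \<alpha> \<beta> (Dop (dlines k \<alpha> \<beta>) (Etrig l)) = 0"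
proof -
 let ?L = "dlines k \<alpha> \<beta>"
 have pos: "wint k \<alpha> \<beta> (Dop ?L (Etrig (int (Suc n)))) = 0" for n
 proof (cases "cis (pi * real (Suc n) / real k) = 1")
  case False
  have t: "Dop ?L (Etrig (int (Suc n))) \<in> trig (freq (Suc n))"
   by (rule Dop_trig, rule trig_Etrig[OF _ finite_freq(1)]) (simp add: freq_def)
  have rot: "Dop ?L (Etrig (int (Suc n))) (\<xi> + pi * of_int 1 / real k)
   = cis (pi * real (Suc n) / real k) * Dop ?L (Etrig (int (Suc n))) \<xi>" for \<xi>
   using Dop_Etrig_rotate[OF k] by (simp only: of_int_1 mult_1_right)
  show ?thesis by (rule wint_rotate_eq_0[OF k ab trig_continuous[OF t] trig_periodic_2pi[OF t] rot False])
 next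
  case True
  hence "cos (pi * real (Suc n) / real k) = 1" by (simp only: complex_eq_iff cis.sel one_complex.sel)
  then obtain m :: int where m: "pi * real (Suc n) / real k = of_int m * 2 * pi" using cos_one_2pi_int by blast
  hence "pi * (real (Suc n) / real k) = pi * (of_int m * 2)" by (simp only: times_divide_eq_right mult_ac)
  hence "real (Suc n) / real k = of_int m * 2" by (simp only: mult_cancel_left pi_neq_zero simp_thms)
  hence "real_of_int (int (Suc n)) = of_int (2 * int k * m)" using k by (simp add: divide_eq_eq mult_ac)
  hence m': "int (Suc n) = 2 * int k * m" by (simp only: of_int_eq_iff)
  hence "m > 0" using k by (smt (verit) mult_nonneg_nonpos of_nat_0_le_iff of_nat_0_less_iff zero_less_Suc)
  define q where "q = nat m"
  have q: "q > 0" "int (Suc n) = int (2 * k * q)" using \<open>m > 0\<close> m' by (simp_all add: q_def)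
  define N where "N = int (2 * k * q)"
  \<comment> \<open>With this H, Dop of \<open>Etrig N\<close> minus iN H equals H' plus the
    logarithmic derivative of the weight times H, which is exact after multiplication by the
    weight.\<close>
  let ?H = "\<lambda>\<xi>. (1/2) * (Etrig N \<xi> - Etrig (-N) \<xi>)" and ?H' = "\<lambda>\<xi>. (1/2) * (\<i> * of_int N * (Etrig N \<xi> + Etrig (-N) \<xi>))"
  have H: "(?H has_vector_derivative ?H' \<xi>) (at \<xi>)" for \<xi>
   by (rule has_vector_derivative_eq_rhs[OF has_vector_derivative_mult_right[OF has_vector_derivative_diff[OF has_vector_derivative_Etrig has_vector_derivative_Etrig]]])
    (simp add: algebra_simps)
  have per: "?H (2 * pi) = ?H 0"
  proof -
   have "cis (of_int j * (2 * pi)) = cis (of_int j * 0)" for j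
    by (simp only: mult.commute[of "of_int j" "2 * pi"] cis_multiple_2pi[OF Ints_of_int]) simp
   thus ?thesis by (simp only:)
  qed
  let ?f = "\<lambda>\<xi>. of_real (wt k \<alpha> \<beta> \<xi>) * (?H' \<xi> + of_real (2 * real k * (\<alpha> * cot (real k * \<xi>) - \<beta> * tan (real k * \<xi>))) * ?H \<xi>)"
  have 1: "(?f has_integral 0) {0..2 * pi}" by (rule wint_FTC[OF k ab H per])
  let ?g = "\<lambda>\<xi>. of_real (wt k \<alpha> \<beta> \<xi>) * (Dop ?L (Etrig N) \<xi> - (\<i> * of_int N) * ?H \<xi>)"
  have "(?g has_integral 0) {0..2 * pi}"
  proof (rule has_integral_spike_finite[OF finite_zeros_sin_cos[OF k] _ 1])
   fix \<xi> assume "\<xi> \<in> {0..2 * pi} - {\<xi> \<in> {0..2 * pi}. sin (real k * \<xi>) = 0 \<or> cos (real k * \<xi>) = 0}"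
   hence "sin (real k * \<xi>) \<noteq> 0" "cos (real k * \<xi>) \<noteq> 0" by auto
   from Dop_Etrig_resonant[OF k q(1) this, of \<alpha> \<beta>]
   have D: "Dop ?L (Etrig N) \<xi> = \<i> * of_int N * Etrig N \<xi>
    + of_real (real k * (\<alpha> * cot (real k * \<xi>) - \<beta> * tan (real k * \<xi>))) * (Etrig N \<xi> - Etrig (-N) \<xi>)"
    unfolding N_def .
   have "x * E + c * (E - F) - x * ((1/2) * (E - F)) = (1/2) * (x * (E + F)) + (2 * c) * ((1/2) * (E - F))" for x E F c :: complex
    by (simp add: field_simps)
   moreover have "complex_of_real (2 * real k * z) = 2 * of_real (real k * z)" for z by simp
   ultimately show "?g \<xi> = ?f \<xi>" unfolding D by (simp only:)
  qed
  hence g0: "wint k \<alpha> \<beta> (\<lambda>\<xi>. Dop ?L (Etrig N) \<xi> - (\<i> * of_int N) * ?H \<xi>) = 0"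
   unfolding wint_def by (rule integral_unique)
  have t: "Dop ?L (Etrig N) \<in> trig (freq (Suc n))"
   unfolding N_def q(2)[symmetric] by (rule Dop_trig, rule trig_Etrig[OF _ finite_freq(1)]) (simp add: freq_def)
  have cH: "continuous_on UNIV ?H" by (intro continuous_intros)
  \<comment> \<open>The reflection at angle 0 preserves the weight and changes the sign of H, so the
    subtracted term integrates to 0.\<close>
  have "wint k \<alpha> \<beta> (\<lambda>\<xi>. ?H (pi * of_int 0 / real k - \<xi>)) = wint k \<alpha> \<beta> ?H"
  proof (rule wint_reflect[OF k ab cH])
   show "?H (\<xi> + 2 * pi) = ?H \<xi>" for \<xi>
   proof -
    have "cis (of_int j * (\<xi> + 2 * pi)) = cis (of_int j * \<xi>)" for j
     using trig_periodic_2pi[OF trig_Etrig[of j "{j}"], of \<xi>] by simp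
    thus ?thesis by (simp only:)
   qed
  qed
  moreover have "?H (pi * of_int 0 / real k - \<xi>) = (-1) * ?H \<xi> + 0" for \<xi> by simp
  ultimately have "wint k \<alpha> \<beta> (\<lambda>\<xi>. (-1) * ?H \<xi> + 0) = wint k \<alpha> \<beta> ?H" by (simp only:)
  moreover have "wint k \<alpha> \<beta> (\<lambda>\<xi>. (-1) * ?H \<xi> + 0) = (-1) * wint k \<alpha> \<beta> ?H + wint k \<alpha> \<beta> (\<lambda>_. 0)"
   by (rule wint_linear[OF ab cH]) simp
  moreover have w0: "wint k \<alpha> \<beta> (\<lambda>_. 0) = 0" by (simp add: wint_def)
  ultimately have H0: "wint k \<alpha> \<beta> ?H = 0" by simp
  have "wint k \<alpha> \<beta> (\<lambda>\<xi>. (- (\<i> * of_int N)) * ?H \<xi> + Dop ?L (Etrig N) \<xi>)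
   = (- (\<i> * of_int N)) * wint k \<alpha> \<beta> ?H + wint k \<alpha> \<beta> (Dop ?L (Etrig N))"
   by (rule wint_linear[OF ab cH trig_continuous[OF t]])
  moreover have "(- (\<i> * of_int N)) * ?H \<xi> + Dop ?L (Etrig N) \<xi> = Dop ?L (Etrig N) \<xi> - (\<i> * of_int N) * ?H \<xi>" for \<xi>
   by simp
  ultimately have "wint k \<alpha> \<beta> (Dop ?L (Etrig N)) = 0" using g0 H0 by (simp only: mult_zero_right add_0)
  thus ?thesis by (simp only: N_def q(2))
 qed
 consider "l = 0" | n where "l = int (Suc n)" | n where "l = - int (Suc n)"
  by (metis int_cases3 not0_implies_Suc of_nat_0_less_iff neq0_conv)
 thus ?thesis
 proof cases
  case 1
  have "Dop ?L (Etrig 0) = (\<lambda>_. 0)"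
   by (rule ext) (simp only: Dop_def dlines_sum Dline_Etrig_0 vd_Etrig, simp)
  thus ?thesis unfolding 1 by (simp add: wint_def)
 next
  case 2 thus ?thesis using pos by (simp only:)
 next
  case (3 n)
  have "Dop ?L (Etrig l) = (\<lambda>\<xi>. cnj (Dop ?L (Etrig (int (Suc n))) \<xi>))"
   unfolding 3 by (rule ext) (rule Dop_cnj)
  thus ?thesis by (simp only: wint_cnj pos complex_cnj_zero)
 qed
qed

theorem dunkl_circle_dlines:
 assumes k: "k > 0" and ab: "\<alpha> > 0" "\<beta> \<ge> 0"
 shows "dunkl_circle (dlines k \<alpha> \<beta>) (wint k \<alpha> \<beta>)"
proof
 fix g h a S T assume "g \<in> trig S" "h \<in> trig T"
 thus "wint k \<alpha> \<beta> (\<lambda>\<xi>. a * g \<xi> + h \<xi>) = a * wint k \<alpha> \<beta> g + wint k \<alpha> \<beta> h"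
  using ab by (intro wint_linear trig_continuous) auto
next
 fix t c g S assume t: "(t, c) \<in> set (dlines k \<alpha> \<beta>)" and g: "g \<in> trig S"
 obtain n :: int where n: "2 * t = pi * of_int n / real k" using dlines_double_angle[OF k t] by blast
 show "wint k \<alpha> \<beta> (\<lambda>\<xi>. g (2 * t - \<xi>)) = wint k \<alpha> \<beta> g"
  unfolding n using ab by (intro wint_reflect k trig_continuous[OF g] trig_periodic_2pi[OF g]) auto
next
 fix l show "wint k \<alpha> \<beta> (Dop (dlines k \<alpha> \<beta>) (Etrig l)) = 0" using ab by (intro wint_Dop k) auto
next
 fix g S assume "g \<in> trig S" "wint k \<alpha> \<beta> (\<lambda>\<xi>. g \<xi> * cnj (g \<xi>)) = 0"
 thus "g = (\<lambda>_. 0)" using ab by (intro wint_pos[OF k]) auto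
next
 show "dlines k \<alpha> \<beta> \<noteq> []" using k by (simp add: dlines_def)
qed (use ab in \<open>auto simp: line_sum_dlines_sym[OF k] Kop_dlines regular_angle_dlines_reflect[OF k]\<close>)

subsection \<open>A product over roots of unity\<close>

text \<open>The difference of the two sides is a polynomial of degree at most k with k + 1 zeros:
  the k-th roots of unity and 0.\<close>

lemma prod_roots_of_unity:
 fixes z :: complex
 assumes k: "k > 0"
 shows "(\<Prod>l<k. 1 - z * cis (2 * pi * real l / real k)) = 1 - z ^ k"
proof -
 let ?a = "\<lambda>l. 2 * pi * real l / real k"
 define p :: "complex poly" where "p = (\<Prod>l<k. [:1, - cis (?a l):]) - (1 - monom 1 k)"
 have pz: "poly p z = (\<Prod>l<k. 1 - z * cis (?a l)) - (1 - z ^ k)" for z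
  by (simp add: p_def poly_prod poly_monom)
 have "p = 0"
 proof (rule ccontr)
  assume "p \<noteq> 0"
  have "degree (\<Prod>l<k. [:1, - cis (?a l):]) \<le> (\<Sum>l<k. degree [:1, - cis (?a l):])"
   using degree_prod_sum_le[of "{..<k}" "\<lambda>l. [:1, - cis (?a l):]"] by (simp add: o_def)
  also have "\<dots> \<le> (\<Sum>l<k. 1)" by (intro sum_mono) simp
  finally have "degree (\<Prod>l<k. [:1, - cis (?a l):]) \<le> k" by simp
  moreover have "degree (1 - monom (1::complex) k) \<le> k" by (rule degree_diff_le) (auto simp: degree_monom_le)
  ultimately have deg: "degree p \<le> k" unfolding p_def by (rule degree_diff_le)
  have sub: "insert 0 {z. z ^ k = 1} \<subseteq> {z. poly p z = 0}"
  proof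
   fix z :: complex assume z: "z \<in> insert 0 {z. z ^ k = 1}"
   show "z \<in> {z. poly p z = 0}"
   proof (cases "z = 0")
    case True thus ?thesis using k by (simp add: pz zero_power)
   next
    case False
    with z have zk: "z ^ k = 1" by simp
    hence "inverse z \<in> {z. z ^ k = 1}" by (simp add: power_inverse)
    hence "inverse z \<in> (\<lambda>l. cis (?a l)) ` {..<k}"
     using Complex.bij_betw_roots_unity[OF k] by (simp add: bij_betw_def)
    then obtain l where l: "l < k" "inverse z = cis (?a l)" by blast
    have "1 - z * cis (?a l) = 0" unfolding l(2)[symmetric] using False by simp
    with l(1) have "(\<Prod>l<k. 1 - z * cis (?a l)) = 0"
     by (intro prod_zero) auto
    thus ?thesis using zk by (simp add: pz)
   qed
  qed
  have fin: "finite {z. poly p z = 0}" by (rule poly_roots_finite[OF \<open>p \<noteq> 0\<close>])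
  have fin1: "finite {z::complex. z ^ k = 1}" by (rule finite_subset[OF _ fin]) (use sub in blast)
  have "Suc k = card (insert 0 {z::complex. z ^ k = 1})"
   using k fin1 card_roots_unity_eq[OF k] by (simp add: zero_power)
  also have "\<dots> \<le> card {z. poly p z = 0}" by (rule card_mono[OF fin sub])
  also have "\<dots> \<le> degree p" by (rule card_poly_roots_bound[OF \<open>p \<noteq> 0\<close>])
  finally show False using deg by simp
 qed
 thus ?thesis using pz[of z] by simp
qed

text \<open>Each quadratic splits into 1 - r e^(i\<theta>) and 1 - r e^(-i\<theta>), and the
  products of the two kinds of factors are taken separately over rotated roots of unity.\<close>

lemma prod_quadratic_cos:
 fixes r :: complex
 assumes k: "k > 0"
 shows "(\<Prod>l<k. 1 + r\<^sup>2 - 2 * r * of_real (cos ((q + 2 * pi * real l) / real k))) = 1 - 2 * r ^ k * of_real (cos q) + r ^ (2 * k)"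
proof -
 have f: "1 + r\<^sup>2 - 2 * r * of_real (cos ((q + 2 * pi * real l) / real k))
  = (1 - r * cis (q / real k) * cis (2 * pi * real l / real k)) * (1 - r * cis (- (q / real k)) * cnj (cis (2 * pi * real l / real k)))" for l
 proof -
  let ?p = "(q + 2 * pi * real l) / real k"
  have 1: "cis (q / real k) * cis (2 * pi * real l / real k) = cis ?p" by (simp add: cis_mult add_divide_distrib)
  have 2: "cis (- (q / real k)) * cnj (cis (2 * pi * real l / real k)) = cis (- ?p)"
   by (simp add: cis_mult cis_cnj add_divide_distrib)
  have P: "cis ?p + cis (- ?p) = 2 * of_real (cos ?p)" by (simp add: complex_eq_iff)
  have Q: "cis ?p * cis (- ?p) = 1" by (simp add: cis_mult)
  have R: "(1 - r * a) * (1 - r * b) = 1 + r\<^sup>2 * (a * b) - r * (a + b)" for a b by (simp add: algebra_simps power2_eq_square)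
  show ?thesis unfolding mult.assoc[of r] 1 2 R P Q by (simp add: mult_ac)
 qed
 have B: "(\<Prod>l<k. 1 - z * cnj (cis (2 * pi * real l / real k))) = 1 - z ^ k" for z
 proof -
  have "(\<Prod>l<k. 1 - z * cnj (cis (2 * pi * real l / real k))) = cnj (\<Prod>l<k. 1 - cnj z * cis (2 * pi * real l / real k))"
   by simp
  also have "\<dots> = 1 - z ^ k" unfolding prod_roots_of_unity[OF k] by simp
  finally show ?thesis .
 qed
 have "(\<Prod>l<k. 1 + r\<^sup>2 - 2 * r * of_real (cos ((q + 2 * pi * real l) / real k)))
  = (1 - (r * cis (q / real k)) ^ k) * (1 - (r * cis (- (q / real k))) ^ k)"
  unfolding f prod.distrib prod_roots_of_unity[OF k] B ..
 also have "(r * cis (q / real k)) ^ k = r ^ k * cis q" using k by (simp add: power_mult_distrib Complex.DeMoivre)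
 also have "(r * cis (- (q / real k))) ^ k = r ^ k * cis (- q)" using k by (simp add: power_mult_distrib Complex.DeMoivre)
 also have "(1 - r ^ k * cis q) * (1 - r ^ k * cis (- q)) = 1 - r ^ k * (cis q + cis (- q)) + r ^ k * r ^ k * (cis q * cis (- q))"
  by (simp only: left_diff_distrib right_diff_distrib distrib_left mult_1 mult_1_right mult_ac diff_diff_eq diff_diff_eq2 diff_add_eq)
 also have "cis q + cis (- q) = 2 * of_real (cos q)" by (simp add: complex_eq_iff)
 also have "cis q * cis (- q) = 1" by (simp add: cis_mult)
 finally have P: "(\<Prod>l<k. 1 + r\<^sup>2 - 2 * r * of_real (cos ((q + 2 * pi * real l) / real k))) = 1 - r ^ k * (2 * of_real (cos q)) + r ^ k * r ^ k * 1" .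
 have "r ^ (2 * k) = r ^ k * r ^ k" by (simp add: mult_2 power_add)
 with P show ?thesis by (simp add: mult_ac)
qed

text \<open>For w other than 0 this solves the quadratic w (1 + r^2) = r. If 1 + r^2 were 0, then r
  = 0, a contradiction.\<close>

lemma joukowski_surj:
 fixes w :: complex
 obtains r where "w * (1 + r\<^sup>2) = r" "1 + r\<^sup>2 \<noteq> 0"
proof (cases "w = 0")
 case True thus ?thesis by (intro that[of 0]) auto
next
 case False
 define s where "s = csqrt (1 - 4 * w\<^sup>2)"
 have s: "s\<^sup>2 = 1 - 4 * w\<^sup>2" by (simp add: s_def)
 define r where "r = (1 - s) / (2 * w)"
 have "4 * w\<^sup>2 * (1 + r\<^sup>2) = 4 * w\<^sup>2 + (1 - s)\<^sup>2" using False by (simp add: r_def power_divide power_mult_distrib field_simps)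
 also have "\<dots> = 4 * w\<^sup>2 + 1 - 2 * s + s\<^sup>2" by (simp add: power2_diff)
 also have "\<dots> = 2 * (1 - s)" unfolding s by simp
 also have "\<dots> = 4 * w * r" using False by (simp add: r_def)
 finally have "4 * w * (w * (1 + r\<^sup>2)) = 4 * w * r" by (simp add: power2_eq_square mult_ac)
 hence 1: "w * (1 + r\<^sup>2) = r" using False by simp
 have "1 + r\<^sup>2 \<noteq> 0" using 1 by (cases "r = 0") auto
 with 1 that show ?thesis by blast
qed

text \<open>Under w = r/(1 + r^2) and after multiplication by (1 + r^2)^k, the product depends on q
  only through -2 r^k cos q, and r^k corresponds to w^k. This identity accounts for the second term
  of the bracket and for its constant 2^(1-k).\<close>

lemma prod_cos_shift:
 fixes w :: complex
 assumes k: "k > 0"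
 shows "(\<Prod>l<k. 1 - 2 * w * of_real (cos ((q + 2 * pi * real l) / real k))) + 2 * w ^ k * of_real (cos q - cos q')
  = (\<Prod>l<k. 1 - 2 * w * of_real (cos ((q' + 2 * pi * real l) / real k)))"
proof -
 obtain r where r: "w * (1 + r\<^sup>2) = r" "1 + r\<^sup>2 \<noteq> 0" by (rule joukowski_surj)
 have P: "(1 + r\<^sup>2) ^ k * (\<Prod>l<k. 1 - 2 * w * of_real (cos ((q + 2 * pi * real l) / real k))) = 1 - 2 * r ^ k * of_real (cos q) + r ^ (2 * k)" for q
 proof -
  have "(1 + r\<^sup>2) * (1 - 2 * w * c) = 1 + r\<^sup>2 - 2 * (w * (1 + r\<^sup>2)) * c" for c by (simp add: algebra_simps)
  hence e: "(1 + r\<^sup>2) * (1 - 2 * w * c) = 1 + r\<^sup>2 - 2 * r * c" for c unfolding r(1) .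
  have "(1 + r\<^sup>2) ^ k * (\<Prod>l<k. 1 - 2 * w * of_real (cos ((q + 2 * pi * real l) / real k)))
   = (\<Prod>l<k. (1 + r\<^sup>2) * (1 - 2 * w * of_real (cos ((q + 2 * pi * real l) / real k))))" by (simp add: prod.distrib)
  thus ?thesis unfolding e prod_quadratic_cos[OF k] .
 qed
 have "(1 + r\<^sup>2) ^ k * (2 * w ^ k * c) = 2 * (w * (1 + r\<^sup>2)) ^ k * c" for c by (simp add: power_mult_distrib mult_ac)
 hence W: "(1 + r\<^sup>2) ^ k * (2 * w ^ k * c) = 2 * r ^ k * c" for c unfolding r(1) .
 have "(1 + r\<^sup>2) ^ k * ((\<Prod>l<k. 1 - 2 * w * of_real (cos ((q + 2 * pi * real l) / real k))) + 2 * w ^ k * of_real (cos q - cos q'))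
  = (1 + r\<^sup>2) ^ k * (\<Prod>l<k. 1 - 2 * w * of_real (cos ((q' + 2 * pi * real l) / real k)))"
  unfolding distrib_left P W by (simp add: algebra_simps)
 thus ?thesis using r(2) by simp
qed

subsection \<open>Bromwich integrals of products of powers\<close>

lemma norm_add_imaginary_bounds:
 assumes "1 \<le> Re s" "\<bar>x\<bar> \<le> 1" "b > 0"
 shows "norm (s + \<i> * of_real b * of_real x) \<le> (1 + b) * norm s" "norm s \<le> (1 + b) * norm (s + \<i> * of_real b * of_real x)"
proof -
 let ?z = "s + \<i> * of_real b * of_real x"
 have t: "norm (\<i> * of_real b * of_real x) \<le> b" using assms by (simp add: norm_mult mult_left_le)
 have 1: "1 \<le> norm s" using complex_Re_le_cmod[of s] assms by linarith
 have 2: "1 \<le> norm ?z" using complex_Re_le_cmod[of "s + \<i> * of_real b * of_real x"] assms by simp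
 have "norm ?z \<le> norm s + b" using norm_triangle_ineq[of s "\<i> * of_real b * of_real x"] t by linarith
 also have "\<dots> \<le> norm s + b * norm s" using 1 assms by simp
 finally show "norm ?z \<le> (1 + b) * norm s" by (simp add: algebra_simps)
 have "norm s \<le> norm ?z + b"
  using norm_triangle_ineq4[of "s + \<i> * of_real b * of_real x" "\<i> * of_real b * of_real x"] t by simp
 also have "\<dots> \<le> norm ?z + b * norm ?z" using 2 assms by simp
 finally show "norm s \<le> (1 + b) * norm ?z" by (simp add: algebra_simps)
qed

text \<open>The exponent may have either sign, hence comparability in both directions is
  assumed.\<close>

lemma powr_comparable_le:
 fixes M y z a :: real
 assumes "y > 0" "z > 0" "M > 0" "z \<le> M * y" "y \<le> M * z"
 shows "z powr a \<le> M powr \<bar>a\<bar> * y powr a"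
proof (cases "a \<ge> 0")
 case True
 have "z powr a \<le> (M * y) powr a" using assms True by (intro powr_mono2) auto
 thus ?thesis using assms True by (simp add: powr_mult)
next
 case False
 have "y / M \<le> z" using assms by (simp add: divide_le_eq mult.commute)
 hence "z powr a \<le> (y / M) powr a" using assms False by (intro powr_mono2') auto
 also have "\<dots> = y powr a * M powr (- a)" using assms by (subst powr_divide) (use assms in \<open>simp_all add: powr_minus divide_inverse\<close>)
 finally show ?thesis using False by (simp add: mult.commute)
qed

text \<open>A single form for numerators and denominators: exponent \<open>a = -1\<close> gives a
  plain product of linear factors.\<close>

definition prodpow :: "real \<Rightarrow> nat set \<Rightarrow> (nat \<Rightarrow> real) \<Rightarrow> real \<Rightarrow> complex \<Rightarrow> complex" where
 "prodpow b L x a s = (\<Prod>l\<in>L. (s + \<i> * of_real b * of_real (x l)) powr (- of_real a))"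

lemma prodpow_holomorphic: "prodpow b L x a holomorphic_on {s. 0 < Re s}"
 unfolding prodpow_def by (intro holomorphic_intros) (auto simp: complex_nonpos_Reals_iff)

lemma prodpow_bound:
 assumes s: "1 \<le> Re s" and b: "b > 0" and x: "\<And>l. l \<in> L \<Longrightarrow> \<bar>x l\<bar> \<le> 1" and L: "finite L"
 shows "norm (prodpow b L x a s) \<le> ((1 + b) powr \<bar>a\<bar>) ^ card L * norm s powr (- (real (card L) * a))"
proof -
 have s0: "norm s > 0" using s by auto
 have n: "norm ((s + \<i> * of_real b * of_real (x l)) powr (- of_real a)) \<le> (1 + b) powr \<bar>a\<bar> * norm s powr (-a)" if l: "l \<in> L" for l
 proof -
  have "Re (s + \<i> * of_real b * of_real (x l)) \<ge> 1" using s by simp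
  hence p: "norm (s + \<i> * of_real b * of_real (x l)) > 0"
   using complex_Re_le_cmod[of "s + \<i> * of_real b * of_real (x l)"] by linarith
  have "norm ((s + \<i> * of_real b * of_real (x l)) powr (- of_real a)) = norm (s + \<i> * of_real b * of_real (x l)) powr (-a)"
   by (subst norm_powr_real_powr') simp_all
  also have "\<dots> \<le> (1 + b) powr \<bar>-a\<bar> * norm s powr (-a)"
   by (rule powr_comparable_le[OF s0 p]) (use norm_add_imaginary_bounds[OF s x[OF l] b] b in auto)
  finally show ?thesis by simp
 qed
 have "norm (prodpow b L x a s) \<le> (\<Prod>l\<in>L. (1 + b) powr \<bar>a\<bar> * norm s powr (-a))"
  unfolding prodpow_def prod_norm[symmetric] by (intro prod_mono conjI norm_ge_zero n)
 also have "\<dots> = ((1 + b) powr \<bar>a\<bar>) ^ card L * (norm s powr (-a)) ^ card L" by (simp add: power_mult_distrib)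
 also have "(norm s powr (-a)) ^ card L = norm s powr (- (real (card L) * a))"
  using s0 by (simp add: powr_powr powr_realpow[symmetric] mult.commute)
 finally show ?thesis .
qed

text \<open>For Re s >= 1 each linear factor is comparable with |s|, so the exponents of decay add
  up; a total above 1 gives integrability and lets the line move.\<close>

lemma exp_prodpow:
 fixes b c a :: real
 assumes b: "b > 0" and x: "\<And>l. l \<in> L \<Longrightarrow> \<bar>x l\<bar> \<le> 1" and y: "\<And>l. l \<in> M \<Longrightarrow> \<bar>y l\<bar> \<le> 1"
  and fin: "finite L" "finite M" and A: "real (card L) * a + real (card M) * c > 1"
 defines "f \<equiv> \<lambda>s. exp s * (prodpow b L x a s * prodpow b M y c s)"
 shows exp_prodpow_integrable: "integrable lborel (\<lambda>t. f (Complex 1 t))"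
  and exp_prodpow_shift: "1 \<le> C \<Longrightarrow> (LINT t|lborel. f (Complex 1 t)) = (LINT t|lborel. f (Complex C t))"
proof -
 let ?A = "real (card L) * a + real (card M) * c"
 have hol: "f holomorphic_on {s. 0 < Re s}"
  unfolding f_def by (intro holomorphic_intros prodpow_holomorphic)
 let ?B = "((1 + b) powr \<bar>a\<bar>) ^ card L * ((1 + b) powr \<bar>c\<bar>) ^ card M"
 have bd: "norm (f s) \<le> exp C * ?B * norm s powr (- ?A)" if s: "1 \<le> Re s" "Re s \<le> C" for s C
 proof -
  have s0: "norm s > 0" using s by auto
  have e: "norm (exp s) \<le> exp C" using s by simp
  have "norm (prodpow b L x a s * prodpow b M y c s)
   \<le> (((1 + b) powr \<bar>a\<bar>) ^ card L * norm s powr (- (real (card L) * a))) * (((1 + b) powr \<bar>c\<bar>) ^ card M * norm s powr (- (real (card M) * c)))"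
   unfolding norm_mult
   by (rule mult_mono[OF prodpow_bound[OF s(1) b x fin(1)] prodpow_bound[OF s(1) b y fin(2)]]) auto
  also have "\<dots> = ?B * norm s powr (- ?A)" using s0 by (simp add: powr_add[symmetric] mult_ac)
  finally have "norm (f s) \<le> exp C * (?B * norm s powr (- ?A))"
   unfolding f_def norm_mult[of "exp s"] using e by (intro mult_mono) auto
  thus ?thesis by (simp only: mult.assoc)
 qed
 show "integrable lborel (\<lambda>t. f (Complex 1 t))"
  by (rule integrable_vertical_line[OF hol _ A, of 1 "exp 1 * ?B"]) (use bd[of _ 1] in auto)
 show "(LINT t|lborel. f (Complex 1 t)) = (LINT t|lborel. f (Complex C t))" if "1 \<le> C"
  by (rule vertical_line_integral_shift[OF hol _ that A, of "exp C * ?B"]) (use bd[of _ C] in auto)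
qed

lemma exp_powr_integrable:
 assumes "c > 0" "\<nu> > 1"
 shows "integrable lborel (\<lambda>t. exp (Complex c t) * Complex c t powr (- of_real \<nu>))"
  and "integrable lborel (\<lambda>t. norm (Complex c t) powr (- \<nu>))"
proof -
 have 1: "(\<lambda>s. exp s * s powr (- of_real \<nu>)) holomorphic_on {s. 0 < Re s}"
  by (intro holomorphic_intros) (auto simp: complex_nonpos_Reals_iff)
 show "integrable lborel (\<lambda>t. exp (Complex c t) * Complex c t powr (- of_real \<nu>))"
  by (rule integrable_vertical_line[OF 1 assms, of "exp c"]) (simp add: norm_mult norm_powr_real_powr')
 have 2: "(\<lambda>s. s powr (- of_real \<nu>)) holomorphic_on {s. 0 < Re s}"
  by (intro holomorphic_intros) (auto simp: complex_nonpos_Reals_iff)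
 have "integrable lborel (\<lambda>t. Complex c t powr (- of_real \<nu>))"
  by (rule integrable_vertical_line[OF 2 assms, of 1]) (simp add: norm_powr_real_powr')
 from integrable_norm[OF this] show "integrable lborel (\<lambda>t. norm (Complex c t) powr (- \<nu>))"
  by (simp add: norm_powr_real_powr')
qed

text \<open>Both factors lie in the right half-plane, so their arguments add to less than pi in
  modulus and the principal logarithms add.\<close>

lemma powr_split_halfplane:
 assumes "Re s > 0" "norm u < 1"
 shows "(s * (1 + u)) powr a = s powr a * (1 + u) powr a"
proof -
 have "Re (1 + u) > 0" using abs_Re_le_cmod[of u] assms by simp
 moreover from this have "1 + u \<noteq> 0" by (metis less_irrefl zero_complex.simps(1))
 moreover have "s \<noteq> 0" using assms by auto
 moreover have "\<bar>Im (Ln s)\<bar> < pi / 2" using Re_Ln_pos_lt_imp[of s] assms by simp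
 moreover have "\<bar>Im (Ln (1 + u))\<bar> < pi / 2" using Re_Ln_pos_lt_imp[of "1 + u"] \<open>Re (1 + u) > 0\<close> by simp
 ultimately have "Ln (s * (1 + u)) = Ln s + Ln (1 + u)" by (intro Ln_times_simple) auto
 moreover have "s * (1 + u) \<noteq> 0" using \<open>s \<noteq> 0\<close> \<open>1 + u \<noteq> 0\<close> by (simp only: mult_eq_0_iff simp_thms)
 ultimately show ?thesis using \<open>s \<noteq> 0\<close> \<open>1 + u \<noteq> 0\<close> by (simp only: powr_def if_False exp_add distrib_left)
qed

subsection \<open>The generating function of the expansion coefficients\<close>

text \<open>With w = -ib/(2s) a factor s + ib x becomes s (1 - 2 w x); this is what remains of the
  integrand once the powers of s are taken out.\<close>

definition Dgen :: "nat set \<Rightarrow> (nat \<Rightarrow> real) \<Rightarrow> nat set \<Rightarrow> (nat \<Rightarrow> real) \<Rightarrow> real \<Rightarrow> complex \<Rightarrow> complex" where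
 "Dgen M y L x a w = (\<Prod>l\<in>M. 1 - 2 * w * of_real (y l)) * (\<Prod>l\<in>L. (1 - 2 * w * of_real (x l)) powr (- of_real a))"

definition dcoef :: "nat set \<Rightarrow> (nat \<Rightarrow> real) \<Rightarrow> nat set \<Rightarrow> (nat \<Rightarrow> real) \<Rightarrow> real \<Rightarrow> nat \<Rightarrow> complex" where
 "dcoef M y L x a n = fps_nth (fps_expansion (Dgen M y L x a) 0) n"

lemma norm_2_mult_le: "\<bar>x\<bar> \<le> 1 \<Longrightarrow> norm (2 * w * complex_of_real x) \<le> 2 * norm w"
 by (simp add: norm_mult mult_left_le)

lemma Dgen_holomorphic:
 assumes "\<And>l. l \<in> L \<Longrightarrow> \<bar>x l\<bar> \<le> 1"
 shows "Dgen M y L x a holomorphic_on ball 0 (1/2)"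
proof -
 have "1 - 2 * w * of_real (x l) \<notin> \<real>\<^sub>\<le>\<^sub>0" if "w \<in> ball 0 (1/2)" "l \<in> L" for w :: complex and l
 proof -
  have "norm (2 * w * of_real (x l)) < 1" using norm_2_mult_le[OF assms[OF that(2)], of w] that by simp
  hence "Re (1 - 2 * w * of_real (x l)) > 0" using complex_Re_le_cmod[of "2 * w * of_real (x l)"] by simp
  thus ?thesis by (auto simp: complex_nonpos_Reals_iff)
 qed
 thus ?thesis unfolding Dgen_def by (intro holomorphic_intros) auto
qed

lemma Dgen_bound:
 assumes x: "\<And>l. l \<in> L \<Longrightarrow> \<bar>x l\<bar> \<le> 1" and y: "\<And>l. l \<in> M \<Longrightarrow> \<bar>y l\<bar> \<le> 1" and a: "a \<ge> 0" and w: "norm w \<le> 3/8"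
 shows "norm (Dgen M y L x a w) \<le> 2 ^ card M * (4 powr a) ^ card L"
proof -
 have 1: "norm (1 - 2 * w * of_real (y l)) \<le> 2" if "l \<in> M" for l
  using norm_triangle_ineq4[of 1 "2 * w * of_real (y l)"] norm_2_mult_le[OF y[OF that], of w] w by simp
 have 2: "norm ((1 - 2 * w * of_real (x l)) powr (- of_real a)) \<le> 4 powr a" if "l \<in> L" for l
 proof -
  have "1/4 \<le> norm (1 - 2 * w * of_real (x l))"
   using norm_triangle_ineq2[of 1 "2 * w * of_real (x l)"] norm_2_mult_le[OF x[OF that], of w] w by simp
  hence "norm (1 - 2 * w * of_real (x l)) powr (-a) \<le> (1/4) powr (-a)" using a by (intro powr_mono2') auto
  also have "(1/4::real) powr (-a) = 4 powr a" by (simp add: powr_divide powr_minus)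
  finally show ?thesis by (subst norm_powr_real_powr') simp_all
 qed
 show ?thesis unfolding Dgen_def norm_mult prod_norm[symmetric]
  using prod_mono[of M "\<lambda>l. norm (1 - 2 * w * of_real (y l))" "\<lambda>_. 2"]
   prod_mono[of L "\<lambda>l. norm ((1 - 2 * w * of_real (x l)) powr (- of_real a))" "\<lambda>_. 4 powr a"] 1 2
  by (intro mult_mono) (auto intro!: prod_nonneg)
qed

text \<open>A Cauchy estimate on the circle of radius 3/8, inside the disc of radius 1/2 where
  \<open>Dgen\<close> is holomorphic. The bound is independent of the nodes, hence uniform in u and
  v.\<close>

lemma dcoef_bound:
 assumes x: "\<And>l. l \<in> L \<Longrightarrow> \<bar>x l\<bar> \<le> 1" and y: "\<And>l. l \<in> M \<Longrightarrow> \<bar>y l\<bar> \<le> 1" and a: "a \<ge> 0"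
 shows "norm (dcoef M y L x a n) \<le> 2 ^ card M * (4 powr a) ^ card L * (8/3) ^ n"
proof -
 have h: "Dgen M y L x a holomorphic_on ball 0 (1/2)" by (rule Dgen_holomorphic[OF x])
 have "norm ((deriv ^^ n) (Dgen M y L x a) 0) \<le> fact n * (2 ^ card M * (4 powr a) ^ card L) / (3/8) ^ n"
 proof (rule Cauchy_inequality)
  show "Dgen M y L x a holomorphic_on ball 0 (3/8)" by (rule holomorphic_on_subset[OF h]) auto
  show "continuous_on (cball 0 (3/8)) (Dgen M y L x a)"
   by (rule holomorphic_on_imp_continuous_on, rule holomorphic_on_subset[OF h]) auto
  show "norm (Dgen M y L x a w) \<le> 2 ^ card M * (4 powr a) ^ card L" if "norm (0 - w) = 3/8" for w
   by (rule Dgen_bound[OF x y a]) (use that in auto)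
 qed auto
 hence "norm ((deriv ^^ n) (Dgen M y L x a) 0) / fact n \<le> (2 ^ card M * (4 powr a) ^ card L) / (3/8) ^ n"
  by (simp add: field_simps)
 also have "\<dots> = 2 ^ card M * (4 powr a) ^ card L * (8/3) ^ n" by (simp add: power_divide)
 finally show ?thesis by (simp add: dcoef_def fps_expansion_def norm_divide)
qed

lemma dcoef_sums:
 assumes "\<And>l. l \<in> L \<Longrightarrow> \<bar>x l\<bar> \<le> 1" "norm w < 1/2"
 shows "(\<lambda>n. dcoef M y L x a n * w ^ n) sums Dgen M y L x a w"
 using holomorphic_power_series[OF Dgen_holomorphic[OF assms(1)], where w=w] assms(2)
 by (simp add: dcoef_def fps_expansion_def)

lemma prodpow_eq_Dgen:
 fixes b a :: real
 assumes b: "b > 0" and x: "\<And>l. l \<in> L \<Longrightarrow> \<bar>x l\<bar> \<le> 1" and y: "\<And>l. l \<in> M \<Longrightarrow> \<bar>y l\<bar> \<le> 1"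
  and s: "Re s > b" and fin: "finite L" "finite M"
 shows "prodpow b L x a s * prodpow b M y (-1) s
  = s powr (- of_real (real (card L) * a - real (card M))) * Dgen M y L x a (- \<i> * of_real b / (2 * s))"
proof -
 let ?w = "- \<i> * of_real b / (2 * s)"
 have s0: "s \<noteq> 0" "Re s > 0" using s b by auto
 have ns: "norm s > b" using s complex_Re_le_cmod[of s] by linarith
 have f: "s + \<i> * of_real b * of_real t = s * (1 + - (2 * ?w * of_real t))" for t using s0 by (simp add: field_simps)
 have f': "1 + - (2 * ?w * of_real t) = 1 - 2 * ?w * of_real t" for t by simp
 have "2 * norm ?w < 1" using ns b s0 by (simp add: norm_divide norm_mult pos_divide_less_eq)
 hence nu: "norm (- (2 * ?w * of_real t)) < 1" if "\<bar>t\<bar> \<le> 1" for t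
  using norm_2_mult_le[OF that, of ?w] by (simp only: norm_minus_cancel)
 have 1: "prodpow b L x a s = (s powr (- of_real a)) ^ card L * (\<Prod>l\<in>L. (1 - 2 * ?w * of_real (x l)) powr (- of_real a))"
 proof -
  have "prodpow b L x a s = (\<Prod>l\<in>L. s powr (- of_real a) * (1 - 2 * ?w * of_real (x l)) powr (- of_real a))"
   unfolding prodpow_def f by (intro prod.cong refl) (subst powr_split_halfplane[OF s0(2) nu[OF x]]; simp)
  thus ?thesis by (simp only: prod.distrib prod_constant)
 qed
 have 2: "prodpow b M y (-1) s = s ^ card M * (\<Prod>l\<in>M. 1 - 2 * ?w * of_real (y l))"
 proof -
  have "(s + \<i> * of_real b * of_real t) powr (- of_real (-1)) = s * (1 - 2 * ?w * of_real t)" for t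
  proof -
   have "Re (s + \<i> * of_real b * of_real t) > 0" using s0 by simp
   hence nz: "s + \<i> * of_real b * of_real t \<noteq> 0" by (intro notI) simp
   have "(s + \<i> * of_real b * of_real t) powr (- of_real (-1)) = s + \<i> * of_real b * of_real t"
    using nz by (simp add: powr_def exp_Ln)
   thus ?thesis unfolding f f' .
  qed
  thus ?thesis unfolding prodpow_def by (simp only: prod.distrib prod_constant)
 qed
 have 3: "(s powr (- of_real a)) ^ card L * s ^ card M = s powr (- of_real (real (card L) * a - real (card M)))"
 proof -
  have "(s powr (- of_real a)) ^ card L = exp (of_nat (card L) * (- of_real a * Ln s))"
   using s0 by (simp only: powr_def if_False exp_of_nat_mult[symmetric])
  moreover have "s ^ card M = exp (of_nat (card M) * Ln s)" using s0 by (simp only: exp_of_nat_mult exp_Ln not_False_eq_True)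
  ultimately have "(s powr (- of_real a)) ^ card L * s ^ card M = exp (of_nat (card L) * (- of_real a * Ln s) + of_nat (card M) * Ln s)"
   by (simp only: exp_add)
  moreover have "of_nat (card L) * (- of_real a * Ln s) + of_nat (card M) * Ln s = - of_real (real (card L) * a - real (card M)) * Ln s"
   by (simp add: algebra_simps)
  ultimately show ?thesis using s0 by (simp only: powr_def if_False)
 qed
 show ?thesis unfolding 1 2 Dgen_def 3[symmetric] by (simp only: mult_ac)
qed

text \<open>On a line far enough to the right the expansion in w has geometrically decreasing terms,
  and its partial sums are dominated by a multiple of |s|^(-\<nu>). Integrating termwise, the power
  s^(-\<nu>-n) contributes 2 pi / Gamma(\<nu> + n).\<close>

theorem bromwich_prodpow_sums:
 fixes b a :: real
 assumes b: "b > 0" and x: "\<And>l. l \<in> L \<Longrightarrow> \<bar>x l\<bar> \<le> 1" and y: "\<And>l. l \<in> M \<Longrightarrow> \<bar>y l\<bar> \<le> 1"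
  and fin: "finite L" "finite M" and a: "a \<ge> 0" and \<nu>: "\<nu> = real (card L) * a - real (card M)" "\<nu> > 1"
 shows "(\<lambda>n. dcoef M y L x a n * (- \<i> * of_real b / 2) ^ n * of_real (2 * pi / Gamma (\<nu> + real n))) sums
  (LINT t|lborel. exp (Complex 1 t) * (prodpow b L x a (Complex 1 t) * prodpow b M y (-1) (Complex 1 t)))"
proof -
 \<comment> \<open>On this line |w| <= 1/4, so coefficients of size (8/3)^n give terms of ratio
   2/3.\<close>
 define c where "c = 1 + 2 * b"
 have c: "1 \<le> c" "c > 0" using b by (auto simp: c_def)
 define MD where "MD = 2 ^ card M * (4 powr a) ^ card L"
 have MD: "MD \<ge> 0" by (simp add: MD_def)
 let ?d = "dcoef M y L x a" and ?D = "Dgen M y L x a"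
 define w where "w s = - \<i> * of_real b / (2 * s)" for s :: complex
 let ?u = "\<lambda>n t. ?d n * (- \<i> * of_real b / 2) ^ n * (exp (Complex c t) * Complex c t powr (- of_real (\<nu> + real n)))"
 have wb: "norm (w (Complex c t)) \<le> 1/4" for t
 proof -
  have "c \<le> norm (Complex c t)" using complex_Re_le_cmod[of "Complex c t"] by simp
  hence "2 * b \<le> norm (Complex c t)" unfolding c_def by simp
  moreover have "Complex c t \<noteq> 0" using c by (auto simp: complex_eq_iff)
  ultimately show ?thesis using b by (simp add: w_def norm_divide norm_mult divide_simps)
 qed
 have ut: "?u n t = exp (Complex c t) * Complex c t powr (- of_real \<nu>) * (?d n * w (Complex c t) ^ n)" for n t
 proof -
  let ?s = "Complex c t"
  have s: "?s \<noteq> 0" using c by (auto simp: complex_eq_iff)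
  have "?s powr (- of_real (\<nu> + real n)) = ?s powr (- of_real \<nu> + - of_nat n)" by simp
  also have "\<dots> = ?s powr (- of_real \<nu>) * ?s powr (- of_nat n)" by (rule powr_add)
  also have "?s powr (- of_nat n) = inverse (?s ^ n)" using s by (simp only: powr_minus powr_complexpow not_False_eq_True)
  finally have 1: "?s powr (- of_real (\<nu> + real n)) = ?s powr (- of_real \<nu>) * inverse (?s ^ n)" .
  have "w ?s ^ n = ((- \<i> * of_real b / 2) * inverse ?s) ^ n" by (simp only: w_def divide_divide_eq_left[symmetric] divide_inverse[of _ ?s])
  hence "w ?s ^ n = (- \<i> * of_real b / 2) ^ n * inverse (?s ^ n)" by (simp only: power_mult_distrib power_inverse)
  thus ?thesis unfolding 1 by (simp only: mult_ac)
 qed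
 have i: "integrable lborel (?u n)" for n
  using exp_powr_integrable(1)[OF c(2), of "\<nu> + real n"] \<nu> by (intro integrable_mult_right) auto
 have Iu: "(LINT t|lborel. ?u n t) = ?d n * (- \<i> * of_real b / 2) ^ n * of_real (2 * pi / Gamma (\<nu> + real n))" for n
  using bromwich_integral_rGamma[of "\<nu> + real n" c] \<nu> c by (simp only: integral_mult_right_zero)
 let ?f = "\<lambda>t. exp (Complex c t) * Complex c t powr (- of_real \<nu>) * ?D (w (Complex c t))"
 have sm: "summable (\<lambda>n. (2/3::real) ^ n)" by (rule summable_geometric) simp
 have bnd: "norm (?d n * w (Complex c t) ^ n) \<le> MD * (2/3) ^ n" for n t
 proof -
  have "norm (?d n) \<le> MD * (8/3) ^ n" unfolding MD_def by (rule dcoef_bound[OF x y a])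
  hence "norm (?d n * w (Complex c t) ^ n) \<le> (MD * (8/3) ^ n) * (1/4) ^ n"
   unfolding norm_mult norm_power using wb MD by (intro mult_mono power_mono) auto
  also have "\<dots> = MD * ((8/3) * (1/4)) ^ n" by (simp only: power_mult_distrib mult.assoc)
  finally show ?thesis by simp
 qed
 have "(\<lambda>N. LINT t|lborel. (\<Sum>n<N. ?u n t)) \<longlonglongrightarrow> (LINT t|lborel. ?f t)"
 proof (rule integral_dominated_convergence)
  show "integrable lborel (\<lambda>t. exp c * (MD * 3) * norm (Complex c t) powr (- \<nu>))"
   using exp_powr_integrable(2)[OF c(2) \<nu>(2)] by simp
  show "AE t in lborel. (\<lambda>N. \<Sum>n<N. ?u n t) \<longlonglongrightarrow> ?f t"
  proof (rule AE_I2)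
   fix t
   have "norm (w (Complex c t)) < 1/2" using wb[of t] by simp
   from sums_mult[OF dcoef_sums[OF x this]]
   have "(\<lambda>n. ?u n t) sums ?f t" unfolding ut .
   thus "(\<lambda>N. \<Sum>n<N. ?u n t) \<longlonglongrightarrow> ?f t" unfolding sums_def .
  qed
  show "AE t in lborel. norm (\<Sum>n<N. ?u n t) \<le> exp c * (MD * 3) * norm (Complex c t) powr (- \<nu>)" for N
  proof (rule AE_I2)
   fix t
   have "norm (\<Sum>n<N. ?d n * w (Complex c t) ^ n) \<le> (\<Sum>n<N. MD * (2/3) ^ n)" by (rule sum_norm_le[OF bnd])
   also have "\<dots> = MD * (\<Sum>n<N. (2/3) ^ n)" by (simp only: sum_distrib_left)
   also have "(\<Sum>n<N. (2/3::real) ^ n) \<le> 3"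
    using sum_le_suminf[OF sm, of "{..<N}"] suminf_geometric[of "2/3::real"] by simp
   finally have 1: "norm (\<Sum>n<N. ?d n * w (Complex c t) ^ n) \<le> MD * 3" using MD by (simp add: mult_left_mono)
   have "(\<Sum>n<N. ?u n t) = exp (Complex c t) * Complex c t powr (- of_real \<nu>) * (\<Sum>n<N. ?d n * w (Complex c t) ^ n)"
    unfolding ut by (simp only: sum_distrib_left)
   hence "norm (\<Sum>n<N. ?u n t) = exp c * norm (Complex c t) powr (- \<nu>) * norm (\<Sum>n<N. ?d n * w (Complex c t) ^ n)"
    by (simp add: norm_mult norm_powr_real_powr')
   also have "\<dots> \<le> exp c * norm (Complex c t) powr (- \<nu>) * (MD * 3)" using 1 by (intro mult_left_mono) auto
   finally show "norm (\<Sum>n<N. ?u n t) \<le> exp c * (MD * 3) * norm (Complex c t) powr (- \<nu>)" by (simp only: mult_ac)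
  qed
  show "(\<lambda>t. \<Sum>n<N. ?u n t) \<in> borel_measurable lborel" for N
   by (intro borel_measurable_sum borel_measurable_integrable i)
  show "?f \<in> borel_measurable lborel"
  proof (rule borel_measurable_LIMSEQ_metric[where f="\<lambda>N t. \<Sum>n<N. ?u n t"])
   show "(\<lambda>t. \<Sum>n<N. ?u n t) \<in> borel_measurable lborel" for N
    by (intro borel_measurable_sum borel_measurable_integrable i)
   fix t
   have "norm (w (Complex c t)) < 1/2" using wb[of t] by simp
   from sums_mult[OF dcoef_sums[OF x this]]
   have "(\<lambda>n. ?u n t) sums ?f t" unfolding ut .
   thus "(\<lambda>N. \<Sum>n<N. ?u n t) \<longlonglongrightarrow> ?f t" unfolding sums_def .
  qed
 qed
 moreover have "(LINT t|lborel. (\<Sum>n<N. ?u n t)) = (\<Sum>n<N. ?d n * (- \<i> * of_real b / 2) ^ n * of_real (2 * pi / Gamma (\<nu> + real n)))" for N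
  unfolding Iu[symmetric] by (rule Bochner_Integration.integral_sum) (rule i)
 ultimately have "(\<lambda>n. ?d n * (- \<i> * of_real b / 2) ^ n * of_real (2 * pi / Gamma (\<nu> + real n))) sums (LINT t|lborel. ?f t)"
  unfolding sums_def by (simp only:)
 moreover have "(LINT t|lborel. ?f t) = (LINT t|lborel. exp (Complex c t) * (prodpow b L x a (Complex c t) * prodpow b M y (-1) (Complex c t)))"
 proof (rule Bochner_Integration.integral_cong[OF refl])
  fix t
  have "Re (Complex c t) > b" using b by (simp add: c_def)
  from prodpow_eq_Dgen[OF b x y this fin, where a=a]
  show "?f t = exp (Complex c t) * (prodpow b L x a (Complex c t) * prodpow b M y (-1) (Complex c t))"
   unfolding \<nu>(1) w_def by (simp only: mult.assoc)
 qed
 moreover have "\<dots> = (LINT t|lborel. exp (Complex 1 t) * (prodpow b L x a (Complex 1 t) * prodpow b M y (-1) (Complex 1 t)))"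
  by (rule exp_prodpow_shift[OF b x y fin _ c(1), symmetric]) (use \<nu> in auto)
 ultimately show ?thesis by (simp only:)
qed

subsection \<open>The integrand as a Bromwich integral\<close>

text \<open>The solutions y of T_k(y) = cos q for the Chebyshev polynomial T_k; A(s,q) is the
  product of s + ib y over them.\<close>

definition chebnode :: "nat \<Rightarrow> real \<Rightarrow> nat \<Rightarrow> real" where
 "chebnode k q l = cos ((q + 2 * pi * real l) / real k)"

lemma abs_chebnode: "\<bar>chebnode k q l\<bar> \<le> 1" by (simp add: chebnode_def)

lemma Complex_1_eq: "Complex 1 t = 1 + \<i> * of_real t" by (simp add: complex_eq_iff)

lemma powr_minus_one:
 assumes "z \<noteq> 0" shows "z powr (-1) = inverse (z::complex)"
proof -
 have "z powr (-1) = exp (- Ln z)" using assms by (simp add: powr_def)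
 also have "\<dots> = inverse (exp (Ln z))" by (rule exp_minus)
 finally show ?thesis using assms by simp
qed

lemma h_fun_prodpow:
 "h_fun k b \<omega> \<eta> \<gamma> 1 (of_real q) = of_real (1 / (2 * pi)) *
  (LINT t|lborel. exp (Complex 1 t) * (prodpow b {..<k} (chebnode k q) \<gamma> (Complex 1 t) * prodpow b {0} (\<lambda>_. Re (\<omega> * cnj \<eta>)) 1 (Complex 1 t)))"
proof -
 have c: "cos ((complex_of_real q + 2 * of_real pi * of_nat l) / of_nat k) = of_real (chebnode k q l)" for l
 proof -
  have "(complex_of_real q + 2 * of_real pi * of_nat l) / of_nat k = of_real ((q + 2 * pi * real l) / real k)" by simp
  thus ?thesis unfolding chebnode_def by (simp only: cos_of_real)
 qed
 have "exp (s * of_real 1) * A_pow k b \<gamma> s (of_real q) / B_fun b \<omega> \<eta> s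
   = exp s * (prodpow b {..<k} (chebnode k q) \<gamma> s * prodpow b {0} (\<lambda>_. Re (\<omega> * cnj \<eta>)) 1 s)" if "s = Complex 1 t" for s t
 proof -
  have "Re (s + \<i> * of_real b * of_real (Re (\<omega> * cnj \<eta>))) = 1" using that by simp
  hence nz: "s + \<i> * of_real b * of_real (Re (\<omega> * cnj \<eta>)) \<noteq> 0" by (metis zero_complex.simps(1) zero_neq_one)
  have p: "prodpow b {0} (\<lambda>_. Re (\<omega> * cnj \<eta>)) 1 s = inverse (s + \<i> * of_real b * of_real (Re (\<omega> * cnj \<eta>)))"
   unfolding prodpow_def by (simp only: of_real_1 prod.insert prod.empty finite.emptyI empty_iff not_False_eq_True mult_1_right powr_minus_one[OF nz])
  show ?thesis unfolding A_pow_def c B_fun_def p unfolding prodpow_def by (simp only: of_real_1 mult_1_right divide_inverse mult.assoc)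
 qed
 thus ?thesis unfolding h_fun_def Let_def Complex_1_eq by simp
qed

lemma prodpow_Suc:
 assumes "Re s > 0"
 shows "prodpow b L x \<gamma> s = prodpow b L x (\<gamma> + 1) s * (\<Prod>l\<in>L. s + \<i> * of_real b * of_real (x l))"
proof -
 have "z powr (- of_real \<gamma>) = z powr (- of_real (\<gamma> + 1)) * z" if "z \<noteq> 0" for z :: complex
 proof -
  have "z powr (- of_real (\<gamma> + 1) + 1) = z powr (- of_real (\<gamma> + 1)) * z powr 1" by (rule powr_add)
  thus ?thesis using that by (simp add: powr_def exp_Ln)
 qed
 moreover have "s + \<i> * of_real b * of_real (x l) \<noteq> 0" for l
 proof -
  have "Re (s + \<i> * of_real b * of_real (x l)) > 0" using assms by simp
  thus ?thesis by (metis less_irrefl zero_complex.simps(1))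
 qed
 ultimately show ?thesis unfolding prodpow_def prod.distrib[symmetric] by (intro prod.cong refl) blast
qed

text \<open>Over the common denominator A(s,q)^(\<gamma>+1) B(s) the numerator is A(s,q) plus the
  constant, which \<open>prod_cos_shift\<close> identifies as A(s,q'). The node l = 0 of q' is
  Re(\<omega> cnj \<eta>), so B(s) is one of its factors and cancels, and the nodes 1, ..., k - 1
  remain in the numerator.\<close>

lemma h_fun_combination:
 assumes k: "k > 0" and b: "b > 0" and \<gamma>: "\<gamma> > 0" and \<omega>: "Re (\<omega> * cnj \<eta>) = cos (q' / real k)"
 shows "h_fun k b \<omega> \<eta> \<gamma> 1 (of_real q) + of_real (2 powr (1 - real k)) * (- \<i> * of_real b) ^ k * of_real (cos q - cos q') * h_fun k b \<omega> \<eta> (\<gamma> + 1) 1 (of_real q)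
  = of_real (1 / (2 * pi)) * (LINT t|lborel. exp (Complex 1 t) * (prodpow b {..<k} (chebnode k q) (\<gamma> + 1) (Complex 1 t) * prodpow b {1..<k} (chebnode k q') (-1) (Complex 1 t)))"
proof -
 let ?c = "of_real (2 powr (1 - real k)) * (- \<i> * of_real b) ^ k * of_real (cos q - cos q') :: complex"
 let ?P = "prodpow b {0} (\<lambda>_. Re (\<omega> * cnj \<eta>)) 1"
 let ?g = "\<lambda>\<gamma> t. exp (Complex 1 t) * (prodpow b {..<k} (chebnode k q) \<gamma> (Complex 1 t) * ?P (Complex 1 t))"
 have Re1: "\<bar>Re (\<omega> * cnj \<eta>)\<bar> \<le> 1" unfolding \<omega> by simp
 have i: "integrable lborel (?g g)" if "g > 0" for g
  by (rule exp_prodpow_integrable[OF b abs_chebnode Re1]) (use that k in auto)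
 have pt: "?g \<gamma> t + ?c * ?g (\<gamma> + 1) t = exp (Complex 1 t) * (prodpow b {..<k} (chebnode k q) (\<gamma> + 1) (Complex 1 t) * prodpow b {1..<k} (chebnode k q') (-1) (Complex 1 t))" for t
 proof -
  let ?s = "Complex 1 t"
  have s: "Re ?s > 0" "?s \<noteq> 0" by (auto simp: complex_eq_iff)
  have nz: "?s + \<i> * of_real b * of_real x \<noteq> 0" for x
  proof -
   have "Re (?s + \<i> * of_real b * of_real x) = 1" by simp
   thus ?thesis by (metis zero_complex.simps(1) zero_neq_one)
  qed
  define w where "w = - \<i> * of_real b / (2 * ?s)"
  have f: "?s * (1 - 2 * w * x) = ?s + \<i> * of_real b * x" for x using s by (simp add: w_def field_simps)
  have F: "?s ^ k * (\<Prod>l<k. 1 - 2 * w * of_real (chebnode k q l)) = (\<Prod>l<k. ?s + \<i> * of_real b * of_real (chebnode k q l))" for q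
   unfolding f[symmetric] prod.distrib by simp
  have "?s * w = - \<i> * of_real b / 2" using s by (simp add: w_def)
  hence "(?s * w) ^ k = (- \<i> * of_real b / 2) ^ k" by (simp only:)
  moreover have "(- \<i> * of_real b / 2) ^ k = (- \<i> * of_real b) ^ k * inverse (2 ^ k)" by (subst power_divide) (rule divide_inverse)
  ultimately have W: "?s ^ k * w ^ k = (- \<i> * of_real b) ^ k * inverse (2 ^ k)" by (simp only: power_mult_distrib)
  have "2 powr (1 - real k) = 2 * inverse (2 ^ k)" by (simp add: powr_diff powr_realpow divide_inverse)
  hence two: "of_real (2 powr (1 - real k)) = 2 * inverse (2 ^ k :: complex)" by simp
  have "?s ^ k * (2 * w ^ k * e) = 2 * (?s ^ k * w ^ k) * e" for e by (simp only: mult_ac)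
  hence "?s ^ k * (2 * w ^ k * e) = 2 * inverse (2 ^ k) * (- \<i> * of_real b) ^ k * e" for e
   unfolding W by (simp only: mult_ac)
  hence C: "?c = ?s ^ k * (2 * w ^ k * of_real (cos q - cos q'))" unfolding two by (rule sym)
  have "(\<Prod>l<k. ?s + \<i> * of_real b * of_real (chebnode k q l)) + ?c = ?s ^ k * ((\<Prod>l<k. 1 - 2 * w * of_real (chebnode k q l)) + 2 * w ^ k * of_real (cos q - cos q'))"
   unfolding C distrib_left F ..
  also have "\<dots> = (\<Prod>l<k. ?s + \<i> * of_real b * of_real (chebnode k q' l))"
   unfolding chebnode_def prod_cos_shift[OF k] F[unfolded chebnode_def] ..
  also have "{..<k} = insert 0 {1..<k}" using k by auto
  also have "(\<Prod>l\<in>insert 0 {1..<k}. ?s + \<i> * of_real b * of_real (chebnode k q' l))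
   = (?s + \<i> * of_real b * of_real (Re (\<omega> * cnj \<eta>))) * (\<Prod>l\<in>{1..<k}. ?s + \<i> * of_real b * of_real (chebnode k q' l))"
   unfolding \<omega> by (subst prod.insert) (simp_all add: chebnode_def)
  finally have A: "(\<Prod>l\<in>insert 0 {1..<k}. ?s + \<i> * of_real b * of_real (chebnode k q l)) + ?c
   = (?s + \<i> * of_real b * of_real (Re (\<omega> * cnj \<eta>))) * (\<Prod>l\<in>{1..<k}. ?s + \<i> * of_real b * of_real (chebnode k q' l))" .
  have I: "insert 0 {1..<k} = {..<k}" using k by auto
  have P1: "?P ?s * (?s + \<i> * of_real b * of_real (Re (\<omega> * cnj \<eta>))) = 1"
   using nz[of "Re (\<omega> * cnj \<eta>)"] unfolding prodpow_def
   by (simp only: of_real_1 prod.insert prod.empty finite.emptyI empty_iff not_False_eq_True mult_1_right powr_minus_one left_inverse)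
  have M: "prodpow b {1..<k} (chebnode k q') (-1) ?s = (\<Prod>l\<in>{1..<k}. ?s + \<i> * of_real b * of_real (chebnode k q' l))"
  proof -
   have "z powr (- of_real (-1)) = z" if "z \<noteq> 0" for z :: complex using that by (simp add: powr_def exp_Ln)
   thus ?thesis unfolding prodpow_def using nz by (intro prod.cong refl) blast
  qed
  have "?g \<gamma> t + ?c * ?g (\<gamma> + 1) t = exp ?s * (prodpow b {..<k} (chebnode k q) (\<gamma> + 1) ?s * (?P ?s * ((\<Prod>l<k. ?s + \<i> * of_real b * of_real (chebnode k q l)) + ?c)))"
   unfolding prodpow_Suc[OF s(1), of b "{..<k}" "chebnode k q" \<gamma>] by (simp only: distrib_left mult_ac)
  also have "?P ?s * ((\<Prod>l<k. ?s + \<i> * of_real b * of_real (chebnode k q l)) + ?c) = prodpow b {1..<k} (chebnode k q') (-1) ?s"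
   unfolding A[unfolded I] M mult.assoc[symmetric] P1 by (rule mult_1)
  finally show ?thesis .
 qed
 have "(LINT t|lborel. ?g \<gamma> t + ?c * ?g (\<gamma> + 1) t) = (LINT t|lborel. ?g \<gamma> t) + ?c * (LINT t|lborel. ?g (\<gamma> + 1) t)"
  by (subst Bochner_Integration.integral_add) (use i[of \<gamma>] i[of "\<gamma> + 1"] \<gamma> in \<open>auto intro: integrable_mult_right\<close>)
 thus ?thesis unfolding h_fun_prodpow pt by (simp only: distrib_left mult_ac)
qed

subsection \<open>Power series identities\<close>

text \<open>Near 1 the principal power is multiplicative; each induction step keeps one factor and
  the remaining product within distance 1 of 1.\<close>

lemma eventually_prod_powr:
 fixes f :: "'i \<Rightarrow> complex \<Rightarrow> complex"
 assumes "finite L" "\<And>l. l \<in> L \<Longrightarrow> (f l \<longlongrightarrow> 1) F"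
 shows "eventually (\<lambda>z. (\<Prod>l\<in>L. f l z) powr a = (\<Prod>l\<in>L. f l z powr a)) F"
 using assms
proof (induction L rule: finite_induct)
 case empty thus ?case by simp
next
 case (insert i L)
 have 1: "(f i \<longlongrightarrow> 1) F" using insert by blast
 have 2: "((\<lambda>z. \<Prod>l\<in>L. f l z) \<longlongrightarrow> (\<Prod>l\<in>L. 1)) F" using insert by (intro tendsto_prod) auto
 have "eventually (\<lambda>z. dist (f i z) 1 < 1) F" "eventually (\<lambda>z. dist (\<Prod>l\<in>L. f l z) 1 < 1) F"
  using tendstoD[OF 1, of 1] tendstoD[OF 2, of 1] by simp_all
 moreover have "eventually (\<lambda>z. (\<Prod>l\<in>L. f l z) powr a = (\<Prod>l\<in>L. f l z powr a)) F" using insert by blast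
 ultimately show ?case
 proof eventually_elim
  case (elim z)
  have "\<bar>Re (f i z - 1)\<bar> < 1" using abs_Re_le_cmod[of "f i z - 1"] elim(1) by (simp add: dist_norm)
  hence r: "Re (f i z) > 0" by simp
  have n: "norm ((\<Prod>l\<in>L. f l z) - 1) < 1" using elim(2) by (simp add: dist_norm)
  from powr_split_halfplane[OF r n, of a] show ?case using insert(1,2) elim(3) by simp
 qed
qed

lemma fps_compose_power_X_nth:
 assumes "k > 0"
 shows "fps_nth (C oo fps_X ^ k) n = (if k dvd n then fps_nth C (n div k) else (0::complex))"
proof -
 have "fps_nth (C oo fps_X ^ k) n = (\<Sum>i=0..n. fps_nth C i * (if n = k * i then 1 else 0))"
  unfolding fps_compose_nth power_mult[symmetric] by (simp add: fps_X_power_nth)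
 also have "\<dots> = (\<Sum>i\<in>{0..n}. if i = n div k \<and> k dvd n then fps_nth C i else 0)"
  using assms by (intro sum.cong refl) auto
 also have "\<dots> = (if k dvd n then fps_nth C (n div k) else 0)" by (simp add: sum.delta)
 finally show ?thesis .
qed

lemma has_fps_binomial_square:
 "(\<lambda>r::complex. (1 + r\<^sup>2) powr c) has_fps_expansion (fps_binomial c oo fps_X ^ 2)"
proof -
 have "(\<lambda>x::complex. x ^ 2) has_fps_expansion fps_X ^ 2" by (intro fps_expansion_intros)
 from has_fps_expansion_compose[OF has_fps_expansion_binomial_complex this, of c]
 show ?thesis by (simp add: o_def)
qed

lemma fps_binomial_square_power:
 "(fps_binomial c oo fps_X ^ 2) * (fps_binomial (-1) oo fps_X ^ 2) ^ n = (fps_binomial (c - of_nat n) oo (fps_X ^ 2 :: complex fps))"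
proof (induction n)
 case (Suc n)
 have "(fps_binomial c oo fps_X ^ 2) * (fps_binomial (-1) oo fps_X ^ 2) ^ Suc n
  = (fps_binomial (c - of_nat n) oo fps_X ^ 2) * (fps_binomial (-1) oo (fps_X ^ 2 :: complex fps))"
  unfolding Suc[symmetric] by (simp only: power_Suc mult_ac)
 also have "\<dots> = (fps_binomial (c - of_nat n) * fps_binomial (-1)) oo fps_X ^ 2"
  by (rule fps_compose_mult_distrib[symmetric]) simp
 also have "fps_binomial (c - of_nat n) * fps_binomial (-1) = fps_binomial (c - of_nat (Suc n))"
  unfolding fps_binomial_add_mult[symmetric] by (simp add: algebra_simps)
 finally show ?case .
qed simp

text \<open>With W = r/(1 + r^2) as a formal series, W^n (1 + r^2)^c = r^n (1 + r^2)^(c-n), so each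
  coefficient of \<open>D\<close> contributes one binomial series in r^2.\<close>

lemma fps_nth_joukowski:
 fixes D :: "complex fps" and c :: complex
 shows "fps_nth ((fps_binomial c oo fps_X ^ 2) * (D oo (fps_X * (fps_binomial (-1) oo fps_X ^ 2)))) J
  = (\<Sum>i\<le>J div 2. ((c - of_nat (J - 2 * i)) gchoose i) * fps_nth D (J - 2 * i))"
proof -
 let ?W = "fps_X * (fps_binomial (-1) oo fps_X ^ 2) :: complex fps" and ?B = "fps_binomial c oo fps_X ^ 2 :: complex fps"
 have W0: "fps_nth (?W ^ n) j = 0" if "j < n" for n j
  using that by (simp add: power_mult_distrib fps_X_power_mult_nth)
 have "fps_nth (?B * (D oo ?W)) J = (\<Sum>j=0..J. fps_nth ?B (J - j) * (\<Sum>n=0..j. fps_nth D n * fps_nth (?W ^ n) j))"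
  unfolding mult.commute[of ?B] fps_mult_nth fps_compose_nth by (intro sum.cong refl) (simp only: mult.commute)
 also have "\<dots> = (\<Sum>j=0..J. fps_nth ?B (J - j) * (\<Sum>n=0..J. fps_nth D n * fps_nth (?W ^ n) j))"
  by (intro sum.cong refl arg_cong2[where f="(*)"] sum.mono_neutral_left) (auto simp: W0)
 also have "\<dots> = (\<Sum>n=0..J. fps_nth D n * (\<Sum>j=0..J. fps_nth (?W ^ n) j * fps_nth ?B (J - j)))"
  unfolding sum_distrib_left by (subst sum.swap) (simp only: mult_ac)
 also have "\<dots> = (\<Sum>n=0..J. fps_nth D n * fps_nth (fps_X ^ n * (fps_binomial (c - of_nat n) oo fps_X ^ 2)) J)"
 proof (intro sum.cong refl arg_cong2[where f="(*)"])
  fix n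
  have "?W ^ n * ?B = fps_X ^ n * (fps_binomial (c - of_nat n) oo fps_X ^ 2)"
   unfolding fps_binomial_square_power[symmetric] by (simp only: power_mult_distrib mult_ac)
  thus "(\<Sum>j=0..J. fps_nth (?W ^ n) j * fps_nth ?B (J - j)) = fps_nth (fps_X ^ n * (fps_binomial (c - of_nat n) oo fps_X ^ 2)) J"
   unfolding fps_mult_nth[symmetric] by (simp only:)
 qed
 also have "\<dots> = (\<Sum>n=0..J. if even (J - n) then ((c - of_nat n) gchoose ((J - n) div 2)) * fps_nth D n else 0)"
  by (intro sum.cong refl) (auto simp: fps_X_power_mult_nth fps_compose_power_X_nth)
 also have "\<dots> = (\<Sum>n\<in>{n\<in>{0..J}. even (J - n)}. ((c - of_nat n) gchoose ((J - n) div 2)) * fps_nth D n)"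
  by (rule sum.inter_filter[symmetric]) simp
 also have "\<dots> = (\<Sum>i\<le>J div 2. ((c - of_nat (J - 2 * i)) gchoose i) * fps_nth D (J - 2 * i))"
 proof (rule sum.reindex_bij_witness[where i="\<lambda>i. J - 2 * i" and j="\<lambda>n. (J - n) div 2"])
  fix n assume "n \<in> {n \<in> {0..J}. even (J - n)}"
  hence e: "J - 2 * ((J - n) div 2) = n" by auto
  show "J - 2 * ((J - n) div 2) = n" by (rule e)
  show "(c - of_nat (J - 2 * ((J - n) div 2)) gchoose ((J - n) div 2)) * fps_nth D (J - 2 * ((J - n) div 2))
   = (c - of_nat n gchoose ((J - n) div 2)) * fps_nth D n" unfolding e ..
 qed auto
 finally show ?thesis .
qed

text \<open>The Gegenbauer polynomial of degree \<open>N\<close> and parameter \<gamma> + 1, with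
  generating function (1 - 2xr + r^2)^(-\<gamma>-1).\<close>

definition Cpol :: "real \<Rightarrow> nat \<Rightarrow> real \<Rightarrow> real" where
 "Cpol \<gamma> N x = (\<Sum>q\<le>N div 2. (-1) ^ q * pochhammer (\<gamma> + 1) (N - q) * 2 ^ (N - 2 * q) / (fact q * fact (N - 2 * q)) * x ^ (N - 2 * q))"

lemma fps_nth_quadratic_power:
 fixes c :: complex
 assumes "i \<le> N"
 shows "fps_nth ((fps_X ^ 2 - fps_const c * fps_X) ^ i) N = of_nat (i choose (N - i)) * (- c) ^ (i - (N - i))"
proof -
 have "fps_X ^ 2 - fps_const c * fps_X = fps_X * (fps_X + fps_const (- c))" by (simp add: algebra_simps power2_eq_square fps_const_neg[symmetric] del: fps_const_neg)
 hence "fps_nth ((fps_X ^ 2 - fps_const c * fps_X) ^ i) N = fps_nth ((fps_X + fps_const (- c)) ^ i) (N - i)"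
  using assms by (simp only: power_mult_distrib fps_X_power_mult_nth) simp
 also have "(fps_X + fps_const (- c)) ^ i = (\<Sum>l\<le>i. of_nat (i choose l) * fps_X ^ l * fps_const (- c) ^ (i - l))"
  by (rule binomial_ring)
 also have "fps_nth \<dots> (N - i) = (\<Sum>l\<le>i. if l = N - i then of_nat (i choose l) * (- c) ^ (i - l) else 0)"
  unfolding fps_sum_nth
 proof (intro sum.cong refl)
  fix l
  have "of_nat (i choose l) * fps_X ^ l * fps_const (- c) ^ (i - l) = fps_const (of_nat (i choose l) * (- c) ^ (i - l)) * fps_X ^ l"
   by (simp add: fps_of_nat[symmetric] fps_const_power fps_const_mult[symmetric] mult_ac del: fps_const_mult)
  thus "fps_nth (of_nat (i choose l) * fps_X ^ l * fps_const (- c) ^ (i - l)) (N - i) = (if l = N - i then of_nat (i choose l) * (- c) ^ (i - l) else 0)"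
   by (simp only: fps_mult_left_const_nth fps_X_power_nth) simp
 qed
 also have "\<dots> = of_nat (i choose (N - i)) * (- c) ^ (i - (N - i))" by (auto simp: sum.delta binomial_eq_0)
 finally show ?thesis .
qed

lemma fps_nth_Cpol:
 "fps_nth (fps_binomial (- of_real (\<gamma> + 1)) oo (fps_X ^ 2 - fps_const (of_real (2 * x)) * fps_X)) N = complex_of_real (Cpol \<gamma> N x)"
proof -
 let ?a = "- of_real (\<gamma> + 1) :: complex" and ?c = "of_real (2 * x) :: complex"
 let ?t = "\<lambda>i. (?a gchoose i) * (of_nat (i choose (N - i)) * (- ?c) ^ (i - (N - i)))"
 have "fps_nth (fps_binomial ?a oo (fps_X ^ 2 - fps_const ?c * fps_X)) N = (\<Sum>i=0..N. ?t i)"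
  unfolding fps_compose_nth by (intro sum.cong refl) (simp only: fps_nth_quadratic_power fps_binomial_nth atLeastAtMost_iff)
 also have "\<dots> = (\<Sum>i\<in>{N - N div 2..N}. ?t i)"
  by (rule sum.mono_neutral_right) (auto simp: binomial_eq_0)
 also have "\<dots> = (\<Sum>q\<le>N div 2. ?t (N - q))"
  by (rule sum.reindex_bij_witness[where i="\<lambda>q. N - q" and j="\<lambda>i. N - i"]) auto
 also have "\<dots> = (\<Sum>q\<le>N div 2. of_real ((-1) ^ q * pochhammer (\<gamma> + 1) (N - q) * 2 ^ (N - 2 * q) / (fact q * fact (N - 2 * q)) * x ^ (N - 2 * q)))"
 proof (intro sum.cong refl)
  fix q assume q: "q \<in> {..N div 2}"
  hence e: "N - (N - q) = q" "N - q - q = N - 2 * q" "q \<le> N - q" by auto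
  have 1: "?a gchoose (N - q) = of_real ((-1) ^ (N - q) * pochhammer (\<gamma> + 1) (N - q) / fact (N - q))"
   unfolding gbinomial_pochhammer by (simp add: pochhammer_of_real[symmetric] add.commute)
  have 2: "of_nat ((N - q) choose q) = complex_of_real (fact (N - q) / (fact q * fact (N - 2 * q)))"
   using binomial_fact[OF e(3), where 'a=complex] e by simp
  have 3: "(- ?c) ^ (N - 2 * q) = of_real ((-1) ^ (N - 2 * q) * 2 ^ (N - 2 * q) * x ^ (N - 2 * q))"
   by (simp add: power_mult_distrib power_minus[of "2 * complex_of_real x"])
  have "even (N - q + (N - 2 * q) + q)" using q by auto
  hence "(-1::real) ^ (N - q + (N - 2 * q) + q) = 1" by simp
  hence "(-1::real) ^ (N - q) * (-1) ^ (N - 2 * q) * (-1) ^ q = 1" by (simp only: power_add)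
  hence "(-1::real) ^ (N - q) * (-1) ^ (N - 2 * q) * ((-1) ^ q * (-1) ^ q) = (-1) ^ q" by (simp only: mult.assoc[symmetric] mult_1)
  hence s: "(-1::real) ^ (N - q) * (-1) ^ (N - 2 * q) = (-1) ^ q" by (simp add: power_mult_distrib[symmetric])
  have "((-1) ^ (N - q) * pochhammer (\<gamma> + 1) (N - q) / fact (N - q)) * ((fact (N - q) / (fact q * fact (N - 2 * q))) * ((-1) ^ (N - 2 * q) * 2 ^ (N - 2 * q) * x ^ (N - 2 * q)))
   = ((-1) ^ (N - q) * (-1) ^ (N - 2 * q)) * pochhammer (\<gamma> + 1) (N - q) * 2 ^ (N - 2 * q) / (fact q * fact (N - 2 * q)) * x ^ (N - 2 * q)"
   by (simp add: mult_ac)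
  thus "?t (N - q) = of_real ((-1) ^ q * pochhammer (\<gamma> + 1) (N - q) * 2 ^ (N - 2 * q) / (fact q * fact (N - 2 * q)) * x ^ (N - 2 * q))"
   unfolding e 1 2 3 s by (simp only: of_real_mult[symmetric])
 qed
 finally show ?thesis unfolding Cpol_def of_real_sum .
qed

text \<open>The coefficient of r^J in the product of the two geometric sums of length k in r
  e^(i\<psi>) and r e^(-i\<psi>) with (1 - 2x r^k + r^(2k))^(-\<gamma>-1). The divisibility
  condition picks out the powers of r^k.\<close>

definition Spol :: "nat \<Rightarrow> real \<Rightarrow> real \<Rightarrow> nat \<Rightarrow> real \<Rightarrow> complex" where
 "Spol k \<gamma> \<psi> J x = (\<Sum>m<k. \<Sum>m'<k. if m + m' \<le> J \<and> k dvd (J - m - m')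
  then cis ((real m - real m') * \<psi>) * of_real (Cpol \<gamma> ((J - m - m') div k) x) else 0)"

lemma has_fps_geometric_sum:
 "(\<lambda>r::complex. \<Sum>m<k. (r * \<xi>) ^ m) has_fps_expansion (\<Sum>m<k. fps_const (\<xi> ^ m) * fps_X ^ m)"
proof (rule has_fps_expansion_sum)
 fix m
 have "(\<lambda>r::complex. \<xi> ^ m * r ^ m) has_fps_expansion fps_const (\<xi> ^ m) * fps_X ^ m" by (intro fps_expansion_intros)
 thus "(\<lambda>r::complex. (r * \<xi>) ^ m) has_fps_expansion fps_const (\<xi> ^ m) * fps_X ^ m" by (simp add: power_mult_distrib mult.commute)
qed

lemma fps_nth_Spol:
 assumes "k > 0"
 shows "fps_nth ((\<Sum>m<k. fps_const (cis \<psi> ^ m) * fps_X ^ m) * (\<Sum>m<k. fps_const (cis (- \<psi>) ^ m) * fps_X ^ m)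
  * ((fps_binomial (- of_real (\<gamma> + 1)) oo (fps_X ^ 2 - fps_const (of_real (2 * x)) * fps_X)) oo fps_X ^ k)) J = Spol k \<gamma> \<psi> J x"
proof -
 let ?C = "(fps_binomial (- of_real (\<gamma> + 1)) oo (fps_X ^ 2 - fps_const (of_real (2 * x)) * fps_X)) oo fps_X ^ k :: complex fps"
 have "(\<Sum>m<k. fps_const (cis \<psi> ^ m) * fps_X ^ m) * (\<Sum>m<k. fps_const (cis (- \<psi>) ^ m) * fps_X ^ m) * ?C
  = (\<Sum>m<k. \<Sum>m'<k. fps_const (cis ((real m - real m') * \<psi>)) * (fps_X ^ (m + m') * ?C))"
 proof -
  have E: "fps_const (cis \<psi> ^ m) * fps_X ^ m * (fps_const (cis (- \<psi>) ^ m') * fps_X ^ m') = fps_const (cis ((real m - real m') * \<psi>)) * fps_X ^ (m + m')" for m m'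
  proof -
   have "cis \<psi> ^ m * cis (- \<psi>) ^ m' = cis ((real m - real m') * \<psi>)" by (simp add: Complex.DeMoivre cis_mult algebra_simps)
   hence "fps_const (cis ((real m - real m') * \<psi>)) = fps_const (cis \<psi> ^ m) * fps_const (cis (- \<psi>) ^ m')" by (simp only: fps_const_mult)
   thus ?thesis by (simp only: power_add mult_ac)
  qed
  have "fps_const (cis \<psi> ^ m) * fps_X ^ m * (fps_const (cis (- \<psi>) ^ m') * fps_X ^ m') * ?C
   = fps_const (cis ((real m - real m') * \<psi>)) * (fps_X ^ (m + m') * ?C)" for m m'
   unfolding E by (rule mult.assoc)
  thus ?thesis unfolding sum_product unfolding sum_distrib_right by (simp only:)
 qed
 hence "fps_nth ((\<Sum>m<k. fps_const (cis \<psi> ^ m) * fps_X ^ m) * (\<Sum>m<k. fps_const (cis (- \<psi>) ^ m) * fps_X ^ m) * ?C) J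
  = (\<Sum>m<k. \<Sum>m'<k. cis ((real m - real m') * \<psi>) * fps_nth (fps_X ^ (m + m') * ?C) J)"
  by (simp only: fps_sum_nth fps_mult_left_const_nth)
 also have "\<dots> = Spol k \<gamma> \<psi> J x"
  unfolding Spol_def fps_X_power_mult_nth fps_compose_power_X_nth[OF assms] fps_nth_Cpol
  by (intro sum.cong refl) (auto simp: diff_diff_eq)
 finally show ?thesis .
qed

text \<open>The full product is (1 - z^k)(1 - z'^k), and the factor l = 0 is (1 - z)(1 - z'); the
  quotient consists of two geometric sums. The bound on \<open>r\<close> excludes z = 1 and z' =
  1.\<close>

lemma prod_chebnode_tail:
 fixes r :: complex
 assumes k: "k > 0" and nz: "norm r < 1"
 shows "(\<Prod>l\<in>{1..<k}. 1 + r\<^sup>2 - 2 * r * of_real (chebnode k q' l)) = (\<Sum>m<k. (r * cis (q' / real k)) ^ m) * (\<Sum>m<k. (r * cis (- (q' / real k))) ^ m)"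
proof -
 let ?z = "r * cis (q' / real k)" and ?z' = "r * cis (- (q' / real k))"
 have n: "?z \<noteq> 1" "?z' \<noteq> 1" using nz by (metis norm_mult norm_cis mult_1_right norm_one less_irrefl)+
 have zk: "?z ^ k = r ^ k * cis q'" "?z' ^ k = r ^ k * cis (- q')" using k by (simp_all add: power_mult_distrib Complex.DeMoivre)
 have E: "(1 - a * cis t) * (1 - a * cis (- t)) = 1 + a\<^sup>2 - 2 * a * of_real (cos t)" for a t
 proof -
  have P: "cis t + cis (- t) = 2 * of_real (cos t)" by (simp add: complex_eq_iff)
  have Q: "cis t * cis (- t) = 1" by (simp add: cis_mult)
  have R: "(1 - a * u) * (1 - a * v) = 1 + a\<^sup>2 * (u * v) - a * (u + v)" for u v by (simp add: algebra_simps power2_eq_square)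
  show ?thesis unfolding R P Q by (simp add: mult_ac)
 qed
 have I: "{..<k} = insert 0 {1..<k}" using k by auto
 have "(1 - ?z) * (1 - ?z') * (\<Prod>l\<in>{1..<k}. 1 + r\<^sup>2 - 2 * r * of_real (chebnode k q' l)) = (\<Prod>l<k. 1 + r\<^sup>2 - 2 * r * of_real (chebnode k q' l))"
  unfolding I E by (subst prod.insert) (simp_all add: chebnode_def)
 also have "\<dots> = 1 + (r ^ k)\<^sup>2 - 2 * r ^ k * of_real (cos q')"
  unfolding chebnode_def prod_quadratic_cos[OF k] by (simp add: power_mult[symmetric] mult.commute)
 also have "\<dots> = (1 - ?z ^ k) * (1 - ?z' ^ k)" unfolding zk E ..
 also have "\<dots> = (1 - ?z) * (1 - ?z') * ((\<Sum>m<k. ?z ^ m) * (\<Sum>m<k. ?z' ^ m))"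
  unfolding one_diff_power_eq[of ?z k] one_diff_power_eq[of ?z' k] by (simp only: mult_ac)
 finally show ?thesis using n by simp
qed

text \<open>Near 0 the generating function of \<open>Spol\<close> equals (1 + r^2)^c times
  \<open>Dgen\<close> at r/(1 + r^2). Both sides are expanded as power series in r and their
  coefficients compared.\<close>

theorem Spol_dcoef:
 assumes k: "k > 0" and \<gamma>: "\<gamma> \<ge> 0"
 shows "Spol k \<gamma> (q' / real k) J (cos q) = (\<Sum>i\<le>J div 2. ((-1) ^ i * ((real (J - i) + real k * \<gamma>) gchoose i)) *\<^sub>R dcoef {1..<k} (chebnode k q') {..<k} (chebnode k q) (\<gamma> + 1) (J - 2 * i))"
proof -
 let ?D = "Dgen {1..<k} (chebnode k q') {..<k} (chebnode k q) (\<gamma> + 1)"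
 let ?F = "fps_expansion ?D 0" and ?a = "- of_real (\<gamma> + 1) :: complex"
 \<comment> \<open>Taking a factor 1 + r^2 out of the k - 1 numerator factors and of the k factors
   of exponent -\<gamma> - 1 gives the exponent (k - 1) - k (\<gamma> + 1).\<close>
 define c :: complex where "c = - of_real (real k * \<gamma> + 1)"
 have DF: "?D has_fps_expansion ?F"
  by (rule has_fps_expansion_fps_expansion[OF open_ball _ Dgen_holomorphic[OF abs_chebnode]]) simp
 have Wf: "(\<lambda>r::complex. r * (1 + r\<^sup>2) powr (-1)) has_fps_expansion (fps_X * (fps_binomial (-1) oo fps_X ^ 2))"
  by (intro has_fps_expansion_mult has_fps_expansion_fps_X has_fps_binomial_square)
 have L: "(\<lambda>r. (1 + r\<^sup>2) powr c * (?D \<circ> (\<lambda>r. r * (1 + r\<^sup>2) powr (-1))) r) has_fps_expansion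
   (fps_binomial c oo fps_X ^ 2) * (?F oo (fps_X * (fps_binomial (-1) oo fps_X ^ 2)))"
  by (intro has_fps_expansion_mult has_fps_binomial_square has_fps_expansion_compose[OF DF Wf]) simp
 let ?q = "\<lambda>y::complex. y ^ 2 - of_real (2 * cos q) * y"
 have qf: "?q has_fps_expansion (fps_X ^ 2 - fps_const (of_real (2 * cos q)) * fps_X)" by (intro fps_expansion_intros)
 have Cf: "((\<lambda>x. (1 + x) powr ?a) \<circ> ?q) has_fps_expansion (fps_binomial ?a oo (fps_X ^ 2 - fps_const (of_real (2 * cos q)) * fps_X))"
  by (rule has_fps_expansion_compose[OF has_fps_expansion_binomial_complex qf]) (simp add: power2_eq_square)
 have kf: "(\<lambda>r::complex. r ^ k) has_fps_expansion fps_X ^ k" by (intro fps_expansion_intros)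
 have CK: "(((\<lambda>x. (1 + x) powr ?a) \<circ> ?q) \<circ> (\<lambda>r. r ^ k)) has_fps_expansion ((fps_binomial ?a oo (fps_X ^ 2 - fps_const (of_real (2 * cos q)) * fps_X)) oo fps_X ^ k)"
  by (rule has_fps_expansion_compose[OF Cf kf]) (use k in simp)
 let ?R = "\<lambda>r. (\<Sum>m<k. (r * cis (q' / real k)) ^ m) * (\<Sum>m<k. (r * cis (- (q' / real k))) ^ m) * (((\<lambda>x. (1 + x) powr ?a) \<circ> ?q) \<circ> (\<lambda>r. r ^ k)) r"
 have R: "?R has_fps_expansion ((\<Sum>m<k. fps_const (cis (q' / real k) ^ m) * fps_X ^ m) * (\<Sum>m<k. fps_const (cis (- (q' / real k)) ^ m) * fps_X ^ m)
  * ((fps_binomial ?a oo (fps_X ^ 2 - fps_const (of_real (2 * cos q)) * fps_X)) oo fps_X ^ k))"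
  by (intro has_fps_expansion_mult has_fps_geometric_sum CK)
 \<comment> \<open>For |r| < 1/4 both 1 + r^2 and the factors 1 - 2 w x stay in the right
   half-plane, so principal powers can be split; combining the k powers into one uses a possibly
   smaller neighbourhood.\<close>
 have ev: "eventually (\<lambda>r. (1 + r\<^sup>2) powr c * (?D \<circ> (\<lambda>r. r * (1 + r\<^sup>2) powr (-1))) r = ?R r) (nhds 0)"
 proof -
  have t: "((\<lambda>r::complex. 1 + r\<^sup>2 - 2 * r * of_real (chebnode k q l)) \<longlongrightarrow> 1 + 0\<^sup>2 - 2 * 0 * of_real (chebnode k q l)) (nhds 0)" for l
   by (intro tendsto_intros filterlim_ident)
  have e1: "eventually (\<lambda>r. (\<Prod>l<k. 1 + r\<^sup>2 - 2 * r * of_real (chebnode k q l)) powr ?a = (\<Prod>l<k. (1 + r\<^sup>2 - 2 * r * of_real (chebnode k q l)) powr ?a)) (nhds (0::complex))"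
   by (rule eventually_prod_powr) (use t in simp_all)
  have e2: "eventually (\<lambda>r::complex. r \<in> ball 0 (1/4)) (nhds 0)" by (rule eventually_nhds_in_open) auto
  from e1 e2 show ?thesis
  proof eventually_elim
   case (elim r)
   have nr: "norm r < 1/4" using elim by simp
   let ?s = "1 + r\<^sup>2"
   have nr2: "norm (r\<^sup>2) < 1/4"
   proof -
    have "norm (r\<^sup>2) \<le> norm r * 1" unfolding power2_eq_square norm_mult using nr by (intro mult_left_mono) auto
    thus ?thesis using nr by simp
   qed
   have sR: "Re ?s > 3/4" using abs_Re_le_cmod[of "r\<^sup>2"] nr2 by simp
   hence s0: "?s \<noteq> 0" by (metis zero_complex.simps(1) not_numeral_less_zero zero_less_divide_iff order.strict_trans zero_less_numeral less_irrefl)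
   have ns: "norm ?s > 3/4" using sR complex_Re_le_cmod[of ?s] by linarith
   define w where "w = r * ?s powr (-1)"
   have w: "w = r / ?s" using s0 by (simp only: w_def powr_minus_one[OF s0] divide_inverse)
   have ws: "?s * (1 - 2 * w * x) = 1 + r\<^sup>2 - 2 * r * x" for x using s0 by (simp add: w field_simps)
   have nw: "norm w < 1/2"
   proof -
    have "norm w = norm r / norm ?s" by (simp add: w norm_divide)
    also have "\<dots> < (1/4) / (3/4)" using nr ns by (intro frac_less) auto
    finally show ?thesis by simp
   qed
   have A: "(1 + r\<^sup>2 - 2 * r * of_real (chebnode k q l)) powr ?a = ?s powr ?a * (1 - 2 * w * of_real (chebnode k q l)) powr ?a" for l
   proof -
    have "norm (- (2 * w * complex_of_real (chebnode k q l))) < 1" using norm_2_mult_le[OF abs_chebnode, of w k q l] nw by simp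
    from powr_split_halfplane[OF _ this, of ?s ?a] sR
    have "(?s * (1 - 2 * w * of_real (chebnode k q l))) powr ?a = ?s powr ?a * (1 - 2 * w * of_real (chebnode k q l)) powr ?a" by simp
    thus ?thesis unfolding ws .
   qed
   have PL: "(\<Prod>l<k. (1 + r\<^sup>2 - 2 * r * of_real (chebnode k q l)) powr ?a) = (?s powr ?a) ^ k * (\<Prod>l<k. (1 - 2 * w * of_real (chebnode k q l)) powr ?a)"
    unfolding A prod.distrib by simp
   have PM: "(\<Prod>l\<in>{1..<k}. 1 + r\<^sup>2 - 2 * r * of_real (chebnode k q' l)) = ?s ^ (k - 1) * (\<Prod>l\<in>{1..<k}. 1 - 2 * w * of_real (chebnode k q' l))"
    unfolding ws[symmetric] prod.distrib by simp
   have sc: "?s ^ (k - 1) * (?s powr ?a) ^ k = ?s powr c"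
   proof -
    have 1: "(?s powr ?a) ^ k = exp (of_nat k * (?a * Ln ?s))" using s0 by (simp only: powr_def if_False exp_of_nat_mult[symmetric])
    have "exp (Ln ?s) = ?s" using s0 by simp
    hence 2: "?s ^ (k - 1) = exp (of_nat (k - 1) * Ln ?s)" by (simp only: exp_of_nat_mult)
    have 3: "of_nat (k - 1) * Ln ?s + of_nat k * (?a * Ln ?s) = c * Ln ?s" using k by (simp add: c_def of_nat_diff algebra_simps)
    show ?thesis unfolding 1 2 exp_add[symmetric] 3 using s0 by (simp only: powr_def if_False)
   qed
   have H: "(((\<lambda>x. (1 + x) powr ?a) \<circ> ?q) \<circ> (\<lambda>r. r ^ k)) r = (\<Prod>l<k. 1 + r\<^sup>2 - 2 * r * of_real (chebnode k q l)) powr ?a"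
   proof -
    have "1 + ?q (r ^ k) = 1 - 2 * r ^ k * of_real (cos q) + r ^ (2 * k)" by (simp add: power_mult[symmetric] mult_ac)
    thus ?thesis unfolding chebnode_def prod_quadratic_cos[OF k] o_def by (simp only:)
   qed
   have "?R r = (\<Prod>l\<in>{1..<k}. 1 + r\<^sup>2 - 2 * r * of_real (chebnode k q' l)) * (\<Prod>l<k. (1 + r\<^sup>2 - 2 * r * of_real (chebnode k q l)) powr ?a)"
    unfolding H elim(1) using prod_chebnode_tail[OF k, of r q'] nr by simp
   also have "\<dots> = ?s powr c * ?D w" unfolding PL PM Dgen_def sc[symmetric] by (simp only: mult_ac)
   finally show ?case unfolding w_def o_def by (rule sym)
  qed
 qed
 have eq: "(fps_binomial c oo fps_X ^ 2) * (?F oo (fps_X * (fps_binomial (-1) oo fps_X ^ 2)))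
  = (\<Sum>m<k. fps_const (cis (q' / real k) ^ m) * fps_X ^ m) * (\<Sum>m<k. fps_const (cis (- (q' / real k)) ^ m) * fps_X ^ m)
  * ((fps_binomial ?a oo (fps_X ^ 2 - fps_const (of_real (2 * cos q)) * fps_X)) oo fps_X ^ k)"
  by (rule fps_expansion_unique_complex[OF iffD1[OF has_fps_expansion_cong[OF ev refl] L] R])
 have "Spol k \<gamma> (q' / real k) J (cos q) = (\<Sum>i\<le>J div 2. ((c - of_nat (J - 2 * i)) gchoose i) * fps_nth ?F (J - 2 * i))"
  unfolding fps_nth_Spol[OF k, symmetric] eq[symmetric] by (rule fps_nth_joukowski)
 also have "\<dots> = (\<Sum>i\<le>J div 2. ((-1) ^ i * ((real (J - i) + real k * \<gamma>) gchoose i)) *\<^sub>R fps_nth ?F (J - 2 * i))"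
 proof (intro sum.cong refl)
  fix i assume "i \<in> {..J div 2}"
  hence i: "real (J - 2 * i) = real J - 2 * real i" "real (J - i) = real J - real i" by (auto simp: of_nat_diff)
  have "c - of_nat (J - 2 * i) = of_real (- (real k * \<gamma> + 1 + real (J - 2 * i)))" by (simp add: c_def)
  hence "(c - of_nat (J - 2 * i)) gchoose i = of_real ((- (real k * \<gamma> + 1 + real (J - 2 * i))) gchoose i)"
   by (simp add: gbinomial_prod_rev)
  \<comment> \<open>Negating the upper argument of the binomial coefficient brings the relation into
    the form required by \<open>catalan_inversion\<close> with K = k \<gamma>.\<close>
  also have "(- (real k * \<gamma> + 1 + real (J - 2 * i))) gchoose i = (-1) ^ i * ((real i - - (real k * \<gamma> + 1 + real (J - 2 * i)) - 1) gchoose i)"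
   by (rule gbinomial_negated_upper)
  also have "real i - - (real k * \<gamma> + 1 + real (J - 2 * i)) - 1 = real (J - i) + real k * \<gamma>" unfolding i by simp
  finally show "((c - of_nat (J - 2 * i)) gchoose i) * fps_nth ?F (J - 2 * i) = ((-1) ^ i * ((real (J - i) + real k * \<gamma>) gchoose i)) *\<^sub>R fps_nth ?F (J - 2 * i)"
   by (simp only: scaleR_conv_of_real)
 qed
 finally show ?thesis unfolding dcoef_def .
qed

subsection \<open>The measure of the Laplace-type representation\<close>

abbreviation jac :: "real \<Rightarrow> real \<Rightarrow> real" where
 "jac \<gamma> u \<equiv> (1 - u\<^sup>2) powr (\<gamma> - 1)"

text \<open>The substitution u = 2t - 1 gives 2 4^(\<gamma>-1) B(\<gamma>, \<gamma>), and Legendre's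
  duplication formula turns this into the normalizing constant of the measure.\<close>

lemma has_integral_one_minus_square_powr:
 fixes \<gamma> :: real
 assumes "\<gamma> > 0"
 shows "((\<lambda>u. jac \<gamma> u) has_integral Beta (1/2) \<gamma>) {-1..1}"
proof -
 have "((\<lambda>t. t powr (\<gamma> - 1) * (1 - t) powr (\<gamma> - 1)) has_integral Beta \<gamma> \<gamma>) (cbox 0 1)"
  using has_integral_Beta_real[OF assms assms] by simp
 from has_integral_affinity'[OF this, of "1/2" "1/2"]
 have 1: "((\<lambda>u. (u/2 + 1/2) powr (\<gamma> - 1) * (1 - (u/2 + 1/2)) powr (\<gamma> - 1)) has_integral (2 * Beta \<gamma> \<gamma>)) {-1..1}"
  by (simp add: mult.commute)
 have 2: "jac \<gamma> u = 4 powr (\<gamma> - 1) * ((u/2 + 1/2) powr (\<gamma> - 1) * (1 - (u/2 + 1/2)) powr (\<gamma> - 1))" if "u \<in> {-1..1}" for u :: real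
 proof -
  have "1 - u\<^sup>2 = 4 * ((u/2 + 1/2) * (1 - (u/2 + 1/2)))" by (simp add: algebra_simps power2_eq_square)
  hence "jac \<gamma> u = (4 * ((u/2 + 1/2) * (1 - (u/2 + 1/2)))) powr (\<gamma> - 1)" by (simp only:)
  also have "\<dots> = 4 powr (\<gamma> - 1) * ((u/2 + 1/2) * (1 - (u/2 + 1/2))) powr (\<gamma> - 1)" by (rule powr_mult)
  also have "((u/2 + 1/2) * (1 - (u/2 + 1/2))) powr (\<gamma> - 1) = (u/2 + 1/2) powr (\<gamma> - 1) * (1 - (u/2 + 1/2)) powr (\<gamma> - 1)" by (rule powr_mult)
  finally show ?thesis .
 qed
 have "((\<lambda>u. 4 powr (\<gamma> - 1) * ((u/2 + 1/2) powr (\<gamma> - 1) * (1 - (u/2 + 1/2)) powr (\<gamma> - 1))) has_integral 4 powr (\<gamma> - 1) * (2 * Beta \<gamma> \<gamma>)) {-1..1}"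
  by (rule has_integral_mult_right[OF 1])
 hence 3: "((\<lambda>u. jac \<gamma> u) has_integral 4 powr (\<gamma> - 1) * (2 * Beta \<gamma> \<gamma>)) {-1..1}"
  by (rule has_integral_eq[rotated]) (simp only: 2)
 have "4 powr (\<gamma> - 1) * (2 * Beta \<gamma> \<gamma>) = Beta (1/2) \<gamma>"
 proof -
  have nz: "Gamma \<gamma> \<noteq> 0" "Gamma (\<gamma> + 1/2) \<noteq> 0" "Gamma (2 * \<gamma>) \<noteq> 0"
   using assms Gamma_real_pos[of \<gamma>] Gamma_real_pos[of "\<gamma> + 1/2"] Gamma_real_pos[of "2 * \<gamma>"] by linarith+
  have "\<gamma> \<notin> \<int>\<^sub>\<le>\<^sub>0" "\<gamma> + 1/2 \<notin> \<int>\<^sub>\<le>\<^sub>0" using assms by (auto elim!: nonpos_Ints_cases)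
  hence "complex_of_real \<gamma> \<notin> \<int>\<^sub>\<le>\<^sub>0" "complex_of_real (\<gamma> + 1/2) \<notin> \<int>\<^sub>\<le>\<^sub>0"
   by (simp_all only: of_real_in_nonpos_Ints_iff not_False_eq_True)
  moreover have "complex_of_real (\<gamma> + 1/2) = complex_of_real \<gamma> + 1/2" by simp
  ultimately have "complex_of_real \<gamma> \<notin> \<int>\<^sub>\<le>\<^sub>0" "complex_of_real \<gamma> + 1/2 \<notin> \<int>\<^sub>\<le>\<^sub>0" by (simp_all only: simp_thms)
  from Gamma_legendre_duplication[OF this]
  have "complex_of_real (Gamma \<gamma> * Gamma (\<gamma> + 1/2)) = of_real (exp ((1 - 2 * \<gamma>) * ln 2) * sqrt pi * Gamma (2 * \<gamma>))"
   by (simp add: Gamma_complex_of_real[symmetric] exp_of_real[symmetric] Ln_of_real[symmetric])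
  hence "Gamma \<gamma> * Gamma (\<gamma> + 1/2) = exp ((1 - 2 * \<gamma>) * ln 2) * sqrt pi * Gamma (2 * \<gamma>)"
   by (simp only: of_real_eq_iff)
  also have "exp ((1 - 2 * \<gamma>) * ln 2) = 2 powr (1 - 2 * \<gamma>)" by (simp add: powr_def)
  finally have G: "Gamma \<gamma> * Gamma (\<gamma> + 1/2) = 2 powr (1 - 2 * \<gamma>) * sqrt pi * Gamma (2 * \<gamma>)" .
  have "4 powr (\<gamma> - 1) = (2 powr 2) powr (\<gamma> - 1)" by simp
  also have "\<dots> = 2 powr (2 * (\<gamma> - 1))" by (rule powr_powr)
  finally have "4 powr (\<gamma> - 1) * (2 * 2 powr (1 - 2 * \<gamma>)) = 2 * (2 powr (2 * (\<gamma> - 1)) * 2 powr (1 - 2 * \<gamma>))" by simp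
  also have "\<dots> = 2 * 2 powr (-1)" unfolding powr_add[symmetric] by (simp add: algebra_simps)
  finally have f: "4 powr (\<gamma> - 1) * (2 * 2 powr (1 - 2 * \<gamma>)) = 1" by (simp add: powr_minus)
  have "4 powr (\<gamma> - 1) * (2 * Beta \<gamma> \<gamma>) * (Gamma (\<gamma> + 1/2) * Gamma (2 * \<gamma>)) = 4 powr (\<gamma> - 1) * 2 * Gamma \<gamma> * (Gamma \<gamma> * Gamma (\<gamma> + 1/2))"
   using nz unfolding Beta_def by (simp add: mult_2[symmetric] field_simps)
  also have "\<dots> = (4 powr (\<gamma> - 1) * (2 * 2 powr (1 - 2 * \<gamma>))) * (sqrt pi * Gamma \<gamma>) * Gamma (2 * \<gamma>)" unfolding G by (simp only: mult_ac)
  also have "\<dots> = Beta (1/2) \<gamma> * (Gamma (\<gamma> + 1/2) * Gamma (2 * \<gamma>))"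
   unfolding f using nz by (simp add: Beta_def Gamma_one_half_real add.commute)
  finally show ?thesis using nz by simp
 qed
 with 3 show ?thesis by (simp only:)
qed

lemma continuous_one_minus_square_powr: "\<gamma> > 0 \<Longrightarrow> continuous_on {-1..1} (\<lambda>u::real. (1 - u\<^sup>2) powr \<gamma>)"
 by (intro continuous_on_powr' continuous_intros) (auto simp: abs_square_le_1)

lemma set_integrable_one_minus_square_powr:
 fixes \<gamma> :: real and f :: "real \<Rightarrow> complex"
 assumes g: "\<gamma> > 0" and f: "continuous_on {-1..1} f"
 shows "set_integrable lborel {-1..1} (\<lambda>u. jac \<gamma> u *\<^sub>R f u)"
proof -
 let ?w = "\<lambda>u. indicator {-1..1} u *\<^sub>R jac \<gamma> u"
 have "(\<lambda>u::real. jac \<gamma> u) absolutely_integrable_on {-1..1}"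
  by (rule nonnegative_absolutely_integrable_1) (use has_integral_one_minus_square_powr[OF g] in \<open>auto simp: integrable_on_def\<close>)
 hence "integrable lborel (\<lambda>u::real. indicator {-1..1} u *\<^sub>R jac \<gamma> u)"
  unfolding set_integrable_def by (subst (asm) integrable_completion) (simp_all)
 hence w: "integrable lborel (\<lambda>u::real. indicator {-1..1} u *\<^sub>R jac \<gamma> u)" .
 obtain B where "\<forall>z\<in>f ` {-1..1}. norm z \<le> B"
  using compact_imp_bounded[OF compact_continuous_image[OF f compact_Icc]] unfolding bounded_iff by blast
 hence B: "\<And>u. u \<in> {-1..1} \<Longrightarrow> norm (f u) \<le> B" by blast
 have m: "(\<lambda>u. indicator {-1..1} u *\<^sub>R f u) \<in> borel_measurable borel"
  by (rule borel_measurable_continuous_on_indicator[OF _ f]) simp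
 have "integrable lborel (\<lambda>u. ?w u *\<^sub>R (indicator {-1..1} u *\<^sub>R f u))"
 proof (rule Bochner_Integration.integrable_bound)
  show "integrable lborel (\<lambda>u. B * ?w u)" using w by simp
  show "(\<lambda>u. ?w u *\<^sub>R (indicator {-1..1} u *\<^sub>R f u)) \<in> borel_measurable lborel"
   using m by measurable
  show "AE u in lborel. norm (?w u *\<^sub>R (indicator {-1..1} u *\<^sub>R f u))
   \<le> norm (B * ?w u)"
  proof (rule AE_I2)
   fix u :: real
   show "norm (?w u *\<^sub>R (indicator {-1..1} u *\<^sub>R f u))
    \<le> norm (B * ?w u)"
   proof (cases "u \<in> {-1..1}")
    case True
    hence "norm (f u) \<le> \<bar>B\<bar>" using B[OF True] by linarith
    hence "jac \<gamma> u * norm (f u) \<le> jac \<gamma> u * \<bar>B\<bar>" by (intro mult_left_mono) auto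
    thus ?thesis using True by (simp add: abs_mult mult.commute)
   qed simp
  qed
 qed
 moreover have "?w u *\<^sub>R (indicator {-1..1} u *\<^sub>R f u)
  = indicator {-1..1} u *\<^sub>R (jac \<gamma> u *\<^sub>R f u)" for u by (simp add: indicator_def)
 ultimately show ?thesis unfolding set_integrable_def by (simp only:)
qed

lemma mu_int_alt:
 "mu_int \<gamma> f = set_lebesgue_integral lborel {-1..1} (\<lambda>u. jac \<gamma> u *\<^sub>R (of_real (inverse (Beta (1/2) \<gamma>) * (1 + u)) * f u))"
 unfolding mu_int_def by (simp add: scaleR_conv_of_real mult_ac)

lemma mu_int_integrable:
 fixes f :: "real \<Rightarrow> complex"
 assumes g: "\<gamma> > 0" and f: "continuous_on {-1..1} f"
 shows "set_integrable lborel {-1..1} (\<lambda>u. jac \<gamma> u *\<^sub>R (of_real (inverse (Beta (1/2) \<gamma>) * (1 + u)) * f u))"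
 by (rule set_integrable_one_minus_square_powr[OF g]) (intro continuous_intros f)

lemma mu_int_add_cmult:
 assumes g: "\<gamma> > 0" and f: "continuous_on {-1..1} f" "continuous_on {-1..1} h"
 shows "mu_int \<gamma> (\<lambda>u. a * f u + h u) = a * mu_int \<gamma> f + mu_int \<gamma> h"
proof -
 let ?w = "\<lambda>f u. jac \<gamma> u *\<^sub>R (of_real (inverse (Beta (1/2) \<gamma>) * (1 + u)) * f u)"
 have "mu_int \<gamma> (\<lambda>u. a * f u + h u) = set_lebesgue_integral lborel {-1..1} (\<lambda>u. a * ?w f u + ?w h u)"
  unfolding mu_int_alt by (simp add: scaleR_conv_of_real algebra_simps)
 also have "\<dots> = set_lebesgue_integral lborel {-1..1} (\<lambda>u. a * ?w f u) + set_lebesgue_integral lborel {-1..1} (?w h)"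
  by (rule set_integral_add(2)) (intro set_integrable_mult_right mu_int_integrable g f)+
 finally show ?thesis by (simp only: set_integral_mult_right mu_int_alt)
qed

lemma mu_int_sum:
 assumes g: "\<gamma> > 0" and f: "\<And>i. i \<in> A \<Longrightarrow> continuous_on {-1..1} (f i)" and A: "finite A"
 shows "mu_int \<gamma> (\<lambda>u. \<Sum>i\<in>A. a i * f i u) = (\<Sum>i\<in>A. a i * mu_int \<gamma> (f i))"
 using A f
proof (induction A rule: finite_induct)
 case empty thus ?case by (simp add: mu_int_def set_lebesgue_integral_def)
next
 case (insert i A)
 have "mu_int \<gamma> (\<lambda>u. a i * f i u + (\<Sum>i\<in>A. a i * f i u)) = a i * mu_int \<gamma> (f i) + mu_int \<gamma> (\<lambda>u. \<Sum>i\<in>A. a i * f i u)"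
  by (rule mu_int_add_cmult[OF g]) (use insert in \<open>auto intro!: continuous_intros\<close>)
 with insert show ?case by simp
qed

lemma mu_int_bound:
 assumes g: "\<gamma> > 0"
 obtains C where "C \<ge> 0" "\<And>(f :: real \<Rightarrow> complex) B. continuous_on {-1..1} f \<Longrightarrow> (\<And>u. u \<in> {-1..1} \<Longrightarrow> norm (f u) \<le> B) \<Longrightarrow> norm (mu_int \<gamma> f) \<le> C * B"
proof -
 let ?w = "\<lambda>f u. jac \<gamma> u *\<^sub>R (of_real (inverse (Beta (1/2) \<gamma>) * (1 + u)) * f u) :: complex"
 define C where "C = (LINT u|lborel. norm (indicator {-1..1} u *\<^sub>R ?w (\<lambda>_. 1) u))"
 have i: "integrable lborel (\<lambda>u. norm (indicator {-1..1} u *\<^sub>R ?w (\<lambda>_. 1) u))"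
  using mu_int_integrable[OF g, of "\<lambda>_. 1"] unfolding set_integrable_def by (intro integrable_norm) (simp only: continuous_on_const simp_thms)
 show ?thesis
 proof (rule that)
  show "C \<ge> 0" unfolding C_def by (intro integral_nonneg_AE) simp
  fix f :: "real \<Rightarrow> complex" and B assume f: "continuous_on {-1..1} f" and B: "\<And>u. u \<in> {-1..1} \<Longrightarrow> norm (f u) \<le> B"
  have j: "integrable lborel (\<lambda>u. indicator {-1..1} u *\<^sub>R ?w f u)"
   using mu_int_integrable[OF g f] unfolding set_integrable_def .
  have "norm (mu_int \<gamma> f) \<le> (LINT u|lborel. norm (indicator {-1..1} u *\<^sub>R ?w f u))"
   unfolding mu_int_alt set_lebesgue_integral_def by (rule integral_norm_bound)
  also have "\<dots> \<le> (LINT u|lborel. norm (indicator {-1..1} u *\<^sub>R ?w (\<lambda>_. 1) u) * B)"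
  proof (rule integral_mono)
   show "integrable lborel (\<lambda>u. norm (indicator {-1..1} u *\<^sub>R ?w f u))" using j by (rule integrable_norm)
   show "integrable lborel (\<lambda>u. norm (indicator {-1..1} u *\<^sub>R ?w (\<lambda>_. 1) u) * B)" using i by simp
   fix u :: real
   show "norm (indicator {-1..1} u *\<^sub>R ?w f u) \<le> norm (indicator {-1..1} u *\<^sub>R ?w (\<lambda>_. 1) u) * B"
   proof (cases "u \<in> {-1..1}")
    case True
    have "norm (?w f u) = norm (?w (\<lambda>_. 1) u) * norm (f u)" by (simp add: norm_mult)
    also have "\<dots> \<le> norm (?w (\<lambda>_. 1) u) * B" using B[OF True] by (rule mult_left_mono) simp
    finally show ?thesis using True by simp
   qed simp
  qed
  also have "\<dots> = C * B" unfolding C_def by simp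
  finally show "norm (mu_int \<gamma> f) \<le> C * B" .
 qed
qed

text \<open>The derivative of p(u) (1 - u^2)^\<gamma> is integrated for p = 1 and p = u^(m+1); the
  boundary terms vanish because \<gamma> > 0.\<close>

lemma integral_power_recursion:
 fixes \<gamma> :: real
 assumes g: "\<gamma> > 0"
 defines "A \<equiv> \<lambda>m::nat. integral {-1..1} (\<lambda>u::real. u ^ m * jac \<gamma> u)"
 shows "A 1 = 0" "(real m + 1 + 2 * \<gamma>) * A (m + 2) = (real m + 1) * A m"
proof -
 let ?n = "real m + 1 + 2 * \<gamma>"
 have int: "(\<lambda>u::real. u ^ m * jac \<gamma> u) integrable_on {-1..1}" for m :: nat
 proof -
  have "set_integrable lborel {-1..1} (\<lambda>u. jac \<gamma> u *\<^sub>R (of_real (u ^ m) :: complex))"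
   by (rule set_integrable_one_minus_square_powr[OF g]) (intro continuous_intros)
  from set_borel_integral_eq_integral(1)[OF this]
  have "(Re \<circ> (\<lambda>u. jac \<gamma> u *\<^sub>R (of_real (u ^ m) :: complex))) integrable_on {-1..1}"
   by (rule integrable_linear) (rule bounded_linear_Re)
  thus ?thesis by (simp add: o_def mult.commute)
 qed
 have rec: "((\<lambda>u. D u * (1 - u\<^sup>2) powr \<gamma> - 2 * \<gamma> * (p u * u * jac \<gamma> u)) has_integral 0) {-1..1}"
  if D: "\<And>u. (p has_real_derivative D u) (at u)" for p D :: "real \<Rightarrow> real"
 proof -
  have "((\<lambda>u. D u * (1 - u\<^sup>2) powr \<gamma> - 2 * \<gamma> * (p u * u * jac \<gamma> u)) has_integral (p 1 * (1 - 1\<^sup>2) powr \<gamma> - p (-1) * (1 - (-1)\<^sup>2) powr \<gamma>)) {-1..1}"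
  \<comment> \<open>For \<gamma> < 1 the derivative can be unbounded at the end points, so
    differentiability is used only in the interior.\<close>
  proof (rule fundamental_theorem_of_calculus_interior)
   have "continuous_on {-1..1} p" by (meson D DERIV_isCont continuous_at_imp_continuous_on)
   thus "continuous_on {-1..1} (\<lambda>u. p u * (1 - u\<^sup>2) powr \<gamma>)" by (intro continuous_intros continuous_one_minus_square_powr g)
   fix u :: real assume "u \<in> {-1<..<1}"
   hence "\<bar>u\<bar> < 1" by auto
   hence pos: "1 - u\<^sup>2 > 0" by (simp add: abs_square_less_1)
   have "((\<lambda>u. (1 - u\<^sup>2) powr \<gamma>) has_real_derivative (\<gamma> * jac \<gamma> u * (- (2 * u)))) (at u)"
    using pos by (auto intro!: derivative_eq_intros)
   from DERIV_mult[OF D this]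
   show "((\<lambda>u. p u * (1 - u\<^sup>2) powr \<gamma>) has_vector_derivative (D u * (1 - u\<^sup>2) powr \<gamma> - 2 * \<gamma> * (p u * u * jac \<gamma> u))) (at u)"
    unfolding has_real_derivative_iff_has_vector_derivative[symmetric] by (rule DERIV_cong) (simp add: algebra_simps)
  qed simp
  thus ?thesis using g by simp
 qed
 have pw: "(1 - u\<^sup>2) powr \<gamma> = (1 - u\<^sup>2) * jac \<gamma> u" if "u \<in> {-1..1}" for u :: real
 proof (cases "1 - u\<^sup>2 = 0")
  case False
  with that have "1 - u\<^sup>2 > 0" using abs_square_le_1[of u] by auto
  thus ?thesis using powr_add[of "1 - u\<^sup>2" 1 "\<gamma> - 1"] by simp
 qed (use g in simp)
 have "((\<lambda>u. 0 * (1 - u\<^sup>2) powr \<gamma> - 2 * \<gamma> * (1 * u * jac \<gamma> u)) has_integral 0) {-1..1}" by (rule rec) simp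
 hence "((\<lambda>u. (- 2 * \<gamma>) * (u ^ 1 * jac \<gamma> u)) has_integral 0) {-1..1}" by simp
 moreover have "((\<lambda>u. (- 2 * \<gamma>) * (u ^ 1 * jac \<gamma> u)) has_integral ((- 2 * \<gamma>) * A 1)) {-1..1}"
  unfolding A_def by (rule has_integral_mult_right[OF integrable_integral[OF int]])
 ultimately have "(- 2 * \<gamma>) * A 1 = 0" by (rule has_integral_unique[symmetric])
 thus "A 1 = 0" using g by simp
 have "((\<lambda>u. (real m + 1) * u ^ m * (1 - u\<^sup>2) powr \<gamma> - 2 * \<gamma> * (u ^ (m + 1) * u * jac \<gamma> u)) has_integral 0) {-1..1}"
 proof (rule rec)
  show "((\<lambda>u. u ^ (m + 1)) has_real_derivative (real m + 1) * u ^ m) (at u)" for u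
   using DERIV_pow[of "m + 1" u] by (simp add: add.commute)
 qed
 hence "((\<lambda>u. (real m + 1) * (u ^ m * jac \<gamma> u) - ?n * (u ^ (m + 2) * jac \<gamma> u)) has_integral 0) {-1..1}"
 proof (rule has_integral_eq[rotated])
  fix u :: real assume "u \<in> {-1..1}"
  thus "(real m + 1) * u ^ m * (1 - u\<^sup>2) powr \<gamma> - 2 * \<gamma> * (u ^ (m + 1) * u * jac \<gamma> u)
   = (real m + 1) * (u ^ m * jac \<gamma> u) - ?n * (u ^ (m + 2) * jac \<gamma> u)"
   unfolding pw[OF \<open>u \<in> {-1..1}\<close>] by (simp add: algebra_simps power2_eq_square)
 qed
 moreover have "((\<lambda>u. (real m + 1) * (u ^ m * jac \<gamma> u) - ?n * (u ^ (m + 2) * jac \<gamma> u)) has_integral ((real m + 1) * A m - ?n * A (m + 2))) {-1..1}"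
  unfolding A_def by (intro has_integral_diff has_integral_mult_right integrable_integral int)
 ultimately have "(real m + 1) * A m - ?n * A (m + 2) = 0" by (rule has_integral_unique[symmetric])
 thus "?n * A (m + 2) = (real m + 1) * A m" by simp
qed

text \<open>The factor 1 + w of the measure makes an odd moment equal to the next even one, hence
  the rounding up in \<open>(m + 1) div 2\<close>.\<close>

definition mumom :: "real \<Rightarrow> nat \<Rightarrow> real" where
 "mumom \<gamma> m = pochhammer (1/2) ((m + 1) div 2) / pochhammer (\<gamma> + 1/2) ((m + 1) div 2)"

lemma mu_int_power:
 assumes g: "\<gamma> > 0"
 shows "mu_int \<gamma> (\<lambda>u. of_real (u ^ m)) = of_real (mumom \<gamma> m)"
proof -
 let ?v = "\<lambda>m u. jac \<gamma> u *\<^sub>R (of_real (u ^ m) :: complex)"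
 define A where "A m = integral {-1..1} (\<lambda>u::real. u ^ m * jac \<gamma> u)" for m :: nat
 have A0: "A 0 = Beta (1/2) \<gamma>" using has_integral_one_minus_square_powr[OF g] by (simp add: A_def integral_unique)
 note rec = integral_power_recursion[OF g, folded A_def]
 have odd: "A (2 * c + 1) = 0" for c
 proof (induction c)
  case (Suc c)
  have "(real (2 * c + 1) + 1 + 2 * \<gamma>) * A (2 * c + 1 + 2) = 0" using rec(2)[of "2 * c + 1"] Suc by simp
  moreover have "real (2 * c + 1) + 1 + 2 * \<gamma> \<noteq> 0" using g by simp
  ultimately have "A (2 * c + 1 + 2) = 0" by (simp only: mult_eq_0_iff simp_thms)
  moreover have "2 * Suc c + 1 = 2 * c + 1 + 2" by simp
  ultimately show ?case by (simp only:)
 qed (use rec(1) in simp)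
 have even: "A (2 * c) = Beta (1/2) \<gamma> * (pochhammer (1/2) c / pochhammer (\<gamma> + 1/2) c)" for c
 proof (induction c)
  case (Suc c)
  have nz: "\<gamma> + 1/2 + real c \<noteq> 0" "pochhammer (\<gamma> + 1/2) c \<noteq> 0" using g pochhammer_pos[of "\<gamma> + 1/2" c] by simp_all
  have "(2 * (\<gamma> + 1/2 + real c)) * A (2 * c + 2) = (2 * (1/2 + real c)) * A (2 * c)"
   using rec(2)[of "2 * c"] by (simp add: algebra_simps)
  hence "A (2 * c + 2) = (1/2 + real c) / (\<gamma> + 1/2 + real c) * A (2 * c)" using nz(1) by (simp add: field_simps)
  also have "\<dots> = Beta (1/2) \<gamma> * (pochhammer (1/2) (Suc c) / pochhammer (\<gamma> + 1/2) (Suc c))"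
   unfolding Suc pochhammer_Suc by (simp add: mult_ac)
  finally show ?case by simp
 qed (use A0 in simp)
 have AA: "A m + A (m + 1) = Beta (1/2) \<gamma> * mumom \<gamma> m"
 proof (cases "even m")
  case True
  then obtain c where m: "m = 2 * c" by (elim evenE)
  have "(m + 1) div 2 = c" using m by simp
  thus ?thesis using even[of c] odd[of c] unfolding mumom_def by (simp add: m)
 next
  case False
  then obtain c where m: "m = 2 * c + 1" by (elim oddE)
  have "(m + 1) div 2 = c + 1" "m + 1 = 2 * (c + 1)" using m by simp_all
  thus ?thesis using even[of "c + 1"] odd[of c] unfolding mumom_def by (simp add: m)
 qed
 have pos: "Beta (1/2) \<gamma> > 0" using g Gamma_real_pos[of \<gamma>] Gamma_real_pos[of "1/2::real"] Gamma_real_pos[of "1/2 + \<gamma>"] by (simp add: Beta_def)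
 have si: "set_integrable lborel {-1..1} (\<lambda>u. ?v m u)" for m
  by (rule set_integrable_one_minus_square_powr[OF g]) (intro continuous_intros)
 have L: "set_lebesgue_integral lborel {-1..1} (\<lambda>u. ?v m u) = of_real (A m)" for m
 proof -
  have "set_lebesgue_integral lborel {-1..1} (\<lambda>u. ?v m u)
   = integral {-1..1} (\<lambda>u. ?v m u)"
   by (rule set_borel_integral_eq_integral(2)[OF si])
  also have "\<dots> = integral {-1..1} (\<lambda>u. of_real (u ^ m * jac \<gamma> u))"
   by (simp add: scaleR_conv_of_real mult.commute)
  also have "\<dots> = of_real (A m)"
  proof -
   have "(Re \<circ> (\<lambda>u. ?v m u)) integrable_on {-1..1}"
    by (rule integrable_linear[OF set_borel_integral_eq_integral(1)[OF si] bounded_linear_Re])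
   hence "(\<lambda>u::real. u ^ m * jac \<gamma> u) integrable_on {-1..1}" by (simp add: o_def mult.commute)
   from integral_linear[OF this bounded_linear_of_real[where 'a=complex]] show ?thesis by (simp add: o_def A_def)
  qed
  finally show ?thesis .
 qed
 let ?c = "of_real (inverse (Beta (1/2) \<gamma>)) :: complex"
 have "mu_int \<gamma> (\<lambda>u. of_real (u ^ m)) = set_lebesgue_integral lborel {-1..1} (\<lambda>u. ?c * (?v m u + jac \<gamma> u *\<^sub>R (of_real (u ^ (m + 1)) :: complex)))"
  unfolding mu_int_alt by (simp add: scaleR_conv_of_real algebra_simps)
 also have "\<dots> = ?c * (of_real (A m) + of_real (A (m + 1)))"
  unfolding set_integral_mult_right using set_integral_add(2)[OF si si] L by (simp only:)
 also have "\<dots> = of_real (inverse (Beta (1/2) \<gamma>) * (A m + A (m + 1)))" by simp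
 also have "inverse (Beta (1/2) \<gamma>) * (A m + A (m + 1)) = mumom \<gamma> m" unfolding AA using pos by simp
 finally show ?thesis .
qed

subsection \<open>Trigonometric moments\<close>

definition tmom :: "real \<Rightarrow> real \<Rightarrow> nat \<Rightarrow> nat \<Rightarrow> complex" where
 "tmom \<alpha> \<beta> a b = wint 1 \<alpha> \<beta> (\<lambda>\<xi>. of_real (sin \<xi> ^ a * cos \<xi> ^ b))"

lemma continuous_of_real_sin_cos: "continuous_on A (\<lambda>\<xi>. complex_of_real (sin \<xi> ^ a * cos \<xi> ^ b))"
 by (intro continuous_intros)

lemma wint_sum:
 assumes ab: "\<alpha> \<ge> 0" "\<beta> \<ge> 0" and f: "\<And>i. i \<in> A \<Longrightarrow> continuous_on UNIV (f i)" and A: "finite A"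
 shows "wint k \<alpha> \<beta> (\<lambda>u. \<Sum>i\<in>A. a i * f i u) = (\<Sum>i\<in>A. a i * wint k \<alpha> \<beta> (f i))"
 using A f
proof (induction A rule: finite_induct)
 case empty thus ?case by (simp add: wint_def)
next
 case (insert i A)
 have "wint k \<alpha> \<beta> (\<lambda>u. a i * f i u + (\<Sum>i\<in>A. a i * f i u)) = a i * wint k \<alpha> \<beta> (f i) + wint k \<alpha> \<beta> (\<lambda>u. \<Sum>i\<in>A. a i * f i u)"
  by (rule wint_linear[OF ab]) (use insert in \<open>auto intro!: continuous_intros\<close>)
 with insert show ?case by simp
qed

lemma wint_cmult:
 assumes "\<alpha> \<ge> 0" "\<beta> \<ge> 0" "continuous_on UNIV f"
 shows "wint k \<alpha> \<beta> (\<lambda>\<xi>. a * f \<xi>) = a * wint k \<alpha> \<beta> f"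
 using wint_sum[OF assms(1,2), of "{0::nat}" "\<lambda>_. f" k "\<lambda>_. a"] assms(3) by simp

lemma tmom_diff:
 assumes "\<alpha> \<ge> 0" "\<beta> \<ge> 0"
 shows "wint 1 \<alpha> \<beta> (\<lambda>\<xi>. of_real (x * (sin \<xi> ^ a * cos \<xi> ^ b) + y * (sin \<xi> ^ c * cos \<xi> ^ d)))
  = of_real x * tmom \<alpha> \<beta> a b + of_real y * tmom \<alpha> \<beta> c d"
proof -
 have "wint 1 \<alpha> \<beta> (\<lambda>\<xi>. of_real x * of_real (sin \<xi> ^ a * cos \<xi> ^ b) + of_real y * of_real (sin \<xi> ^ c * cos \<xi> ^ d))
  = of_real x * tmom \<alpha> \<beta> a b + wint 1 \<alpha> \<beta> (\<lambda>\<xi>. of_real y * of_real (sin \<xi> ^ c * cos \<xi> ^ d))"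
  unfolding tmom_def by (rule wint_linear[OF assms]) (intro continuous_intros)+
 also have "wint 1 \<alpha> \<beta> (\<lambda>\<xi>. of_real y * of_real (sin \<xi> ^ c * cos \<xi> ^ d)) = of_real y * tmom \<alpha> \<beta> c d"
  unfolding tmom_def by (rule wint_cmult[OF assms]) (intro continuous_intros)
 finally show ?thesis by (simp only: of_real_add of_real_mult)
qed

lemma tmom_split:
 assumes "\<alpha> \<ge> 0" "\<beta> \<ge> 0"
 shows "tmom \<alpha> \<beta> a b = tmom \<alpha> \<beta> (a + 2) b + tmom \<alpha> \<beta> a (b + 2)"
proof -
 have "1 * (sin \<xi> ^ (a + 2) * cos \<xi> ^ b) + 1 * (sin \<xi> ^ a * cos \<xi> ^ (b + 2)) = sin \<xi> ^ a * cos \<xi> ^ b" for \<xi> :: real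
 proof -
  have "1 * (sin \<xi> ^ (a + 2) * cos \<xi> ^ b) + 1 * (sin \<xi> ^ a * cos \<xi> ^ (b + 2)) = sin \<xi> ^ a * cos \<xi> ^ b * ((sin \<xi>)\<^sup>2 + (cos \<xi>)\<^sup>2)"
   by (simp only: power_add mult_1 distrib_left mult_ac)
  thus ?thesis by simp
 qed
 thus ?thesis using tmom_diff[OF assms, of 1 "a + 2" b 1 a "b + 2"] by (simp add: tmom_def)
qed

text \<open>Integration by parts applied to the product of the powers a + 1 of sine and b + 1 of
  cosine; the logarithmic derivative of the weight only changes the two factors.\<close>

lemma tmom_FTC:
 assumes ab: "\<alpha> \<ge> 0" "\<beta> \<ge> 0"
 shows "of_real (real a + 1 + 2 * \<alpha>) * tmom \<alpha> \<beta> a (b + 2) = of_real (real b + 1 + 2 * \<beta>) * tmom \<alpha> \<beta> (a + 2) b"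
proof -
 let ?h = "\<lambda>\<xi>::real. sin \<xi> ^ (a + 1) * cos \<xi> ^ (b + 1)"
 let ?h' = "\<lambda>\<xi>::real. (real a + 1) * (sin \<xi> ^ a * cos \<xi> ^ (b + 2)) - (real b + 1) * (sin \<xi> ^ (a + 2) * cos \<xi> ^ b)"
 have h: "(?h has_real_derivative ?h' \<xi>) (at \<xi>)" for \<xi>
 proof -
  have 1: "((\<lambda>\<xi>. sin \<xi> ^ (a + 1)) has_real_derivative ((real a + 1) * sin \<xi> ^ a * cos \<xi>)) (at \<xi>)"
   using DERIV_power[OF DERIV_sin, of "a + 1" \<xi>] by (simp add: mult_ac add.commute)
  have 2: "((\<lambda>\<xi>. cos \<xi> ^ (b + 1)) has_real_derivative (- ((real b + 1) * cos \<xi> ^ b * sin \<xi>))) (at \<xi>)"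
   using DERIV_power[OF DERIV_cos, of "b + 1" \<xi>] by (simp add: mult_ac add.commute)
  show ?thesis by (rule DERIV_cong[OF DERIV_mult[OF 1 2]]) (simp add: power_add power2_eq_square algebra_simps)
 qed
 have H: "((\<lambda>\<xi>. complex_of_real (?h \<xi>)) has_vector_derivative of_real (?h' \<xi>)) (at \<xi>)" for \<xi>
  by (rule bounded_linear.has_vector_derivative[OF bounded_linear_of_real]) (use h in \<open>simp only: has_real_derivative_iff_has_vector_derivative\<close>)
 have per: "complex_of_real (?h (2 * pi)) = of_real (?h 0)" by simp
 have k1: "(1::nat) > 0" by simp
 let ?g = "\<lambda>\<xi>. of_real (wt 1 \<alpha> \<beta> \<xi>) * complex_of_real ((real a + 1 + 2 * \<alpha>) * (sin \<xi> ^ a * cos \<xi> ^ (b + 2)) + (- (real b + 1 + 2 * \<beta>)) * (sin \<xi> ^ (a + 2) * cos \<xi> ^ b))"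
 have "(?g has_integral 0) {0..2 * pi}"
 proof (rule has_integral_spike_finite[OF finite_zeros_sin_cos[OF k1] _ wint_FTC[OF k1 ab H per]])
  fix \<xi> assume "\<xi> \<in> {0..2 * pi} - {\<xi> \<in> {0..2 * pi}. sin (real 1 * \<xi>) = 0 \<or> cos (real 1 * \<xi>) = 0}"
  hence nz: "sin \<xi> \<noteq> 0" "cos \<xi> \<noteq> 0" by auto
  have c1: "cot \<xi> * ?h \<xi> = sin \<xi> ^ a * cos \<xi> ^ (b + 2)" and t1: "tan \<xi> * ?h \<xi> = sin \<xi> ^ (a + 2) * cos \<xi> ^ b"
   using nz by (simp_all add: cot_def tan_def power_add power2_eq_square)
  have "?h' \<xi> + 2 * real 1 * (\<alpha> * cot (real 1 * \<xi>) - \<beta> * tan (real 1 * \<xi>)) * ?h \<xi>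
   = ?h' \<xi> + 2 * \<alpha> * (cot \<xi> * ?h \<xi>) - 2 * \<beta> * (tan \<xi> * ?h \<xi>)" by (simp add: algebra_simps)
  also have "\<dots> = (real a + 1 + 2 * \<alpha>) * (sin \<xi> ^ a * cos \<xi> ^ (b + 2)) + (- (real b + 1 + 2 * \<beta>)) * (sin \<xi> ^ (a + 2) * cos \<xi> ^ b)"
   unfolding c1 t1 by (simp add: algebra_simps)
  finally show "?g \<xi> = of_real (wt 1 \<alpha> \<beta> \<xi>) * (of_real (?h' \<xi>) + of_real (2 * real 1 * (\<alpha> * cot (real 1 * \<xi>) - \<beta> * tan (real 1 * \<xi>))) * of_real (?h \<xi>))"
   by (simp only: of_real_add[symmetric] of_real_mult[symmetric])
 qed
 hence "of_real (real a + 1 + 2 * \<alpha>) * tmom \<alpha> \<beta> a (b + 2) + of_real (- (real b + 1 + 2 * \<beta>)) * tmom \<alpha> \<beta> (a + 2) b = 0"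
  unfolding tmom_diff[OF ab, symmetric] unfolding wint_def by (rule integral_unique)
 thus ?thesis by (simp only: of_real_minus mult_minus_left) (simp add: algebra_simps)
qed

lemma tmom_odd:
 assumes ab: "\<alpha> \<ge> 0" "\<beta> \<ge> 0" and o: "odd a \<or> odd b"
 shows "tmom \<alpha> \<beta> a b = 0"
proof -
 let ?g = "\<lambda>\<xi>. complex_of_real (sin \<xi> ^ a * cos \<xi> ^ b)"
 have k1: "(1::nat) > 0" by simp
 have c: "continuous_on UNIV ?g" by (rule continuous_of_real_sin_cos)
 have p: "?g (\<xi> + 2 * pi) = ?g \<xi>" for \<xi> by simp
 have "tmom \<alpha> \<beta> a b = - tmom \<alpha> \<beta> a b"
 proof (cases "odd a")
  case True
  have r: "?g (pi * of_int 0 / real 1 - \<xi>) = (-1) * ?g \<xi>" for \<xi> using True by (simp add: power_minus_odd)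
  have "tmom \<alpha> \<beta> a b = wint 1 \<alpha> \<beta> (\<lambda>\<xi>. (-1) * ?g \<xi>)" unfolding tmom_def wint_reflect[OF k1 ab c p, of 0, symmetric] r ..
  thus ?thesis unfolding wint_cmult[OF ab c] tmom_def[symmetric] by simp
 next
  case False
  with o have "odd b" by simp
  hence r: "?g (pi * of_int 1 / real 1 - \<xi>) = (-1) * ?g \<xi>" for \<xi> by (simp add: power_minus_odd)
  have "tmom \<alpha> \<beta> a b = wint 1 \<alpha> \<beta> (\<lambda>\<xi>. (-1) * ?g \<xi>)" unfolding tmom_def wint_reflect[OF k1 ab c p, of 1, symmetric] r ..
  thus ?thesis unfolding wint_cmult[OF ab c] tmom_def[symmetric] by simp
 qed
 thus ?thesis by simp
qed

text \<open>\<open>tmom_split\<close> and \<open>tmom_FTC\<close> are two linear equations for the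
  two next higher moments, and solving them gives both recursions.\<close>

lemma tmom_even:
 assumes ab: "\<alpha> > 0" "\<beta> \<ge> 0"
 shows "tmom \<alpha> \<beta> (2 * i) (2 * l) = tmom \<alpha> \<beta> 0 0 * of_real (pochhammer (\<alpha> + 1/2) i * pochhammer (\<beta> + 1/2) l / pochhammer (\<alpha> + \<beta> + 1) (i + l))"
proof -
 have ab': "\<alpha> \<ge> 0" "\<beta> \<ge> 0" using ab by auto
 have r: "of_real (\<alpha> + \<beta> + 1 + real (i + l)) * tmom \<alpha> \<beta> (2 * i + 2) (2 * l) = of_real (\<alpha> + 1/2 + real i) * tmom \<alpha> \<beta> (2 * i) (2 * l)"
  "of_real (\<alpha> + \<beta> + 1 + real (i + l)) * tmom \<alpha> \<beta> (2 * i) (2 * l + 2) = of_real (\<beta> + 1/2 + real l) * tmom \<alpha> \<beta> (2 * i) (2 * l)" for i l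
 proof -
  note 1 = tmom_split[OF ab', of "2 * i" "2 * l"] and 2 = tmom_FTC[OF ab', of "2 * i" "2 * l"]
  have e: "of_real (real (2 * i) + 1 + 2 * \<alpha>) = 2 * complex_of_real (\<alpha> + 1/2 + real i)" "of_real (real (2 * l) + 1 + 2 * \<beta>) = 2 * complex_of_real (\<beta> + 1/2 + real l)"
   "complex_of_real (\<alpha> + \<beta> + 1 + real (i + l)) = of_real (\<alpha> + 1/2 + real i) + of_real (\<beta> + 1/2 + real l)" by (simp_all add: algebra_simps)
  have 2: "of_real (\<alpha> + 1/2 + real i) * tmom \<alpha> \<beta> (2 * i) (2 * l + 2) = of_real (\<beta> + 1/2 + real l) * tmom \<alpha> \<beta> (2 * i + 2) (2 * l)"
   using 2 unfolding e mult.assoc by simp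
  show "of_real (\<alpha> + \<beta> + 1 + real (i + l)) * tmom \<alpha> \<beta> (2 * i + 2) (2 * l) = of_real (\<alpha> + 1/2 + real i) * tmom \<alpha> \<beta> (2 * i) (2 * l)"
   unfolding e 1 distrib_left distrib_right 2 ..
  show "of_real (\<alpha> + \<beta> + 1 + real (i + l)) * tmom \<alpha> \<beta> (2 * i) (2 * l + 2) = of_real (\<beta> + 1/2 + real l) * tmom \<alpha> \<beta> (2 * i) (2 * l)"
   unfolding e 1 distrib_left distrib_right 2 by simp
 qed
 have nz: "\<alpha> + \<beta> + 1 + real n \<noteq> 0" "pochhammer (\<alpha> + \<beta> + 1) n \<noteq> 0" for n
  using ab pochhammer_pos[of "\<alpha> + \<beta> + 1" n] by linarith+
 have step: "t = tmom \<alpha> \<beta> 0 0 * of_real (p * y / (P * x))"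
  if "x \<noteq> 0" "tmom \<alpha> \<beta> 0 0 * of_real (p / P) * of_real y = of_real x * t" for t x y p P
 proof -
  have "t = (of_real x * t) / of_real x" using that(1) by simp
  thus ?thesis unfolding that(2)[symmetric] by simp
 qed
 have base: "tmom \<alpha> \<beta> 0 (2 * l) = tmom \<alpha> \<beta> 0 0 * of_real (pochhammer (\<beta> + 1/2) l / pochhammer (\<alpha> + \<beta> + 1) l)"
 proof (induction l)
  case (Suc l)
  have "tmom \<alpha> \<beta> 0 0 * of_real (pochhammer (\<beta> + 1/2) l / pochhammer (\<alpha> + \<beta> + 1) l) * of_real (\<beta> + 1/2 + real l) = of_real (\<alpha> + \<beta> + 1 + real l) * tmom \<alpha> \<beta> 0 (2 * l + 2)"
   using r(2)[of 0 l] unfolding Suc[symmetric] by (simp add: mult.commute)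
  from step[OF nz(1) this] show ?case by (simp add: pochhammer_Suc)
 qed simp
 show ?thesis
 proof (induction i)
  case 0 thus ?case using base by simp
 next
  case (Suc i)
  have "tmom \<alpha> \<beta> 0 0 * of_real (pochhammer (\<alpha> + 1/2) i * pochhammer (\<beta> + 1/2) l / pochhammer (\<alpha> + \<beta> + 1) (i + l)) * of_real (\<alpha> + 1/2 + real i) = of_real (\<alpha> + \<beta> + 1 + real (i + l)) * tmom \<alpha> \<beta> (2 * i + 2) (2 * l)"
   using r(1)[of i l] unfolding Suc[symmetric] by (simp add: mult.commute)
  from step[OF nz(1) this] show ?case by (simp add: pochhammer_Suc mult_ac)
 qed
qed

subsection \<open>The reproducing kernel for the Klein four-group\<close>

definition Ccoef :: "real \<Rightarrow> nat \<Rightarrow> nat \<Rightarrow> real" where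
 "Ccoef \<gamma> N q = (-1) ^ q * pochhammer (\<gamma> + 1) (N - q) * 2 ^ (N - 2 * q) / (fact q * fact (N - 2 * q))"

text \<open>The average of the Gegenbauer polynomial \<open>Cpol (\<alpha> + \<beta>) N\<close> at
  sin \<xi> sin \<phi> u + cos \<xi> cos \<phi> v, expanded binomially with the powers of u and v
  replaced by their moments.\<close>

definition Ipol :: "real \<Rightarrow> real \<Rightarrow> nat \<Rightarrow> real \<Rightarrow> real \<Rightarrow> real" where
 "Ipol \<alpha> \<beta> N \<xi> \<phi> = (\<Sum>q\<le>N div 2. Ccoef (\<alpha> + \<beta>) N q * (\<Sum>l\<le>N - 2 * q. real ((N - 2 * q) choose l)
  * (sin \<xi> * sin \<phi>) ^ (N - 2 * q - l) * (cos \<xi> * cos \<phi>) ^ l * mumom \<alpha> (N - 2 * q - l) * mumom \<beta> l))"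

text \<open>Moments of powers of sine and cosine divided by the total mass of the weight.\<close>

definition rmom :: "real \<Rightarrow> real \<Rightarrow> nat \<Rightarrow> nat \<Rightarrow> real" where
 "rmom \<alpha> \<beta> a b = (if even a \<and> even b then pochhammer (\<alpha> + 1/2) (a div 2) * pochhammer (\<beta> + 1/2) (b div 2) / pochhammer (\<alpha> + \<beta> + 1) ((a + b) div 2) else 0)"

lemma tmom_rmom:
 assumes "\<alpha> > 0" "\<beta> \<ge> 0"
 shows "tmom \<alpha> \<beta> a b = tmom \<alpha> \<beta> 0 0 * of_real (rmom \<alpha> \<beta> a b)"
proof (cases "even a \<and> even b")
 case True
 then obtain i l where "a = 2 * i" "b = 2 * l" by (auto elim!: evenE)
 moreover have "(2 * i + 2 * l) div 2 = i + l" by simp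
 ultimately show ?thesis using tmom_even[OF assms, of i l] by (simp add: rmom_def)
next
 case False
 thus ?thesis using tmom_odd[of \<alpha> \<beta> a b] assms by (auto simp: rmom_def)
qed

lemma wint_Ipol:
 assumes ab: "\<alpha> > 0" "\<beta> \<ge> 0"
 shows "wint 1 \<alpha> \<beta> (\<lambda>\<xi>. of_real (sin \<xi> ^ a * cos \<xi> ^ b * Ipol \<alpha> \<beta> N \<xi> \<phi>))
  = tmom \<alpha> \<beta> 0 0 * of_real (\<Sum>q\<le>N div 2. Ccoef (\<alpha> + \<beta>) N q * (\<Sum>l\<le>N - 2 * q. real ((N - 2 * q) choose l)
  * sin \<phi> ^ (N - 2 * q - l) * cos \<phi> ^ l * mumom \<alpha> (N - 2 * q - l) * mumom \<beta> l * rmom \<alpha> \<beta> (a + (N - 2 * q - l)) (b + l)))"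
proof -
 have ab': "\<alpha> \<ge> 0" "\<beta> \<ge> 0" using ab by auto
 let ?c = "\<lambda>q l. Ccoef (\<alpha> + \<beta>) N q * (real ((N - 2 * q) choose l) * sin \<phi> ^ (N - 2 * q - l) * cos \<phi> ^ l * mumom \<alpha> (N - 2 * q - l) * mumom \<beta> l)"
 have e: "complex_of_real (sin \<xi> ^ a * cos \<xi> ^ b * Ipol \<alpha> \<beta> N \<xi> \<phi>) = (\<Sum>p\<in>(SIGMA q:{..N div 2}. {..N - 2 * q}). of_real (?c (fst p) (snd p)) * of_real (sin \<xi> ^ (a + (N - 2 * fst p - snd p)) * cos \<xi> ^ (b + snd p)))" for \<xi>
 proof -
  have "sin \<xi> ^ a * cos \<xi> ^ b * Ipol \<alpha> \<beta> N \<xi> \<phi> = (\<Sum>q\<le>N div 2. \<Sum>l\<le>N - 2 * q. ?c q l * (sin \<xi> ^ (a + (N - 2 * q - l)) * cos \<xi> ^ (b + l)))"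
   unfolding Ipol_def sum_distrib_left by (intro sum.cong refl) (simp only: power_mult_distrib power_add mult_ac)
  also have "\<dots> = (\<Sum>p\<in>(SIGMA q:{..N div 2}. {..N - 2 * q}). ?c (fst p) (snd p) * (sin \<xi> ^ (a + (N - 2 * fst p - snd p)) * cos \<xi> ^ (b + snd p)))"
   by (subst sum.Sigma) (auto simp: case_prod_unfold)
  finally show ?thesis by (simp only: of_real_sum of_real_mult)
 qed
 have "wint 1 \<alpha> \<beta> (\<lambda>\<xi>. of_real (sin \<xi> ^ a * cos \<xi> ^ b * Ipol \<alpha> \<beta> N \<xi> \<phi>))
  = (\<Sum>p\<in>(SIGMA q:{..N div 2}. {..N - 2 * q}). of_real (?c (fst p) (snd p)) * tmom \<alpha> \<beta> (a + (N - 2 * fst p - snd p)) (b + snd p))"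
  unfolding e tmom_def by (rule wint_sum[OF ab' continuous_of_real_sin_cos]) auto
 also have "\<dots> = tmom \<alpha> \<beta> 0 0 * of_real (\<Sum>p\<in>(SIGMA q:{..N div 2}. {..N - 2 * q}). ?c (fst p) (snd p) * rmom \<alpha> \<beta> (a + (N - 2 * fst p - snd p)) (b + snd p))"
  unfolding tmom_rmom[OF ab, of "a + _"] of_real_sum sum_distrib_left by (intro sum.cong refl) (simp only: of_real_mult mult_ac)
 also have "(\<Sum>p\<in>(SIGMA q:{..N div 2}. {..N - 2 * q}). ?c (fst p) (snd p) * rmom \<alpha> \<beta> (a + (N - 2 * fst p - snd p)) (b + snd p))
  = (\<Sum>q\<le>N div 2. \<Sum>l\<le>N - 2 * q. ?c q l * rmom \<alpha> \<beta> (a + (N - 2 * q - l)) (b + l))"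
  by (subst sum.Sigma) (auto simp: case_prod_unfold)
 also have "\<dots> = (\<Sum>q\<le>N div 2. Ccoef (\<alpha> + \<beta>) N q * (\<Sum>l\<le>N - 2 * q. real ((N - 2 * q) choose l)
  * sin \<phi> ^ (N - 2 * q - l) * cos \<phi> ^ l * mumom \<alpha> (N - 2 * q - l) * mumom \<beta> l * rmom \<alpha> \<beta> (a + (N - 2 * q - l)) (b + l)))"
  unfolding sum_distrib_left by (intro sum.cong refl) (simp only: mult_ac)
 finally show ?thesis .
qed

text \<open>Two cases of one formula, with \<open>a\<close> the parity bit of the factorial's
  argument.\<close>

lemma pochhammer_half:
 assumes "a \<le> 1"
 shows "2 ^ (2 * j + a) * pochhammer (1/2) (j + a) * fact j = (fact (2 * j + a) :: real)"
proof -
 have 0: "2 ^ (2 * j) * pochhammer (1/2) j * fact j = (fact (2 * j) :: real)" for j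
 proof (induction j)
  case (Suc j)
  have "2 ^ (2 * Suc j) * pochhammer (1/2) (Suc j) * fact (Suc j) = (2 ^ (2 * j) * pochhammer (1/2) j * fact j) * (4 * (1/2 + real j) * (real j + 1))"
   by (simp add: pochhammer_Suc mult_ac)
  also have "\<dots> = fact (2 * Suc j)" unfolding Suc by (simp add: algebra_simps)
  finally show ?case .
 qed simp
 show ?thesis
 proof (cases "a = 0")
  case True thus ?thesis using 0[of j] by simp
 next
  case False
  with assms have a: "a = 1" by simp
  have "2 ^ (2 * j + 1) * pochhammer (1/2) (j + 1) * fact j = (2 ^ (2 * j) * pochhammer (1/2) j * fact j) * (2 * (1/2 + real j))"
   by (simp add: pochhammer_Suc mult_ac)
  also have "\<dots> = fact (2 * j + 1)" unfolding 0 by (simp add: algebra_simps)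
  finally show ?thesis unfolding a .
 qed
qed

text \<open>The Pochhammer symbols in \<alpha> + 1/2 cancel between the moments of the measure and
  those of the weight, and the ones in \<beta> + 1/2 and \<alpha> + \<beta> + 1 cancel in part. What
  remains is \<open>trinomial_pochhammer_sum\<close> with the squares of sine and cosine. Taking
  \<open>a\<close> at most 1 leaves only one exponent unbounded.\<close>

lemma moment_sum:
 assumes ab: "\<alpha> > 0" "\<beta> \<ge> 0" and a: "a \<le> 1" and aN: "a + b \<le> N" "even (N - (a + b))"
 shows "(\<Sum>q\<le>N div 2. Ccoef (\<alpha> + \<beta>) N q * (\<Sum>l\<le>N - 2 * q. real ((N - 2 * q) choose l)
  * sin \<phi> ^ (N - 2 * q - l) * cos \<phi> ^ l * mumom \<alpha> (N - 2 * q - l) * mumom \<beta> l * rmom \<alpha> \<beta> (a + (N - 2 * q - l)) (b + l)))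
  = sin \<phi> ^ a * cos \<phi> ^ b"
proof -
 \<comment> \<open>Parities are split off: only indices of the parity of \<open>b\<close>
   contribute, and they are later written as 2 l + b'.\<close>
 define b' where "b' = b mod 2"
 define s where "s = b div 2"
 have b: "b = 2 * s + b'" and b': "b' \<le> 1" by (auto simp: b'_def s_def)
 define M where "M = (N - a - b') div 2"
 have N: "N = 2 * M + a + b'" and sM: "s \<le> M"
 proof -
  have "N - a - b' = (N - (a + b)) + 2 * s" using b aN by simp
  hence "even (N - a - b')" using aN by simp
  thus "N = 2 * M + a + b'" using aN b unfolding M_def by auto
  thus "s \<le> M" using aN b by simp
 qed
 let ?g = "\<alpha> + \<beta>"
 \<comment> \<open>\<open>c\<close> and \<open>d\<close> are the arguments left in the Pochhammer
   symbols after the cancellation.\<close>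
 define c where "c = ?g + 1 + real (M + a + b' + s)"
 define d where "d = \<beta> + 1/2 + real b'"
 let ?F = "\<lambda>q l. real ((N - 2 * q) choose l) * sin \<phi> ^ (N - 2 * q - l) * cos \<phi> ^ l * mumom \<alpha> (N - 2 * q - l) * mumom \<beta> l * rmom \<alpha> \<beta> (a + (N - 2 * q - l)) (b + l)"
 have F0: "?F q l = 0" if "odd (b' + l)" for q l using that b by (simp add: rmom_def)
 have trm: "Ccoef ?g N q * ?F q (2 * l + b') = sin \<phi> ^ a * cos \<phi> ^ b' * ((-1) ^ q / fact q * pochhammer (c - real q) (M - s)
   * (((sin \<phi>)\<^sup>2) ^ (M - q - l) * ((cos \<phi>)\<^sup>2) ^ l / (fact l * fact (M - q - l)) * pochhammer (d + real l) s))"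
  if q: "q \<le> M" and l: "l \<le> M - q" for q l
 proof -
  define j where "j = M - q - l"
  have Mq: "M = q + j + l" using q l by (simp add: j_def)
  define n where "n = N - 2 * q"
  have n: "n = (2 * j + a) + (2 * l + b')" "n - (2 * l + b') = 2 * j + a" using Mq N by (simp_all add: n_def)
  have d1: "(2 * j + a + 1) div 2 = j + a" using a by (cases "a = 0") auto
  have d2: "(2 * l + b' + 1) div 2 = l + b'" using b' by (cases "b' = 0") auto
  have e1: "a + (2 * j + a) = 2 * (j + a)" "b + (2 * l + b') = 2 * (l + b' + s)" using b by simp_all
  have e2: "(2 * (j + a) + 2 * (l + b' + s)) div 2 = j + a + (l + b' + s)" by simp
  define K where "K = j + a + (l + b' + s)"
  have Nq: "N - q = K + (M - s)" using Mq N sM by (simp add: K_def)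
  have cq: "c - real q = ?g + 1 + real K" unfolding c_def K_def Mq by simp
  have P1: "pochhammer (?g + 1) (N - q) = pochhammer (?g + 1) K * pochhammer (c - real q) (M - s)"
   unfolding Nq cq by (rule pochhammer_product')
  have P2: "pochhammer (\<beta> + 1/2) (l + b' + s) = pochhammer (\<beta> + 1/2) (l + b') * pochhammer (d + real l) s"
  proof -
   have "d + real l = \<beta> + 1/2 + real (l + b')" by (simp add: d_def)
   thus ?thesis by (simp only: pochhammer_product')
  qed
  have nz: "pochhammer (?g + 1) K \<noteq> 0" "pochhammer (\<beta> + 1/2) (l + b') \<noteq> 0" "pochhammer (\<alpha> + 1/2) (j + a) \<noteq> 0"
   using ab pochhammer_pos[of "?g + 1" K] pochhammer_pos[of "\<beta> + 1/2" "l + b'"] pochhammer_pos[of "\<alpha> + 1/2" "j + a"] by linarith+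
  have ch: "real (n choose (2 * l + b')) = fact n / (fact (2 * l + b') * fact (2 * j + a))"
   using binomial_fact[of "2 * l + b'" n, where 'a=real] n by simp
  have h1: "pochhammer (1/2) (j + a) = (fact (2 * j + a) :: real) / (2 ^ (2 * j + a) * fact j)" using pochhammer_half[OF a, of j] by (subst nonzero_eq_divide_eq) (simp_all add: mult_ac)
  have h2: "pochhammer (1/2) (l + b') = (fact (2 * l + b') :: real) / (2 ^ (2 * l + b') * fact l)" using pochhammer_half[OF b', of l] by (subst nonzero_eq_divide_eq) (simp_all add: mult_ac)
  have CC: "Ccoef ?g N q = (-1) ^ q * (pochhammer (?g + 1) K * pochhammer (c - real q) (M - s)) * (2 ^ (2 * j + a) * 2 ^ (2 * l + b')) / (fact q * fact n)"
   unfolding Ccoef_def n_def[symmetric] P1 n(1)[symmetric] power_add[symmetric] ..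
  have m1: "mumom \<alpha> (2 * j + a) = fact (2 * j + a) / (2 ^ (2 * j + a) * fact j) / pochhammer (\<alpha> + 1/2) (j + a)"
   unfolding mumom_def d1 h1 ..
  have m2: "mumom \<beta> (2 * l + b') = fact (2 * l + b') / (2 ^ (2 * l + b') * fact l) / pochhammer (\<beta> + 1/2) (l + b')"
   unfolding mumom_def d2 h2 ..
  have m3: "rmom \<alpha> \<beta> (2 * (j + a)) (2 * (l + b' + s)) = pochhammer (\<alpha> + 1/2) (j + a) * (pochhammer (\<beta> + 1/2) (l + b') * pochhammer (d + real l) s) / pochhammer (?g + 1) K"
   unfolding rmom_def e2 K_def P2[symmetric] by simp
  \<comment> \<open>The cancellation is done with opaque variables, so that nothing is
    expanded.\<close>
  have core: "(u * (pK * pc) * (t1 * t2) / (fq * fn)) * ((fn / (f2 * f1)) * S * C * (f1 / (t1 * fj) / pa) * (f2 / (t2 * fl) / pb) * (pa * (pb * pd) / pK))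
   = S * C * (u / fq * pc * (1 / (fl * fj) * pd))"
   if "pK \<noteq> 0" "pa \<noteq> 0" "pb \<noteq> 0" "t1 \<noteq> 0" "t2 \<noteq> 0" "fn \<noteq> 0" "f1 \<noteq> 0" "f2 \<noteq> 0"
   for u pK pc t1 t2 fq fn f1 f2 S C fj fl pa pb pd :: real using that by (simp add: mult_ac)
  have "Ccoef ?g N q * ?F q (2 * l + b') = sin \<phi> ^ (2 * j + a) * cos \<phi> ^ (2 * l + b') * ((-1) ^ q / fact q * pochhammer (c - real q) (M - s) * (1 / (fact l * fact j) * pochhammer (d + real l) s))"
   unfolding n_def[symmetric] n(2) e1 CC ch m1 m2 m3 by (rule core) (use nz in simp_all)
  moreover have "sin \<phi> ^ (2 * j + a) = sin \<phi> ^ a * ((sin \<phi>)\<^sup>2) ^ j" "cos \<phi> ^ (2 * l + b') = cos \<phi> ^ b' * ((cos \<phi>)\<^sup>2) ^ l"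
   unfolding power_add power_mult by (simp_all only: mult.commute)
  ultimately show ?thesis unfolding j_def[symmetric]
   by (simp only: times_divide_eq_right times_divide_eq_left mult_1 mult_1_right divide_divide_eq_left mult_ac)
 qed
 have inner: "(\<Sum>l\<le>N - 2 * q. ?F q l) = (\<Sum>l\<le>M - q. ?F q (2 * l + b'))" if "q \<le> M" for q
 proof -
  have "(\<Sum>l\<le>N - 2 * q. ?F q l) = (\<Sum>l\<in>{l\<in>{..N - 2 * q}. even (b' + l)}. ?F q l)"
  proof (rule sum.mono_neutral_right)
   show "\<forall>l\<in>{..N - 2 * q} - {l\<in>{..N - 2 * q}. even (b' + l)}. ?F q l = 0"
   proof
    fix l assume "l \<in> {..N - 2 * q} - {l\<in>{..N - 2 * q}. even (b' + l)}"
    hence "odd (b' + l)" by simp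
    thus "?F q l = 0" by (rule F0)
   qed
  qed auto
  also have "\<dots> = (\<Sum>l\<le>M - q. ?F q (2 * l + b'))"
  proof (rule sum.reindex_bij_witness[where i="\<lambda>l. 2 * l + b'" and j="\<lambda>l. (l - b') div 2"])
   fix l assume l: "l \<in> {l\<in>{..N - 2 * q}. even (b' + l)}"
   hence "b' \<le> l" using b' by (cases "b' = 0"; cases "l = 0") auto
   hence e: "2 * ((l - b') div 2) + b' = l" using l by auto
   show "2 * ((l - b') div 2) + b' = l" by (rule e)
   show "?F q (2 * ((l - b') div 2) + b') = ?F q l" unfolding e ..
   show "(l - b') div 2 \<in> {..M - q}" using l N a that e by auto
  next
   fix l assume "l \<in> {..M - q}"
   thus "2 * l + b' \<in> {l \<in> {..N - 2 * q}. even (b' + l)}" using N that by auto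
  qed simp
  finally show ?thesis .
 qed
 \<comment> \<open>\<open>N div 2\<close> exceeds \<open>M\<close> only if \<open>a\<close> and
   \<open>b'\<close> are both 1; the additional summand then has only l = 0, which has the wrong
   parity.\<close>
 have "(\<Sum>q\<le>N div 2. Ccoef ?g N q * (\<Sum>l\<le>N - 2 * q. ?F q l)) = (\<Sum>q\<le>M. Ccoef ?g N q * (\<Sum>l\<le>N - 2 * q. ?F q l))"
 proof (rule sum.mono_neutral_right)
  show "{..M} \<subseteq> {..N div 2}" using N by auto
  show "\<forall>q\<in>{..N div 2} - {..M}. Ccoef ?g N q * (\<Sum>l\<le>N - 2 * q. ?F q l) = 0"
  proof
   fix q assume "q \<in> {..N div 2} - {..M}"
   hence "N - 2 * q = 0" "b' = 1" using N a b' by auto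
   thus "Ccoef ?g N q * (\<Sum>l\<le>N - 2 * q. ?F q l) = 0" using F0[of 0 q] by simp
  qed
 qed simp
 also have "\<dots> = (\<Sum>q\<le>M. \<Sum>l\<le>M - q. sin \<phi> ^ a * cos \<phi> ^ b' * ((-1) ^ q / fact q * pochhammer (c - real q) (M - s)
   * (((sin \<phi>)\<^sup>2) ^ (M - q - l) * ((cos \<phi>)\<^sup>2) ^ l / (fact l * fact (M - q - l)) * pochhammer (d + real l) s)))"
 proof (intro sum.cong refl)
  fix q assume "q \<in> {..M}"
  hence q: "q \<le> M" by simp
  show "Ccoef ?g N q * (\<Sum>l\<le>N - 2 * q. ?F q l) = (\<Sum>l\<le>M - q. sin \<phi> ^ a * cos \<phi> ^ b' * ((-1) ^ q / fact q * pochhammer (c - real q) (M - s)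
   * (((sin \<phi>)\<^sup>2) ^ (M - q - l) * ((cos \<phi>)\<^sup>2) ^ l / (fact l * fact (M - q - l)) * pochhammer (d + real l) s)))"
   unfolding inner[OF q] sum_distrib_left by (intro sum.cong refl trm[OF q]) simp
 qed
 also have "\<dots> = sin \<phi> ^ a * cos \<phi> ^ b' * (\<Sum>q\<le>M. (-1) ^ q / fact q * pochhammer (c - real q) (M - s)
   * (\<Sum>l\<le>M - q. ((sin \<phi>)\<^sup>2) ^ (M - q - l) * ((cos \<phi>)\<^sup>2) ^ l / (fact l * fact (M - q - l)) * pochhammer (d + real l) s))"
  by (simp only: sum_distrib_left)
 also have "\<dots> = sin \<phi> ^ a * cos \<phi> ^ b' * ((cos \<phi>)\<^sup>2) ^ s"
  by (subst trinomial_pochhammer_sum[OF _ sM]) simp_all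
 also have "\<dots> = sin \<phi> ^ a * cos \<phi> ^ b" unfolding b power_add power_mult by (simp only: mult_ac)
 finally show ?thesis .
qed

text \<open>Replacing one squared sine by 1 minus the squared cosine lowers \<open>a\<close> by two
  and keeps the degree at most \<open>N\<close> with the right parity, down to a <= 1.\<close>

lemma Ipol_reproduces_monomial:
 assumes ab: "\<alpha> > 0" "\<beta> \<ge> 0"
 shows "a + b \<le> N \<Longrightarrow> even (N - (a + b)) \<Longrightarrow>
  wint 1 \<alpha> \<beta> (\<lambda>\<xi>. of_real (sin \<xi> ^ a * cos \<xi> ^ b * Ipol \<alpha> \<beta> N \<xi> \<phi>)) = tmom \<alpha> \<beta> 0 0 * of_real (sin \<phi> ^ a * cos \<phi> ^ b)"
proof (induction a arbitrary: b rule: less_induct)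
 case (less a)
 show ?case
 proof (cases "a \<le> 1")
  case True
  thus ?thesis unfolding wint_Ipol[OF ab] using moment_sum[OF ab True less.prems] by simp
 next
  case False
  then obtain a' where a: "a = a' + 2" by (metis add.commute le_Suc_ex not_less_eq_eq one_add_one plus_1_eq_Suc)
  have c: "continuous_on UNIV (\<lambda>\<xi>. complex_of_real (sin \<xi> ^ a' * cos \<xi> ^ b * Ipol \<alpha> \<beta> N \<xi> \<phi>))" for b
   unfolding Ipol_def by (intro continuous_intros)
  have s: "sin t ^ (a' + 2) * cos t ^ b = (-1) * (sin t ^ a' * cos t ^ (b + 2)) + sin t ^ a' * cos t ^ b" for t :: real
  proof -
   have "sin t ^ (a' + 2) * cos t ^ b = sin t ^ a' * cos t ^ b * (sin t)\<^sup>2" by (simp only: power_add mult_ac)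
   also have "(sin t)\<^sup>2 = 1 - (cos t)\<^sup>2" by (rule sin_squared_eq)
   finally show ?thesis by (simp only: power_add right_diff_distrib mult_1_right mult_minus1 mult.assoc uminus_add_conv_diff)
  qed
  have e: "complex_of_real (sin \<xi> ^ a * cos \<xi> ^ b * Ipol \<alpha> \<beta> N \<xi> \<phi>) = (-1) * of_real (sin \<xi> ^ a' * cos \<xi> ^ (b + 2) * Ipol \<alpha> \<beta> N \<xi> \<phi>) + of_real (sin \<xi> ^ a' * cos \<xi> ^ b * Ipol \<alpha> \<beta> N \<xi> \<phi>)" for \<xi>
   unfolding a s by (simp only: distrib_right of_real_add of_real_mult of_real_minus of_real_1 mult.assoc)
  have "wint 1 \<alpha> \<beta> (\<lambda>\<xi>. of_real (sin \<xi> ^ a * cos \<xi> ^ b * Ipol \<alpha> \<beta> N \<xi> \<phi>))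
   = (-1) * wint 1 \<alpha> \<beta> (\<lambda>\<xi>. of_real (sin \<xi> ^ a' * cos \<xi> ^ (b + 2) * Ipol \<alpha> \<beta> N \<xi> \<phi>)) + wint 1 \<alpha> \<beta> (\<lambda>\<xi>. of_real (sin \<xi> ^ a' * cos \<xi> ^ b * Ipol \<alpha> \<beta> N \<xi> \<phi>))"
   unfolding e by (rule wint_linear[OF _ _ c c]) (use ab in auto)
  also have "\<dots> = (-1) * (tmom \<alpha> \<beta> 0 0 * of_real (sin \<phi> ^ a' * cos \<phi> ^ (b + 2))) + tmom \<alpha> \<beta> 0 0 * of_real (sin \<phi> ^ a' * cos \<phi> ^ b)"
   by (intro arg_cong2[where f="(+)"] arg_cong2[where f="(*)"] refl less.IH) (use less.prems a in auto)
  also have "\<dots> = tmom \<alpha> \<beta> 0 0 * of_real (sin \<phi> ^ a * cos \<phi> ^ b)"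
   unfolding a s by (simp add: algebra_simps)
  finally show ?thesis .
 qed
qed

theorem Ipol_reproduces:
 assumes ab: "\<alpha> > 0" "\<beta> \<ge> 0" and g: "g \<in> trig (freq N)"
 shows "wint 1 \<alpha> \<beta> (\<lambda>\<xi>. g \<xi> * of_real (Ipol \<alpha> \<beta> N \<xi> \<phi>)) = tmom \<alpha> \<beta> 0 0 * g \<phi>"
proof -
 obtain f where f: "homog_poly N f" "\<And>\<xi>. f (cis \<xi>) = g \<xi>" using trig_homog_poly[OF g] by blast
 then obtain c where c: "\<And>z. f z = (\<Sum>i\<le>N. c i * of_real (Re z ^ i * Im z ^ (N - i)))"
  unfolding homog_poly_def by blast
 have gc: "g \<xi> = (\<Sum>i\<le>N. c i * of_real (sin \<xi> ^ (N - i) * cos \<xi> ^ i))" for \<xi>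
  unfolding f(2)[symmetric] c by (simp add: mult.commute)
 have e: "g \<xi> * of_real (Ipol \<alpha> \<beta> N \<xi> \<phi>) = (\<Sum>i\<le>N. c i * of_real (sin \<xi> ^ (N - i) * cos \<xi> ^ i * Ipol \<alpha> \<beta> N \<xi> \<phi>))" for \<xi>
  unfolding gc sum_distrib_right by (simp only: of_real_mult mult.assoc)
 have "wint 1 \<alpha> \<beta> (\<lambda>\<xi>. g \<xi> * of_real (Ipol \<alpha> \<beta> N \<xi> \<phi>)) = (\<Sum>i\<le>N. c i * wint 1 \<alpha> \<beta> (\<lambda>\<xi>. of_real (sin \<xi> ^ (N - i) * cos \<xi> ^ i * Ipol \<alpha> \<beta> N \<xi> \<phi>)))"
  unfolding e by (rule wint_sum) (use ab in \<open>auto simp: Ipol_def intro!: continuous_intros\<close>)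
 also have "\<dots> = (\<Sum>i\<le>N. c i * (tmom \<alpha> \<beta> 0 0 * of_real (sin \<phi> ^ (N - i) * cos \<phi> ^ i)))"
  by (intro sum.cong refl arg_cong2[where f="(*)"] Ipol_reproduces_monomial[OF ab]) auto
 also have "\<dots> = tmom \<alpha> \<beta> 0 0 * g \<phi>" unfolding gc sum_distrib_left by (simp only: mult_ac)
 finally show ?thesis .
qed

subsection \<open>Lifting the reproducing kernel to the dihedral group\<close>

lemma continuous_Ipol: "continuous_on A (\<lambda>\<xi>. complex_of_real (Ipol \<alpha> \<beta> N (real k * \<xi>) \<phi>))"
 unfolding Ipol_def by (intro continuous_intros)

text \<open>The shift changes the sign of the Gegenbauer argument, and a Gegenbauer polynomial has
  the parity of its degree.\<close>

lemma Ipol_shift_pi: "Ipol \<alpha> \<beta> N (\<xi> + pi) \<phi> = (-1) ^ N * Ipol \<alpha> \<beta> N \<xi> \<phi>"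
proof -
 have pq: "(sin (\<xi> + pi) * sin \<phi>) ^ (N - 2 * q - l) * (cos (\<xi> + pi) * cos \<phi>) ^ l
  = (-1) ^ N * ((sin \<xi> * sin \<phi>) ^ (N - 2 * q - l) * (cos \<xi> * cos \<phi>) ^ l)" if "l \<le> N - 2 * q" "q \<le> N div 2" for q l
 proof -
  have m: "sin (\<xi> + pi) * sin \<phi> = (-1) * (sin \<xi> * sin \<phi>)" "cos (\<xi> + pi) * cos \<phi> = (-1) * (cos \<xi> * cos \<phi>)" by simp_all
  have "(-1::real) ^ (N - 2 * q - l) * (-1) ^ l = (-1) ^ (N - 2 * q)" using that by (simp add: power_add[symmetric])
  also have "\<dots> = (-1) ^ (N - 2 * q) * (-1) ^ (2 * q)" by simp
  also have "\<dots> = (-1) ^ N" unfolding power_add[symmetric] using that by simp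
  finally have e: "(-1::real) ^ (N - 2 * q - l) * (-1) ^ l = (-1) ^ N" .
  show ?thesis unfolding m power_mult_distrib[of "-1"] e[symmetric] by (simp only: mult_ac)
 qed
 have t: "real ((N - 2 * q) choose l) * (sin (\<xi> + pi) * sin \<phi>) ^ (N - 2 * q - l) * (cos (\<xi> + pi) * cos \<phi>) ^ l * mumom \<alpha> (N - 2 * q - l) * mumom \<beta> l
  = (-1) ^ N * (real ((N - 2 * q) choose l) * (sin \<xi> * sin \<phi>) ^ (N - 2 * q - l) * (cos \<xi> * cos \<phi>) ^ l * mumom \<alpha> (N - 2 * q - l) * mumom \<beta> l)"
  if "l \<le> N - 2 * q" "q \<le> N div 2" for q l
 proof -
  have g: "C * u * v * x * y = (u * v) * (C * x * y)" for C u v x y :: real by (simp only: mult_ac)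
  show ?thesis unfolding g pq[OF that] by (rule mult.assoc)
 qed
 have "Ipol \<alpha> \<beta> N (\<xi> + pi) \<phi> = (\<Sum>q\<le>N div 2. Ccoef (\<alpha> + \<beta>) N q * (\<Sum>l\<le>N - 2 * q. (-1) ^ N * (real ((N - 2 * q) choose l)
  * (sin \<xi> * sin \<phi>) ^ (N - 2 * q - l) * (cos \<xi> * cos \<phi>) ^ l * mumom \<alpha> (N - 2 * q - l) * mumom \<beta> l)))"
  unfolding Ipol_def by (intro sum.cong refl arg_cong2[where f="(*)"] t) auto
 thus ?thesis unfolding Ipol_def sum_distrib_left by (simp only: mult_ac)
qed

lemma Ipol_periodic: "Ipol \<alpha> \<beta> N (\<xi> + 2 * pi) \<phi> = Ipol \<alpha> \<beta> N \<xi> \<phi>"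
 unfolding Ipol_def by simp

lemma Ipol_periodic_mult: "Ipol \<alpha> \<beta> N (\<xi> + 2 * pi * real n) \<phi> = Ipol \<alpha> \<beta> N \<xi> \<phi>"
proof (induction n)
 case (Suc n)
 have e: "\<xi> + 2 * pi * real (Suc n) = (\<xi> + 2 * pi * real n) + 2 * pi" by (simp add: algebra_simps)
 show ?case unfolding e Ipol_periodic by (rule Suc)
qed simp

lemma Etrig_periodic: "Etrig l (\<xi> + 2 * pi) = Etrig l \<xi>"
 using trig_periodic_2pi[OF trig_Etrig[of l "{l}"]] by simp

lemma wint_Etrig_Ipol_eq_0:
 assumes k: "k > 0" and ab: "\<alpha> > 0" "\<beta> \<ge> 0" and t: "\<not> int k dvd t"
 shows "wint k \<alpha> \<beta> (\<lambda>\<xi>. Etrig t \<xi> * of_real (Ipol \<alpha> \<beta> N (real k * \<xi>) \<phi>)) = 0"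
proof (rule wint_rotate_eq_0[OF k, where n=2 and c="cis (2 * pi * of_int t / real k)"])
 show "cis (2 * pi * of_int t / real k) \<noteq> 1"
 proof
  assume "cis (2 * pi * of_int t / real k) = 1"
  hence "cos (2 * pi * of_int t / real k) = 1" by (simp add: complex_eq_iff)
  then obtain m :: int where "2 * pi * of_int t / real k = of_int m * 2 * pi" using cos_one_2pi_int by blast
  hence "real_of_int t = of_int (m * int k)" using k by (simp add: field_simps)
  hence "t = m * int k" by (simp only: of_int_eq_iff)
  thus False using t by simp
 qed
 fix \<xi>
 have e1: "of_int t * (\<xi> + pi * of_int 2 / real k) = 2 * pi * of_int t / real k + of_int t * \<xi>" by (simp add: algebra_simps)
 have e2: "real k * (\<xi> + pi * of_int 2 / real k) = real k * \<xi> + 2 * pi" using k by (simp add: algebra_simps)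
 show "Etrig t (\<xi> + pi * of_int 2 / real k) * of_real (Ipol \<alpha> \<beta> N (real k * (\<xi> + pi * of_int 2 / real k)) \<phi>)
  = cis (2 * pi * of_int t / real k) * (Etrig t \<xi> * of_real (Ipol \<alpha> \<beta> N (real k * \<xi>) \<phi>))"
  unfolding e1 e2 Ipol_periodic cis_mult[symmetric] by (rule mult.assoc)
 have e3: "real k * (\<xi> + 2 * pi) = real k * \<xi> + 2 * pi * real k" by (simp add: algebra_simps)
 show "Etrig t (\<xi> + 2 * pi) * of_real (Ipol \<alpha> \<beta> N (real k * (\<xi> + 2 * pi)) \<phi>) = Etrig t \<xi> * of_real (Ipol \<alpha> \<beta> N (real k * \<xi>) \<phi>)"
  unfolding Etrig_periodic e3 Ipol_periodic_mult ..
qed (use ab in \<open>auto intro!: continuous_intros continuous_Ipol\<close>)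

lemma wint_Etrig_Ipol_scale:
 assumes k: "k > 0" and ab: "\<alpha> > 0" "\<beta> \<ge> 0"
 shows "wint k \<alpha> \<beta> (\<lambda>\<xi>. Etrig (int k * p) \<xi> * of_real (Ipol \<alpha> \<beta> N (real k * \<xi>) \<phi>)) = wint 1 \<alpha> \<beta> (\<lambda>\<xi>. Etrig p \<xi> * of_real (Ipol \<alpha> \<beta> N \<xi> \<phi>))"
proof -
 have e: "of_int (int k * p) * \<xi> = of_int p * (real k * \<xi>)" for \<xi> by simp
 show ?thesis unfolding e
  by (rule wint_scale[OF k, where g="\<lambda>\<xi>. Etrig p \<xi> * of_real (Ipol \<alpha> \<beta> N \<xi> \<phi>)"])
   (use ab continuous_Ipol[of UNIV \<alpha> \<beta> N 1 \<phi>] in \<open>auto intro!: continuous_intros simp: Ipol_periodic Etrig_periodic\<close>)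
qed

lemma wint_Etrig_Ipol_parity:
 assumes ab: "\<alpha> > 0" "\<beta> \<ge> 0" and p: "odd (p + int N)"
 shows "wint 1 \<alpha> \<beta> (\<lambda>\<xi>. Etrig p \<xi> * of_real (Ipol \<alpha> \<beta> N \<xi> \<phi>)) = 0"
proof (rule wint_rotate_eq_0[where n=1 and c="-1"])
 fix \<xi>
 have "cis (of_int p * pi) * (-1) ^ N = -1"
 proof -
  have "cis (of_int p * pi) = (if even p then 1 else -1)"
   by (simp add: complex_eq_iff cos_int_times_real sin_int_times_real) (metis cos_npi_int mult.commute sin_npi_int)
  thus ?thesis using p by (cases "even p") auto
 qed
 moreover have e: "of_int p * (\<xi> + pi * of_int 1 / real 1) = of_int p * pi + of_int p * \<xi>" "\<xi> + pi * of_int 1 / real 1 = \<xi> + pi" by (simp_all add: algebra_simps)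
 have "Etrig p (\<xi> + pi * of_int 1 / real 1) * of_real (Ipol \<alpha> \<beta> N (\<xi> + pi * of_int 1 / real 1) \<phi>)
  = (cis (of_int p * pi) * (-1) ^ N) * (Etrig p \<xi> * of_real (Ipol \<alpha> \<beta> N \<xi> \<phi>))"
  unfolding e(1) unfolding e(2) Ipol_shift_pi cis_mult[symmetric] by (simp only: of_real_mult of_real_power of_real_minus of_real_1 mult_ac)
 ultimately show "Etrig p (\<xi> + pi * of_int 1 / real 1) * of_real (Ipol \<alpha> \<beta> N (\<xi> + pi * of_int 1 / real 1) \<phi>)
  = -1 * (Etrig p \<xi> * of_real (Ipol \<alpha> \<beta> N \<xi> \<phi>))" by (simp only:)
qed (use ab continuous_Ipol[of UNIV \<alpha> \<beta> N 1 \<phi>] in \<open>auto intro!: continuous_intros simp: Ipol_periodic Etrig_periodic\<close>)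

text \<open>The double sum of \<open>Spol\<close> with each Gegenbauer value replaced by its average
  at the k-fold angles.\<close>

definition SK :: "nat \<Rightarrow> real \<Rightarrow> real \<Rightarrow> nat \<Rightarrow> real \<Rightarrow> real \<Rightarrow> complex" where
 "SK k \<alpha> \<beta> J \<xi> \<phi> = (\<Sum>m<k. \<Sum>m'<k. if m + m' \<le> J \<and> k dvd (J - m - m')
  then cis ((real m - real m') * (\<xi> - \<phi>)) * of_real (Ipol \<alpha> \<beta> ((J - m - m') div k) (real k * \<xi>) (real k * \<phi>)) else 0)"

lemma continuous_SK: "continuous_on A (\<lambda>\<xi>. SK k \<alpha> \<beta> J \<xi> \<phi>)"
proof -
 have "continuous_on A (\<lambda>\<xi>. if P then cis (x * (\<xi> - \<phi>)) * of_real (Ipol \<alpha> \<beta> n (real k * \<xi>) (real k * \<phi>)) else 0)" for P x n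
  by (cases P) (auto intro!: continuous_intros continuous_Ipol)
 thus ?thesis unfolding SK_def by (intro continuous_intros)
qed

lemma cnj_SK: "cnj (SK k \<alpha> \<beta> J \<xi> \<phi>) = SK k \<alpha> \<beta> J \<xi> \<phi>"
proof -
 have "cnj (SK k \<alpha> \<beta> J \<xi> \<phi>) = (\<Sum>m<k. \<Sum>m'<k. if m + m' \<le> J \<and> k dvd (J - m - m')
  then cis ((real m' - real m) * (\<xi> - \<phi>)) * of_real (Ipol \<alpha> \<beta> ((J - m - m') div k) (real k * \<xi>) (real k * \<phi>)) else 0)"
  unfolding SK_def by (simp add: if_distrib[of cnj] cis_cnj algebra_simps cong: if_cong)
 also have "\<dots> = SK k \<alpha> \<beta> J \<xi> \<phi>"
  unfolding SK_def by (subst sum.swap) (intro sum.cong refl, simp add: add.commute diff_commute)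
 finally show ?thesis .
qed

text \<open>In the product the summand (m, m') has frequency l + m - m' against a function of k
  \<xi>. Rotation by 2 pi/k kills it unless k divides this frequency, and a parity argument kills
  half of the rest. Exactly one pair survives, and for it the kernel of the case k = 1 reproduces
  the exponential.\<close>

lemma wint_Etrig_SK:
 assumes k: "k > 0" and ab: "\<alpha> > 0" "\<beta> \<ge> 0" and l: "l \<in> freq J"
 shows "wint k \<alpha> \<beta> (\<lambda>\<xi>. Etrig l \<xi> * SK k \<alpha> \<beta> J \<xi> \<phi>) = tmom \<alpha> \<beta> 0 0 * Etrig l \<phi>"
proof -
 \<comment> \<open>\<open>A\<close> and \<open>B\<close> are the exponents of z and of its conjugate
   in the monomial of degree \<open>J\<close> that restricts to \<open>Etrig l\<close>.\<close>
 define A where "A = nat ((int J + l) div 2)"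
 define B where "B = nat ((int J - l) div 2)"
 have AB: "J = A + B" "l = int A - int B"
 proof -
  from l have "\<bar>l\<bar> \<le> int J" "even (l - int J)" unfolding freq_def by blast+
  hence "even (int J + l)" "even (int J - l)" "0 \<le> int J + l" "0 \<le> int J - l" by auto
  hence "2 * int A = int J + l" "2 * int B = int J - l" unfolding A_def B_def by simp_all
  thus "J = A + B" "l = int A - int B" by linarith+
 qed
 let ?C = "\<lambda>m m'. m + m' \<le> J \<and> k dvd (J - m - m')"
 let ?N = "\<lambda>m m'. (J - m - m') div k"
 let ?t = "\<lambda>m m'. l + int m - int m'"
 let ?w = "\<lambda>m m'. wint k \<alpha> \<beta> (\<lambda>\<xi>. Etrig (?t m m') \<xi> * of_real (Ipol \<alpha> \<beta> (?N m m') (real k * \<xi>) (real k * \<phi>)))"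
 let ?I = "SIGMA m:{..<k}. {..<k}"
 have e: "Etrig l \<xi> * SK k \<alpha> \<beta> J \<xi> \<phi> = (\<Sum>p\<in>?I. (if ?C (fst p) (snd p) then cis (- ((real (fst p) - real (snd p)) * \<phi>)) else 0)
   * (Etrig (?t (fst p) (snd p)) \<xi> * of_real (Ipol \<alpha> \<beta> (?N (fst p) (snd p)) (real k * \<xi>) (real k * \<phi>))))" for \<xi>
 proof -
  have c: "Etrig l \<xi> * cis ((real m - real m') * (\<xi> - \<phi>)) = cis (- ((real m - real m') * \<phi>)) * Etrig (?t m m') \<xi>" for m m'
   unfolding cis_mult by (rule arg_cong[where f=cis]) (simp add: algebra_simps)
  have "Etrig l \<xi> * SK k \<alpha> \<beta> J \<xi> \<phi> = (\<Sum>m<k. \<Sum>m'<k. (if ?C m m' then cis (- ((real m - real m') * \<phi>)) else 0)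
   * (Etrig (?t m m') \<xi> * of_real (Ipol \<alpha> \<beta> (?N m m') (real k * \<xi>) (real k * \<phi>))))"
   unfolding SK_def sum_distrib_left
  proof (intro sum.cong refl)
   fix m m'
   show "Etrig l \<xi> * (if ?C m m' then cis ((real m - real m') * (\<xi> - \<phi>)) * of_real (Ipol \<alpha> \<beta> (?N m m') (real k * \<xi>) (real k * \<phi>)) else 0)
    = (if ?C m m' then cis (- ((real m - real m') * \<phi>)) else 0) * (Etrig (?t m m') \<xi> * of_real (Ipol \<alpha> \<beta> (?N m m') (real k * \<xi>) (real k * \<phi>)))"
    by (cases "?C m m'") (simp_all only: simp_thms if_True if_False mult.assoc[symmetric] c mult_zero_left mult_zero_right)
  qed
  also have "\<dots> = (\<Sum>p\<in>?I. (if ?C (fst p) (snd p) then cis (- ((real (fst p) - real (snd p)) * \<phi>)) else 0)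
   * (Etrig (?t (fst p) (snd p)) \<xi> * of_real (Ipol \<alpha> \<beta> (?N (fst p) (snd p)) (real k * \<xi>) (real k * \<phi>))))"
   by (subst sum.Sigma) (simp_all only: case_prod_unfold finite_lessThan ball_triv simp_thms)
  finally show ?thesis .
 qed
 have "wint k \<alpha> \<beta> (\<lambda>\<xi>. Etrig l \<xi> * SK k \<alpha> \<beta> J \<xi> \<phi>) = (\<Sum>p\<in>?I. (if ?C (fst p) (snd p) then cis (- ((real (fst p) - real (snd p)) * \<phi>)) else 0) * ?w (fst p) (snd p))"
  unfolding e by (rule wint_sum) (use ab in \<open>auto intro!: continuous_intros continuous_Ipol\<close>)
 also have "\<dots> = (\<Sum>p\<in>?I. if p = (B mod k, A mod k) then tmom \<alpha> \<beta> 0 0 * Etrig l \<phi> else 0)"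
 proof (intro sum.cong refl)
  fix p assume "p \<in> ?I"
  obtain m m' where p: "p = (m, m')" by (cases p)
  with \<open>p \<in> ?I\<close> have mk: "m < k" "m' < k" by auto
  show "(if ?C (fst p) (snd p) then cis (- ((real (fst p) - real (snd p)) * \<phi>)) else 0) * ?w (fst p) (snd p)
   = (if p = (B mod k, A mod k) then tmom \<alpha> \<beta> 0 0 * Etrig l \<phi> else 0)"
  proof (cases "p = (B mod k, A mod k)")
   case True
   hence m: "m = B mod k" "m' = A mod k" using p by auto
   have le: "m + m' \<le> J" unfolding m AB(1) using mod_less_eq_dividend[of A k] mod_less_eq_dividend[of B k] by linarith
   have "A = k * (A div k) + m'" "B = k * (B div k) + m" unfolding m by simp_all
   hence Jm: "J - m - m' = k * (A div k + B div k)" using AB(1) by (metis add_diff_cancel_right' diff_diff_left add.assoc add.commute add_mult_distrib2)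
   have tm: "?t m m' = int k * (int (A div k) - int (B div k))"
   proof -
    have "int A = int k * int (A div k) + int m'" "int B = int k * int (B div k) + int m"
     unfolding m by (simp_all flip: of_nat_mult of_nat_add)
    thus ?thesis unfolding AB(2) by (simp add: right_diff_distrib)
   qed
   let ?P = "int (A div k) - int (B div k)" and ?M = "A div k + B div k"
   have N: "?N m m' = ?M" unfolding Jm using k by simp
   have "?P \<in> freq ?M" by (simp add: freq_def)
   from Ipol_reproduces[OF ab trig_Etrig[OF this finite_freq(1)], of "real k * \<phi>"]
   have w: "?w m m' = tmom \<alpha> \<beta> 0 0 * Etrig ?P (real k * \<phi>)" unfolding N tm wint_Etrig_Ipol_scale[OF k ab] .
   have "cis (- ((real m - real m') * \<phi>)) * Etrig ?P (real k * \<phi>) = Etrig l \<phi>"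
    unfolding cis_mult
   proof (rule arg_cong[where f=cis])
    have "real_of_int l = of_int (?t m m') - real m + real m'" by simp
    hence "real_of_int l = real k * of_int ?P - real m + real m'" unfolding tm by simp
    thus "- ((real m - real m') * \<phi>) + of_int ?P * (real k * \<phi>) = of_int l * \<phi>" by (simp only:) (simp add: algebra_simps)
   qed
   moreover have "k dvd (J - m - m')" unfolding Jm by simp
   ultimately show ?thesis using True le unfolding p fst_conv snd_conv w by (simp add: p mult.left_commute)
  next
   case False
   have "?w m m' = 0" if C: "?C m m'"
   proof (cases "int k dvd ?t m m'")
    case False thus ?thesis by (rule wint_Etrig_Ipol_eq_0[OF k ab])
   next
    case True
    then obtain P where P: "?t m m' = int k * P" by (elim dvdE)
    obtain N where N: "J - m - m' = k * N" using C by (elim conjE dvdE)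
    have NN: "?N m m' = N" unfolding N using k by simp
    have "int J = int (m + m' + k * N)" using C N by linarith
    hence J: "int J - int m - int m' = int k * int N" by simp
    \<comment> \<open>If P + N were even, halving the sum of the two relations would give A = m' and
      B = m modulo k, which is the excluded pair.\<close>
    have "odd (P + int N)"
    proof
     assume "even (P + int N)"
     then obtain r where r: "P + int N = 2 * r" by (elim evenE)
     have "2 * (int A - int m') = int k * (P + int N)" using P J AB by (simp add: algebra_simps)
     hence Ar: "int A - int m' = int k * r" unfolding r by simp
     have Br: "int B - int m = int k * (int N - r)" using Ar J AB by (simp add: algebra_simps)
     have "int A = int m' + int k * r" "int B = int m + int k * (int N - r)" using Ar Br by simp_all
     hence "int A mod int k = int m' mod int k" "int B mod int k = int m mod int k" by (simp_all only: mod_mult_self2)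
     hence "A mod k = m' mod k" "B mod k = m mod k" by (simp_all only: zmod_int[symmetric] of_nat_eq_iff)
     hence "m' = A mod k" "m = B mod k" using mk by simp_all
     thus False using \<open>p \<noteq> (B mod k, A mod k)\<close> p by simp
    qed
    thus ?thesis unfolding P NN wint_Etrig_Ipol_scale[OF k ab] by (rule wint_Etrig_Ipol_parity[OF ab])
   qed
   thus ?thesis using False unfolding p fst_conv snd_conv by (cases "?C m m'") (simp_all only: if_True if_False mult_zero_left mult_zero_right)
  qed
 qed
 also have "\<dots> = tmom \<alpha> \<beta> 0 0 * Etrig l \<phi>" using k by (subst sum.delta) auto
 finally show ?thesis .
qed

theorem SK_reproduces:
 assumes k: "k > 0" and ab: "\<alpha> > 0" "\<beta> \<ge> 0" and g: "g \<in> trig (freq J)"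
 shows "wint k \<alpha> \<beta> (\<lambda>\<xi>. g \<xi> * SK k \<alpha> \<beta> J \<xi> \<phi>) = tmom \<alpha> \<beta> 0 0 * g \<phi>"
proof -
 obtain c where c: "g = (\<lambda>\<xi>. \<Sum>l\<in>freq J. c l * Etrig l \<xi>)" using g by (auto simp: trig_def)
 have e: "g \<xi> * SK k \<alpha> \<beta> J \<xi> \<phi> = (\<Sum>l\<in>freq J. c l * (Etrig l \<xi> * SK k \<alpha> \<beta> J \<xi> \<phi>))" for \<xi>
  unfolding c sum_distrib_right by (simp only: mult.assoc)
 have "wint k \<alpha> \<beta> (\<lambda>\<xi>. g \<xi> * SK k \<alpha> \<beta> J \<xi> \<phi>) = (\<Sum>l\<in>freq J. c l * wint k \<alpha> \<beta> (\<lambda>\<xi>. Etrig l \<xi> * SK k \<alpha> \<beta> J \<xi> \<phi>))"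
  unfolding e by (rule wint_sum) (use ab in \<open>auto intro!: continuous_intros continuous_SK\<close>)
 also have "\<dots> = (\<Sum>l\<in>freq J. c l * (tmom \<alpha> \<beta> 0 0 * Etrig l \<phi>))"
  by (intro sum.cong refl arg_cong2[where f="(*)"] wint_Etrig_SK[OF k ab])
 also have "\<dots> = tmom \<alpha> \<beta> 0 0 * g \<phi>" unfolding c sum_distrib_left by (simp only: mult_ac)
 finally show ?thesis .
qed

lemma SK_trig: "k > 0 \<Longrightarrow> (\<lambda>\<xi>. SK k \<alpha> \<beta> J \<xi> \<phi>) \<in> trig (freq J)"
proof -
 assume k: "k > 0"
 have pw: "(\<lambda>\<xi>. complex_of_real (sin (real k * \<xi>) ^ n * cos (real k * \<xi>) ^ l)) \<in> trig (freq (k * (n + l)))" for n l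
 proof -
  have E: "Etrig (int k) \<in> trig (freq k)" "Etrig (- int k) \<in> trig (freq k)"
   by (rule trig_Etrig; (rule finite_freq | simp add: freq_def))+
  have c: "complex_of_real (cos (real k * \<xi>)) = (1/2) * (Etrig (int k) \<xi> + Etrig (- int k) \<xi>)" for \<xi> by (simp add: complex_eq_iff)
  have s: "complex_of_real (sin (real k * \<xi>)) = (-\<i>/2) * (Etrig (int k) \<xi> - Etrig (- int k) \<xi>)" for \<xi> by (simp add: complex_eq_iff)
  have 1: "(\<lambda>\<xi>. complex_of_real (cos (real k * \<xi>))) \<in> trig (freq k)" unfolding c by (intro trig_cmult trig_add E)
  have 2: "(\<lambda>\<xi>. complex_of_real (sin (real k * \<xi>))) \<in> trig (freq k)" unfolding s by (intro trig_cmult trig_diff E)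
  have P: "(\<lambda>\<xi>. g \<xi> ^ m) \<in> trig (freq (k * m))" if "g \<in> trig (freq k)" for g m
   by (induction m) (use trig_1 trig_freq_mult[OF that] in auto)
  show ?thesis using trig_freq_mult[OF P[OF 2, of n] P[OF 1, of l]] by (simp add: distrib_left)
 qed
 have Ip: "(\<lambda>\<xi>. complex_of_real (Ipol \<alpha> \<beta> N (real k * \<xi>) \<psi>)) \<in> trig (freq (k * N))" for N \<psi>
 proof -
  have e: "complex_of_real (Ipol \<alpha> \<beta> N (real k * \<xi>) \<psi>) = (\<Sum>q\<le>N div 2. of_real (Ccoef (\<alpha> + \<beta>) N q) * (\<Sum>l\<le>N - 2 * q.
    of_real (real ((N - 2 * q) choose l) * sin \<psi> ^ (N - 2 * q - l) * cos \<psi> ^ l * mumom \<alpha> (N - 2 * q - l) * mumom \<beta> l)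
    * of_real (sin (real k * \<xi>) ^ (N - 2 * q - l) * cos (real k * \<xi>) ^ l)))" for \<xi>
   unfolding Ipol_def of_real_sum of_real_mult[symmetric] sum_distrib_left
   by (intro sum.cong refl) (simp add: power_mult_distrib mult_ac)
  show ?thesis unfolding e
  proof (intro trig_sum trig_cmult)
   fix q l assume "q \<in> {..N div 2}" "l \<in> {..N - 2 * q}"
   hence n: "N - 2 * q - l + l = N - 2 * q" "k * N - k * (N - 2 * q) = 2 * (k * q)" "k * (N - 2 * q) \<le> k * N"
    by (auto simp: diff_mult_distrib2[symmetric])
   show "(\<lambda>\<xi>. complex_of_real (sin (real k * \<xi>) ^ (N - 2 * q - l) * cos (real k * \<xi>) ^ l)) \<in> trig (freq (k * N))"
    by (rule trig_mono[OF freq_mono finite_freq(1) pw[unfolded]]) (use n in simp_all)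
  qed
 qed
 show ?thesis unfolding SK_def
 proof (intro trig_sum)
  fix m m' assume "m \<in> {..<k}" "m' \<in> {..<k}"
  show "(\<lambda>\<xi>. if m + m' \<le> J \<and> k dvd J - m - m' then cis ((real m - real m') * (\<xi> - \<phi>)) * of_real (Ipol \<alpha> \<beta> ((J - m - m') div k) (real k * \<xi>) (real k * \<phi>)) else 0) \<in> trig (freq J)"
  proof (cases "m + m' \<le> J \<and> k dvd J - m - m'")
   case True
   let ?N = "(J - m - m') div k"
   have J: "(m + m') + k * ?N = J" using True by auto
   have c: "cis ((real m - real m') * (\<xi> - \<phi>)) = cis (- ((real m - real m') * \<phi>)) * Etrig (int m - int m') \<xi>" for \<xi>
    unfolding cis_mult by (rule arg_cong[where f=cis]) (simp add: algebra_simps)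
   have "Etrig (int m - int m') \<in> trig (freq (m + m'))"
    by (rule trig_Etrig[OF _ finite_freq(1)]) (simp add: freq_def)
   from trig_cmult[OF trig_freq_mult[OF this Ip[of ?N "real k * \<phi>"]], of "cis (- ((real m - real m') * \<phi>))"]
   have "(\<lambda>\<xi>. cis (- ((real m - real m') * \<phi>)) * (Etrig (int m - int m') \<xi> * of_real (Ipol \<alpha> \<beta> ?N (real k * \<xi>) (real k * \<phi>)))) \<in> trig (freq J)"
    unfolding J .
   thus ?thesis unfolding c mult.assoc using True by simp
  qed (simp only: if_False trig_0)
 qed
qed

subsection \<open>The reproducing kernel of the spherical harmonics\<close>

definition PK :: "nat \<Rightarrow> real \<Rightarrow> real \<Rightarrow> nat \<Rightarrow> real \<Rightarrow> real \<Rightarrow> complex" where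
 "PK k \<alpha> \<beta> j \<xi> \<phi> = SK k \<alpha> \<beta> j \<xi> \<phi> - (if j < 2 then 0 else SK k \<alpha> \<beta> (j - 2) \<xi> \<phi>)"

lemma PK_trig:
 assumes k: "k > 0" shows "(\<lambda>\<xi>. PK k \<alpha> \<beta> j \<xi> \<phi>) \<in> trig (freq j)"
proof -
 have "(\<lambda>\<xi>. if j < 2 then 0 else SK k \<alpha> \<beta> (j - 2) \<xi> \<phi>) \<in> trig (freq j)"
 proof (cases "j < 2")
  case False
  hence "freq (j - 2) \<subseteq> freq j" by (intro freq_mono) auto
  from trig_mono[OF this finite_freq(1) SK_trig[OF k]] False show ?thesis by simp
 qed (simp add: trig_0)
 thus ?thesis unfolding PK_def by (intro trig_diff SK_trig[OF k])
qed

lemma cnj_PK: "cnj (PK k \<alpha> \<beta> j \<xi> \<phi>) = PK k \<alpha> \<beta> j \<xi> \<phi>"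
 by (simp add: PK_def cnj_SK)

lemma wint_PK:
 assumes k: "k > 0" and ab: "\<alpha> > 0" "\<beta> \<ge> 0" and g: "continuous_on UNIV g"
 shows "wint k \<alpha> \<beta> (\<lambda>\<xi>. g \<xi> * PK k \<alpha> \<beta> j \<xi> \<phi>) = wint k \<alpha> \<beta> (\<lambda>\<xi>. g \<xi> * SK k \<alpha> \<beta> j \<xi> \<phi>)
  - (if j < 2 then 0 else wint k \<alpha> \<beta> (\<lambda>\<xi>. g \<xi> * SK k \<alpha> \<beta> (j - 2) \<xi> \<phi>))"
proof (cases "j < 2")
 case False
 have e: "g \<xi> * PK k \<alpha> \<beta> j \<xi> \<phi> = (-1) * (g \<xi> * SK k \<alpha> \<beta> (j - 2) \<xi> \<phi>) + g \<xi> * SK k \<alpha> \<beta> j \<xi> \<phi>" for \<xi>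
  using False by (simp add: PK_def algebra_simps)
 have "wint k \<alpha> \<beta> (\<lambda>\<xi>. g \<xi> * PK k \<alpha> \<beta> j \<xi> \<phi>) = (-1) * wint k \<alpha> \<beta> (\<lambda>\<xi>. g \<xi> * SK k \<alpha> \<beta> (j - 2) \<xi> \<phi>) + wint k \<alpha> \<beta> (\<lambda>\<xi>. g \<xi> * SK k \<alpha> \<beta> j \<xi> \<phi>)"
  unfolding e by (rule wint_linear) (use ab in \<open>auto intro!: continuous_intros g continuous_SK\<close>)
 thus ?thesis using False by simp
qed (simp add: PK_def)

lemma wint_1:
 assumes k: "k > 0" and ab: "\<alpha> > 0" "\<beta> \<ge> 0"
 shows "wint k \<alpha> \<beta> (\<lambda>_. 1) = tmom \<alpha> \<beta> 0 0" "tmom \<alpha> \<beta> 0 0 \<noteq> 0"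
proof -
 show 1: "wint k \<alpha> \<beta> (\<lambda>_. 1) = tmom \<alpha> \<beta> 0 0"
  using wint_scale[OF k, of \<alpha> \<beta> "\<lambda>_. 1"] ab by (simp add: tmom_def)
 show "tmom \<alpha> \<beta> 0 0 \<noteq> 0"
 proof
  assume "tmom \<alpha> \<beta> 0 0 = 0"
  hence "wint k \<alpha> \<beta> (\<lambda>\<xi>. 1 * cnj 1) = 0" using 1 by simp
  hence "(\<lambda>_::real. 1::complex) = (\<lambda>_. 0)" using ab by (intro wint_pos[OF k _ _ trig_1]) auto
  thus False by (auto dest: fun_cong)
 qed
qed

lemma circ_inner_wint:
 assumes k: "k > 0" and ab: "\<alpha> > 0" "\<beta> \<ge> 0" and w: "\<And>\<xi>. w (cis \<xi>) = wt k \<alpha> \<beta> \<xi>"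
  and f: "continuous_on UNIV (\<lambda>\<xi>. f (cis \<xi>))" "continuous_on UNIV (\<lambda>\<xi>. g (cis \<xi>))"
 shows "circ_inner w f g = wint k \<alpha> \<beta> (\<lambda>\<xi>. f (cis \<xi>) * cnj (g (cis \<xi>))) / tmom \<alpha> \<beta> 0 0"
proof -
 have cw: "continuous_on {0..2 * pi} (wt k \<alpha> \<beta>)" using ab by (intro continuous_wt) auto
 have c1: "continuous_on {0..2 * pi} (\<lambda>\<xi>. f (cis \<xi>) * cnj (g (cis \<xi>)) * of_real (wt k \<alpha> \<beta> \<xi>))"
  by (intro continuous_intros cw continuous_on_subset[OF f(1)] continuous_on_subset[OF f(2)]) auto
 have 1: "set_lebesgue_integral lborel {0..2 * pi} (\<lambda>\<xi>. f (cis \<xi>) * cnj (g (cis \<xi>)) * of_real (wt k \<alpha> \<beta> \<xi>)) = wint k \<alpha> \<beta> (\<lambda>\<xi>. f (cis \<xi>) * cnj (g (cis \<xi>)))"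
  unfolding wint_def by (subst set_borel_integral_eq_integral(2)[OF borel_integrable_atLeastAtMost'[OF c1]]) (simp only: mult.commute)
 have 2: "of_real (set_lebesgue_integral lborel {0..2 * pi} (wt k \<alpha> \<beta>)) = wint k \<alpha> \<beta> (\<lambda>_. 1)"
  unfolding wint_def set_borel_integral_eq_integral(2)[OF borel_integrable_atLeastAtMost'[OF cw]]
  using integral_linear[OF integrable_continuous_interval[OF cw] bounded_linear_of_real[where 'a=complex]] by (simp add: o_def)
 show ?thesis unfolding circ_inner_def w 1 2 wint_1(1)[OF k ab] ..
qed

text \<open>The definite description needs existence and uniqueness. Two candidates have sections in
  the harmonics with the same pairings, so the difference of the sections is orthogonal to itself
  and vanishes.\<close>

theorem repr_kernel_eq:
 assumes k: "k > 0" and ab: "\<alpha> > 0" "\<beta> \<ge> 0" and w: "\<And>\<xi>. w (cis \<xi>) = wt k \<alpha> \<beta> \<xi>"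
  and R: "R = line_roots (dlines k \<alpha> \<beta>)" and \<omega>: "cmod \<omega> = 1" and \<eta>: "cmod \<eta> = 1"
 shows "repr_kernel R w j \<omega> \<eta> = PK k \<alpha> \<beta> j (Arg \<omega>) (Arg \<eta>)"
proof -
 let ?I = "wint k \<alpha> \<beta>"
 have ab': "\<alpha> \<ge> 0" "\<beta> \<ge> 0" using ab by auto
 interpret dunkl_circle "dlines k \<alpha> \<beta>" ?I by (rule dunkl_circle_dlines[OF k ab])
 have hm: "f \<in> harm R j \<longleftrightarrow> homog_poly j f \<and> (\<forall>p\<in>trig (freq_less j). ?I (\<lambda>\<xi>. f (cis \<xi>) * p \<xi>) = 0)" for f
  unfolding R by (rule harm_iff)
 have ca: "cis (Arg z) = z" if "cmod z = 1" for z
 proof -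
  have "z \<noteq> 0" using that by auto
  thus ?thesis using that by (simp add: cis_Arg sgn_eq)
 qed
 have tr: "(\<lambda>\<xi>. f (cis \<xi>)) \<in> trig (freq j)" if "f \<in> harm R j" for f using that hm homog_poly_polar(1) by blast
 have rep: "?I (\<lambda>\<xi>. f (cis \<xi>) * PK k \<alpha> \<beta> j \<xi> \<phi>) = tmom \<alpha> \<beta> 0 0 * f (cis \<phi>)" if f: "f \<in> harm R j" for f \<phi>
 proof -
  have "?I (\<lambda>\<xi>. f (cis \<xi>) * SK k \<alpha> \<beta> (j - 2) \<xi> \<phi>) = 0" if "\<not> j < 2"
  proof -
   have m: "(\<lambda>\<xi>. SK k \<alpha> \<beta> (j - 2) \<xi> \<phi>) \<in> trig (freq_less j)" using SK_trig[OF k] that by (simp add: freq_less_eq)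
   have "\<forall>p\<in>trig (freq_less j). ?I (\<lambda>\<xi>. f (cis \<xi>) * p \<xi>) = 0" using f unfolding hm by (rule conjunct2)
   from bspec[OF this m] show ?thesis .
  qed
  thus ?thesis unfolding wint_PK[OF k ab trig_continuous[OF tr[OF f]]] SK_reproduces[OF k ab tr[OF f]] by simp
 qed
 have orth: "?I (\<lambda>\<xi>. PK k \<alpha> \<beta> j \<xi> \<phi> * p \<xi>) = 0" if p: "p \<in> trig (freq_less j)" for p \<phi>
 proof -
  have pj: "p \<in> trig (freq j)" by (rule trig_mono[OF freq_less_subset finite_freq(1) p])
  have "?I (\<lambda>\<xi>. p \<xi> * PK k \<alpha> \<beta> j \<xi> \<phi>) = 0"
  proof (cases "j < 2")
   case True
   hence "p = (\<lambda>_. 0)" using p by (simp add: freq_less_eq trig_def)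
   thus ?thesis by (simp add: wint_def)
  next
   case False
   hence "p \<in> trig (freq (j - 2))" using p by (simp add: freq_less_eq)
   from SK_reproduces[OF k ab this] SK_reproduces[OF k ab pj] False show ?thesis
    unfolding wint_PK[OF k ab trig_continuous[OF pj]] by simp
  qed
  thus ?thesis by (simp only: mult.commute)
 qed
 have ex: "\<exists>g\<in>harm R j. \<forall>\<xi>. g (cis \<xi>) = PK k \<alpha> \<beta> j \<xi> \<phi>" for \<phi>
 proof -
  obtain g where g: "homog_poly j g" "\<And>\<xi>. g (cis \<xi>) = PK k \<alpha> \<beta> j \<xi> \<phi>"
   using trig_homog_poly[OF PK_trig[OF k]] by blast
  hence "g \<in> harm R j" unfolding hm using orth by simp
  with g(2) show ?thesis by blast
 qed
 have diff: "(\<lambda>z. f z - g z) \<in> harm R j" if "f \<in> harm R j" "g \<in> harm R j" for f g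
 proof -
  have "homog_poly j (\<lambda>z. f z + (-1) * g z)" using that hm by (intro homog_poly_add homog_poly_cmult) auto
  moreover have "?I (\<lambda>\<xi>. (f (cis \<xi>) - g (cis \<xi>)) * p \<xi>) = 0" if p: "p \<in> trig (freq_less j)" for p
  proof -
   have e: "(f (cis \<xi>) - g (cis \<xi>)) * p \<xi> = (-1) * (g (cis \<xi>) * p \<xi>) + f (cis \<xi>) * p \<xi>" for \<xi> by (simp add: algebra_simps)
   have "?I (\<lambda>\<xi>. (-1) * (g (cis \<xi>) * p \<xi>) + f (cis \<xi>) * p \<xi>) = (-1) * ?I (\<lambda>\<xi>. g (cis \<xi>) * p \<xi>) + ?I (\<lambda>\<xi>. f (cis \<xi>) * p \<xi>)"
    by (rule wint_linear[OF ab']) (intro continuous_on_mult trig_continuous[OF tr] trig_continuous[OF p] \<open>f \<in> harm R j\<close> \<open>g \<in> harm R j\<close>)+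
   thus ?thesis unfolding e using p \<open>f \<in> harm R j\<close> \<open>g \<in> harm R j\<close> hm by simp
  qed
  ultimately show ?thesis unfolding hm by simp
 qed
 \<comment> \<open>The value 0 off the circle matches the first clause of the description, which
   makes the kernel unique as a function on the whole plane.\<close>
 define K0 where "K0 = (\<lambda>\<omega> \<eta>. if cmod \<omega> = 1 \<and> cmod \<eta> = 1 then PK k \<alpha> \<beta> j (Arg \<omega>) (Arg \<eta>) else 0)"
 let ?P = "\<lambda>K. (\<forall>\<omega> \<eta>. (cmod \<omega> \<noteq> 1 \<or> cmod \<eta> \<noteq> 1) \<longrightarrow> K \<omega> \<eta> = 0) \<and>
   (\<forall>\<eta>. cmod \<eta> = 1 \<longrightarrow> (\<exists>g \<in> harm R j. \<forall>\<omega>. cmod \<omega> = 1 \<longrightarrow> K \<omega> \<eta> = g \<omega>)) \<and>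
   (\<forall>f \<in> harm R j. \<forall>\<eta>. cmod \<eta> = 1 \<longrightarrow> circ_inner w f (\<lambda>\<omega>. K \<omega> \<eta>) = f \<eta>)"
 have ci: "circ_inner w f L = ?I (\<lambda>\<xi>. f (cis \<xi>) * cnj (g (cis \<xi>))) / tmom \<alpha> \<beta> 0 0"
  if "f \<in> harm R j" "g \<in> harm R j" "\<And>\<omega>. cmod \<omega> = 1 \<Longrightarrow> L \<omega> = g \<omega>" for f g L
 proof -
  have e: "L (cis \<xi>) = g (cis \<xi>)" for \<xi> using that(3) by simp
  have "continuous_on UNIV (\<lambda>\<xi>. L (cis \<xi>))" unfolding e by (rule trig_continuous[OF tr[OF that(2)]])
  from circ_inner_wint[OF k ab w trig_continuous[OF tr[OF that(1)]] this] show ?thesis unfolding e .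
 qed
 have "?P K0"
 proof (intro conjI allI impI ballI)
  fix \<omega> \<eta> :: complex assume "cmod \<omega> \<noteq> 1 \<or> cmod \<eta> \<noteq> 1"
  thus "K0 \<omega> \<eta> = 0" by (auto simp: K0_def)
 next
  fix \<eta> :: complex assume \<eta>: "cmod \<eta> = 1"
  obtain g where g: "g \<in> harm R j" "\<And>\<xi>. g (cis \<xi>) = PK k \<alpha> \<beta> j \<xi> (Arg \<eta>)" using ex by blast
  have K0g: "K0 \<omega> \<eta> = g \<omega>" if "cmod \<omega> = 1" for \<omega>
   using g(2)[of "Arg \<omega>"] ca[OF that] that \<eta> by (simp add: K0_def)
  thus "\<exists>g\<in>harm R j. \<forall>\<omega>. cmod \<omega> = 1 \<longrightarrow> K0 \<omega> \<eta> = g \<omega>" using g(1) by blast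
  fix f assume f: "f \<in> harm R j"
  have "circ_inner w f (\<lambda>\<omega>. K0 \<omega> \<eta>) = ?I (\<lambda>\<xi>. f (cis \<xi>) * cnj (g (cis \<xi>))) / tmom \<alpha> \<beta> 0 0"
   by (rule ci[OF f g(1)]) (rule K0g)
  thus "circ_inner w f (\<lambda>\<omega>. K0 \<omega> \<eta>) = f \<eta>"
   unfolding g(2) cnj_PK rep[OF f] ca[OF \<eta>] using wint_1(2)[OF k ab] by simp
 qed
 moreover have "K = K0" if K: "?P K" for K
 proof (intro ext)
  fix \<omega> \<eta> :: complex
  show "K \<omega> \<eta> = K0 \<omega> \<eta>"
  proof (cases "cmod \<omega> = 1 \<and> cmod \<eta> = 1")
   case False
   thus ?thesis using K by (auto simp: K0_def)
  next
   case True
   hence w1: "cmod \<omega> = 1" and \<eta>: "cmod \<eta> = 1" by auto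
   obtain g where g: "g \<in> harm R j" "\<And>\<omega>. cmod \<omega> = 1 \<Longrightarrow> K \<omega> \<eta> = g \<omega>" using K \<eta> by blast
   obtain g' where g': "g' \<in> harm R j" "\<And>\<omega>. cmod \<omega> = 1 \<Longrightarrow> K0 \<omega> \<eta> = g' \<omega>" using \<open>?P K0\<close> \<eta> by blast
   let ?d = "\<lambda>z. g z - g' z"
   have d: "?d \<in> harm R j" by (rule diff[OF g(1) g'(1)])
   have c1: "circ_inner w ?d (\<lambda>\<omega>. K \<omega> \<eta>) = ?I (\<lambda>\<xi>. ?d (cis \<xi>) * cnj (g (cis \<xi>))) / tmom \<alpha> \<beta> 0 0"
    by (rule ci[OF d g(1)]) (rule g(2))
   have c2: "circ_inner w ?d (\<lambda>\<omega>. K0 \<omega> \<eta>) = ?I (\<lambda>\<xi>. ?d (cis \<xi>) * cnj (g' (cis \<xi>))) / tmom \<alpha> \<beta> 0 0"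
    by (rule ci[OF d g'(1)]) (rule g'(2))
   have "circ_inner w ?d (\<lambda>\<omega>. K \<omega> \<eta>) = ?d \<eta>" using K d \<eta> by blast
   moreover have "circ_inner w ?d (\<lambda>\<omega>. K0 \<omega> \<eta>) = ?d \<eta>" using \<open>?P K0\<close> d \<eta> by blast
   ultimately have "?I (\<lambda>\<xi>. ?d (cis \<xi>) * cnj (g (cis \<xi>))) / tmom \<alpha> \<beta> 0 0 = ?I (\<lambda>\<xi>. ?d (cis \<xi>) * cnj (g' (cis \<xi>))) / tmom \<alpha> \<beta> 0 0"
    unfolding c1 c2 by (simp only:)
   hence eq: "?I (\<lambda>\<xi>. ?d (cis \<xi>) * cnj (g (cis \<xi>))) = ?I (\<lambda>\<xi>. ?d (cis \<xi>) * cnj (g' (cis \<xi>)))"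
    using wint_1(2)[OF k ab] by (simp only: divide_cancel_right simp_thms)
   have e: "?d (cis \<xi>) * cnj (?d (cis \<xi>)) = (-1) * (?d (cis \<xi>) * cnj (g' (cis \<xi>))) + ?d (cis \<xi>) * cnj (g (cis \<xi>))" for \<xi>
    by (simp add: algebra_simps)
   have "?I (\<lambda>\<xi>. ?d (cis \<xi>) * cnj (?d (cis \<xi>))) = (-1) * ?I (\<lambda>\<xi>. ?d (cis \<xi>) * cnj (g' (cis \<xi>))) + ?I (\<lambda>\<xi>. ?d (cis \<xi>) * cnj (g (cis \<xi>)))"
    unfolding e by (rule wint_linear[OF ab'])
     (intro continuous_on_mult continuous_on_cnj continuous_on_diff trig_continuous[OF tr] g(1) g'(1))+
   hence "?I (\<lambda>\<xi>. ?d (cis \<xi>) * cnj (?d (cis \<xi>))) = 0" unfolding eq by simp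
   from wint_pos[OF k ab' tr[OF d] this] have "?d (cis (Arg \<omega>)) = 0" by (rule fun_cong)
   thus ?thesis using g(2)[OF w1] g'(2)[OF w1] ca[OF w1] by simp
  qed
 qed
 ultimately have "repr_kernel R w j = K0" unfolding repr_kernel_def by (rule the_equality)
 thus ?thesis using \<omega> \<eta> by (simp add: K0_def)
qed

lemma roots_eq_dlines:
 "\<beta> \<noteq> 0 \<Longrightarrow> roots_I2k k \<alpha> \<beta> = line_roots (dlines k \<alpha> \<beta>)" "roots_Ik k \<alpha> = line_roots (dlines k \<alpha> 0)"
 by (simp_all add: roots_I2k_def roots_Ik_def line_roots_def dlines_def)

lemma weight_eq_wt:
 assumes "\<alpha> > 0"
 shows "\<beta> > 0 \<Longrightarrow> weight_I2k k \<alpha> \<beta> (cis \<xi>) = wt k \<alpha> \<beta> \<xi>" "weight_Ik k \<alpha> (cis \<xi>) = wt k \<alpha> 0 \<xi>"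
proof -
 have 1: "(cis \<xi> ^ k - cnj (cis \<xi>) ^ k) / (2 * \<i>) = of_real (sin (real k * \<xi>))"
 proof -
  have "cis \<xi> ^ k - cnj (cis \<xi>) ^ k = 2 * \<i> * of_real (sin (real k * \<xi>))"
   by (simp add: cis_cnj Complex.DeMoivre complex_eq_iff)
  thus ?thesis by simp
 qed
 have 2: "(cis \<xi> ^ k + cnj (cis \<xi>) ^ k) / 2 = of_real (cos (real k * \<xi>))"
 proof -
  have "cis \<xi> ^ k + cnj (cis \<xi>) ^ k = 2 * of_real (cos (real k * \<xi>))"
   by (simp add: cis_cnj Complex.DeMoivre complex_eq_iff)
  thus ?thesis by simp
 qed
 show "\<beta> > 0 \<Longrightarrow> weight_I2k k \<alpha> \<beta> (cis \<xi>) = wt k \<alpha> \<beta> \<xi>"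
  unfolding weight_I2k_def 1 2 norm_of_real wt_def wfac_def using assms by simp
 show "weight_Ik k \<alpha> (cis \<xi>) = wt k \<alpha> 0 \<xi>"
  unfolding weight_Ik_def 1 norm_of_real wt_def wfac_def using assms by simp
qed

subsection \<open>The averaging functional\<close>

text \<open>The value \<open>\<beta> = 0\<close> stands for the point mass at 1, the limit of the measures as \<open>\<beta> \<rightarrow> 0\<close>;
 it covers the odd dihedral groups.\<close>
definition nu_int :: "real \<Rightarrow> (real \<Rightarrow> complex) \<Rightarrow> complex" where
 "nu_int \<beta> h = (if \<beta> = 0 then h 1 else mu_int \<beta> h)"

lemma nu_int_sum:
 assumes "\<beta> \<ge> 0" "finite A" "\<And>i. i \<in> A \<Longrightarrow> continuous_on {-1..1} (f i)"
 shows "nu_int \<beta> (\<lambda>u. \<Sum>i\<in>A. a i * f i u) = (\<Sum>i\<in>A. a i * nu_int \<beta> (f i))"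
 using assms by (auto simp: nu_int_def intro!: mu_int_sum)

lemma nu_int_add_cmult:
 assumes "\<beta> \<ge> 0" "continuous_on {-1..1} f" "continuous_on {-1..1} h"
 shows "nu_int \<beta> (\<lambda>u. a * f u + h u) = a * nu_int \<beta> f + nu_int \<beta> h"
 using assms by (auto simp: nu_int_def intro!: mu_int_add_cmult)

lemma nu_int_bound:
 assumes "\<beta> \<ge> 0"
 obtains C where "C \<ge> 0" "\<And>(f :: real \<Rightarrow> complex) B. continuous_on {-1..1} f \<Longrightarrow> (\<And>u. u \<in> {-1..1} \<Longrightarrow> norm (f u) \<le> B) \<Longrightarrow> norm (nu_int \<beta> f) \<le> C * B"
proof (cases "\<beta> = 0")
 case True thus ?thesis by (intro that[of 1]) (auto simp: nu_int_def)
next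
 case False
 hence "\<beta> > 0" using assms by simp
 from mu_int_bound[OF this] obtain C where "C \<ge> 0" "\<And>(f :: real \<Rightarrow> complex) B. continuous_on {-1..1} f \<Longrightarrow> (\<And>u. u \<in> {-1..1} \<Longrightarrow> norm (f u) \<le> B) \<Longrightarrow> norm (mu_int \<beta> f) \<le> C * B" by blast
 with False show ?thesis by (intro that[of C]) (simp_all add: nu_int_def)
qed

lemma nu_int_power:
 assumes "\<beta> \<ge> 0"
 shows "nu_int \<beta> (\<lambda>u. of_real (u ^ m)) = of_real (mumom \<beta> m)"
proof (cases "\<beta> = 0")
 case True
 have "pochhammer (1/2::real) n \<noteq> 0" for n using pochhammer_pos[of "1/2::real" n] by simp
 thus ?thesis using True by (simp add: nu_int_def mumom_def)
next
 case False
 hence "\<beta> > 0" using assms by simp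
 from mu_int_power[OF this, of m] False show ?thesis unfolding nu_int_def by (simp only: if_False)
qed

definition Phi :: "real \<Rightarrow> real \<Rightarrow> real \<Rightarrow> real \<Rightarrow> (real \<Rightarrow> complex) \<Rightarrow> complex" where
 "Phi \<alpha> \<beta> p r g = nu_int \<beta> (\<lambda>v. nu_int \<alpha> (\<lambda>u. g (p * u + r * v)))"

text \<open>Continuity of the inner average in v is recorded together with that of \<open>g\<close>,
  since the outer integral is linear on continuous functions; for powers of the argument it is
  visible from the moments.\<close>

definition Phi_good :: "real \<Rightarrow> real \<Rightarrow> real \<Rightarrow> (real \<Rightarrow> complex) \<Rightarrow> bool" where
 "Phi_good \<alpha> p r g \<longleftrightarrow> continuous_on UNIV g \<and> continuous_on UNIV (\<lambda>v. nu_int \<alpha> (\<lambda>u. g (p * u + r * v)))"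

lemma continuous_on_affine:
 assumes "continuous_on UNIV (g :: real \<Rightarrow> complex)" shows "continuous_on A (\<lambda>u. g (p * u + c))"
 by (rule continuous_on_compose2[OF assms]) (auto intro!: continuous_intros)

lemma Phi_sum:
 assumes ab: "\<alpha> \<ge> 0" "\<beta> \<ge> 0" and A: "finite A" and g: "\<And>i. i \<in> A \<Longrightarrow> Phi_good \<alpha> p r (g i)"
 shows "Phi_good \<alpha> p r (\<lambda>x. \<Sum>i\<in>A. a i * g i x)" "Phi \<alpha> \<beta> p r (\<lambda>x. \<Sum>i\<in>A. a i * g i x) = (\<Sum>i\<in>A. a i * Phi \<alpha> \<beta> p r (g i))"
proof -
 have e: "nu_int \<alpha> (\<lambda>u. \<Sum>i\<in>A. a i * g i (p * u + r * v)) = (\<Sum>i\<in>A. a i * nu_int \<alpha> (\<lambda>u. g i (p * u + r * v)))" for v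
  by (rule nu_int_sum[OF ab(1) A]) (use g in \<open>auto simp: Phi_good_def intro: continuous_on_affine\<close>)
 show "Phi_good \<alpha> p r (\<lambda>x. \<Sum>i\<in>A. a i * g i x)"
  unfolding Phi_good_def e using g by (auto simp: Phi_good_def intro!: continuous_intros)
 show "Phi \<alpha> \<beta> p r (\<lambda>x. \<Sum>i\<in>A. a i * g i x) = (\<Sum>i\<in>A. a i * Phi \<alpha> \<beta> p r (g i))"
  unfolding Phi_def e by (rule nu_int_sum[OF ab(2) A]) (use g in \<open>auto simp: Phi_good_def intro: continuous_on_subset\<close>)
qed

lemma Phi_power:
 assumes ab: "\<alpha> \<ge> 0" "\<beta> \<ge> 0"
 shows "Phi_good \<alpha> p r (\<lambda>x. of_real (x ^ n))"
  "Phi \<alpha> \<beta> p r (\<lambda>x. of_real (x ^ n)) = of_real (\<Sum>l\<le>n. real (n choose l) * p ^ (n - l) * r ^ l * mumom \<alpha> (n - l) * mumom \<beta> l)"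
proof -
 let ?c = "\<lambda>l. real (n choose l) * p ^ (n - l) * r ^ l"
 have b: "complex_of_real ((p * u + r * v) ^ n) = (\<Sum>l\<le>n. of_real (?c l * v ^ l) * of_real (u ^ (n - l)))" for u v
 proof -
  have "(p * u + r * v) ^ n = (r * v + p * u) ^ n" by (simp only: add.commute)
  also have "\<dots> = (\<Sum>l\<le>n. real (n choose l) * (r * v) ^ l * (p * u) ^ (n - l))" by (rule binomial_ring)
  also have "\<dots> = (\<Sum>l\<le>n. ?c l * v ^ l * u ^ (n - l))" by (intro sum.cong refl) (simp only: power_mult_distrib mult_ac)
  finally show ?thesis by (simp only: of_real_sum of_real_mult)
 qed
 have e: "nu_int \<alpha> (\<lambda>u. of_real ((p * u + r * v) ^ n)) = (\<Sum>l\<le>n. of_real (?c l * mumom \<alpha> (n - l)) * of_real (v ^ l))" for v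
 proof -
  have "nu_int \<alpha> (\<lambda>u. \<Sum>l\<le>n. of_real (?c l * v ^ l) * of_real (u ^ (n - l))) = (\<Sum>l\<le>n. of_real (?c l * v ^ l) * nu_int \<alpha> (\<lambda>u. of_real (u ^ (n - l))))"
   by (rule nu_int_sum[OF ab(1)]) (auto intro!: continuous_intros)
  thus ?thesis unfolding b nu_int_power[OF ab(1)] by (simp only: of_real_mult mult_ac)
 qed
 show "Phi_good \<alpha> p r (\<lambda>x. of_real (x ^ n))"
  unfolding Phi_good_def e by (intro conjI continuous_intros)
 have "nu_int \<beta> (\<lambda>v. \<Sum>l\<le>n. of_real (?c l * mumom \<alpha> (n - l)) * of_real (v ^ l)) = (\<Sum>l\<le>n. of_real (?c l * mumom \<alpha> (n - l)) * nu_int \<beta> (\<lambda>v. of_real (v ^ l)))"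
  by (rule nu_int_sum[OF ab(2)]) (auto intro!: continuous_intros)
 thus "Phi \<alpha> \<beta> p r (\<lambda>x. of_real (x ^ n)) = of_real (\<Sum>l\<le>n. real (n choose l) * p ^ (n - l) * r ^ l * mumom \<alpha> (n - l) * mumom \<beta> l)"
  unfolding Phi_def e nu_int_power[OF ab(2)] by (simp only: of_real_sum of_real_mult)
qed

lemma Phi_Cpol:
 assumes ab: "\<alpha> \<ge> 0" "\<beta> \<ge> 0"
 shows "Phi_good \<alpha> p r (\<lambda>x. of_real (Cpol \<gamma> N x))"
  "Phi \<alpha> \<beta> (sin \<xi> * sin \<phi>) (cos \<xi> * cos \<phi>) (\<lambda>x. of_real (Cpol (\<alpha> + \<beta>) N x)) = of_real (Ipol \<alpha> \<beta> N \<xi> \<phi>)"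
proof -
 have e: "complex_of_real (Cpol \<gamma> N x) = (\<Sum>q\<le>N div 2. of_real (Ccoef \<gamma> N q) * of_real (x ^ (N - 2 * q)))" for \<gamma> x
  unfolding Cpol_def Ccoef_def by (simp only: of_real_sum of_real_mult)
 show "Phi_good \<alpha> p r (\<lambda>x. of_real (Cpol \<gamma> N x))"
  unfolding e by (intro Phi_sum(1)[OF ab] Phi_power[OF ab] finite_atMost)
 have "Phi \<alpha> \<beta> (sin \<xi> * sin \<phi>) (cos \<xi> * cos \<phi>) (\<lambda>x. \<Sum>q\<le>N div 2. of_real (Ccoef (\<alpha> + \<beta>) N q) * of_real (x ^ (N - 2 * q)))
  = (\<Sum>q\<le>N div 2. of_real (Ccoef (\<alpha> + \<beta>) N q) * Phi \<alpha> \<beta> (sin \<xi> * sin \<phi>) (cos \<xi> * cos \<phi>) (\<lambda>x. of_real (x ^ (N - 2 * q))))"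
  by (intro Phi_sum(2)[OF ab] Phi_power[OF ab] finite_atMost)
 thus "Phi \<alpha> \<beta> (sin \<xi> * sin \<phi>) (cos \<xi> * cos \<phi>) (\<lambda>x. of_real (Cpol (\<alpha> + \<beta>) N x)) = of_real (Ipol \<alpha> \<beta> N \<xi> \<phi>)"
  unfolding e Phi_power(2)[OF ab] Ipol_def by (simp only: of_real_sum of_real_mult)
qed

lemma Phi_Spol:
 assumes ab: "\<alpha> \<ge> 0" "\<beta> \<ge> 0"
 shows "Phi_good \<alpha> p r (Spol k \<gamma> \<psi> J)"
  "Phi \<alpha> \<beta> (sin (real k * \<xi>) * sin (real k * \<phi>)) (cos (real k * \<xi>) * cos (real k * \<phi>)) (Spol k (\<alpha> + \<beta>) (\<xi> - \<phi>) J) = SK k \<alpha> \<beta> J \<xi> \<phi>"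
proof -
 let ?a = "\<lambda>\<psi> q. if fst q + snd q \<le> J \<and> k dvd (J - fst q - snd q) then cis ((real (fst q) - real (snd q)) * \<psi>) else 0"
 let ?I = "{..<k} \<times> {..<k}"
 have S: "(\<Sum>m<k. \<Sum>m'<k. if m + m' \<le> J \<and> k dvd (J - m - m') then cis ((real m - real m') * \<psi>) * G ((J - m - m') div k) else 0)
  = (\<Sum>q\<in>?I. ?a \<psi> q * G ((J - fst q - snd q) div k))" for \<psi> and G :: "nat \<Rightarrow> complex"
 proof -
  have "(if P then c * d else 0) = (if P then c else 0) * d" for P and c d :: complex by simp
  thus ?thesis unfolding sum.cartesian_product by (simp only: case_prod_unfold)
 qed
 have e: "Spol k \<gamma> \<psi> J = (\<lambda>x. \<Sum>q\<in>?I. ?a \<psi> q * of_real (Cpol \<gamma> ((J - fst q - snd q) div k) x))" for \<gamma> \<psi>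
  unfolding Spol_def[abs_def] by (rule ext, rule S)
 show "Phi_good \<alpha> p r (Spol k \<gamma> \<psi> J)"
  unfolding e by (intro Phi_sum(1)[OF ab] Phi_Cpol[OF ab] finite_cartesian_product finite_lessThan)
 have "Phi \<alpha> \<beta> (sin (real k * \<xi>) * sin (real k * \<phi>)) (cos (real k * \<xi>) * cos (real k * \<phi>)) (Spol k (\<alpha> + \<beta>) (\<xi> - \<phi>) J)
  = (\<Sum>q\<in>?I. ?a (\<xi> - \<phi>) q * Phi \<alpha> \<beta> (sin (real k * \<xi>) * sin (real k * \<phi>)) (cos (real k * \<xi>) * cos (real k * \<phi>)) (\<lambda>x. of_real (Cpol (\<alpha> + \<beta>) ((J - fst q - snd q) div k) x)))"
  unfolding e by (intro Phi_sum(2)[OF ab] Phi_Cpol[OF ab] finite_cartesian_product finite_lessThan)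
 thus "Phi \<alpha> \<beta> (sin (real k * \<xi>) * sin (real k * \<phi>)) (cos (real k * \<xi>) * cos (real k * \<phi>)) (Spol k (\<alpha> + \<beta>) (\<xi> - \<phi>) J) = SK k \<alpha> \<beta> J \<xi> \<phi>"
  unfolding Phi_Cpol(2)[OF ab] SK_def S[where G="\<lambda>N. of_real (Ipol \<alpha> \<beta> N (real k * \<xi>) (real k * \<phi>))"] .
qed

lemma affine_in_unit_interval:
 fixes p r u v :: real
 assumes "\<bar>p\<bar> + \<bar>r\<bar> \<le> 1" "u \<in> {-1..1}" "v \<in> {-1..1}"
 shows "p * u + r * v \<in> {-1..1}"
proof -
 have "\<bar>p * u\<bar> \<le> \<bar>p\<bar>" "\<bar>r * v\<bar> \<le> \<bar>r\<bar>" using assms by (auto simp: abs_mult intro!: mult_left_le)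
 thus ?thesis using assms(1) by (auto simp: abs_le_iff)
qed

lemma Phi_bound:
 assumes ab: "\<alpha> \<ge> 0" "\<beta> \<ge> 0" and pr: "\<bar>p\<bar> + \<bar>r\<bar> \<le> 1"
 obtains C where "C \<ge> 0" "\<And>g B. Phi_good \<alpha> p r g \<Longrightarrow> (\<And>x. x \<in> {-1..1} \<Longrightarrow> norm (g x) \<le> B) \<Longrightarrow> norm (Phi \<alpha> \<beta> p r g) \<le> C * B"
proof -
 obtain C where C: "C \<ge> 0" "\<And>(f :: real \<Rightarrow> complex) B. continuous_on {-1..1} f \<Longrightarrow> (\<And>u. u \<in> {-1..1} \<Longrightarrow> norm (f u) \<le> B) \<Longrightarrow> norm (nu_int \<alpha> f) \<le> C * B"
  using nu_int_bound[OF ab(1)] by blast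
 obtain D where D: "D \<ge> 0" "\<And>(f :: real \<Rightarrow> complex) B. continuous_on {-1..1} f \<Longrightarrow> (\<And>u. u \<in> {-1..1} \<Longrightarrow> norm (f u) \<le> B) \<Longrightarrow> norm (nu_int \<beta> f) \<le> D * B"
  using nu_int_bound[OF ab(2)] by blast
 show ?thesis
 proof (rule that[of "D * C"])
  fix g B assume g: "Phi_good \<alpha> p r g" and B: "\<And>x. x \<in> {-1..1} \<Longrightarrow> norm (g x) \<le> B"
  have "norm (Phi \<alpha> \<beta> p r g) \<le> D * (C * B)" unfolding Phi_def
  proof (rule D(2))
   show "continuous_on {-1..1} (\<lambda>v. nu_int \<alpha> (\<lambda>u. g (p * u + r * v)))"
    using g unfolding Phi_good_def by (blast intro: continuous_on_subset)
   fix v :: real assume v: "v \<in> {-1..1}"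
   show "norm (nu_int \<alpha> (\<lambda>u. g (p * u + r * v))) \<le> C * B"
    by (rule C(2)) (use g in \<open>auto simp: Phi_good_def intro!: continuous_on_affine B affine_in_unit_interval[OF pr _ v, simplified]\<close>)
  qed
  thus "norm (Phi \<alpha> \<beta> p r g) \<le> D * C * B" by (simp only: mult.assoc)
 qed (use C D in simp)
qed

text \<open>Uniform approximation on [-1, 1] passes through both averages. Continuity of the limit
  and of its inner average is obtained there as a uniform limit instead of being assumed.\<close>

lemma Phi_limit:
 assumes ab: "\<alpha> \<ge> 0" "\<beta> \<ge> 0" and pr: "\<bar>p\<bar> + \<bar>r\<bar> \<le> 1"
  and g: "\<And>n. Phi_good \<alpha> p r (g n)" and F: "\<And>n x. x \<in> {-1..1} \<Longrightarrow> norm (F x - g n x) \<le> \<epsilon> n" and \<epsilon>: "\<epsilon> \<longlonglongrightarrow> 0"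
 shows "(\<lambda>n. Phi \<alpha> \<beta> p r (g n)) \<longlonglongrightarrow> Phi \<alpha> \<beta> p r F"
proof -
 obtain C where C: "C \<ge> 0" "\<And>(f :: real \<Rightarrow> complex) B. continuous_on {-1..1} f \<Longrightarrow> (\<And>u. u \<in> {-1..1} \<Longrightarrow> norm (f u) \<le> B) \<Longrightarrow> norm (nu_int \<alpha> f) \<le> C * B"
  using nu_int_bound[OF ab(1)] by blast
 obtain D where D: "D \<ge> 0" "\<And>(f :: real \<Rightarrow> complex) B. continuous_on {-1..1} f \<Longrightarrow> (\<And>u. u \<in> {-1..1} \<Longrightarrow> norm (f u) \<le> B) \<Longrightarrow> norm (nu_int \<beta> f) \<le> D * B"
  using nu_int_bound[OF ab(2)] by blast
 have lim: "uniform_limit S f h sequentially" if "\<And>n x. x \<in> S \<Longrightarrow> norm (h x - f n x) \<le> \<delta> n" "\<delta> \<longlonglongrightarrow> 0"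
  for S :: "real set" and f h and \<delta> :: "nat \<Rightarrow> real"
 proof (rule uniform_limitI)
  fix e :: real assume "e > 0"
  with that(2) have "eventually (\<lambda>n. \<delta> n < e) sequentially" by (rule order_tendstoD(2))
  thus "eventually (\<lambda>n. \<forall>x\<in>S. dist (f n x) (h x) < e) sequentially"
   by (rule eventually_mono) (use that(1) in \<open>auto simp: dist_norm norm_minus_commute intro: le_less_trans\<close>)
 qed
 have cF: "continuous_on {-1..1} F"
 proof (rule uniform_limit_theorem[OF always_eventually lim[OF F \<epsilon>] trivial_limit_sequentially])
  have "continuous_on {-1..1} (g n)" for n
   using g[of n] unfolding Phi_good_def by (blast intro: continuous_on_subset)
  thus "\<forall>n. continuous_on {-1..1} (g n)" ..
 qed
 have cin: "continuous_on {-1..1} (\<lambda>u. F (p * u + r * v))" if v: "v \<in> {-1..1}" for v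
  by (rule continuous_on_compose2[OF cF]) (use affine_in_unit_interval[OF pr _ v] in \<open>auto intro!: continuous_intros\<close>)
 have cg: "continuous_on {-1..1} (\<lambda>u. g n (p * u + r * v))" for n v
  using g[of n] unfolding Phi_good_def by (blast intro: continuous_on_affine)
 let ?G = "\<lambda>n v. nu_int \<alpha> (\<lambda>u. g n (p * u + r * v))" and ?H = "\<lambda>v. nu_int \<alpha> (\<lambda>u. F (p * u + r * v))"
 have in1: "norm (?H v - ?G n v) \<le> C * \<epsilon> n" if v: "v \<in> {-1..1}" for n v
 proof -
  have "norm (nu_int \<alpha> (\<lambda>u. (-1) * g n (p * u + r * v) + F (p * u + r * v))) \<le> C * \<epsilon> n"
  proof (rule C(2))
   show "continuous_on {-1..1} (\<lambda>u. (-1) * g n (p * u + r * v) + F (p * u + r * v))"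
    by (intro continuous_intros cin[OF v] cg)
   fix u :: real assume "u \<in> {-1..1}"
   from F[OF affine_in_unit_interval[OF pr this v], of n]
   show "norm ((-1) * g n (p * u + r * v) + F (p * u + r * v)) \<le> \<epsilon> n" by simp
  qed
  moreover have "nu_int \<alpha> (\<lambda>u. (-1) * g n (p * u + r * v) + F (p * u + r * v)) = (-1) * ?G n v + ?H v"
   by (rule nu_int_add_cmult[OF ab(1) cg cin[OF v]])
  ultimately show ?thesis by simp
 qed
 have cG: "continuous_on {-1..1} (?G n)" for n using g[of n] unfolding Phi_good_def by (blast intro: continuous_on_subset)
 have \<epsilon>': "(\<lambda>n. C * \<epsilon> n) \<longlonglongrightarrow> 0" using tendsto_mult_right_zero[OF \<epsilon>] .
 have cH: "continuous_on {-1..1} ?H"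
  by (rule uniform_limit_theorem[OF always_eventually[OF allI[OF cG]] lim[OF in1 \<epsilon>'] trivial_limit_sequentially])
 have bnd: "norm (Phi \<alpha> \<beta> p r F - Phi \<alpha> \<beta> p r (g n)) \<le> D * (C * \<epsilon> n)" for n
 proof -
  have "norm (nu_int \<beta> (\<lambda>v. (-1) * ?G n v + ?H v)) \<le> D * (C * \<epsilon> n)"
  proof (rule D(2))
   show "continuous_on {-1..1} (\<lambda>v. (-1) * ?G n v + ?H v)"
    by (rule continuous_on_add[OF continuous_on_mult[OF continuous_on_const cG] cH])
   fix v :: real assume "v \<in> {-1..1}"
   from in1[OF this, of n] show "norm ((-1) * ?G n v + ?H v) \<le> C * \<epsilon> n" by simp
  qed
  moreover have "nu_int \<beta> (\<lambda>v. (-1) * ?G n v + ?H v) = (-1) * nu_int \<beta> (?G n) + nu_int \<beta> ?H"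
   by (rule nu_int_add_cmult[OF ab(2) cG cH])
  ultimately show ?thesis unfolding Phi_def by simp
 qed
 have "(\<lambda>n. D * (C * \<epsilon> n)) \<longlonglongrightarrow> 0" using tendsto_mult_right_zero[OF \<epsilon>'] .
 from Lim_null_comparison[OF always_eventually[OF allI[OF bnd]] this]
 have "(\<lambda>n. Phi \<alpha> \<beta> p r F - Phi \<alpha> \<beta> p r (g n)) \<longlonglongrightarrow> 0" .
 from tendsto_diff[OF tendsto_const[of "Phi \<alpha> \<beta> p r F"] this] show ?thesis by simp
qed

subsection \<open>Growth of the kernels\<close>

text \<open>The coefficient is monotone in its upper argument once that is at least
  \<open>i\<close>, so the real \<open>K\<close> can be rounded up and an ordinary binomial
  coefficient bounds it.\<close>

lemma abs_gbinomial_le: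
 assumes K: "K \<ge> 0" and i: "i \<le> J div 2"
 shows "\<bar>(real (J - i) + K) gchoose i\<bar> \<le> 2 ^ (J + nat \<lceil>K\<rceil>)"
proof -
 let ?n = "J - i + nat \<lceil>K\<rceil>"
 have i': "real i \<le> real (J - i) + K" using i K by linarith
 have "0 \<le> ((real (J - i) + K) / real i) ^ i" using K by simp
 also have "\<dots> \<le> (real (J - i) + K) gchoose i" by (rule gbinomial_ge_n_over_k_pow_k[OF i'])
 finally have 0: "0 \<le> (real (J - i) + K) gchoose i" .
 have "(real (J - i) + K) gchoose i \<le> real ?n gchoose i"
  by (rule gbinomial_mono[OF i']) (use K in linarith)
 also have "\<dots> = real (?n choose i)" by (rule binomial_gbinomial[symmetric])
 also have "\<dots> \<le> 2 ^ ?n" using binomial_le_pow2[of ?n i] by (metis of_nat_le_iff of_nat_numeral of_nat_power)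
 also have "\<dots> \<le> 2 ^ (J + nat \<lceil>K\<rceil>)" by (intro power_increasing) auto
 finally show ?thesis using 0 by simp
qed

text \<open>The number of summands and the binomial coefficient each contribute a factor 2^J, the
  coefficients of \<open>Dgen\<close> contribute (8/3)^J, and 32/3 < 11. Any geometric rate would do
  against the factorials of the Bessel series.\<close>

lemma Spol_bound:
 assumes k: "k > 0" and \<gamma>: "\<gamma> \<ge> 0"
 obtains M where "M \<ge> 0" "\<And>J x \<psi>. x \<in> {-1..1} \<Longrightarrow> norm (Spol k \<gamma> \<psi> J x) \<le> M * 11 ^ J"
proof -
 let ?K = "real k * \<gamma>" and ?MD = "2 ^ card {1..<k} * (4 powr (\<gamma> + 1)) ^ card {..<k} :: real"
 let ?\<kappa> = "nat \<lceil>?K\<rceil>"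
 show ?thesis
 proof (rule that[of "2 ^ ?\<kappa> * ?MD"])
  fix J \<psi> and x :: real assume x: "x \<in> {-1..1}"
  have "Spol k \<gamma> \<psi> J x = Spol k \<gamma> ((real k * \<psi>) / real k) J (cos (arccos x))" using x k by simp
  also have "\<dots> = (\<Sum>i\<le>J div 2. ((-1) ^ i * ((real (J - i) + ?K) gchoose i)) *\<^sub>R dcoef {1..<k} (chebnode k (real k * \<psi>)) {..<k} (chebnode k (arccos x)) (\<gamma> + 1) (J - 2 * i))"
   by (rule Spol_dcoef[OF k \<gamma>])
  finally have "norm (Spol k \<gamma> \<psi> J x) \<le> (\<Sum>i\<le>J div 2. 2 ^ (J + ?\<kappa>) * (?MD * (8/3) ^ J))"
  proof (simp only:, intro sum_norm_le)
   fix i assume i: "i \<in> {..J div 2}"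
   have "norm (dcoef {1..<k} (chebnode k (real k * \<psi>)) {..<k} (chebnode k (arccos x)) (\<gamma> + 1) (J - 2 * i)) \<le> ?MD * (8/3) ^ (J - 2 * i)"
    by (rule dcoef_bound) (use \<gamma> abs_chebnode in auto)
   also have "\<dots> \<le> ?MD * (8/3) ^ J" by (intro mult_left_mono power_increasing) auto
   finally have d: "norm (dcoef {1..<k} (chebnode k (real k * \<psi>)) {..<k} (chebnode k (arccos x)) (\<gamma> + 1) (J - 2 * i)) \<le> ?MD * (8/3) ^ J" .
   have b: "\<bar>(real (J - i) + ?K) gchoose i\<bar> \<le> 2 ^ (J + ?\<kappa>)" using i \<gamma> by (intro abs_gbinomial_le) auto
   show "norm (((-1) ^ i * ((real (J - i) + ?K) gchoose i)) *\<^sub>R dcoef {1..<k} (chebnode k (real k * \<psi>)) {..<k} (chebnode k (arccos x)) (\<gamma> + 1) (J - 2 * i)) \<le> 2 ^ (J + ?\<kappa>) * (?MD * (8/3) ^ J)"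
    unfolding norm_scaleR abs_mult power_abs[symmetric] using b d by (intro mult_mono) (auto simp: power_abs)
  qed
  also have "\<dots> \<le> real (J + 1) * (2 ^ (J + ?\<kappa>) * (?MD * (8/3) ^ J))"
   unfolding sum_constant by (intro mult_right_mono) auto
  also have "real (J + 1) \<le> 2 ^ J" using less_exp[of J] by (metis Suc_eq_plus1 Suc_leI of_nat_le_iff of_nat_numeral of_nat_power)
  finally have "norm (Spol k \<gamma> \<psi> J x) \<le> 2 ^ J * (2 ^ (J + ?\<kappa>) * (?MD * (8/3) ^ J))"
   by (simp add: mult_right_mono)
  also have "\<dots> = 2 ^ ?\<kappa> * ?MD * (2 * 2 * (8/3)) ^ J" by (simp only: power_add power_mult_distrib mult_ac)
  also have "\<dots> \<le> 2 ^ ?\<kappa> * ?MD * 11 ^ J" by (intro mult_left_mono power_mono) auto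
  finally show "norm (Spol k \<gamma> \<psi> J x) \<le> 2 ^ ?\<kappa> * ?MD * 11 ^ J" .
 qed simp
qed

text \<open>For each choice of signs the sum is plus or minus a cosine of a + b or a - b.
  Consequently X(u,v) lies in [-1, 1] and its arccosine is real.\<close>

lemma abs_sin_cos_product_le: "\<bar>sin a * sin b\<bar> + \<bar>cos a * cos b\<bar> \<le> (1::real)"
proof -
 have "\<bar>cos (a - b)\<bar> \<le> 1" "\<bar>cos (a + b)\<bar> \<le> 1" by simp_all
 thus ?thesis unfolding cos_diff cos_add by linarith
qed

lemma SK_bound:
 assumes k: "k > 0" and ab: "\<alpha> \<ge> 0" "\<beta> \<ge> 0"
 obtains M where "M \<ge> 0" "\<And>J. norm (SK k \<alpha> \<beta> J \<xi> \<phi>) \<le> M * 11 ^ J"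
proof -
 have g: "\<alpha> + \<beta> \<ge> 0" using ab by simp
 let ?p = "sin (real k * \<xi>) * sin (real k * \<phi>)" and ?r = "cos (real k * \<xi>) * cos (real k * \<phi>)"
 obtain C where C: "C \<ge> 0" "\<And>g B. Phi_good \<alpha> ?p ?r g \<Longrightarrow> (\<And>x. x \<in> {-1..1} \<Longrightarrow> norm (g x) \<le> B) \<Longrightarrow> norm (Phi \<alpha> \<beta> ?p ?r g) \<le> C * B"
  using Phi_bound[OF ab abs_sin_cos_product_le] by blast
 obtain M where M: "M \<ge> 0" "\<And>J x \<psi>. x \<in> {-1..1} \<Longrightarrow> norm (Spol k (\<alpha> + \<beta>) \<psi> J x) \<le> M * 11 ^ J"
  using Spol_bound[OF k g] by blast
 show ?thesis
 proof (rule that[of "C * M"])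
  fix J
  have "norm (Phi \<alpha> \<beta> ?p ?r (Spol k (\<alpha> + \<beta>) (\<xi> - \<phi>) J)) \<le> C * (M * 11 ^ J)"
   by (rule C(2)[OF Phi_Spol(1)[OF ab]]) (rule M(2))
  thus "norm (SK k \<alpha> \<beta> J \<xi> \<phi>) \<le> C * M * 11 ^ J" unfolding Phi_Spol(2)[OF ab] by (simp only: mult.assoc)
 qed (use C M in simp)
qed

subsection \<open>Rearranging the Bessel series\<close>

lemma Gamma_ge_fact:
 assumes "K \<ge> (0::real)" shows "Gamma (K + 1 + real n) \<ge> Gamma (K + 1) * fact n" "Gamma (K + 1) > 0"
proof -
 show pos: "Gamma (K + 1) > 0" using assms by (intro Gamma_real_pos) simp
 have "K + 1 \<notin> \<int>\<^sub>\<le>\<^sub>0" using assms by (auto elim!: nonpos_Ints_cases)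
 hence "Gamma (K + 1 + real n) = Gamma (K + 1) * pochhammer (K + 1) n"
  using pos by (simp add: pochhammer_Gamma)
 moreover have "pochhammer (K + 1) n \<ge> fact n"
 proof (induction n)
  case (Suc n)
  have "fact (Suc n) = fact n * (1 + real n)" by simp
  also have "\<dots> \<le> pochhammer (K + 1) n * (K + 1 + real n)"
   using Suc assms order_trans[OF fact_ge_zero Suc] by (intro mult_mono) auto
  finally show ?case by (simp add: pochhammer_Suc)
 qed simp
 ultimately show "Gamma (K + 1 + real n) \<ge> Gamma (K + 1) * fact n" using pos by simp
qed

text \<open>The Gamma factor is at least Gamma(K + 1) j!, so the double series is dominated by a
  product of two exponential series. It may then be summed by rows, as in the Bessel expansion, or
  along j + 2m = n, as in the Laplace expansion.\<close>

lemma double_series: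
 fixes a :: "nat \<Rightarrow> complex" and w :: complex
 assumes K: "K \<ge> (0::real)" and a: "\<And>j. norm (a j) \<le> M * 11 ^ j" and M: "M \<ge> 0"
 defines "T \<equiv> \<lambda>j m. w ^ (j + 2 * m) * a j / of_real (fact m * Gamma (K + 1 + real (j + m)))"
 obtains S where "\<And>j. summable (T j)" "(\<lambda>j. \<Sum>m. T j m) sums S" "(\<lambda>n. \<Sum>m\<le>n div 2. T (n - 2 * m) m) sums S"
proof -
 let ?G = "Gamma (K + 1)"
 define h where "h j m = M / ?G * ((11 * norm w) ^ j / fact j) * (((norm w)\<^sup>2) ^ m / fact m)" for j m
 have G: "?G > 0" by (rule Gamma_ge_fact(2)[OF K])
 have h0: "h j m \<ge> 0" for j m using M G by (simp add: h_def)
 have Th: "norm (T j m) \<le> h j m" for j m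
 proof -
  have "?G * fact j \<le> ?G * fact (j + m)" using G by (intro mult_left_mono fact_mono) auto
  also have "\<dots> \<le> Gamma (K + 1 + real (j + m))" by (rule Gamma_ge_fact(1)[OF K])
  finally have g: "?G * fact j \<le> Gamma (K + 1 + real (j + m))" .
  moreover have gp: "?G * fact j > 0" using G by simp
  ultimately have gp': "Gamma (K + 1 + real (j + m)) > 0" by linarith
  have "norm (T j m) = norm w ^ (j + 2 * m) * norm (a j) / (fact m * Gamma (K + 1 + real (j + m)))"
   using gp' by (simp add: T_def norm_mult norm_divide norm_power)
  also have "\<dots> \<le> norm w ^ (j + 2 * m) * (M * 11 ^ j) / (fact m * (?G * fact j))"
   using a g gp M by (intro frac_le mult_left_mono mult_nonneg_nonneg) auto
  also have "norm w ^ (j + 2 * m) = norm w ^ j * ((norm w)\<^sup>2) ^ m" by (simp only: power_add power_mult)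
  also have "norm w ^ j * ((norm w)\<^sup>2) ^ m * (M * 11 ^ j) / (fact m * (?G * fact j)) = h j m"
   unfolding h_def by (simp add: power_mult_distrib mult_ac)
  finally show ?thesis .
 qed
 have ex: "(\<lambda>n. x ^ n / fact n) sums exp x" for x :: real using exp_converges[of x] by (simp add: divide_inverse mult.commute)
 have "(\<lambda>p. h (fst p) (snd p)) summable_on (SIGMA j:UNIV. UNIV)"
 proof (rule summable_on_SigmaI)
  fix j :: nat
  have "(\<lambda>m. h j m) sums (M / ?G * ((11 * norm w) ^ j / fact j) * exp ((norm w)\<^sup>2))" unfolding h_def by (rule sums_mult[OF ex])
  thus "((\<lambda>m. h (fst (j, m)) (snd (j, m))) has_sum (M / ?G * ((11 * norm w) ^ j / fact j) * exp ((norm w)\<^sup>2))) UNIV"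
   unfolding fst_conv snd_conv by (rule sums_nonneg_imp_has_sum) (rule h0)
 next
  have "summable (\<lambda>j. M / ?G * ((11 * norm w) ^ j / fact j) * exp ((norm w)\<^sup>2))"
   by (intro summable_mult2 summable_mult sums_summable[OF ex])
  thus "(\<lambda>j. M / ?G * ((11 * norm w) ^ j / fact j) * exp ((norm w)\<^sup>2)) summable_on UNIV"
   by (rule summable_nonneg_imp_summable_on) (use M G in simp)
 qed (use h0 in simp)
 hence "(\<lambda>p. h (fst p) (snd p)) summable_on UNIV" by simp
 hence "(\<lambda>p. norm (T (fst p) (snd p))) summable_on UNIV"
  by (rule summable_on_comparison_test) (use Th in auto)
 hence sm: "(\<lambda>p. T (fst p) (snd p)) summable_on UNIV" by (rule abs_summable_summable)
 define S where "S = infsum (\<lambda>p. T (fst p) (snd p)) UNIV"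
 have S: "((\<lambda>p. T (fst p) (snd p)) has_sum S) UNIV" unfolding S_def by (rule has_sum_infsum[OF sm])
 have sT: "summable (\<lambda>m. norm (T j m))" for j
 proof (rule summable_comparison_test)
  show "\<exists>N. \<forall>m\<ge>N. norm (norm (T j m)) \<le> h j m" using Th by simp
  show "summable (h j)" unfolding h_def by (rule summable_mult[OF sums_summable[OF ex]])
 qed
 have 1: "summable (T j)" for j by (rule summable_norm_cancel[OF sT])
 have 2: "(\<lambda>j. \<Sum>m. T j m) sums S"
 proof (rule has_sum_imp_sums, rule has_sum_SigmaD)
  show "((\<lambda>p. T (fst p) (snd p)) has_sum S) (SIGMA j:UNIV. UNIV)" using S by simp
  show "((\<lambda>m. T (fst (j, m)) (snd (j, m))) has_sum (\<Sum>m. T j m)) UNIV" for j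
   unfolding fst_conv snd_conv by (rule norm_summable_imp_has_sum[OF sT summable_sums[OF 1]])
 qed
 have 3: "(\<lambda>n. \<Sum>m\<le>n div 2. T (n - 2 * m) m) sums S"
 proof (rule has_sum_imp_sums, rule has_sum_SigmaD)
  have bij: "bij_betw (\<lambda>p. (fst p - 2 * snd p, snd p)) (SIGMA n:UNIV. {..n div 2}) (UNIV :: (nat \<times> nat) set)"
   by (rule bij_betw_byWitness[where f'="\<lambda>p. (fst p + 2 * snd p, snd p)"]) auto
  show "((\<lambda>p. T (fst p - 2 * snd p) (snd p)) has_sum S) (SIGMA n:UNIV. {..n div 2})"
   using S unfolding has_sum_reindex_bij_betw[OF bij, symmetric] by simp
  show "((\<lambda>m. T (fst (n, m) - 2 * snd (n, m)) (snd (n, m))) has_sum (\<Sum>m\<le>n div 2. T (n - 2 * m) m)) {..n div 2}" for n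
   unfolding fst_conv snd_conv by (rule has_sum_finite) simp
 qed
 show ?thesis by (rule that[OF 1 2 3])
qed

subsection \<open>The integrand as a function of one variable\<close>

text \<open>The bracket after the cancellation of B(s), as a function of x = X(u,v) alone.\<close>

definition laplace_integrand :: "nat \<Rightarrow> real \<Rightarrow> real \<Rightarrow> real \<Rightarrow> real \<Rightarrow> complex" where
 "laplace_integrand k b \<gamma> \<psi> x = of_real (1 / (2 * pi)) * (LINT t|lborel. exp (Complex 1 t) *
  (prodpow b {..<k} (chebnode k (arccos x)) (\<gamma> + 1) (Complex 1 t) * prodpow b {1..<k} (chebnode k (real k * \<psi>)) (-1) (Complex 1 t)))"

text \<open>The difference of the accumulated kernels for degrees J and J - 2 is written as a sum
  over {0, 1}, so that linearity of the averages over finite sums applies as it stands.\<close>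

definition lcoef :: "nat \<Rightarrow> real \<Rightarrow> real \<Rightarrow> nat \<Rightarrow> real \<Rightarrow> complex" where
 "lcoef k \<gamma> \<psi> n x = (\<Sum>m\<le>n div 2. of_real ((real n + real k * \<gamma>) gchoose m) *
  (\<Sum>i\<in>{0,1::nat}. (if i = 0 then 1 else if 2 * m + 2 \<le> n then -1 else 0) * Spol k \<gamma> \<psi> (n - 2 * m - 2 * i) x))"

text \<open>The inversion is carried out before averaging, where the generating function is
  available; averaging later turns the differences into the kernels P_j.\<close>

lemma lcoef_dcoef:
 assumes k: "k > 0" and \<gamma>: "\<gamma> \<ge> 0" and x: "x \<in> {-1..1}"
 shows "dcoef {1..<k} (chebnode k (real k * \<psi>)) {..<k} (chebnode k (arccos x)) (\<gamma> + 1) n = lcoef k \<gamma> \<psi> n x"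
proof -
 let ?d = "dcoef {1..<k} (chebnode k (real k * \<psi>)) {..<k} (chebnode k (arccos x)) (\<gamma> + 1)"
 have e: "real k * \<psi> / real k = \<psi>" "cos (arccos x) = x" using k x by simp_all
 have "Spol k \<gamma> \<psi> J x = (\<Sum>i\<le>J div 2. ((-1) ^ i * ((real (J - i) + real k * \<gamma>) gchoose i)) *\<^sub>R ?d (J - 2 * i))" for J
  using Spol_dcoef[OF k \<gamma>, of "real k * \<psi>" J "arccos x"] unfolding e .
 hence "?d n = (\<Sum>m\<le>n div 2. ((real n + real k * \<gamma>) gchoose m) *\<^sub>R (Spol k \<gamma> \<psi> (n - 2 * m) x - (if 2 * m + 2 \<le> n then Spol k \<gamma> \<psi> (n - 2 * m - 2) x else 0)))"
  by (rule catalan_inversion)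
 also have "\<dots> = lcoef k \<gamma> \<psi> n x"
  unfolding lcoef_def
 proof (intro sum.cong refl)
  fix m
  show "((real n + real k * \<gamma>) gchoose m) *\<^sub>R (Spol k \<gamma> \<psi> (n - 2 * m) x - (if 2 * m + 2 \<le> n then Spol k \<gamma> \<psi> (n - 2 * m - 2) x else 0))
   = of_real ((real n + real k * \<gamma>) gchoose m) * (\<Sum>i\<in>{0,1::nat}. (if i = 0 then 1 else if 2 * m + 2 \<le> n then -1 else 0) * Spol k \<gamma> \<psi> (n - 2 * m - 2 * i) x)"
   by (cases "2 * m + 2 \<le> n") (simp_all add: scaleR_conv_of_real)
 qed
 finally show ?thesis .
qed

lemma laplace_integrand_sums:
 assumes k: "k > 0" and \<gamma>: "\<gamma> > 0" and b: "b > 0" and x: "x \<in> {-1..1}"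
 shows "(\<lambda>n. (- \<i> * of_real b / 2) ^ n * of_real (1 / Gamma (real k * \<gamma> + 1 + real n)) * lcoef k \<gamma> \<psi> n x) sums laplace_integrand k b \<gamma> \<psi> x"
proof -
 have \<nu>: "real k * \<gamma> + 1 = real (card {..<k}) * (\<gamma> + 1) - real (card {1..<k})" "real k * \<gamma> + 1 > 1"
  using k \<gamma> by (auto simp: of_nat_diff algebra_simps)
 have g0: "\<gamma> + 1 \<ge> 0" "\<gamma> \<ge> 0" using \<gamma> by auto
 let ?d = "dcoef {1..<k} (chebnode k (real k * \<psi>)) {..<k} (chebnode k (arccos x)) (\<gamma> + 1)"
 have "(\<lambda>n. ?d n * (- \<i> * of_real b / 2) ^ n * of_real (2 * pi / Gamma (real k * \<gamma> + 1 + real n))) sums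
  (LINT t|lborel. exp (Complex 1 t) * (prodpow b {..<k} (chebnode k (arccos x)) (\<gamma> + 1) (Complex 1 t) * prodpow b {1..<k} (chebnode k (real k * \<psi>)) (-1) (Complex 1 t)))"
  by (rule bromwich_prodpow_sums[OF b abs_chebnode abs_chebnode _ _ g0(1) \<nu>]) simp_all
 from sums_mult[OF this, of "of_real (1 / (2 * pi))"]
 have "(\<lambda>n. of_real (1 / (2 * pi)) * (?d n * (- \<i> * of_real b / 2) ^ n * of_real (2 * pi / Gamma (real k * \<gamma> + 1 + real n)))) sums laplace_integrand k b \<gamma> \<psi> x"
  unfolding laplace_integrand_def .
 moreover have "of_real (1 / (2 * pi)) * (?d n * (- \<i> * of_real b / 2) ^ n * of_real (2 * pi / Gamma (real k * \<gamma> + 1 + real n)))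
  = (- \<i> * of_real b / 2) ^ n * of_real (1 / Gamma (real k * \<gamma> + 1 + real n)) * lcoef k \<gamma> \<psi> n x" for n
 proof -
  have "2 * pi / Gamma (real k * \<gamma> + 1 + real n) = (2 * pi) * (1 / Gamma (real k * \<gamma> + 1 + real n))" by simp
  hence "of_real (1 / (2 * pi)) * (D * W * of_real (2 * pi / Gamma (real k * \<gamma> + 1 + real n))) = W * of_real (1 / Gamma (real k * \<gamma> + 1 + real n)) * D" for D W :: complex
   by simp
  thus ?thesis unfolding lcoef_dcoef[OF k g0(2) x, symmetric] .
 qed
 ultimately show ?thesis by (simp only:)
qed

lemma lcoef_bound:
 assumes k: "k > 0" and \<gamma>: "\<gamma> \<ge> 0" and x: "x \<in> {-1..1}"
 shows "norm (lcoef k \<gamma> \<psi> n x) \<le> 2 ^ (k - 1) * (4 powr (\<gamma> + 1)) ^ k * (8/3) ^ n"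
proof -
 have "\<gamma> + 1 \<ge> 0" using \<gamma> by simp
 hence "norm (dcoef {1..<k} (chebnode k (real k * \<psi>)) {..<k} (chebnode k (arccos x)) (\<gamma> + 1) n) \<le> 2 ^ card {1..<k} * (4 powr (\<gamma> + 1)) ^ card {..<k} * (8/3) ^ n"
  by (intro dcoef_bound abs_chebnode)
 thus ?thesis unfolding lcoef_dcoef[OF k \<gamma> x] by simp
qed

lemma Phi_lcoef:
 assumes ab: "\<alpha> \<ge> 0" "\<beta> \<ge> 0"
 shows "Phi_good \<alpha> p r (lcoef k \<gamma> \<psi> n)"
  "Phi \<alpha> \<beta> (sin (real k * \<xi>) * sin (real k * \<phi>)) (cos (real k * \<xi>) * cos (real k * \<phi>)) (lcoef k (\<alpha> + \<beta>) (\<xi> - \<phi>) n)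
   = (\<Sum>m\<le>n div 2. of_real ((real n + real k * (\<alpha> + \<beta>)) gchoose m) * PK k \<alpha> \<beta> (n - 2 * m) \<xi> \<phi>)"
proof -
 let ?c = "\<lambda>m i::nat. if i = 0 then 1 else if 2 * m + 2 \<le> n then -1 else (0::complex)"
 let ?g = "\<lambda>\<gamma> \<psi> m x. \<Sum>i\<in>{0,1::nat}. ?c m i * Spol k \<gamma> \<psi> (n - 2 * m - 2 * i) x"
 have fin: "finite {0, 1::nat}" by simp
 have e: "lcoef k \<gamma> \<psi> n = (\<lambda>x. \<Sum>m\<le>n div 2. of_real ((real n + real k * \<gamma>) gchoose m) * ?g \<gamma> \<psi> m x)" for \<gamma> \<psi>
  by (rule ext) (rule lcoef_def)
 have g: "Phi_good \<alpha> p r (?g \<gamma> \<psi> m)" for p r \<gamma> \<psi> m by (rule Phi_sum(1)[OF ab fin Phi_Spol(1)[OF ab]])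
 show "Phi_good \<alpha> p r (lcoef k \<gamma> \<psi> n)" unfolding e by (rule Phi_sum(1)[OF ab finite_atMost g])
 let ?p = "sin (real k * \<xi>) * sin (real k * \<phi>)" and ?r = "cos (real k * \<xi>) * cos (real k * \<phi>)"
 have "Phi \<alpha> \<beta> ?p ?r (?g (\<alpha> + \<beta>) (\<xi> - \<phi>) m) = PK k \<alpha> \<beta> (n - 2 * m) \<xi> \<phi>" if m: "m \<le> n div 2" for m
 proof -
  have "Phi \<alpha> \<beta> ?p ?r (?g (\<alpha> + \<beta>) (\<xi> - \<phi>) m) = (\<Sum>i\<in>{0,1::nat}. ?c m i * SK k \<alpha> \<beta> (n - 2 * m - 2 * i) \<xi> \<phi>)"
   by (subst Phi_sum(2)[OF ab fin Phi_Spol(1)[OF ab]]) (simp only: Phi_Spol(2)[OF ab])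
  also have "\<dots> = SK k \<alpha> \<beta> (n - 2 * m) \<xi> \<phi> + (if 2 * m + 2 \<le> n then -1 else 0) * SK k \<alpha> \<beta> (n - 2 * m - 2) \<xi> \<phi>" by simp
  also have "\<dots> = PK k \<alpha> \<beta> (n - 2 * m) \<xi> \<phi>"
  proof (cases "2 * m + 2 \<le> n")
   case True
   hence "\<not> n - 2 * m < 2" by simp
   with True show ?thesis unfolding PK_def by (simp only: if_True if_False)  simp
  next
   case False
   hence "n - 2 * m < 2" using m by simp
   with False show ?thesis unfolding PK_def by (simp only: if_True if_False) simp
  qed
  finally show ?thesis .
 qed
 thus "Phi \<alpha> \<beta> ?p ?r (lcoef k (\<alpha> + \<beta>) (\<xi> - \<phi>) n) = (\<Sum>m\<le>n div 2. of_real ((real n + real k * (\<alpha> + \<beta>)) gchoose m) * PK k \<alpha> \<beta> (n - 2 * m) \<xi> \<phi>)"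
  unfolding e by (subst Phi_sum(2)[OF ab finite_atMost g]) simp
qed

text \<open>The series is averaged termwise. Its uniform majorant (4b/3)^n / n!, up to a constant,
  combines (b/2)^n, the growth (8/3)^n of the coefficients and the Gamma factor.\<close>

lemma Phi_laplace_integrand:
 assumes k: "k > 0" and ab: "\<alpha> > 0" "\<beta> \<ge> 0" and b: "b > 0"
 shows "(\<lambda>n. (- \<i> * of_real b / 2) ^ n * of_real (1 / Gamma (real k * (\<alpha> + \<beta>) + 1 + real n))
   * (\<Sum>m\<le>n div 2. of_real ((real n + real k * (\<alpha> + \<beta>)) gchoose m) * PK k \<alpha> \<beta> (n - 2 * m) \<xi> \<phi>))
  sums Phi \<alpha> \<beta> (sin (real k * \<xi>) * sin (real k * \<phi>)) (cos (real k * \<xi>) * cos (real k * \<phi>)) (laplace_integrand k b (\<alpha> + \<beta>) (\<xi> - \<phi>))"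
proof -
 have ab': "\<alpha> \<ge> 0" "\<beta> \<ge> 0" and g: "\<alpha> + \<beta> > 0" "\<alpha> + \<beta> \<ge> 0" using ab by auto
 let ?K = "real k * (\<alpha> + \<beta>)"
 have K: "?K \<ge> 0" using g by simp
 let ?p = "sin (real k * \<xi>) * sin (real k * \<phi>)" and ?r = "cos (real k * \<xi>) * cos (real k * \<phi>)"
 let ?e = "\<lambda>n. (- \<i> * of_real b / 2) ^ n * of_real (1 / Gamma (?K + 1 + real n))"
 let ?l = "lcoef k (\<alpha> + \<beta>) (\<xi> - \<phi>)" and ?F = "laplace_integrand k b (\<alpha> + \<beta>) (\<xi> - \<phi>)"
 define M where "M = 2 ^ (k - 1) * (4 powr (\<alpha> + \<beta> + 1)) ^ k"
 have M: "M \<ge> 0" by (simp add: M_def)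
 define t where "t n = M / Gamma (?K + 1) * ((4 * b / 3) ^ n / fact n)" for n
 have G: "Gamma (?K + 1) > 0" by (rule Gamma_ge_fact(2)[OF K])
 have bd: "norm (?e n * ?l n x) \<le> t n" if x: "x \<in> {-1..1}" for n x
 proof -
  have gn: "Gamma (?K + 1) * fact n \<le> Gamma (?K + 1 + real n)" by (rule Gamma_ge_fact(1)[OF K])
  have gp: "Gamma (?K + 1) * fact n > 0" using G by simp
  hence gp': "Gamma (?K + 1 + real n) > 0" using gn by linarith
  have "norm (?e n * ?l n x) = (b / 2) ^ n * norm (?l n x) / Gamma (?K + 1 + real n)"
   using gp' b by (simp add: norm_mult norm_power norm_divide)
  also have "\<dots> \<le> (b / 2) ^ n * (M * (8/3) ^ n) / (Gamma (?K + 1) * fact n)"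
   using lcoef_bound[OF k g(2) x, of "\<xi> - \<phi>" n] gn gp b M unfolding M_def
   by (intro frac_le mult_left_mono mult_nonneg_nonneg) auto
  also have "\<dots> = t n"
  proof -
   have e: "(4 * b / 3) ^ n = (b / 2) ^ n * (8/3) ^ n" by (simp add: power_mult_distrib[symmetric])
   show ?thesis unfolding t_def e by (simp only: times_divide_eq_left times_divide_eq_right divide_divide_eq_left mult_ac)
  qed
  finally show ?thesis .
 qed
 have "summable (\<lambda>n. x ^ n / fact n)" for x :: real
  using summable_exp[of x] by (simp add: divide_inverse mult.commute)
 hence st: "summable t" unfolding t_def[abs_def] by (rule summable_mult)
 define \<epsilon> where "\<epsilon> N = suminf t - (\<Sum>n<N. t n)" for N
 have \<epsilon>: "\<epsilon> \<longlonglongrightarrow> 0" unfolding \<epsilon>_def[abs_def]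
  using tendsto_diff[OF tendsto_const[of "suminf t"] summable_LIMSEQ[OF st]] by simp
 have "(\<lambda>N. Phi \<alpha> \<beta> ?p ?r (\<lambda>x. \<Sum>n<N. ?e n * ?l n x)) \<longlonglongrightarrow> Phi \<alpha> \<beta> ?p ?r ?F"
 proof (rule Phi_limit[OF ab' abs_sin_cos_product_le _ _ \<epsilon>])
  show "Phi_good \<alpha> ?p ?r (\<lambda>x. \<Sum>n<N. ?e n * ?l n x)" for N
   by (rule Phi_sum(1)[OF ab' finite_lessThan Phi_lcoef(1)[OF ab']])
  fix N and x :: real assume x: "x \<in> {-1..1}"
  have S: "(\<lambda>n. ?e n * ?l n x) sums ?F x" by (rule laplace_integrand_sums[OF k g(1) b x])
  have s: "summable (\<lambda>n. ?e n * ?l n x)" by (rule sums_summable[OF S])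
  have "?F x - (\<Sum>n<N. ?e n * ?l n x) = (\<Sum>n. ?e (n + N) * ?l (n + N) x)"
   using suminf_minus_initial_segment[OF s, of N] sums_unique[OF S] by simp
  moreover have "norm (\<Sum>n. ?e (n + N) * ?l (n + N) x) \<le> (\<Sum>n. t (n + N))"
  proof (rule norm_suminf_le)
   show "norm (?e (n + N) * ?l (n + N) x) \<le> t (n + N)" for n by (rule bd[OF x])
   show "summable (\<lambda>n. t (n + N))" using st by (simp only: summable_iff_shift)
  qed
  moreover have "(\<Sum>n. t (n + N)) = \<epsilon> N" unfolding \<epsilon>_def by (rule suminf_minus_initial_segment[OF st])
  ultimately show "norm (?F x - (\<Sum>n<N. ?e n * ?l n x)) \<le> \<epsilon> N" by (simp only:)
 qed
 moreover have "Phi \<alpha> \<beta> ?p ?r (\<lambda>x. \<Sum>n<N. ?e n * ?l n x) = (\<Sum>n<N. ?e n * Phi \<alpha> \<beta> ?p ?r (?l n))" for N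
  by (rule Phi_sum(2)[OF ab' finite_lessThan Phi_lcoef(1)[OF ab']])
 ultimately have "(\<lambda>n. ?e n * Phi \<alpha> \<beta> ?p ?r (?l n)) sums Phi \<alpha> \<beta> ?p ?r ?F" unfolding sums_def by (simp only:)
 thus ?thesis unfolding Phi_lcoef(2)[OF ab'] .
qed

subsection \<open>The Bessel expansion\<close>

text \<open>The Bessel series multiplied by 2^K b^(-K) has only integer powers of b/2, and the sign
  (-1)^m is absorbed into the power of -ib/2.\<close>

lemma bessel_term:
 assumes b: "b > 0" and K: "K \<ge> 0"
 shows "(\<lambda>m. (- \<i> * of_real b / 2) ^ (j + 2 * m) * A / of_real (fact m * Gamma (K + 1 + real (j + m))))
  sums (of_real (2 powr K) * ((- \<i>) ^ j * of_real (b powr (- K) * bessel_J (real j + K) b) * A))"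
proof -
 let ?w = "- \<i> * of_real b / 2"
 define R where "R m = (-1) ^ m / (fact m * Gamma (real m + (real j + K) + 1)) * (b / 2) powr (2 * real m + (real j + K))" for m
 let ?c = "2 powr K * b powr (- K)"
 have G: "real m + (real j + K) + 1 = K + 1 + real (j + m)" for m by simp
 have cR: "(- \<i>) ^ j * of_real (?c * R m) = ?w ^ (j + 2 * m) / of_real (fact m * Gamma (K + 1 + real (j + m)))" for m
 proof -
  have "(b / 2) powr (2 * real m + (real j + K)) = (b / 2) powr (real (j + 2 * m) + K)" by (simp add: algebra_simps)
  also have "\<dots> = (b / 2) ^ (j + 2 * m) * (b / 2) powr K" using b by (simp only: powr_add powr_realpow half_gt_zero)
  finally have P: "(b / 2) powr (2 * real m + (real j + K)) = (b / 2) ^ (j + 2 * m) * (b / 2) powr K" .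
  have "(b / 2) powr K = b powr K / 2 powr K" using b by (subst powr_divide) simp_all
  hence Q: "?c * (b / 2) powr K = 1" using b by (simp add: powr_minus)
  have r: "?c * R m = (-1) ^ m * (b / 2) ^ (j + 2 * m) / (fact m * Gamma (K + 1 + real (j + m)))"
  proof -
   have "?c * R m = (-1) ^ m / (fact m * Gamma (K + 1 + real (j + m))) * (b / 2) ^ (j + 2 * m) * (?c * (b / 2) powr K)"
    unfolding R_def G P by (simp only: mult_ac)
   thus ?thesis unfolding Q by simp
  qed
  have "?w = (- \<i>) * of_real (b / 2)" by simp
  hence "?w ^ (j + 2 * m) = (- \<i>) ^ (j + 2 * m) * of_real ((b / 2) ^ (j + 2 * m))"
   by (simp only: power_mult_distrib of_real_power)
  also have "(- \<i>) ^ (j + 2 * m) = (- \<i>) ^ j * (-1) ^ m" by (simp add: power_add power_mult)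
  finally have W: "?w ^ (j + 2 * m) = (- \<i>) ^ j * (-1) ^ m * of_real ((b / 2) ^ (j + 2 * m))" .
  show ?thesis unfolding r W by (simp add: mult_ac)
 qed
 \<comment> \<open>Convergence of the Bessel series is read off from \<open>double_series\<close>
   with constant coefficients; the unit factor (-i)^j is removed afterwards by multiplying with
   i^j.\<close>
 obtain S where "\<And>j. summable (\<lambda>m. ?w ^ (j + 2 * m) * 1 / of_real (fact m * Gamma (K + 1 + real (j + m))))"
  by (rule double_series[OF K, of "\<lambda>_. 1" 1 ?w]) auto
 hence s1: "summable (\<lambda>m. (- \<i>) ^ j * of_real (?c * R m))" unfolding cR by simp
 have ci: "(\<i> ^ j) * ((- \<i>) ^ j * z) = z" for z :: complex
  by (simp only: mult.assoc[symmetric] power_mult_distrib[symmetric]) simp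
 have "summable (\<lambda>m. \<i> ^ j * ((- \<i>) ^ j * of_real (?c * R m)))" by (rule summable_mult[OF s1])
 hence "summable (\<lambda>m. complex_of_real (?c * R m))" unfolding ci .
 hence "summable (\<lambda>m. Re (complex_of_real (?c * R m)))" by (rule summable_Re)
 hence "summable (\<lambda>m. ?c * R m)" by (simp only: Re_complex_of_real)
 hence si: "summable (\<lambda>m. inverse ?c * (?c * R m))" by (rule summable_mult)
 have nz: "?c \<noteq> 0" using b by simp
 have cancel: "inverse c * (c * x) = x" if "c \<noteq> 0" for c x :: real using that by simp
 have "summable R" using si unfolding cancel[OF nz] .
 hence "R sums bessel_J (real j + K) b" unfolding bessel_J_def R_def[abs_def] by (rule summable_sums)
 hence "(\<lambda>m. complex_of_real (?c * R m)) sums of_real (?c * bessel_J (real j + K) b)"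
  by (intro sums_of_real sums_mult)
 from sums_mult[OF this, of "(- \<i>) ^ j * A"]
 have "(\<lambda>m. ((- \<i>) ^ j * of_real (?c * R m)) * A) sums ((- \<i>) ^ j * A * of_real (?c * bessel_J (real j + K) b))"
  by (simp only: mult_ac)
 thus ?thesis unfolding cR by (simp only: of_real_mult mult_ac times_divide_eq_left times_divide_eq_right)
qed

text \<open>The two series agree because (n + K choose m) / Gamma(K + 1 + n) = 1 / (m! Gamma(K + 1 +
  n - m)), and for n = j + 2m this is the Bessel coefficient of index m in the term of degree
  j.\<close>

theorem dunkl_kernel_Phi:
 assumes k: "k > 0" and ab: "\<alpha> > 0" "\<beta> \<ge> 0" and z: "z1 \<noteq> 0" "z2 \<noteq> 0"
  and w: "\<And>\<xi>. w (cis \<xi>) = wt k \<alpha> \<beta> \<xi>" and R: "R = line_roots (dlines k \<alpha> \<beta>)"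
 defines "\<xi> \<equiv> Arg (z1 / of_real (cmod z1))" and "\<phi> \<equiv> Arg (z2 / of_real (cmod z2))"
 shows "dunkl_kernel R w z1 z2 = of_real (Gamma (real k * (\<alpha> + \<beta>) + 1)) *
  Phi \<alpha> \<beta> (sin (real k * \<xi>) * sin (real k * \<phi>)) (cos (real k * \<xi>) * cos (real k * \<phi>)) (laplace_integrand k (cmod z1 * cmod z2) (\<alpha> + \<beta>) (\<xi> - \<phi>))"
proof -
 define b where "b = cmod z1 * cmod z2"
 have b: "b > 0" using z by (simp add: b_def)
 define K where "K = real k * (\<alpha> + \<beta>)"
 have K: "K \<ge> 0" using ab by (simp add: K_def)
 have ab': "\<alpha> \<ge> 0" "\<beta> \<ge> 0" using ab by auto
 have sumR: "sum_list (map snd R) = K"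
  unfolding R line_roots_def dlines_def K_def by (cases "\<beta> = 0") (simp_all add: o_def case_prod_unfold sum_list_triv algebra_simps)
 let ?P = "\<lambda>j. PK k \<alpha> \<beta> j \<xi> \<phi>" and ?w = "- \<i> * of_real b / 2"
 have rk: "repr_kernel R w j (z1 / of_real (cmod z1)) (z2 / of_real (cmod z2)) = ?P j" for j
  unfolding \<xi>_def \<phi>_def by (rule repr_kernel_eq[OF k ab w R]) (use z in \<open>simp_all add: norm_divide\<close>)
 obtain M where M: "M \<ge> 0" "\<And>J. norm (SK k \<alpha> \<beta> J \<xi> \<phi>) \<le> M * 11 ^ J" using SK_bound[OF k ab'] by blast
 have PB: "norm (?P j) \<le> (2 * M) * 11 ^ j" for j
 proof (cases "j < 2")
  case True
  hence "norm (?P j) \<le> M * 11 ^ j" using M(2)[of j] by (simp add: PK_def)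
  also have "\<dots> \<le> 2 * M * 11 ^ j" using M(1) by simp
  finally show ?thesis .
 next
  case False
  have "norm (?P j) \<le> norm (SK k \<alpha> \<beta> j \<xi> \<phi>) + norm (SK k \<alpha> \<beta> (j - 2) \<xi> \<phi>)"
   using False norm_triangle_ineq4 by (simp add: PK_def)
  also have "\<dots> \<le> M * 11 ^ j + M * 11 ^ (j - 2)" by (intro add_mono M)
  also have "M * 11 ^ (j - 2) \<le> M * 11 ^ j" using M(1) by (intro mult_left_mono power_increasing) auto
  finally show ?thesis by simp
 qed
 obtain S where S: "(\<lambda>j. \<Sum>m. ?w ^ (j + 2 * m) * ?P j / of_real (fact m * Gamma (K + 1 + real (j + m)))) sums S"
  "(\<lambda>n. \<Sum>m\<le>n div 2. ?w ^ (n - 2 * m + 2 * m) * ?P (n - 2 * m) / of_real (fact m * Gamma (K + 1 + real (n - 2 * m + m)))) sums S"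
  by (rule double_series[OF K PB, of ?w]) (use M(1) in auto)
 let ?J = "\<lambda>j. (- \<i>) ^ j * of_real (b powr (- K) * bessel_J (real j + K) b) * ?P j"
 have "(\<lambda>j. of_real (2 powr K) * ?J j) sums S"
  using S(1) unfolding sums_unique[OF bessel_term[OF b K], symmetric] .
 from sums_divide[OF this, of "of_real (2 powr K)"]
 have J: "?J sums (S / of_real (2 powr K))" by simp
 have E: "dunkl_kernel R w z1 z2 = of_real (2 powr K * Gamma (K + 1)) * (\<Sum>j. ?J j)"
  unfolding dunkl_kernel_def Let_def sumR b_def[symmetric] rk ..
 have L: "dunkl_kernel R w z1 z2 = of_real (Gamma (K + 1)) * S"
  unfolding E sums_unique[OF J, symmetric] by simp
 \<comment> \<open>The Gamma form of the binomial coefficient matches a summand of the Laplace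
   expansion with one of the Bessel expansion.\<close>
 have t: "?w ^ n * of_real (1 / Gamma (K + 1 + real n)) * (of_real ((real n + K) gchoose m) * ?P (n - 2 * m))
  = ?w ^ (n - 2 * m + 2 * m) * ?P (n - 2 * m) / of_real (fact m * Gamma (K + 1 + real (n - 2 * m + m)))" if m: "m \<le> n div 2" for n m
 proof -
  have n: "n - 2 * m + 2 * m = n" "real (n - 2 * m + m) = real n - real m" using m by (auto simp: of_nat_diff)
  have "real n + K + 1 \<notin> \<int>\<^sub>\<le>\<^sub>0" using K by (auto elim!: nonpos_Ints_cases)
  from gbinomial_Gamma[OF this, of m]
  have g: "(real n + K) gchoose m = Gamma (K + 1 + real n) / (fact m * Gamma (K + 1 + real (n - 2 * m + m)))"
   unfolding n(2) by (simp add: algebra_simps)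
  have "Gamma (K + 1 + real n) > 0" by (rule Gamma_real_pos) (use K in simp)
  hence "Gamma (K + 1 + real n) \<noteq> 0" by (metis less_irrefl)
  thus ?thesis unfolding n(1) g by simp
 qed
 have "(\<lambda>n. ?w ^ n * of_real (1 / Gamma (K + 1 + real n)) * (\<Sum>m\<le>n div 2. of_real ((real n + K) gchoose m) * ?P (n - 2 * m))) sums S"
 proof -
  have "?w ^ n * of_real (1 / Gamma (K + 1 + real n)) * (\<Sum>m\<le>n div 2. of_real ((real n + K) gchoose m) * ?P (n - 2 * m))
   = (\<Sum>m\<le>n div 2. ?w ^ (n - 2 * m + 2 * m) * ?P (n - 2 * m) / of_real (fact m * Gamma (K + 1 + real (n - 2 * m + m))))" for n
   unfolding sum_distrib_left by (intro sum.cong refl t) simp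
  thus ?thesis using S(2) by (simp only:)
 qed
 from sums_unique2[OF Phi_laplace_integrand[OF k ab b, of \<xi> \<phi>, folded K_def] this]
 show ?thesis unfolding L K_def[symmetric] b_def[symmetric] by simp
qed

section \<open>The integral formulas for both families of dihedral groups\<close>

lemma mu_int_cong:
 assumes "\<And>u. u \<in> {-1..1} \<Longrightarrow> f u = g u" shows "mu_int \<gamma> f = mu_int \<gamma> g"
 unfolding mu_int_def by (rule set_lebesgue_integral_cong) (use assms in auto)

text \<open>\<open>x\<close> lies in [-1, 1], so its complex arccosine is real. The point
  \<open>y\<close> may lie outside, but its arccosine occurs only under the cosine.\<close>

lemma h_fun_combination_Arccos:
 assumes k: "k > 0" and b: "b > 0" and \<gamma>: "\<gamma> > 0" and x: "\<bar>x\<bar> \<le> 1" and y: "y = x - cos (real k * (\<xi> - \<phi>))"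
 shows "h_fun k b (cis \<xi>) (cis \<phi>) \<gamma> 1 (Arccos (of_real x)) + of_real (2 powr (1 - real k)) * (- \<i> * of_real b) ^ k
   * cos (Arccos (of_real y)) * h_fun k b (cis \<xi>) (cis \<phi>) (\<gamma> + 1) 1 (Arccos (of_real x))
  = laplace_integrand k b \<gamma> (\<xi> - \<phi>) x"
proof -
 have A: "Arccos (of_real x) = of_real (arccos x)" using of_real_arccos[OF x] by simp
 have c: "cos (Arccos (of_real y)) = of_real (cos (arccos x) - cos (real k * (\<xi> - \<phi>)))" using x y by (simp add: cos_arccos_abs)
 have \<omega>: "Re (cis \<xi> * cnj (cis \<phi>)) = cos (real k * (\<xi> - \<phi>) / real k)" using k by (simp add: cis_cnj cis_mult)
 show ?thesis unfolding A c laplace_integrand_def by (rule h_fun_combination[OF k b \<gamma> \<omega>])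
qed

theorem theorem18:
 fixes k :: nat and \<alpha> \<beta> :: real and z1 z2 :: complex
 assumes "k \<ge> 1" and "\<alpha> > 0" and "z1 \<noteq> 0" and "z2 \<noteq> 0"
 defines "b \<equiv> cmod z1 * cmod z2"
   and "\<omega> \<equiv> z1 / of_real (cmod z1)"
   and "\<eta> \<equiv> z2 / of_real (cmod z2)"
 shows "(\<beta> > 0 \<longrightarrow>
     E_I2k k \<alpha> \<beta> z1 z2 =
      of_real (Gamma (real k * (\<alpha> + \<beta>) + 1)) *
      mu_int \<beta> (\<lambda>v. mu_int \<alpha> (\<lambda>u.
        h_fun k b \<omega> \<eta> (\<alpha> + \<beta>) 1 (qfun k \<omega> \<eta> u v)
        + of_real (2 powr (1 - real k)) * (- \<i> * of_real b) ^ k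
         * cos (qfun k \<omega> \<eta> (u - 1) (v - 1))
         * h_fun k b \<omega> \<eta> (\<alpha> + \<beta> + 1) 1 (qfun k \<omega> \<eta> u v))))
   \<and> (odd k \<longrightarrow>
     E_Ik k \<alpha> z1 z2 =
      of_real (Gamma (real k * \<alpha> + 1)) *
      mu_int \<alpha> (\<lambda>u.
        h_fun k b \<omega> \<eta> \<alpha> 1 (qfun k \<omega> \<eta> u 1)
        + of_real (2 powr (1 - real k)) * (- \<i> * of_real b) ^ k
         * cos (qfun k \<omega> \<eta> (u - 1) 0)
         * h_fun k b \<omega> \<eta> (\<alpha> + 1) 1 (qfun k \<omega> \<eta> u 1)))"
proof -
 have k: "k > 0" and b: "b > 0" using assms by auto
 define \<xi> where "\<xi> = Arg \<omega>"
 define \<phi> where "\<phi> = Arg \<eta>"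
 have w1: "\<omega> = cis \<xi>" and e1: "\<eta> = cis \<phi>"
  using assms by (simp_all add: \<xi>_def \<phi>_def cis_Arg sgn_eq norm_divide)
 let ?p = "sin (real k * \<xi>) * sin (real k * \<phi>)" and ?r = "cos (real k * \<xi>) * cos (real k * \<phi>)"
 have X: "Xfun k \<omega> \<eta> u v = ?p * u + ?r * v" for u v by (simp add: Xfun_def w1 e1 Complex.DeMoivre)
 have pr: "?p + ?r = cos (real k * (\<xi> - \<phi>))" by (simp add: cos_diff right_diff_distrib)
 \<comment> \<open>Linearity of X gives X(u-1, v-1) = X(u,v) - X(1,1), and X(1,1) is the cosine of k
   (\<xi> - \<phi>). The variable \<open>v'\<close> covers both v - 1 and the literal 0 of the odd
   case.\<close>
 have core: "h_fun k b \<omega> \<eta> \<gamma> 1 (qfun k \<omega> \<eta> u v) + of_real (2 powr (1 - real k)) * (- \<i> * of_real b) ^ k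
   * cos (qfun k \<omega> \<eta> (u - 1) v') * h_fun k b \<omega> \<eta> (\<gamma> + 1) 1 (qfun k \<omega> \<eta> u v) = laplace_integrand k b \<gamma> (\<xi> - \<phi>) (?p * u + ?r * v)"
  if "\<gamma> > 0" "u \<in> {-1..1}" "v \<in> {-1..1}" "v' = v - 1" for \<gamma> u v v'
 proof -
  have "?p * u + ?r * v \<in> {-1..1}" by (rule affine_in_unit_interval[OF abs_sin_cos_product_le that(2,3)])
  hence x: "\<bar>?p * u + ?r * v\<bar> \<le> 1" unfolding atLeastAtMost_iff by (intro abs_leI) linarith+
  have "?p * (u - 1) + ?r * v' = (?p * u + ?r * v) - (?p + ?r)" unfolding that(4) by (simp add: right_diff_distrib)
  hence y: "?p * (u - 1) + ?r * v' = (?p * u + ?r * v) - cos (real k * (\<xi> - \<phi>))" unfolding pr .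
  show ?thesis unfolding qfun_def X unfolding w1 e1 by (rule h_fun_combination_Arccos[OF k b that(1) x y])
 qed
 have E_I2k: "E_I2k k \<alpha> \<beta> z1 z2 = of_real (Gamma (real k * (\<alpha> + \<beta>) + 1)) * Phi \<alpha> \<beta> ?p ?r (laplace_integrand k b (\<alpha> + \<beta>) (\<xi> - \<phi>))" if "\<beta> > 0"
  unfolding E_I2k_def \<xi>_def \<phi>_def \<omega>_def \<eta>_def b_def
  by (rule dunkl_kernel_Phi[OF k assms(2) _ assms(3,4) weight_eq_wt(1)[OF assms(2) that] roots_eq_dlines(1)]) (use that in auto)
 have E_Ik: "E_Ik k \<alpha> z1 z2 = of_real (Gamma (real k * (\<alpha> + 0) + 1)) * Phi \<alpha> 0 ?p ?r (laplace_integrand k b (\<alpha> + 0) (\<xi> - \<phi>))"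
  unfolding E_Ik_def \<xi>_def \<phi>_def \<omega>_def \<eta>_def b_def
  by (rule dunkl_kernel_Phi[OF k assms(2) _ assms(3,4) weight_eq_wt(2)[OF assms(2)] roots_eq_dlines(2)]) simp
 have a0: "\<alpha> \<noteq> 0" using assms by simp
 show ?thesis
 proof (intro conjI impI, goal_cases)
  case 1
  hence g: "\<alpha> + \<beta> > 0" "\<beta> \<noteq> 0" using assms by auto
  show ?case unfolding E_I2k[OF 1] Phi_def nu_int_def if_not_P[OF a0] if_not_P[OF g(2)]
   by (intro arg_cong2[where f="(*)"] refl mu_int_cong core[OF g(1), symmetric])
 next
  case 2
  \<comment> \<open>For \<beta> = 0 the outer average is evaluation at v = 1, so v - 1 = 0.\<close>
  have one: "(1::real) \<in> {-1..1}" "(0::real) = 1 - 1" by auto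
  show ?case unfolding E_Ik Phi_def nu_int_def if_not_P[OF a0] add_0_right if_P[OF refl]
   by (intro arg_cong2[where f="(*)"] refl mu_int_cong core[OF assms(2) _ one, symmetric])
 qed
qed

end
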